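(* Let $(H,\mathcal{R})$ be a triangular Hopf algebra and $\mathcal{A}$ a braided commutative left $H$-module algebra. An equivariant covariant derivative $\nabla^\mathcal{R}$ on $\mathfrak{X}^1_\mathcal{R}(\mathcal{A})$ induces an equivariant covariant derivative $\tilde{\nabla}^\mathcal{R}$ on $\Omega^1_\mathcal{R}(\mathcal{A})$ via $$\langle\tilde{\nabla}^\mathcal{R}_X\omega,Y\rangle_\mathcal{R}=\mathscr{L}^\mathcal{R}_X\langle\omega,Y\rangle_\mathcal{R}-\langle\mathcal{R}_1^{-1}\rhd\omega,\nabla^\mathcal{R}_{\mathcal{R}_2^{-1}\rhd X}Y\rangle_\mathcal{R}$$ for all $X,Y\in\mathfrak{X}^1_\mathcal{R}(\mathcal{A})$ and $\omega\in\Omega^1_\mathcal{R}(\mathcal{A})$. Moreover, $\nabla^\mathcal{R}$ and $\tilde{\nabla}^\mathcal{R}$ can be extended as braided derivations (of $\wedge_\mathcal{R}$) to equivariant covariant derivatives on $\mathfrak{X}^\bullet_\mathcal{R}(\mathcal{A})$ and $\Omega^\bullet_\mathcal{R}(\mathcal{A})$, respectively.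
   Context: **Hopf algebras.** $\Bbbk$ is a commutative ring, $\otimes=\otimes_\Bbbk$, algebras are unital associative $\Bbbk$-algebras. A Hopf algebra $H$ has coproduct $\Delta(\xi)=\xi_{(1)}\otimes\xi_{(2)}$, counit $\epsilon$ and bijective antipode $S$. A triangular Hopf algebra $(H,\mathcal{R})$ is a Hopf algebra with an invertible $\mathcal{R}=\mathcal{R}_1\otimes\mathcal{R}_2\in H\otimes H$ (sums suppressed) such that $\mathcal{R}^{-1}=\mathcal{R}_{21}$, $\xi_{(2)}\otimes\xi_{(1)}=\mathcal{R}\Delta(\xi)\mathcal{R}^{-1}$, $(\Delta\otimes\mathrm{id})(\mathcal{R})=\mathcal{R}_{13}\mathcal{R}_{23}$, $(\mathrm{id}\otimes\Delta)(\mathcal{R})=\mathcal{R}_{13}\mathcal{R}_{12}$. Write $\mathcal{R}^{-1}=\mathcal{R}_1^{-1}\otimes\mathcal{R}_2^{-1}$, with primes for further copies and $\mathcal{R}^{-1}_{2(1)}\otimes\mathcal{R}^{-1}_{2(2)}$ etc. for coproducts of legs. **Modules.** A left $H$-module algebra $\mathcal{A}$ satisfies $\xi\rhd(ab)=(\xi_{(1)}\rhd a)(\xi_{(2)}\rhd b)$, $\xi\rhd1=\epsilon(\xi)1$; it is braided commutative if $ba=(\mathcal{R}_1^{-1}\rhd a)(\mathcal{R}_2^{-1}\rhd b)$. An $H$-equivariant braided symmetric $\mathcal{A}$-bimodule $\mathcal{M}$ is an $\mathcal{A}$-bimodule and left $H$-module with $\xi\rhd(a\cdot m\cdot b)=(\xi_{(1)}\rhd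 a)\cdot(\xi_{(2)}\rhd m)\cdot(\xi_{(3)}\rhd b)$ and $m\cdot a=(\mathcal{R}_1^{-1}\rhd a)\cdot(\mathcal{R}_2^{-1}\rhd m)$. $H$ acts on tensor products via iterated coproducts and on $\Bbbk$-linear maps by the adjoint action $(\xi\rhd\Phi)(v)=\xi_{(1)}\rhd(\Phi(S(\xi_{(2)})\rhd v))$. **Braided exterior algebra.** For such $\mathcal{M}$, $(\Lambda^\bullet\mathcal{M},\wedge_\mathcal{R})$ is the quotient of the tensor algebra $\mathrm{T}^\bullet\mathcal{M}=\mathcal{A}\oplus\mathcal{M}\oplus(\mathcal{M}\otimes_\mathcal{A}\mathcal{M})\oplus\cdots$ by the ideal generated by all elements of $\mathrm{T}^k\mathcal{M}$ which, for some $1\le i<j\le k$, are fixed by the braided exchange of the $i$-th and $j$-th factor, i.e. by the map sending (sums of) $m_1\otimes_\mathcal{A}\cdots\otimes_\mathcal{A}m_k$ to $m_1\otimes_\mathcal{A}\cdots\otimes_\mathcal{A}m_{i-1}\otimes_\mathcal{A}\big(\mathcal{R}_1'^{-1}\rhd((\mathcal{R}_1^{-1}\rhd m_j)\otimes_\mathcal{A}(\mathcal{R}_2^{-1}\rhd(m_{i+1}\otimes_\mathcal{A}\cdots\otimes_\mathcal{A}m_{j-1})))\big)\otimes_\mathcal{A}(\mathcal{R}_2'^{-1}\rhd m_i)\otimes_\mathcal{A}m_{j+1}\otimes_\mathcal{A}\cdots\otimes_\mathcal{A}m_k$. **Multivector fields.** $\mathfrak{X}^1_\mathcal{R}(\mathcal{A})=\mathrm{Der}_\mathcal{R}(\mathcal{A})$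 is the set of braided derivations: $\Bbbk$-linear $X\colon\mathcal{A}\to\mathcal{A}$ with $X(ab)=X(a)b+(\mathcal{R}_1^{-1}\rhd a)((\mathcal{R}_2^{-1}\rhd X)(b))$; it is an $H$-equivariant braided symmetric $\mathcal{A}$-bimodule with adjoint action, $(a\cdot X)(b)=a\,X(b)$ and $X\cdot a=(\mathcal{R}_1^{-1}\rhd a)\cdot(\mathcal{R}_2^{-1}\rhd X)$. Put $[X,Y]_\mathcal{R}=XY-(\mathcal{R}_1^{-1}\rhd Y)(\mathcal{R}_2^{-1}\rhd X)$, $\mathscr{L}^\mathcal{R}_Xa=X(a)$ for $a\in\mathcal{A}$, and $\mathfrak{X}^\bullet_\mathcal{R}(\mathcal{A})=\Lambda^\bullet\mathrm{Der}_\mathcal{R}(\mathcal{A})$. **Forms.** $\underline{\Omega}^1_\mathcal{R}(\mathcal{A})$ is the set of $\Bbbk$-linear $\omega\colon\mathrm{Der}_\mathcal{R}(\mathcal{A})\to\mathcal{A}$ with $\omega(X\cdot a)=\omega(X)a$, with adjoint $H$-action, $(a\cdot\omega)(X)=a\,\omega(X)$, $(\omega\cdot a)(X)=\omega(\mathcal{R}_1^{-1}\rhd X)(\mathcal{R}_2^{-1}\rhd a)$. Put $\underline{\Omega}^\bullet_\mathcal{R}(\mathcal{A})=\Lambda^\bullet\underline{\Omega}^1_\mathcal{R}(\mathcal{A})$; two-forms are evaluated by $(\omega\wedge_\mathcal{R}\eta)(X,Y)=\omega(\mathcal{R}_1^{-1}\rhd X)\,(\mathcal{R}_2^{-1}\rhd\eta)(Y)-\omega(\mathcal{R}_1^{-1}\rhd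 Y)\,(\mathcal{R}^{-1}_{2(1)}\rhd\eta)(\mathcal{R}^{-1}_{2(2)}\rhd X)$. The differential $\mathrm{d}$ is defined on $a\in\mathcal{A}$ by $(\mathcal{R}_1^{-1}\rhd\mathrm{d}a)(\mathcal{R}_2^{-1}\rhd X)=X(a)$, on one-forms by $(\mathrm{d}\omega)(X,Y)=(\mathcal{R}_1^{-1}\rhd X)((\mathcal{R}_2^{-1}\rhd\omega)(Y))-(\mathcal{R}_1^{-1}\rhd Y)(\mathcal{R}_2^{-1}\rhd(\omega(X)))-\omega([X,Y]_\mathcal{R})$, and as a graded derivation of $\wedge_\mathcal{R}$. The braided differential forms $\Omega^\bullet_\mathcal{R}(\mathcal{A})$ are the smallest differential graded subalgebra of $\underline{\Omega}^\bullet_\mathcal{R}(\mathcal{A})$ containing $\mathcal{A}$. The braided dual pairing $\langle\cdot,\cdot\rangle_\mathcal{R}\colon\Omega^1_\mathcal{R}(\mathcal{A})\otimes\mathfrak{X}^1_\mathcal{R}(\mathcal{A})\to\mathcal{A}$ is $\langle\omega,X\rangle_\mathcal{R}=\omega(X)$. **Equivariant covariant derivative.** On an $H$-equivariant braided symmetric $\mathcal{A}$-bimodule $\mathcal{M}$: a $\Bbbk$-linear map $\nabla^\mathcal{R}\colon\mathfrak{X}^1_\mathcal{R}(\mathcal{A})\otimes\mathcal{M}\to\mathcal{M}$ which is $H$-equivariant, $\xi\rhd(\nabla^\mathcal{R}_Xs)=\nabla^\mathcal{R}_{\xi_{(1)}\rhd X}(\xi_{(2)}\rhd s)$, with $\nabla^\mathcal{R}_{a\cdot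 X}s=a\cdot(\nabla^\mathcal{R}_Xs)$ and $\nabla^\mathcal{R}_X(a\cdot s)=(\mathscr{L}^\mathcal{R}_Xa)\cdot s+(\mathcal{R}_1^{-1}\rhd a)\cdot(\nabla^\mathcal{R}_{\mathcal{R}_2^{-1}\rhd X}s)$. Extending as a braided derivation means $\nabla^\mathcal{R}_X(s\wedge_\mathcal{R}t)=(\nabla^\mathcal{R}_Xs)\wedge_\mathcal{R}t+(\mathcal{R}_1^{-1}\rhd s)\wedge_\mathcal{R}\nabla^\mathcal{R}_{\mathcal{R}_2^{-1}\rhd X}t$ (same for $\tilde{\nabla}^\mathcal{R}$), with $\nabla^\mathcal{R}_Xa=\mathscr{L}^\mathcal{R}_Xa$ in degree $0$.
   Formalization: On Ω¹ and Ω^• the claim is proved assuming the formula's derivative maps Ω¹ into itself, which can fail (e.g. F_p[x,y,z]/(xy−z^p), H=k) and is necessary for the claim; on all k-linear, right A-linear one-forms and their exterior algebra it is proved unconditionally. *)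

theory Defs
  imports
    "HOL-Computational_Algebra.Group_Closure"
    "HOL-Algebra.Free_Abelian_Groups"
    "HOL-Algebra.QuotRing"
    "HOL-Algebra.Subrings"
begin

text \<open>
  The base ring, the Hopf algebra and the module algebra are whole types.  The sorts
  \<open>{comm_ring, comm_monoid_mult}\<close> and \<open>{ring, monoid_mult}\<close> are used instead of
  \<open>comm_ring_1\<close> and \<open>ring_1\<close> because the latter exclude the zero ring.
  Modules such as the braided derivations are proper subsets of function types, or consist of
  cosets; they are records in the style of HOL-Algebra.

  An element of a tensor product is given in Sweedler style, by a finite list of words
  (the pure tensors whose sum it is).  Equality of two such sums is equality in the tensor product,
  i.e. in the free abelian group on words modulo additivity in each slot and balancing.
\<close>

section \<open>Tensor products\<close>

definition tensor_relators ::
    "'m set \<Rightarrow> ('m \<Rightarrow> 'm \<Rightarrow> 'm) \<Rightarrow> ('s \<Rightarrow> 'm \<Rightarrow> 'm) \<Rightarrow> ('m \<Rightarrow> 's \<Rightarrow> 'm) \<Rightarrow> ('m list \<Rightarrow>\<^sub>0 int) set" where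
  "tensor_relators C pl lft rgt =
     {frag_of (u @ [pl x y] @ v) - frag_of (u @ [x] @ v) - frag_of (u @ [y] @ v) | u v x y.
        set u \<union> set v \<union> {x, y} \<subseteq> C} \<union>
     {frag_of (u @ [rgt x c, y] @ v) - frag_of (u @ [x, lft c y] @ v) | u v x y c.
        set u \<union> set v \<union> {x, y} \<subseteq> C}"

definition tensor_null ::
    "'m set \<Rightarrow> ('m \<Rightarrow> 'm \<Rightarrow> 'm) \<Rightarrow> ('s \<Rightarrow> 'm \<Rightarrow> 'm) \<Rightarrow> ('m \<Rightarrow> 's \<Rightarrow> 'm) \<Rightarrow> ('m list \<Rightarrow>\<^sub>0 int) set" where
  "tensor_null C pl lft rgt = group_closure (tensor_relators C pl lft rgt)"


section \<open>Triangular Hopf algebras\<close>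

definition k_algebra :: "('k::{comm_ring, comm_monoid_mult} \<Rightarrow> 'a::{ring, monoid_mult} \<Rightarrow> 'a) \<Rightarrow> bool" where
  "k_algebra sm \<longleftrightarrow>
     (\<forall>c x y. sm c (x + y) = sm c x + sm c y) \<and>
     (\<forall>c d x. sm (c + d) x = sm c x + sm d x) \<and>
     (\<forall>c d x. sm (c * d) x = sm c (sm d x)) \<and>
     (\<forall>x. sm 1 x = x) \<and>
     (\<forall>c x y. sm c x * y = sm c (x * y)) \<and>
     (\<forall>c x y. x * sm c y = sm c (x * y))"

text \<open>\<open>coprod H \<xi>\<close> is a list of pairs representing $\sum \xi_{(1)} \otimes \xi_{(2)}$.\<close>

record ('k, 'h) hopf =
  hsmult :: "'k \<Rightarrow> 'h \<Rightarrow> 'h"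
  coprod :: "'h \<Rightarrow> ('h \<times> 'h) list"
  counit :: "'h \<Rightarrow> 'k"
  antipode :: "'h \<Rightarrow> 'h"

text \<open>Equality in $H \otimes_k \cdots \otimes_k H$ (at least one factor).\<close>

definition tensor_eq :: "('k, 'h::{ring, monoid_mult}) hopf \<Rightarrow> 'h list list \<Rightarrow> 'h list list \<Rightarrow> bool" where
  "tensor_eq H xs ys \<longleftrightarrow>
     (\<Sum>w\<leftarrow>xs. frag_of w) - (\<Sum>w\<leftarrow>ys. frag_of w)
       \<in> tensor_null UNIV (+) (hsmult H) (\<lambda>x c. hsmult H c x)"

definition hopf_algebra ::
    "('k::{comm_ring, comm_monoid_mult}, 'h::{ring, monoid_mult}) hopf \<Rightarrow> bool" where
  "hopf_algebra H \<longleftrightarrow>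
     k_algebra (hsmult H) \<and>
     (\<forall>x y. tensor_eq H [[a, b]. (a, b) \<leftarrow> coprod H (x + y)] [[a, b]. (a, b) \<leftarrow> coprod H x @ coprod H y]) \<and>
     (\<forall>c x. tensor_eq H [[a, b]. (a, b) \<leftarrow> coprod H (hsmult H c x)] [[hsmult H c a, b]. (a, b) \<leftarrow> coprod H x]) \<and>
     (\<forall>x y. tensor_eq H [[a, b]. (a, b) \<leftarrow> coprod H (x * y)]
        [[a * a', b * b']. (a, b) \<leftarrow> coprod H x, (a', b') \<leftarrow> coprod H y]) \<and>
     tensor_eq H [[a, b]. (a, b) \<leftarrow> coprod H 1] [[1, 1]] \<and>
     (\<forall>x. tensor_eq H [[a1, a2, b]. (a, b) \<leftarrow> coprod H x, (a1, a2) \<leftarrow> coprod H a]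
        [[a, b1, b2]. (a, b) \<leftarrow> coprod H x, (b1, b2) \<leftarrow> coprod H b]) \<and>
     (\<forall>x y. counit H (x + y) = counit H x + counit H y) \<and>
     (\<forall>c x. counit H (hsmult H c x) = c * counit H x) \<and>
     (\<forall>x y. counit H (x * y) = counit H x * counit H y) \<and>
     counit H 1 = 1 \<and>
     (\<forall>x. (\<Sum>(a, b)\<leftarrow>coprod H x. hsmult H (counit H a) b) = x) \<and>
     (\<forall>x. (\<Sum>(a, b)\<leftarrow>coprod H x. hsmult H (counit H b) a) = x) \<and>
     (\<forall>x y. antipode H (x + y) = antipode H x + antipode H y) \<and>
     (\<forall>c x. antipode H (hsmult H c x) = hsmult H c (antipode H x)) \<and>
     (\<forall>x. (\<Sum>(a, b)\<leftarrow>coprod H x. antipode H a * b) = hsmult H (counit H x) 1) \<and>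
     (\<forall>x. (\<Sum>(a, b)\<leftarrow>coprod H x. a * antipode H b) = hsmult H (counit H x) 1) \<and>
     bij (antipode H)"

text \<open>
  In the triangular case $\mathcal{R}^{-1} = \mathcal{R}_{21}$, so the inverse is the flip of
  \<open>R\<close>; that the flip is inverse to \<open>R\<close> is required in \<open>triangular\<close>.
\<close>

definition rinv :: "('h \<times> 'h) list \<Rightarrow> ('h \<times> 'h) list" where
  "rinv R = [(b, a). (a, b) \<leftarrow> R]"

definition triangular ::
    "('k::{comm_ring, comm_monoid_mult}, 'h::{ring, monoid_mult}) hopf \<Rightarrow> ('h \<times> 'h) list \<Rightarrow> bool" where
  "triangular H R \<longleftrightarrow>
     tensor_eq H [[a * r, b * s]. (a, b) \<leftarrow> R, (r, s) \<leftarrow> rinv R] [[1, 1]] \<and>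
     tensor_eq H [[r * a, s * b]. (r, s) \<leftarrow> rinv R, (a, b) \<leftarrow> R] [[1, 1]] \<and>
     (\<forall>x. tensor_eq H [[x2, x1]. (x1, x2) \<leftarrow> coprod H x]
        [[a * x1 * r, b * x2 * s]. (a, b) \<leftarrow> R, (x1, x2) \<leftarrow> coprod H x, (r, s) \<leftarrow> rinv R]) \<and>
     tensor_eq H [[a1, a2, b]. (a, b) \<leftarrow> R, (a1, a2) \<leftarrow> coprod H a]
        [[a, a', b * b']. (a, b) \<leftarrow> R, (a', b') \<leftarrow> R] \<and>
     tensor_eq H [[a, b1, b2]. (a, b) \<leftarrow> R, (b1, b2) \<leftarrow> coprod H b]
        [[a * a', b', b]. (a, b) \<leftarrow> R, (a', b') \<leftarrow> R]"

definition triangular_hopf_algebra ::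
    "('k::{comm_ring, comm_monoid_mult}, 'h::{ring, monoid_mult}) hopf \<Rightarrow> ('h \<times> 'h) list \<Rightarrow> bool" where
  "triangular_hopf_algebra H R \<longleftrightarrow> hopf_algebra H \<and> triangular H R"


section \<open>Module algebras and bimodules\<close>

record ('k, 'h, 'a) malg =
  asmult :: "'k \<Rightarrow> 'a \<Rightarrow> 'a"
  aact :: "'h \<Rightarrow> 'a \<Rightarrow> 'a"

definition module_algebra ::
    "('k::{comm_ring, comm_monoid_mult}, 'h::{ring, monoid_mult}) hopf
       \<Rightarrow> ('k, 'h, 'a::{ring, monoid_mult}) malg \<Rightarrow> bool" where
  "module_algebra H A \<longleftrightarrow>
     k_algebra (asmult A) \<and>
     (\<forall>x a b. aact A x (a + b) = aact A x a + aact A x b) \<and>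
     (\<forall>x y a. aact A (x + y) a = aact A x a + aact A y a) \<and>
     (\<forall>c x a. aact A (hsmult H c x) a = asmult A c (aact A x a)) \<and>
     (\<forall>c x a. aact A x (asmult A c a) = asmult A c (aact A x a)) \<and>
     (\<forall>x y a. aact A (x * y) a = aact A x (aact A y a)) \<and>
     (\<forall>a. aact A 1 a = a) \<and>
     (\<forall>x a b. aact A x (a * b) = (\<Sum>(x1, x2)\<leftarrow>coprod H x. aact A x1 a * aact A x2 b)) \<and>
     (\<forall>x. aact A x 1 = asmult A (counit H x) 1)"

definition braided_commutative ::
    "('h \<times> 'h) list \<Rightarrow> ('k, 'h, 'a::{ring, monoid_mult}) malg \<Rightarrow> bool" where
  "braided_commutative R A \<longleftrightarrow> (\<forall>a b. b * a = (\<Sum>(r, s)\<leftarrow>rinv R. aact A r a * aact A s b))"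

text \<open>
  As for \<open>module\<close> in HOL-Algebra, the fields \<open>mult\<close> and \<open>one\<close> are irrelevant for a mere bimodule;
  they are the product and unit when the bimodule is an algebra.
\<close>

record ('a, 'h, 'm) bimod = "'m ring" +
  lact :: "'a \<Rightarrow> 'm \<Rightarrow> 'm"
  ract :: "'m \<Rightarrow> 'a \<Rightarrow> 'm"
  hact :: "'h \<Rightarrow> 'm \<Rightarrow> 'm"

definition lsum :: "('m, 'z) ring_scheme \<Rightarrow> 'm list \<Rightarrow> 'm" where
  "lsum M xs = foldr (\<lambda>x y. x \<oplus>\<^bsub>M\<^esub> y) xs \<zero>\<^bsub>M\<^esub>"

text \<open>
  The \<open>k\<close>-module structure of an \<open>A\<close>-bimodule is $c\,m = (c\,1_A)\cdot m = m\cdot(c\,1_A)$.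
\<close>

definition braided_symmetric_bimodule ::
    "('k::{comm_ring, comm_monoid_mult}, 'h::{ring, monoid_mult}) hopf \<Rightarrow> ('h \<times> 'h) list
       \<Rightarrow> ('k, 'h, 'a::{ring, monoid_mult}) malg \<Rightarrow> ('a, 'h, 'm) bimod \<Rightarrow> bool" where
  "braided_symmetric_bimodule H R A M \<longleftrightarrow>
     abelian_group M \<and>
     (\<forall>a. \<forall>m\<in>carrier M. lact M a m \<in> carrier M \<and> ract M m a \<in> carrier M) \<and>
     (\<forall>x. \<forall>m\<in>carrier M. hact M x m \<in> carrier M) \<and>
     (\<forall>a. \<forall>m\<in>carrier M. \<forall>n\<in>carrier M.
        lact M a (m \<oplus>\<^bsub>M\<^esub> n) = lact M a m \<oplus>\<^bsub>M\<^esub> lact M a n \<and>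
        ract M (m \<oplus>\<^bsub>M\<^esub> n) a = ract M m a \<oplus>\<^bsub>M\<^esub> ract M n a) \<and>
     (\<forall>a b. \<forall>m\<in>carrier M.
        lact M (a + b) m = lact M a m \<oplus>\<^bsub>M\<^esub> lact M b m \<and>
        ract M m (a + b) = ract M m a \<oplus>\<^bsub>M\<^esub> ract M m b \<and>
        lact M (a * b) m = lact M a (lact M b m) \<and>
        ract M m (a * b) = ract M (ract M m a) b \<and>
        ract M (lact M a m) b = lact M a (ract M m b)) \<and>
     (\<forall>m\<in>carrier M. lact M 1 m = m \<and> ract M m 1 = m) \<and>
     (\<forall>c. \<forall>m\<in>carrier M. lact M (asmult A c 1) m = ract M m (asmult A c 1)) \<and>
     (\<forall>x. \<forall>m\<in>carrier M. \<forall>n\<in>carrier M. hact M x (m \<oplus>\<^bsub>M\<^esub> n) = hact M x m \<oplus>\<^bsub>M\<^esub> hact M x n) \<and>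
     (\<forall>x y. \<forall>m\<in>carrier M.
        hact M (x + y) m = hact M x m \<oplus>\<^bsub>M\<^esub> hact M y m \<and>
        hact M (x * y) m = hact M x (hact M y m)) \<and>
     (\<forall>m\<in>carrier M. hact M 1 m = m) \<and>
     (\<forall>c x. \<forall>m\<in>carrier M.
        hact M (hsmult H c x) m = lact M (asmult A c 1) (hact M x m) \<and>
        hact M x (lact M (asmult A c 1) m) = lact M (asmult A c 1) (hact M x m)) \<and>
     (\<forall>x a b. \<forall>m\<in>carrier M.
        hact M x (ract M (lact M a m) b) =
          lsum M [ract M (lact M (aact A x1 a) (hact M x2 m)) (aact A x3 b).
                    (x1, y) \<leftarrow> coprod H x, (x2, x3) \<leftarrow> coprod H y]) \<and>
     (\<forall>a. \<forall>m\<in>carrier M.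
        ract M m a = lsum M [lact M (aact A r a) (hact M s m). (r, s) \<leftarrow> rinv R])"


section \<open>Braided derivations and one-forms\<close>

text \<open>Adjoint action on maps into \<open>A\<close>; \<open>hv\<close> is the action on the domain.\<close>

definition adj_act ::
    "('k, 'h) hopf \<Rightarrow> ('k, 'h, 'a::{ring, monoid_mult}) malg \<Rightarrow> ('h \<Rightarrow> 'v \<Rightarrow> 'v)
       \<Rightarrow> 'h \<Rightarrow> ('v \<Rightarrow> 'a) \<Rightarrow> 'v \<Rightarrow> 'a" where
  "adj_act H A hv x \<Phi> = (\<lambda>v. \<Sum>(x1, x2)\<leftarrow>coprod H x. aact A x1 (\<Phi> (hv (antipode H x2) v)))"

definition Der ::
    "('k, 'h) hopf \<Rightarrow> ('h \<times> 'h) list \<Rightarrow> ('k, 'h, 'a::{ring, monoid_mult}) malg \<Rightarrow> ('a \<Rightarrow> 'a) set" where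
  "Der H R A =
     {X. (\<forall>a b. X (a + b) = X a + X b) \<and>
         (\<forall>c a. X (asmult A c a) = asmult A c (X a)) \<and>
         (\<forall>a b. X (a * b) =
            X a * b + (\<Sum>(r, s)\<leftarrow>rinv R. aact A r a * adj_act H A (aact A) s X b))}"

definition vfields ::
    "('k, 'h) hopf \<Rightarrow> ('h \<times> 'h) list \<Rightarrow> ('k, 'h, 'a::{ring, monoid_mult}) malg
       \<Rightarrow> ('a, 'h, 'a \<Rightarrow> 'a) bimod" where
  "vfields H R A =
     \<lparr>carrier = Der H R A, mult = undefined, one = undefined,
      zero = (\<lambda>b. 0), add = (\<lambda>X Y b. X b + Y b),
      lact = (\<lambda>a X b. a * X b),
      ract = (\<lambda>X a b. \<Sum>(r, s)\<leftarrow>rinv R. aact A r a * adj_act H A (aact A) s X b),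
      hact = adj_act H A (aact A)\<rparr>"

definition braided_bracket ::
    "('k, 'h) hopf \<Rightarrow> ('h \<times> 'h) list \<Rightarrow> ('k, 'h, 'a::{ring, monoid_mult}) malg
       \<Rightarrow> ('a \<Rightarrow> 'a) \<Rightarrow> ('a \<Rightarrow> 'a) \<Rightarrow> 'a \<Rightarrow> 'a" where
  "braided_bracket H R A X Y = (\<lambda>a. X (Y a) -
     (\<Sum>(r, s)\<leftarrow>rinv R. hact (vfields H R A) r Y (hact (vfields H R A) s X a)))"

text \<open>
  The full one-forms $\underline{\Omega}^1$.  Functions on \<open>Der\<close> are represented by
  functions on all maps \<open>'a \<Rightarrow> 'a\<close> that vanish outside \<open>Der\<close>.
\<close>

definition one_forms ::
    "('k, 'h) hopf \<Rightarrow> ('h \<times> 'h) list \<Rightarrow> ('k, 'h, 'a::{ring, monoid_mult}) malg \<Rightarrow> (('a \<Rightarrow> 'a) \<Rightarrow> 'a) set" where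
  "one_forms H R A =
     {\<omega>. (\<forall>X\<in>Der H R A. \<forall>Y\<in>Der H R A. \<omega> (\<lambda>b. X b + Y b) = \<omega> X + \<omega> Y) \<and>
         (\<forall>c. \<forall>X\<in>Der H R A. \<omega> (\<lambda>b. asmult A c (X b)) = asmult A c (\<omega> X)) \<and>
         (\<forall>a. \<forall>X\<in>Der H R A. \<omega> (ract (vfields H R A) X a) = \<omega> X * a) \<and>
         (\<forall>X. X \<notin> Der H R A \<longrightarrow> \<omega> X = 0)}"

definition full_forms1 ::
    "('k, 'h) hopf \<Rightarrow> ('h \<times> 'h) list \<Rightarrow> ('k, 'h, 'a::{ring, monoid_mult}) malg
       \<Rightarrow> ('a, 'h, ('a \<Rightarrow> 'a) \<Rightarrow> 'a) bimod" where
  "full_forms1 H R A =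
     \<lparr>carrier = one_forms H R A, mult = undefined, one = undefined,
      zero = (\<lambda>X. 0), add = (\<lambda>\<omega> \<eta> X. \<omega> X + \<eta> X),
      lact = (\<lambda>a \<omega> X. a * \<omega> X),
      ract = (\<lambda>\<omega> a X. if X \<in> Der H R A
                then \<Sum>(r, s)\<leftarrow>rinv R. \<omega> (hact (vfields H R A) r X) * aact A s a else 0),
      hact = (\<lambda>x \<omega> X. if X \<in> Der H R A
                then adj_act H A (hact (vfields H R A)) x \<omega> X else 0)\<rparr>"


section \<open>Tensor algebra and braided exterior algebra of a bimodule\<close>

text \<open>
  $\mathrm{T}^\bullet M = A \oplus M \oplus (M \otimes_A M) \oplus \cdots$ consists of pairs: the
  degree zero component, and a class of formal sums of nonempty words in \<open>M\<close>.  All relators are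
  homogeneous in the word length, so the second component is the direct sum over all
  positive degrees.
\<close>

definition tensor_class :: "('a, 'h, 'm) bimod \<Rightarrow> ('m list \<Rightarrow>\<^sub>0 int) \<Rightarrow> ('m list \<Rightarrow>\<^sub>0 int) set" where
  "tensor_class M f = {g. g - f \<in> tensor_null (carrier M) (add M) (lact M) (ract M)}"

definition tensor_lift ::
    "('a, 'h, 'm) bimod \<Rightarrow> (('m list \<Rightarrow>\<^sub>0 int) \<Rightarrow> ('m list \<Rightarrow>\<^sub>0 int))
       \<Rightarrow> ('m list \<Rightarrow>\<^sub>0 int) set \<Rightarrow> ('m list \<Rightarrow>\<^sub>0 int) set" where
  "tensor_lift M \<phi> P = (\<Union>f\<in>P. tensor_class M (\<phi> f))"

definition word_lact :: "('a, 'h, 'm) bimod \<Rightarrow> 'a \<Rightarrow> ('m list \<Rightarrow>\<^sub>0 int) \<Rightarrow> ('m list \<Rightarrow>\<^sub>0 int)" where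
  "word_lact M a = frag_extend (\<lambda>w. frag_of (lact M a (hd w) # tl w))"

definition word_ract :: "('a, 'h, 'm) bimod \<Rightarrow> ('m list \<Rightarrow>\<^sub>0 int) \<Rightarrow> 'a \<Rightarrow> ('m list \<Rightarrow>\<^sub>0 int)" where
  "word_ract M f a = frag_extend (\<lambda>w. frag_of (butlast w @ [ract M (last w) a])) f"

definition word_mult :: "('m list \<Rightarrow>\<^sub>0 int) \<Rightarrow> ('m list \<Rightarrow>\<^sub>0 int) \<Rightarrow> ('m list \<Rightarrow>\<^sub>0 int)" where
  "word_mult f g = frag_extend (\<lambda>u. frag_extend (\<lambda>v. frag_of (u @ v)) g) f"

text \<open>The action via iterated coproducts; only used for nonempty words.\<close>

fun word_hact_list :: "('k, 'h) hopf \<Rightarrow> ('a, 'h, 'm) bimod \<Rightarrow> 'h \<Rightarrow> 'm list \<Rightarrow> 'm list list" where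
  "word_hact_list H M x [] = []"
| "word_hact_list H M x [m] = [[hact M x m]]"
| "word_hact_list H M x (m # n # w) =
     [hact M x1 m # w'. (x1, x2) \<leftarrow> coprod H x, w' \<leftarrow> word_hact_list H M x2 (n # w)]"

definition word_hact ::
    "('k, 'h) hopf \<Rightarrow> ('a, 'h, 'm) bimod \<Rightarrow> 'h \<Rightarrow> ('m list \<Rightarrow>\<^sub>0 int) \<Rightarrow> ('m list \<Rightarrow>\<^sub>0 int)" where
  "word_hact H M x = frag_extend (\<lambda>w. \<Sum>w'\<leftarrow>word_hact_list H M x w. frag_of w')"

definition tensor_algebra ::
    "('k, 'h) hopf \<Rightarrow> ('k, 'h, 'a::{ring, monoid_mult}) malg \<Rightarrow> ('a, 'h, 'm) bimod
       \<Rightarrow> ('a, 'h, 'a \<times> ('m list \<Rightarrow>\<^sub>0 int) set) bimod" where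
  "tensor_algebra H A M =
     \<lparr>carrier = {(a, tensor_class M f) | a f. \<forall>w\<in>Poly_Mapping.keys f. w \<noteq> [] \<and> set w \<subseteq> carrier M},
      mult = (\<lambda>(a, P) (b, Q). (a * b,
        \<Union>f\<in>P. \<Union>g\<in>Q. tensor_class M (word_lact M a g + word_ract M f b + word_mult f g))),
      one = (1, tensor_class M 0),
      zero = (0, tensor_class M 0),
      add = (\<lambda>(a, P) (b, Q). (a + b, \<Union>f\<in>P. \<Union>g\<in>Q. tensor_class M (f + g))),
      lact = (\<lambda>a (b, P). (a * b, tensor_lift M (word_lact M a) P)),
      ract = (\<lambda>(b, P) a. (b * a, tensor_lift M (\<lambda>f. word_ract M f a) P)),
      hact = (\<lambda>x (b, P). (aact A x b, tensor_lift M (word_hact H M x) P))\<rparr>"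

text \<open>
  Braided exchange of the factors at positions \<open>i < j\<close>, counted from \<open>0\<close>.  If no factors lie in
  between, the inner braiding is with the unit of \<open>A\<close> and hence trivial.
\<close>

definition exchange_word ::
    "('k, 'h) hopf \<Rightarrow> ('h \<times> 'h) list \<Rightarrow> ('a, 'h, 'm) bimod \<Rightarrow> nat \<Rightarrow> nat \<Rightarrow> 'm list \<Rightarrow> 'm list list" where
  "exchange_word H R M i j w =
     (let mid = take (j - Suc i) (drop (Suc i) w);
          inner = (if mid = [] then [[w ! j]]
                   else [hact M r (w ! j) # z. (r, s) \<leftarrow> rinv R, z \<leftarrow> word_hact_list H M s mid])
      in [take i w @ z' @ [hact M s' (w ! i)] @ drop (Suc j) w.
            (r', s') \<leftarrow> rinv R, z \<leftarrow> inner, z' \<leftarrow> word_hact_list H M r' z])"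

definition exchange ::
    "('k, 'h) hopf \<Rightarrow> ('h \<times> 'h) list \<Rightarrow> ('a, 'h, 'm) bimod \<Rightarrow> nat \<Rightarrow> nat
       \<Rightarrow> ('m list \<Rightarrow>\<^sub>0 int) \<Rightarrow> ('m list \<Rightarrow>\<^sub>0 int)" where
  "exchange H R M i j = frag_extend (\<lambda>w. \<Sum>z\<leftarrow>exchange_word H R M i j w. frag_of z)"

definition exchange_fixed ::
    "('k, 'h) hopf \<Rightarrow> ('h \<times> 'h) list \<Rightarrow> ('a::{ring, monoid_mult}, 'h, 'm) bimod
       \<Rightarrow> ('a \<times> ('m list \<Rightarrow>\<^sub>0 int) set) set" where
  "exchange_fixed H R M =
     {(0, tensor_class M f) | f i j k.
        i < j \<and> j < k \<and>
        (\<forall>w\<in>Poly_Mapping.keys f. length w = k \<and> set w \<subseteq> carrier M) \<and>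
        tensor_class M (exchange H R M i j f) = tensor_class M f}"

definition ext_ideal ::
    "('k, 'h) hopf \<Rightarrow> ('h \<times> 'h) list \<Rightarrow> ('k, 'h, 'a::{ring, monoid_mult}) malg \<Rightarrow> ('a, 'h, 'm) bimod
       \<Rightarrow> ('a \<times> ('m list \<Rightarrow>\<^sub>0 int) set) set" where
  "ext_ideal H R A M = Idl\<^bsub>tensor_algebra H A M\<^esub> (exchange_fixed H R M)"

definition ext_coset ::
    "('k, 'h) hopf \<Rightarrow> ('h \<times> 'h) list \<Rightarrow> ('k, 'h, 'a::{ring, monoid_mult}) malg \<Rightarrow> ('a, 'h, 'm) bimod
       \<Rightarrow> 'a \<times> ('m list \<Rightarrow>\<^sub>0 int) set \<Rightarrow> ('a \<times> ('m list \<Rightarrow>\<^sub>0 int) set) set" where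
  "ext_coset H R A M t = ext_ideal H R A M +>\<^bsub>tensor_algebra H A M\<^esub> t"

definition ext_algebra ::
    "('k, 'h) hopf \<Rightarrow> ('h \<times> 'h) list \<Rightarrow> ('k, 'h, 'a::{ring, monoid_mult}) malg \<Rightarrow> ('a, 'h, 'm) bimod
       \<Rightarrow> ('a, 'h, ('a \<times> ('m list \<Rightarrow>\<^sub>0 int) set) set) bimod" where
  "ext_algebra H R A M =
     (let T = tensor_algebra H A M; Q = T Quot (ext_ideal H R A M) in
      \<lparr>carrier = carrier Q, mult = mult Q, one = one Q, zero = zero Q, add = add Q,
       lact = (\<lambda>a P. \<Union>t\<in>P. ext_coset H R A M (lact T a t)),
       ract = (\<lambda>P a. \<Union>t\<in>P. ext_coset H R A M (ract T t a)),
       hact = (\<lambda>x P. \<Union>t\<in>P. ext_coset H R A M (hact T x t))\<rparr>)"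

definition ext_in0 ::
    "('k, 'h) hopf \<Rightarrow> ('h \<times> 'h) list \<Rightarrow> ('k, 'h, 'a::{ring, monoid_mult}) malg \<Rightarrow> ('a, 'h, 'm) bimod
       \<Rightarrow> 'a \<Rightarrow> ('a \<times> ('m list \<Rightarrow>\<^sub>0 int) set) set" where
  "ext_in0 H R A M a = ext_coset H R A M (a, tensor_class M 0)"

definition ext_in1 ::
    "('k, 'h) hopf \<Rightarrow> ('h \<times> 'h) list \<Rightarrow> ('k, 'h, 'a::{ring, monoid_mult}) malg \<Rightarrow> ('a, 'h, 'm) bimod
       \<Rightarrow> 'm \<Rightarrow> ('a \<times> ('m list \<Rightarrow>\<^sub>0 int) set) set" where
  "ext_in1 H R A M m = ext_coset H R A M (0, tensor_class M (frag_of [m]))"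

definition ext_degree ::
    "('k, 'h) hopf \<Rightarrow> ('h \<times> 'h) list \<Rightarrow> ('k, 'h, 'a::{ring, monoid_mult}) malg \<Rightarrow> ('a, 'h, 'm) bimod
       \<Rightarrow> nat \<Rightarrow> ('a \<times> ('m list \<Rightarrow>\<^sub>0 int) set) set set" where
  "ext_degree H R A M k =
     {ext_coset H R A M (a, tensor_class M f) | a f.
        (k \<noteq> 0 \<longrightarrow> a = 0) \<and>
        (\<forall>w\<in>Poly_Mapping.keys f. w \<noteq> [] \<and> length w = k \<and> set w \<subseteq> carrier M)}"

abbreviation multivector_fields where
  "multivector_fields H R A \<equiv> ext_algebra H R A (vfields H R A)"

abbreviation full_forms where
  "full_forms H R A \<equiv> ext_algebra H R A (full_forms1 H R A)"


section \<open>Differential and braided differential forms\<close>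

text \<open>Value on \<open>(X, Y)\<close> of the wedge product of the one-forms \<open>\<alpha>\<close> and \<open>\<beta>\<close>.\<close>

definition wedge_eval ::
    "('k, 'h) hopf \<Rightarrow> ('h \<times> 'h) list \<Rightarrow> ('k, 'h, 'a::{ring, monoid_mult}) malg
       \<Rightarrow> (('a \<Rightarrow> 'a) \<Rightarrow> 'a) \<Rightarrow> (('a \<Rightarrow> 'a) \<Rightarrow> 'a) \<Rightarrow> ('a \<Rightarrow> 'a) \<Rightarrow> ('a \<Rightarrow> 'a) \<Rightarrow> 'a" where
  "wedge_eval H R A \<alpha> \<beta> X Y =
     (\<Sum>(r, s)\<leftarrow>rinv R. \<alpha> (hact (vfields H R A) r X) * hact (full_forms1 H R A) s \<beta> Y) -
     (\<Sum>(r, s)\<leftarrow>rinv R. \<Sum>(s1, s2)\<leftarrow>coprod H s.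
        \<alpha> (hact (vfields H R A) r Y) * hact (full_forms1 H R A) s1 \<beta> (hact (vfields H R A) s2 X))"

text \<open>
  \<open>d\<close> is a differential on $\underline{\Omega}^\bullet$: \<open>k\<close>-linear, of degree one, a graded
  derivation, square zero, with the prescribed values on functions and on one-forms.
  The value on a one-form is prescribed through the evaluation of a representation
  $\mathrm{d}\omega = \sum \alpha\wedge\beta$.  Such a \<open>d\<close> need not exist for every \<open>A\<close>,
  since two-forms are not determined by, and do not realise, arbitrary values on pairs of
  derivations; hence it is a predicate.
\<close>

definition braided_differential ::
    "('k, 'h) hopf \<Rightarrow> ('h \<times> 'h) list \<Rightarrow> ('k, 'h, 'a::{ring, monoid_mult}) malg
       \<Rightarrow> (('a \<times> ((('a \<Rightarrow> 'a) \<Rightarrow> 'a) list \<Rightarrow>\<^sub>0 int) set) set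
            \<Rightarrow> ('a \<times> ((('a \<Rightarrow> 'a) \<Rightarrow> 'a) list \<Rightarrow>\<^sub>0 int) set) set) \<Rightarrow> bool" where
  "braided_differential H R A d \<longleftrightarrow>
     (let F = full_forms1 H R A; L = full_forms H R A; V = vfields H R A;
          \<iota>0 = ext_in0 H R A F; \<iota>1 = ext_in1 H R A F; deg = ext_degree H R A F in
      (\<forall>s\<in>carrier L. d s \<in> carrier L) \<and>
      (\<forall>s\<in>carrier L. \<forall>t\<in>carrier L. d (s \<oplus>\<^bsub>L\<^esub> t) = d s \<oplus>\<^bsub>L\<^esub> d t) \<and>
      (\<forall>c. \<forall>s\<in>carrier L. d (lact L (asmult A c 1) s) = lact L (asmult A c 1) (d s)) \<and>
      (\<forall>k. \<forall>s\<in>deg k. d s \<in> deg (Suc k)) \<and>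
      (\<forall>a. \<exists>\<alpha>\<in>carrier F. d (\<iota>0 a) = \<iota>1 \<alpha> \<and>
         (\<forall>X\<in>carrier V. (\<Sum>(r, s)\<leftarrow>rinv R. hact F r \<alpha> (hact V s X)) = X a)) \<and>
      (\<forall>\<omega>\<in>carrier F. \<exists>ws. set ws \<subseteq> carrier F \<times> carrier F \<and>
         d (\<iota>1 \<omega>) = lsum L [\<iota>1 \<alpha> \<otimes>\<^bsub>L\<^esub> \<iota>1 \<beta>. (\<alpha>, \<beta>) \<leftarrow> ws] \<and>
         (\<forall>X\<in>carrier V. \<forall>Y\<in>carrier V.
            (\<Sum>(\<alpha>, \<beta>)\<leftarrow>ws. wedge_eval H R A \<alpha> \<beta> X Y) =
              (\<Sum>(r, s)\<leftarrow>rinv R. hact V r X (hact F s \<omega> Y)) -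
              (\<Sum>(r, s)\<leftarrow>rinv R. hact V r Y (aact A s (\<omega> X))) -
              \<omega> (braided_bracket H R A X Y))) \<and>
      (\<forall>k. \<forall>s\<in>deg k. \<forall>t\<in>carrier L.
         d (s \<otimes>\<^bsub>L\<^esub> t) =
           (if even k then (d s \<otimes>\<^bsub>L\<^esub> t) \<oplus>\<^bsub>L\<^esub> (s \<otimes>\<^bsub>L\<^esub> d t) else (d s \<otimes>\<^bsub>L\<^esub> t) \<ominus>\<^bsub>L\<^esub> (s \<otimes>\<^bsub>L\<^esub> d t))) \<and>
      (\<forall>s\<in>carrier L. d (d s) = \<zero>\<^bsub>L\<^esub>))"

definition dg_subalgebra ::
    "('k, 'h) hopf \<Rightarrow> ('h \<times> 'h) list \<Rightarrow> ('k, 'h, 'a::{ring, monoid_mult}) malg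
       \<Rightarrow> (('a \<times> ((('a \<Rightarrow> 'a) \<Rightarrow> 'a) list \<Rightarrow>\<^sub>0 int) set) set
            \<Rightarrow> ('a \<times> ((('a \<Rightarrow> 'a) \<Rightarrow> 'a) list \<Rightarrow>\<^sub>0 int) set) set)
       \<Rightarrow> ('a \<times> ((('a \<Rightarrow> 'a) \<Rightarrow> 'a) list \<Rightarrow>\<^sub>0 int) set) set set \<Rightarrow> bool" where
  "dg_subalgebra H R A d S \<longleftrightarrow>
     (let F = full_forms1 H R A; L = full_forms H R A in
      subring S L \<and>
      (\<forall>c. \<forall>s\<in>S. lact L (asmult A c 1) s \<in> S) \<and>
      (\<forall>s\<in>S. \<exists>ys. set ys \<subseteq> S \<inter> (\<Union>k. ext_degree H R A F k) \<and> s = lsum L ys) \<and>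
      (\<forall>s\<in>S. d s \<in> S))"

text \<open>
  $\Omega^\bullet$, its degree one part $\Omega^1 \subseteq \underline{\Omega}^1$, with the
  structure inherited from $\underline{\Omega}^\bullet$ and $\underline{\Omega}^1$.
\<close>

definition forms ::
    "('k, 'h) hopf \<Rightarrow> ('h \<times> 'h) list \<Rightarrow> ('k, 'h, 'a::{ring, monoid_mult}) malg
       \<Rightarrow> (('a \<times> ((('a \<Rightarrow> 'a) \<Rightarrow> 'a) list \<Rightarrow>\<^sub>0 int) set) set
            \<Rightarrow> ('a \<times> ((('a \<Rightarrow> 'a) \<Rightarrow> 'a) list \<Rightarrow>\<^sub>0 int) set) set)
       \<Rightarrow> ('a, 'h, ('a \<times> ((('a \<Rightarrow> 'a) \<Rightarrow> 'a) list \<Rightarrow>\<^sub>0 int) set) set) bimod" where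
  "forms H R A d = (full_forms H R A)
     \<lparr>carrier := \<Inter>{S. dg_subalgebra H R A d S \<and> range (ext_in0 H R A (full_forms1 H R A)) \<subseteq> S}\<rparr>"

definition forms1 ::
    "('k, 'h) hopf \<Rightarrow> ('h \<times> 'h) list \<Rightarrow> ('k, 'h, 'a::{ring, monoid_mult}) malg
       \<Rightarrow> (('a \<times> ((('a \<Rightarrow> 'a) \<Rightarrow> 'a) list \<Rightarrow>\<^sub>0 int) set) set
            \<Rightarrow> ('a \<times> ((('a \<Rightarrow> 'a) \<Rightarrow> 'a) list \<Rightarrow>\<^sub>0 int) set) set)
       \<Rightarrow> ('a, 'h, ('a \<Rightarrow> 'a) \<Rightarrow> 'a) bimod" where
  "forms1 H R A d = (full_forms1 H R A)
     \<lparr>carrier := {\<omega> \<in> one_forms H R A.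
        ext_in1 H R A (full_forms1 H R A) \<omega> \<in> carrier (forms H R A d)}\<rparr>"


section \<open>Equivariant covariant derivatives\<close>

definition equivariant_cov_deriv ::
    "('k::{comm_ring, comm_monoid_mult}, 'h::{ring, monoid_mult}) hopf \<Rightarrow> ('h \<times> 'h) list
       \<Rightarrow> ('k, 'h, 'a::{ring, monoid_mult}) malg \<Rightarrow> ('a, 'h, 'm) bimod
       \<Rightarrow> (('a \<Rightarrow> 'a) \<Rightarrow> 'm \<Rightarrow> 'm) \<Rightarrow> bool" where
  "equivariant_cov_deriv H R A M N \<longleftrightarrow>
     braided_symmetric_bimodule H R A M \<and>
     (let V = vfields H R A in
      (\<forall>X\<in>carrier V. \<forall>s\<in>carrier M. N X s \<in> carrier M) \<and>
      (\<forall>X\<in>carrier V. \<forall>Y\<in>carrier V. \<forall>s\<in>carrier M. N (X \<oplus>\<^bsub>V\<^esub> Y) s = N X s \<oplus>\<^bsub>M\<^esub> N Y s) \<and>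
      (\<forall>X\<in>carrier V. \<forall>s\<in>carrier M. \<forall>t\<in>carrier M. N X (s \<oplus>\<^bsub>M\<^esub> t) = N X s \<oplus>\<^bsub>M\<^esub> N X t) \<and>
      (\<forall>c. \<forall>X\<in>carrier V. \<forall>s\<in>carrier M.
         N (lact V (asmult A c 1) X) s = lact M (asmult A c 1) (N X s) \<and>
         N X (lact M (asmult A c 1) s) = lact M (asmult A c 1) (N X s)) \<and>
      (\<forall>x. \<forall>X\<in>carrier V. \<forall>s\<in>carrier M.
         hact M x (N X s) = lsum M [N (hact V x1 X) (hact M x2 s). (x1, x2) \<leftarrow> coprod H x]) \<and>
      (\<forall>a. \<forall>X\<in>carrier V. \<forall>s\<in>carrier M. N (lact V a X) s = lact M a (N X s)) \<and>
      (\<forall>a. \<forall>X\<in>carrier V. \<forall>s\<in>carrier M.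
         N X (lact M a s) = lact M (X a) s \<oplus>\<^bsub>M\<^esub>
           lsum M [lact M (aact A r a) (N (hact V s' X) s). (r, s') \<leftarrow> rinv R]))"

text \<open>
  \<open>N'\<close> is an equivariant covariant derivative on \<open>L\<close> that extends \<open>N\<close> on \<open>M\<close> as a braided
  derivation.  Here \<open>\<iota>0\<close> and \<open>\<iota>1\<close> embed \<open>A\<close> and \<open>M\<close> into \<open>L\<close>.
\<close>

definition braided_derivation_extension ::
    "('k::{comm_ring, comm_monoid_mult}, 'h::{ring, monoid_mult}) hopf \<Rightarrow> ('h \<times> 'h) list
       \<Rightarrow> ('k, 'h, 'a::{ring, monoid_mult}) malg \<Rightarrow> ('a, 'h, 'm) bimod \<Rightarrow> ('a, 'h, 'l) bimod
       \<Rightarrow> ('a \<Rightarrow> 'l) \<Rightarrow> ('m \<Rightarrow> 'l)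
       \<Rightarrow> (('a \<Rightarrow> 'a) \<Rightarrow> 'm \<Rightarrow> 'm) \<Rightarrow> (('a \<Rightarrow> 'a) \<Rightarrow> 'l \<Rightarrow> 'l) \<Rightarrow> bool" where
  "braided_derivation_extension H R A M L \<iota>0 \<iota>1 N N' \<longleftrightarrow>
     equivariant_cov_deriv H R A L N' \<and>
     (\<forall>X\<in>Der H R A.
        (\<forall>a. N' X (\<iota>0 a) = \<iota>0 (X a)) \<and>
        (\<forall>m\<in>carrier M. N' X (\<iota>1 m) = \<iota>1 (N X m)) \<and>
        (\<forall>s\<in>carrier L. \<forall>t\<in>carrier L.
           N' X (s \<otimes>\<^bsub>L\<^esub> t) = (N' X s \<otimes>\<^bsub>L\<^esub> t) \<oplus>\<^bsub>L\<^esub>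
             lsum L [hact L r s \<otimes>\<^bsub>L\<^esub> N' (hact (vfields H R A) s' X) t. (r, s') \<leftarrow> rinv R]))"

end

theory Submission
  imports Defs
begin

text \<open>
  Both derivatives extend from a bimodule \<open>M\<close> to the tensor algebra by the Leibniz rule; the rule is
  compatible with the balancing over \<open>A\<close> because the two copies of \<open>\<R>\<close> that appear when a scalar
  is moved across a factor cancel.  The extension and the Hopf action are both given on words by
  expanding a coproduct or \<open>\<R>\<^sup>-\<^sup>1\<close> along the factors, and this expansion is compatible with products and
  with the braiding.  The exchange of two factors is composed of braidings, so the elements fixed by
  an exchange are stable under the action and the derivative, which therefore pass to the braided
  exterior algebra.

  The pairing of forms with vector fields is nondegenerate and equivariant.  Hence a differential,
  being prescribed by its pairing on functions, is equivariant on functions.  The braided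
  differential forms are spanned by products of functions and differentials of functions, and so are
  stable under the Hopf action, and under the derivative as soon as the one-forms are.
\<close>

section \<open>Finite sums and additive maps out of tensor products\<close>

text \<open>An element of H \<otimes> H is a list of pairs, so two Sweedler expressions for one
  tensor are different lists, and a Hopf algebra identity applies only under a map k-linear in each
  leg. This dictates the form of all computations: a sum \<open>sw\<close>, a rule for rewriting it,
  and linearity goals. Two obstacles shape the rest. Differentiating one factor of a tensor is not
  balanced over A; only the whole Leibniz sum is, because the correction terms of neighbouring
  factors agree. The exchange is never shown to descend to tensor products over A: it is handled as
  a k-multilinear function of words. An element counts as fixed through one representative, so
  action and derivative are lifted to lists of words of unchanged length, and their commutation with
  the exchange is checked on words. Equivariance of \<open>d\<close> on functions has to be read off
  from pairings, and an equivariance identity can be solved for the action of x when x is a value of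
  the antipode; this is where its surjectivity enters.\<close>

lemma lsum_Nil [simp]: "lsum M [] = \<zero>\<^bsub>M\<^esub>"
  and lsum_Cons [simp]: "lsum M (x # xs) = x \<oplus>\<^bsub>M\<^esub> lsum M xs"
  by (simp_all add: lsum_def)

lemma lsum_carrier_update [simp]: "lsum (M\<lparr>carrier := S\<rparr>) xs = lsum M xs"
  by (induction xs) simp_all

context abelian_group
begin

lemma lsum_closed: "set xs \<subseteq> carrier G \<Longrightarrow> lsum G xs \<in> carrier G"
  by (induction xs) auto

lemma lsum_append:
  "set xs \<subseteq> carrier G \<Longrightarrow> set ys \<subseteq> carrier G \<Longrightarrow> lsum G (xs @ ys) = lsum G xs \<oplus> lsum G ys"
  by (induction xs) (auto simp: a_assoc lsum_closed)

lemma minus_add_cancel': "x \<in> carrier G \<Longrightarrow> y \<in> carrier G \<Longrightarrow> x \<ominus> y \<oplus> y = x"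
  by (simp add: minus_eq a_assoc l_neg)

lemma eq_if_minus_eq_zero: "x \<in> carrier G \<Longrightarrow> y \<in> carrier G \<Longrightarrow> x \<ominus> y = \<zero> \<Longrightarrow> x = y"
  using minus_add_cancel'[of x y] by simp

lemma add_minus_cancel': "x \<in> carrier G \<Longrightarrow> y \<in> carrier G \<Longrightarrow> x \<oplus> y \<ominus> y = x"
  by (simp add: minus_eq a_assoc r_neg)

lemma add_minus_minus: "x \<in> carrier G \<Longrightarrow> y \<in> carrier G \<Longrightarrow> x \<oplus> y \<ominus> x \<ominus> y = \<zero>"
proof -
  assume xy: "x \<in> carrier G" "y \<in> carrier G"
  have "x \<oplus> y \<ominus> x = y"
    using add_minus_cancel'[OF xy(2,1)] a_comm[OF xy] by metis
  then show ?thesis using xy by (simp add: minus_eq r_neg)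
qed

end

text \<open>The common shape of all Sweedler sums: a list of pairs stands for the tensor, and a
  curried function into the target module is summed over it. Every rule for \<Delta> and \<R> below
  is an equation between such sums.\<close>

definition sw :: "('m, 'z) ring_scheme \<Rightarrow> ('x \<times> 'y) list \<Rightarrow> ('x \<Rightarrow> 'y \<Rightarrow> 'm) \<Rightarrow> 'm" where
  "sw M xs F = lsum M (map (\<lambda>(a, b). F a b) xs)"

lemma sw_Nil [simp]: "sw M [] F = \<zero>\<^bsub>M\<^esub>"
  and sw_Cons [simp]: "sw M ((a, b) # xs) F = F a b \<oplus>\<^bsub>M\<^esub> sw M xs F"
  by (simp_all add: sw_def)

lemma sw_cong: "(\<And>a b. F a b = G a b) \<Longrightarrow> sw M xs F = sw M xs G"
  by (simp add: sw_def)

lemma sw_carrier_update [simp]: "sw (M\<lparr>carrier := S\<rparr>) xs F = sw M xs F"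
  by (simp add: sw_def)

lemma sw_closed:
  assumes "abelian_group M" "\<And>a b. F a b \<in> carrier M"
  shows "sw M xs F \<in> carrier M"
proof -
  interpret abelian_group M by fact
  show ?thesis using assms(2) by (auto simp: sw_def intro!: lsum_closed)
qed

lemma sw_zero:
  assumes "abelian_group M" shows "sw M xs (\<lambda>a b. \<zero>\<^bsub>M\<^esub>) = \<zero>\<^bsub>M\<^esub>"
proof -
  interpret abelian_group M by fact
  show ?thesis by (induction xs) auto
qed

lemma sw_add:
  assumes "abelian_group M" "\<And>a b. F a b \<in> carrier M" "\<And>a b. G a b \<in> carrier M"
  shows "sw M xs (\<lambda>a b. F a b \<oplus>\<^bsub>M\<^esub> G a b) = sw M xs F \<oplus>\<^bsub>M\<^esub> sw M xs G"
proof -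
  interpret abelian_group M by fact
  show ?thesis
    by (induction xs) (auto simp: assms sw_closed[OF assms(1)] a_ac)
qed

lemma sw_append:
  assumes "abelian_group M" "\<And>a b. F a b \<in> carrier M"
  shows "sw M (xs @ ys) F = sw M xs F \<oplus>\<^bsub>M\<^esub> sw M ys F"
proof -
  interpret abelian_group M by fact
  show ?thesis
    by (induction xs) (auto simp: assms sw_closed[OF assms(1)] a_ac)
qed

lemma sw_swap:
  assumes "abelian_group M" "\<And>a b c d. F a b c d \<in> carrier M"
  shows "sw M xs (\<lambda>a b. sw M ys (\<lambda>c d. F a b c d)) = sw M ys (\<lambda>c d. sw M xs (\<lambda>a b. F a b c d))"
proof (induction xs)
  case Nil
  then show ?case by (simp add: sw_zero assms(1))
next
  case (Cons p xs)
  then show ?case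
    by (cases p) (simp add: sw_add[OF assms(1)] assms sw_closed)
qed

lemma additive_zero:
  assumes "abelian_group M" "abelian_group M'" "\<And>m. m \<in> carrier M \<Longrightarrow> \<phi> m \<in> carrier M'"
    and "\<And>m n. m \<in> carrier M \<Longrightarrow> n \<in> carrier M \<Longrightarrow> \<phi> (m \<oplus>\<^bsub>M\<^esub> n) = \<phi> m \<oplus>\<^bsub>M'\<^esub> \<phi> n"
  shows "\<phi> \<zero>\<^bsub>M\<^esub> = \<zero>\<^bsub>M'\<^esub>"
proof -
  interpret M: abelian_group M by fact
  interpret M': abelian_group M' by fact
  have "\<phi> \<zero>\<^bsub>M\<^esub> \<oplus>\<^bsub>M'\<^esub> \<phi> \<zero>\<^bsub>M\<^esub> = \<phi> \<zero>\<^bsub>M\<^esub>"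
    using assms(4)[of "\<zero>\<^bsub>M\<^esub>" "\<zero>\<^bsub>M\<^esub>"] by simp
  then show ?thesis
    using assms(3)[OF M.zero_closed] M'.add.r_cancel_one by auto
qed

lemma lsum_hom:
  assumes "abelian_group M" "abelian_group M'" "\<And>m. m \<in> carrier M \<Longrightarrow> \<phi> m \<in> carrier M'"
    and "\<And>m n. m \<in> carrier M \<Longrightarrow> n \<in> carrier M \<Longrightarrow> \<phi> (m \<oplus>\<^bsub>M\<^esub> n) = \<phi> m \<oplus>\<^bsub>M'\<^esub> \<phi> n"
    and "set xs \<subseteq> carrier M"
  shows "\<phi> (lsum M xs) = lsum M' (map \<phi> xs)"
  using assms(5)
  by (induction xs)
    (auto simp: additive_zero[OF assms(1-4)] assms(4) abelian_group.lsum_closed[OF assms(1)])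

lemma sw_hom:
  assumes "abelian_group M" "abelian_group M'" "\<And>m. m \<in> carrier M \<Longrightarrow> \<phi> m \<in> carrier M'"
    and "\<And>m n. m \<in> carrier M \<Longrightarrow> n \<in> carrier M \<Longrightarrow> \<phi> (m \<oplus>\<^bsub>M\<^esub> n) = \<phi> m \<oplus>\<^bsub>M'\<^esub> \<phi> n"
    and "\<And>a b. F a b \<in> carrier M"
  shows "\<phi> (sw M xs F) = sw M' xs (\<lambda>a b. \<phi> (F a b))"
  unfolding sw_def
  by (subst lsum_hom[OF assms(1-4)]) (auto simp: assms(5) intro!: arg_cong[where f="lsum M'"])

lemma additive_minus:
  assumes "abelian_group M" "abelian_group M'" "\<And>m. m \<in> carrier M \<Longrightarrow> \<phi> m \<in> carrier M'"
    and "\<And>m n. m \<in> carrier M \<Longrightarrow> n \<in> carrier M \<Longrightarrow> \<phi> (m \<oplus>\<^bsub>M\<^esub> n) = \<phi> m \<oplus>\<^bsub>M'\<^esub> \<phi> n"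
    and "m \<in> carrier M" "n \<in> carrier M"
  shows "\<phi> (m \<ominus>\<^bsub>M\<^esub> n) = \<phi> m \<ominus>\<^bsub>M'\<^esub> \<phi> n"
proof -
  interpret M: abelian_group M by fact
  interpret M': abelian_group M' by fact
  have "\<phi> m = \<phi> (m \<ominus>\<^bsub>M\<^esub> n) \<oplus>\<^bsub>M'\<^esub> \<phi> n"
    using assms(5,6) by (subst assms(4)[symmetric]) (auto simp: M.minus_eq M.a_assoc M.l_neg)
  then show ?thesis
    using assms(3)[OF assms(5)] assms(3)[OF assms(6)] assms(3)[OF M.minus_closed[OF assms(5,6)]]
    by (simp add: M'.minus_eq M'.a_assoc M'.r_neg)
qed

lemma lsum_map_concat:
  assumes "abelian_group M" "\<And>w. \<phi> w \<in> carrier M"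
  shows "lsum M (map \<phi> (concat xss)) = lsum M (map (\<lambda>xs. lsum M (map \<phi> xs)) xss)"
proof -
  interpret abelian_group M by fact
  show ?thesis
    by (induction xss) (auto simp: lsum_append lsum_closed image_subset_iff assms(2))
qed

text \<open>The target is a group given by a carrier, so the additive extension of \<phi> to formal
  sums is chosen from what the universal property of the free abelian group provides.\<close>

definition wlift :: "('b, 'z) ring_scheme \<Rightarrow> ('w \<Rightarrow> 'b) \<Rightarrow> ('w \<Rightarrow>\<^sub>0 int) \<Rightarrow> 'b" where
  "wlift B \<phi> = (SOME h. (\<forall>f g. h (f + g) = h f \<oplus>\<^bsub>B\<^esub> h g) \<and> (\<forall>f. h f \<in> carrier B) \<and>
     (\<forall>w. h (frag_of w) = \<phi> w))"

locale word_lift = abelian_group B for B :: "('b, 'z) ring_scheme" (structure) +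
  fixes \<phi> :: "'w \<Rightarrow> 'b"
  assumes word_closed: "\<And>w. \<phi> w \<in> carrier B"
begin

lemma wlift_spec:
  "(\<forall>f g. wlift B \<phi> (f + g) = wlift B \<phi> f \<oplus> wlift B \<phi> g) \<and> (\<forall>f. wlift B \<phi> f \<in> carrier B) \<and>
   (\<forall>w. wlift B \<phi> (frag_of w) = \<phi> w)"
proof -
  obtain h where "h \<in> hom (free_Abelian_group UNIV) (add_monoid B)"
    "\<And>w. w \<in> UNIV \<Longrightarrow> h (frag_of w) = \<phi> w"
    using comm_group.free_Abelian_group_universal[OF a_comm_group, of \<phi> UNIV] word_closed by (metis image_subsetI partial_object.simps(1))
  then have "(\<forall>f g. h (f + g) = h f \<oplus> h g) \<and> (\<forall>f. h f \<in> carrier B) \<and> (\<forall>w. h (frag_of w) = \<phi> w)"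
    by (auto simp: hom_def Pi_def)
  then have "\<exists>h. (\<forall>f g. h (f + g) = h f \<oplus> h g) \<and> (\<forall>f. h f \<in> carrier B) \<and> (\<forall>w. h (frag_of w) = \<phi> w)"
    by blast
  then show ?thesis unfolding wlift_def by (rule someI_ex)
qed

lemma wlift_add: "wlift B \<phi> (f + g) = wlift B \<phi> f \<oplus> wlift B \<phi> g"
  and wlift_closed [simp]: "wlift B \<phi> f \<in> carrier B"
  and wlift_of [simp]: "wlift B \<phi> (frag_of w) = \<phi> w"
  using wlift_spec by auto

lemma wlift_diff: "wlift B \<phi> (f - g) = wlift B \<phi> f \<ominus> wlift B \<phi> g"
proof -
  have "wlift B \<phi> f = wlift B \<phi> (f - g) \<oplus> wlift B \<phi> g"
    using wlift_add[of "f - g" g] by simp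
  then show ?thesis by (simp add: minus_eq a_assoc r_neg)
qed

lemma wlift_zero [simp]: "wlift B \<phi> 0 = \<zero>"
  using wlift_diff[of 0 0] by (simp add: r_neg minus_eq)

lemma wlift_sum_list: "wlift B \<phi> (\<Sum>x\<leftarrow>xs. frag_of x) = lsum B (map \<phi> xs)"
  by (induction xs) (auto simp: wlift_add)

text \<open>The null set is generated as a group by the relators, so additivity in each slot and
  balancing are all that a word function needs in order to factor through the tensor
  product.\<close>

lemma wlift_tensor_null:
  assumes add: "\<And>u v x y. set u \<union> set v \<union> {x, y} \<subseteq> C \<Longrightarrow>
      \<phi> (e (u @ [pl x y] @ v)) = \<phi> (e (u @ [x] @ v)) \<oplus> \<phi> (e (u @ [y] @ v))"
    and bal: "\<And>u v x y c. set u \<union> set v \<union> {x, y} \<subseteq> C \<Longrightarrow>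
      \<phi> (e (u @ [rgt x c, y] @ v)) = \<phi> (e (u @ [x, lft c y] @ v))"
    and f: "f \<in> tensor_null C pl lft rgt"
  shows "wlift B (\<lambda>w. \<phi> (e w)) f = \<zero>"
proof -
  interpret L: word_lift B "\<lambda>w. \<phi> (e w)"
    by unfold_locales (simp add: word_closed)
  show ?thesis
    using f unfolding tensor_null_def
  proof (induction f rule: group_closure.induct)
    case (base s)
    have "wlift B (\<lambda>w. \<phi> (e w)) s = \<zero>" if "s = frag_of (u @ [pl x y] @ v) - frag_of (u @ [x] @ v) - frag_of (u @ [y] @ v)"
      "set u \<union> set v \<union> {x, y} \<subseteq> C" for u v x y
      unfolding that(1) L.wlift_diff L.wlift_of add[OF that(2)]
      by (simp add: word_closed add_minus_minus)
    moreover have "wlift B (\<lambda>w. \<phi> (e w)) s = \<zero>" if "s = frag_of (u @ [rgt x c, y] @ v) - frag_of (u @ [x, lft c y] @ v)"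
      "set u \<union> set v \<union> {x, y} \<subseteq> C" for u v x y c
      unfolding that(1) L.wlift_diff L.wlift_of bal[OF that(2)]
      using word_closed by (simp add: minus_eq r_neg)
    ultimately show ?case
      using base L.wlift_zero unfolding tensor_relators_def by blast
  next
    case (diff s t)
    then show ?case by (simp add: L.wlift_diff minus_eq)
  qed
qed

end

text \<open>The way in which a \<open>tensor_eq\<close> hypothesis is exploited throughout: as an
  equality of sums in any module that receives a multilinear function.\<close>

lemma tensor_eq_lift:
  assumes "abelian_group M" and closed: "\<And>w. \<phi> w \<in> carrier M"
    and add: "\<And>u v x y. \<phi> (u @ [x + y] @ v) = \<phi> (u @ [x] @ v) \<oplus>\<^bsub>M\<^esub> \<phi> (u @ [y] @ v)"
    and bal: "\<And>u v x y c. \<phi> (u @ [hsmult H c x, y] @ v) = \<phi> (u @ [x, hsmult H c y] @ v)"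
    and eq: "tensor_eq H xs ys"
  shows "lsum M (map \<phi> xs) = lsum M (map \<phi> ys)"
proof -
  interpret abelian_group M by fact
  interpret word_lift M \<phi> by unfold_locales (rule closed)
  have "wlift M (\<lambda>w. \<phi> (id w)) ((\<Sum>w\<leftarrow>xs. frag_of w) - (\<Sum>w\<leftarrow>ys. frag_of w)) = \<zero>\<^bsub>M\<^esub>"
    using eq unfolding tensor_eq_def
    by (intro wlift_tensor_null) (auto simp only: id_apply add bal)
  then have "lsum M (map \<phi> xs) \<ominus>\<^bsub>M\<^esub> lsum M (map \<phi> ys) = \<zero>\<^bsub>M\<^esub>"
    by (simp add: wlift_diff wlift_sum_list del: sum_list.eq_foldr)
  moreover have "lsum M (map \<phi> xs) \<in> carrier M" "lsum M (map \<phi> ys) \<in> carrier M"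
    by (auto intro!: lsum_closed simp: closed)
  ultimately show ?thesis
    using eq_if_minus_eq_zero by blast
qed

section \<open>Sweedler calculus in a triangular Hopf algebra\<close>

text \<open>\<open>triangular\<close> speaks of \<open>R\<close>, the later sums run over its
  inverse. As the inverse is the flip, changing between them only swaps the bound variables.\<close>

lemma sw_rinv: "sw M R F = sw M (rinv R) (\<lambda>r s. F s r)"
proof -
  have *: "map (\<lambda>(a, b). F a b) R = map (\<lambda>(r, s). F s r) (rinv R)"
    by (induction R) (auto simp: rinv_def)
  show ?thesis by (simp only: sw_def *)
qed

locale thopf =
  fixes H :: "('k::{comm_ring, comm_monoid_mult}, 'h::{ring, monoid_mult}) hopf"
    and R :: "('h \<times> 'h) list"
    and A :: "('k, 'h, 'a::{ring, monoid_mult}) malg"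
  assumes tri: "triangular_hopf_algebra H R"
    and ma: "module_algebra H A"
    and bc: "braided_commutative R A"
begin

abbreviation \<Delta> where "\<Delta> \<equiv> coprod H"
abbreviation \<rho> where "\<rho> \<equiv> rinv R"
abbreviation \<epsilon> where "\<epsilon> \<equiv> counit H"
abbreviation S where "S \<equiv> antipode H"
abbreviation sc where "sc M c m \<equiv> lact M (asmult A c 1) m"

text \<open>The k-module part of a bimodule, isolated because the Sweedler rules already have to be
  available for A and the tensor algebra while their bimodule axioms are being proved.\<close>

definition scm :: "('a, 'h, 'm) bimod \<Rightarrow> bool" where
  "scm M \<longleftrightarrow> abelian_group M \<and> (\<forall>c. \<forall>m\<in>carrier M. sc M c m \<in> carrier M) \<and>
     (\<forall>c. \<forall>m\<in>carrier M. \<forall>n\<in>carrier M. sc M c (m \<oplus>\<^bsub>M\<^esub> n) = sc M c m \<oplus>\<^bsub>M\<^esub> sc M c n) \<and>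
     (\<forall>c d. \<forall>m\<in>carrier M. sc M (c + d) m = sc M c m \<oplus>\<^bsub>M\<^esub> sc M d m) \<and>
     (\<forall>c d. \<forall>m\<in>carrier M. sc M (c * d) m = sc M c (sc M d m)) \<and>
     (\<forall>m\<in>carrier M. sc M 1 m = m)"

text \<open>k-linearity in one variable from H. A rule that replaces one tensor by another is sound
  only for sums that are linear in each leg, so every application leaves goals of this form; the
  collection \<open>lins\<close> discharges them by the structure of the term.\<close>

definition lin :: "('a, 'h, 'm) bimod \<Rightarrow> ('h \<Rightarrow> 'm) \<Rightarrow> bool" where
  "lin M f \<longleftrightarrow> (\<forall>x. f x \<in> carrier M) \<and> (\<forall>x y. f (x + y) = f x \<oplus>\<^bsub>M\<^esub> f y) \<and>
     (\<forall>c x. f (hsmult H c x) = sc M c (f x))"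

definition hl :: "('h \<Rightarrow> 'h) \<Rightarrow> bool" where
  "hl g \<longleftrightarrow> (\<forall>x y. g (x + y) = g x + g y) \<and> (\<forall>c x. g (hsmult H c x) = hsmult H c (g x))"

lemma scm_ab [simp, dest]: "scm M \<Longrightarrow> abelian_group M"
  and scm_closed [simp]: "scm M \<Longrightarrow> m \<in> carrier M \<Longrightarrow> sc M c m \<in> carrier M"
  and scm_add: "scm M \<Longrightarrow> m \<in> carrier M \<Longrightarrow> n \<in> carrier M \<Longrightarrow> sc M c (m \<oplus>\<^bsub>M\<^esub> n) = sc M c m \<oplus>\<^bsub>M\<^esub> sc M c n"
  and scm_add': "scm M \<Longrightarrow> m \<in> carrier M \<Longrightarrow> sc M (c + d) m = sc M c m \<oplus>\<^bsub>M\<^esub> sc M d m"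
  and scm_mult: "scm M \<Longrightarrow> m \<in> carrier M \<Longrightarrow> sc M (c * d) m = sc M c (sc M d m)"
  and scm_one [simp]: "scm M \<Longrightarrow> m \<in> carrier M \<Longrightarrow> sc M 1 m = m"
  by (auto simp: scm_def)

lemma linD:
  assumes "lin M f"
  shows "f x \<in> carrier M" "f (x + y) = f x \<oplus>\<^bsub>M\<^esub> f y" "f (hsmult H c x) = sc M c (f x)"
  using assms by (auto simp: lin_def)

lemma ha: "hopf_algebra H" and tr: "triangular H R"
  using tri by (auto simp: triangular_hopf_algebra_def)

lemma hsm: "k_algebra (hsmult H)" and asm: "k_algebra (asmult A)"
  using ha ma by (auto simp: hopf_algebra_def module_algebra_def)

lemma counit_add: "\<epsilon> (x + y) = \<epsilon> x + \<epsilon> y"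
  and counit_scale: "\<epsilon> (hsmult H c x) = c * \<epsilon> x"
  and counit_mult: "\<epsilon> (x * y) = \<epsilon> x * \<epsilon> y"
  and counit_one [simp]: "\<epsilon> 1 = 1"
  and counit_sum_l: "(\<Sum>(a, b)\<leftarrow>\<Delta> x. hsmult H (\<epsilon> a) b) = x"
  and counit_sum_r: "(\<Sum>(a, b)\<leftarrow>\<Delta> x. hsmult H (\<epsilon> b) a) = x"
  and antipode_add: "S (x + y) = S x + S y"
  and antipode_scale: "S (hsmult H c x) = hsmult H c (S x)"
  and antipode_sum_l: "(\<Sum>(a, b)\<leftarrow>\<Delta> x. S a * b) = hsmult H (\<epsilon> x) 1"
  and antipode_sum_r: "(\<Sum>(a, b)\<leftarrow>\<Delta> x. a * S b) = hsmult H (\<epsilon> x) 1"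
  using ha unfolding hopf_algebra_def by blast+

subsection \<open>Linear maps\<close>

named_theorems lins

lemma hl_id [lins]: "hl (\<lambda>x. x)"
  by (simp add: hl_def)

lemma hl_mult_l [lins]: "hl g \<Longrightarrow> hl (\<lambda>x. g x * y)"
  and hl_mult_r [lins]: "hl g \<Longrightarrow> hl (\<lambda>x. y * g x)"
  using hsm by (auto simp: hl_def k_algebra_def distrib_left distrib_right)

lemma hl_antipode [lins]: "hl g \<Longrightarrow> hl (\<lambda>x. S (g x))"
  by (auto simp: hl_def antipode_add antipode_scale)

lemma lin_add [lins]: "scm M \<Longrightarrow> lin M f \<Longrightarrow> lin M g \<Longrightarrow> lin M (\<lambda>x. f x \<oplus>\<^bsub>M\<^esub> g x)"
proof -
  assume M: "scm M" "lin M f" "lin M g"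
  interpret abelian_group M using M by simp
  show ?thesis using M by (auto simp: lin_def scm_add a_ac)
qed

lemma lin_comp: "lin M f \<Longrightarrow> hl g \<Longrightarrow> lin M (\<lambda>x. f (g x))"
  by (auto simp: lin_def hl_def)

lemma lin_counit [lins]: "scm M \<Longrightarrow> m \<in> carrier M \<Longrightarrow> hl g \<Longrightarrow> lin M (\<lambda>x. sc M (\<epsilon> (g x)) m)"
  by (auto simp: lin_def hl_def counit_add counit_scale scm_add' scm_mult)

lemma sc_commute: "scm M \<Longrightarrow> m \<in> carrier M \<Longrightarrow> sc M c (sc M d m) = sc M d (sc M c m)"
  by (metis scm_mult mult.commute)

lemma lin_sc [lins]: "scm M \<Longrightarrow> lin M f \<Longrightarrow> lin M (\<lambda>x. sc M c (f x))"
  by (auto simp: lin_def scm_add sc_commute)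

lemma sc_sw: "scm M \<Longrightarrow> (\<And>a b. F a b \<in> carrier M) \<Longrightarrow> sc M c (sw M xs F) = sw M xs (\<lambda>a b. sc M c (F a b))"
  by (rule sw_hom) (auto simp: scm_add)

lemma lin_sw [lins]:
  "scm M \<Longrightarrow> (\<And>a b. lin M (\<lambda>x. F x a b)) \<Longrightarrow> lin M (\<lambda>x. sw M xs (\<lambda>a b. F x a b))"
proof -
  assume M: "scm M" and F: "\<And>a b. lin M (\<lambda>x. F x a b)"
  have "F (x + y) = (\<lambda>a b. F x a b \<oplus>\<^bsub>M\<^esub> F y a b)" "F (hsmult H c x) = (\<lambda>a b. sc M c (F x a b))" "F x a b \<in> carrier M" for x y a b c
    using linD[OF F] by (auto intro!: ext)
  then show ?thesis
    using M by (simp add: lin_def sw_closed sw_add sc_sw)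
qed

lemma lin_zero: "scm M \<Longrightarrow> lin M f \<Longrightarrow> f 0 = \<zero>\<^bsub>M\<^esub>"
proof -
  assume M: "scm M" "lin M f"
  interpret abelian_group M using M by simp
  have "f 0 \<oplus>\<^bsub>M\<^esub> f 0 = f 0" "f 0 \<in> carrier M"
    using linD(2)[OF M(2), of 0 0] linD(1)[OF M(2)] by auto
  then show ?thesis using add.r_cancel_one by auto
qed

lemma lin_sum_list:
  assumes "scm M" "lin M f"
  shows "f (\<Sum>(a, b)\<leftarrow>xs. G a b) = sw M xs (\<lambda>a b. f (G a b))"
  by (induction xs) (auto simp: lin_zero[OF assms] linD[OF assms(2)] simp del: sum_list.eq_foldr)

subsection \<open>Equalities of tensors as rules for sums\<close>

lemma sw_concat:
  assumes "abelian_group M" "\<And>w. \<phi> w \<in> carrier M"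
  shows "lsum M (map \<phi> (concat (map (\<lambda>(a, b). map (\<lambda>(c, d). G a b c d) (ys a b)) xs))) =
    sw M xs (\<lambda>a b. sw M (ys a b) (\<lambda>c d. \<phi> (G a b c d)))"
  by (simp add: lsum_map_concat assms sw_def o_def case_prod_unfold)

lemma sw_concat3:
  assumes "abelian_group M" "\<And>w. \<phi> w \<in> carrier M"
  shows "lsum M (map \<phi> (concat (map (\<lambda>(a, b). concat (map (\<lambda>(c, d). map (\<lambda>(e, f). G a b c d e f) (zs a b c d)) (ys a b))) xs))) =
    sw M xs (\<lambda>a b. sw M (ys a b) (\<lambda>c d. sw M (zs a b c d) (\<lambda>e f. \<phi> (G a b c d e f))))"
  by (simp add: lsum_map_concat assms sw_def o_def case_prod_unfold)

text \<open>Words of length other than two get the value zero. This respects the relators, since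
  each of them involves words of one length only.\<close>

lemma tensor_eq_lift2:
  assumes M: "scm M" and l: "\<And>b. lin M (\<lambda>a. F a b)" "\<And>a. lin M (\<lambda>b. F a b)"
  defines "\<phi> \<equiv> \<lambda>w. case w of [a, b] \<Rightarrow> F a b | _ \<Rightarrow> \<zero>\<^bsub>M\<^esub>"
  shows "tensor_eq H xs ys \<Longrightarrow> lsum M (map \<phi> xs) = lsum M (map \<phi> ys)" and "\<phi> w \<in> carrier M"
proof -
  interpret abelian_group M using M by simp
  show c: "\<phi> w \<in> carrier M" for w
    by (auto simp: \<phi>_def linD(1)[OF l(1)] split: list.split)
  have l1: "F (x + y) b = F x b \<oplus>\<^bsub>M\<^esub> F y b" "F (hsmult H c x) b = sc M c (F x b)" for x y b c
    using linD[OF l(1)] by auto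
  have l2: "F b (x + y) = F b x \<oplus>\<^bsub>M\<^esub> F b y" "F b (hsmult H c x) = sc M c (F b x)" for x y b c
    using linD[OF l(2)] by auto
  show "lsum M (map \<phi> xs) = lsum M (map \<phi> ys)" if "tensor_eq H xs ys"
    by (rule tensor_eq_lift[OF _ c _ _ that])
      (use M in \<open>auto simp: \<phi>_def Cons_eq_append_conv append_eq_Cons_conv l1 l2 split: list.splits\<close>)
qed

lemma tensor_eq_lift3:
  assumes M: "scm M" and l: "\<And>b c. lin M (\<lambda>a. F a b c)" "\<And>a c. lin M (\<lambda>b. F a b c)" "\<And>a b. lin M (\<lambda>c. F a b c)"
  defines "\<phi> \<equiv> \<lambda>w. case w of [a, b, c] \<Rightarrow> F a b c | _ \<Rightarrow> \<zero>\<^bsub>M\<^esub>"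
  shows "tensor_eq H xs ys \<Longrightarrow> lsum M (map \<phi> xs) = lsum M (map \<phi> ys)" and "\<phi> w \<in> carrier M"
proof -
  interpret abelian_group M using M by simp
  show c: "\<phi> w \<in> carrier M" for w
    by (auto simp: \<phi>_def linD(1)[OF l(1)] split: list.split)
  have l1: "F (x + y) a b = F x a b \<oplus>\<^bsub>M\<^esub> F y a b" "F (hsmult H c x) a b = sc M c (F x a b)" for x y a b c
    using linD[OF l(1)] by auto
  have l2: "F a (x + y) b = F a x b \<oplus>\<^bsub>M\<^esub> F a y b" "F a (hsmult H c x) b = sc M c (F a x b)" for x y a b c
    using linD[OF l(2)] by auto
  have l3: "F a b (x + y) = F a b x \<oplus>\<^bsub>M\<^esub> F a b y" "F a b (hsmult H c x) = sc M c (F a b x)" for x y a b c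
    using linD[OF l(3)] by auto
  show "lsum M (map \<phi> xs) = lsum M (map \<phi> ys)" if "tensor_eq H xs ys"
    by (rule tensor_eq_lift[OF _ c _ _ that])
      (use M in \<open>auto simp: \<phi>_def Cons_eq_append_conv append_eq_Cons_conv l1 l2 l3 split: list.splits\<close>)
qed

context
  fixes M :: "('a, 'h, 'm) bimod" and F :: "'h \<Rightarrow> 'h \<Rightarrow> 'm"
  assumes M: "scm M" and l: "\<And>b. lin M (\<lambda>a. F a b)" "\<And>a. lin M (\<lambda>b. F a b)"
begin

private lemmas lift = tensor_eq_lift2[OF M l]
private lemmas ab = scm_ab[OF M]

lemma coprod_add: "sw M (\<Delta> (x + y)) F = sw M (\<Delta> x) F \<oplus>\<^bsub>M\<^esub> sw M (\<Delta> y) F"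
proof -
  have "tensor_eq H [[a, b]. (a, b) \<leftarrow> \<Delta> (x + y)] [[a, b]. (a, b) \<leftarrow> \<Delta> x @ \<Delta> y]"
    using ha[unfolded hopf_algebra_def, THEN conjunct2, THEN conjunct1] by (elim allE)
  from lift(1)[OF this] have "sw M (\<Delta> (x + y)) F = sw M (\<Delta> x @ \<Delta> y) F"
    by (simp add: sw_def o_def case_prod_unfold)
  then show ?thesis
    by (simp add: sw_append[OF ab] linD(1)[OF l(1)])
qed

lemma coprod_scale: "sw M (\<Delta> (hsmult H c x)) F = sc M c (sw M (\<Delta> x) F)"
proof -
  have "tensor_eq H [[a, b]. (a, b) \<leftarrow> \<Delta> (hsmult H c x)] [[hsmult H c a, b]. (a, b) \<leftarrow> \<Delta> x]"
    using ha unfolding hopf_algebra_def by blast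
  from lift(1)[OF this] have "sw M (\<Delta> (hsmult H c x)) F = sw M (\<Delta> x) (\<lambda>a b. F (hsmult H c a) b)"
    by (simp add: sw_def o_def case_prod_unfold)
  also have "\<dots> = sw M (\<Delta> x) (\<lambda>a b. sc M c (F a b))"
    by (simp add: linD(3)[OF l(1)])
  finally show ?thesis
    by (simp add: sc_sw M linD(1)[OF l(1)])
qed

lemma coprod_mult:
  "sw M (\<Delta> (x * y)) F = sw M (\<Delta> x) (\<lambda>a b. sw M (\<Delta> y) (\<lambda>c d. F (a * c) (b * d)))"
proof -
  have "tensor_eq H [[a, b]. (a, b) \<leftarrow> \<Delta> (x * y)]
        [[a * a', b * b']. (a, b) \<leftarrow> \<Delta> x, (a', b') \<leftarrow> \<Delta> y]"
    using ha unfolding hopf_algebra_def by blast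
  from lift(1)[OF this] show ?thesis
    by (subst (asm) sw_concat[OF ab lift(2)]) (auto simp: sw_def o_def case_prod_unfold tensor_eq_def)
qed

lemma coprod_one: "sw M (\<Delta> 1) F = F 1 1"
proof -
  interpret abelian_group M by (rule ab)
  have "tensor_eq H [[a, b]. (a, b) \<leftarrow> \<Delta> 1] [[1, 1]]"
    using ha unfolding hopf_algebra_def by blast
  from lift(1)[OF this] show ?thesis
    by (simp add: sw_def o_def case_prod_unfold linD(1)[OF l(1)])
qed

text \<open>The second copy enters with its legs crossed because \<open>R\<close> is the flip of
  \<rho>; crossed pairs of this kind are what later computations look for in order to cancel two
  braidings.\<close>

lemma R_inv: "sw M \<rho> (\<lambda>r s. sw M \<rho> (\<lambda>r' s'. F (r * s') (s * r'))) = F 1 1"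
proof -
  interpret abelian_group M by (rule ab)
  have "tensor_eq H [[r * a, s * b]. (r, s) \<leftarrow> \<rho>, (a, b) \<leftarrow> R] [[1, 1]]"
    using tr unfolding triangular_def by blast
  from lift(1)[OF this] have "sw M \<rho> (\<lambda>r s. sw M R (\<lambda>a b. F (r * a) (s * b))) = F 1 1"
    by (subst (asm) sw_concat[OF ab lift(2)]) (auto simp: tensor_eq_def linD(1)[OF l(1)])
  then show "sw M \<rho> (\<lambda>r s. sw M \<rho> (\<lambda>r' s'. F (r * s') (s * r'))) = F 1 1"
    by (subst (asm) sw_rinv[of M R]) simp
qed

end

text \<open>The list \<open>coprod H x\<close> is not additive in x; only its image under a bilinear
  map is.\<close>

lemma lin_coprod [lins]:
  assumes "scm M" "\<And>b. lin M (\<lambda>a. F a b)" "\<And>a. lin M (\<lambda>b. F a b)" "hl g"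
  shows "lin M (\<lambda>x. sw M (\<Delta> (g x)) F)"
  using assms(4) unfolding lin_def hl_def
  by (simp add: coprod_add[OF assms(1-3)] coprod_scale[OF assms(1-3)] sw_closed assms(1) linD(1)[OF assms(2)])

context
  fixes M :: "('a, 'h, 'm) bimod" and F :: "'h \<Rightarrow> 'h \<Rightarrow> 'h \<Rightarrow> 'm"
  assumes M: "scm M"
    and l: "\<And>b c. lin M (\<lambda>a. F a b c)" "\<And>a c. lin M (\<lambda>b. F a b c)" "\<And>a b. lin M (\<lambda>c. F a b c)"
begin

private lemmas lift_triple = tensor_eq_lift3[OF M l]
private lemmas abM = scm_ab[OF M]

lemma coassoc:
  "sw M (\<Delta> x) (\<lambda>a b. sw M (\<Delta> a) (\<lambda>c d. F c d b)) = sw M (\<Delta> x) (\<lambda>a b. sw M (\<Delta> b) (\<lambda>c d. F a c d))"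
proof -
  have "tensor_eq H [[a1, a2, b]. (a, b) \<leftarrow> \<Delta> x, (a1, a2) \<leftarrow> \<Delta> a]
        [[a, b1, b2]. (a, b) \<leftarrow> \<Delta> x, (b1, b2) \<leftarrow> \<Delta> b]"
    using ha unfolding hopf_algebra_def by blast
  from lift_triple(1)[OF this] show ?thesis
    by (subst (asm) (1 2) sw_concat[OF abM lift_triple(2)]) (auto simp: tensor_eq_def)
qed

text \<open>Passing from \<open>R\<close> to its flip interchanges the two hexagon axioms: \<Delta>
  on the first leg of \<rho> is governed by the axiom for \<Delta> on the second leg of
  \<open>R\<close>, and conversely.\<close>

lemma R_Delta1:
  "sw M \<rho> (\<lambda>r s. sw M (\<Delta> r) (\<lambda>a b. F a b s)) = sw M \<rho> (\<lambda>r s. sw M \<rho> (\<lambda>r' s'. F r' r (s * s')))"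
  and R_Delta2:
  "sw M \<rho> (\<lambda>r s. sw M (\<Delta> s) (\<lambda>a b. F r a b)) = sw M \<rho> (\<lambda>r s. sw M \<rho> (\<lambda>r' s'. F (r * r') s s'))"
proof -
  have 1: "tensor_eq H [[a1, a2, b]. (a, b) \<leftarrow> R, (a1, a2) \<leftarrow> \<Delta> a]
        [[a, a', b * b']. (a, b) \<leftarrow> R, (a', b') \<leftarrow> R]"
    and 2: "tensor_eq H [[a, b1, b2]. (a, b) \<leftarrow> R, (b1, b2) \<leftarrow> \<Delta> b]
        [[a * a', b', b]. (a, b) \<leftarrow> R, (a', b') \<leftarrow> R]"
    using tr unfolding triangular_def by blast+
  note lift1 = tensor_eq_lift3[OF M, of "\<lambda>a b c. F b c a", OF l(3,1,2)]
  note lift2 = tensor_eq_lift3[OF M, of "\<lambda>a b c. F c a b", OF l(2,3,1)]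
  from lift1(1)[OF 2] have "sw M R (\<lambda>a b. sw M (\<Delta> b) (\<lambda>c d. F c d a)) = sw M R (\<lambda>a b. sw M R (\<lambda>a' b'. F b' b (a * a')))"
    by (subst (asm) (1 2) sw_concat[OF abM lift1(2)]) (auto simp: tensor_eq_def)
  then show "sw M \<rho> (\<lambda>r s. sw M (\<Delta> r) (\<lambda>a b. F a b s)) = sw M \<rho> (\<lambda>r s. sw M \<rho> (\<lambda>r' s'. F r' r (s * s')))"
    by (simp add: sw_rinv[of M R])
  from lift2(1)[OF 1] have "sw M R (\<lambda>a b. sw M (\<Delta> a) (\<lambda>c d. F b c d)) = sw M R (\<lambda>a b. sw M R (\<lambda>a' b'. F (b * b') a a'))"
    by (subst (asm) (1 2) sw_concat[OF abM lift2(2)]) (auto simp: tensor_eq_def)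
  then show "sw M \<rho> (\<lambda>r s. sw M (\<Delta> s) (\<lambda>a b. F r a b)) = sw M \<rho> (\<lambda>r s. sw M \<rho> (\<lambda>r' s'. F (r * r') s s'))"
    by (simp add: sw_rinv[of M R])
qed

end

context
  fixes M :: "('a, 'h, 'm) bimod"
  assumes M: "scm M"
begin

lemma counit_l: "lin M f \<Longrightarrow> sw M (\<Delta> x) (\<lambda>a b. sc M (\<epsilon> a) (f b)) = f x"
  using lin_sum_list[OF M, of f "\<lambda>a b. hsmult H (\<epsilon> a) b" "\<Delta> x"]
  by (simp add: linD counit_sum_l del: sum_list.eq_foldr)

lemma counit_r: "lin M f \<Longrightarrow> sw M (\<Delta> x) (\<lambda>a b. sc M (\<epsilon> b) (f a)) = f x"
  using lin_sum_list[OF M, of f "\<lambda>a b. hsmult H (\<epsilon> b) a" "\<Delta> x"]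
  by (simp add: linD counit_sum_r del: sum_list.eq_foldr)

lemma antipode_l: "lin M f \<Longrightarrow> sw M (\<Delta> x) (\<lambda>a b. f (S a * b)) = sc M (\<epsilon> x) (f 1)"
  using lin_sum_list[OF M, of f "\<lambda>a b. S a * b" "\<Delta> x"]
  by (simp add: linD antipode_sum_l del: sum_list.eq_foldr)

lemma antipode_r: "lin M f \<Longrightarrow> sw M (\<Delta> x) (\<lambda>a b. f (a * S b)) = sc M (\<epsilon> x) (f 1)"
  using lin_sum_list[OF M, of f "\<lambda>a b. a * S b" "\<Delta> x"]
  by (simp add: linD antipode_sum_r del: sum_list.eq_foldr)

context
  fixes F :: "'h \<Rightarrow> 'h \<Rightarrow> 'm"
  assumes l: "\<And>b. lin M (\<lambda>a. F a b)" "\<And>a. lin M (\<lambda>b. F a b)"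
begin

lemma antipode_l_snd: "sw M (\<Delta> x) (\<lambda>a b. sw M (\<Delta> b) (\<lambda>c d. F a (S c * d))) = F x 1"
  by (simp add: antipode_l[OF l(2)] counit_r[OF l(1)])

lemma antipode_r_snd: "sw M (\<Delta> x) (\<lambda>a b. sw M (\<Delta> b) (\<lambda>c d. F a (c * S d))) = F x 1"
  by (simp add: antipode_r[OF l(2)] counit_r[OF l(1)])

lemma antipode_l_fst: "sw M (\<Delta> x) (\<lambda>a b. sw M (\<Delta> a) (\<lambda>c d. F (S c * d) b)) = F 1 x"
  by (simp add: antipode_l[OF l(1)] counit_l[OF l(2)])

lemma antipode_r_fst: "sw M (\<Delta> x) (\<lambda>a b. sw M (\<Delta> a) (\<lambda>c d. F (c * S d) b)) = F 1 x"
  by (simp add: antipode_r[OF l(1)] counit_l[OF l(2)])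

text \<open>This is the quasi-cocommutativity axiom multiplied by R^-1 from the left. The function
  \<open>G\<close> is \<open>F\<close> with that multiplication built in, and \<open>R_inv\<close>
  removes the copy of \<open>R\<close> that the axiom brings along.\<close>

lemma R_cocomm:
  "sw M (\<Delta> x) (\<lambda>a b. sw M \<rho> (\<lambda>r s. F (a * r) (b * s))) =
   sw M \<rho> (\<lambda>r s. sw M (\<Delta> x) (\<lambda>a b. F (r * b) (s * a)))"
proof -
  note ab = scm_ab[OF M]
  have c [simp]: "F a b \<in> carrier M" for a b using linD(1)[OF l(1)] by auto
  note l' = l(1)[THEN lin_comp] l(2)[THEN lin_comp]
  define G where "G = (\<lambda>p q. sw M \<rho> (\<lambda>r s. F (r * p) (s * q)))"
  have Gl: "lin M (\<lambda>a. G a b)" "lin M (\<lambda>b. G a b)" for a b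
    unfolding G_def by (intro lins l' M)+
  have eq: "tensor_eq H [[x2, x1]. (x1, x2) \<leftarrow> \<Delta> x]
        [[a * x1 * r, b * x2 * s]. (a, b) \<leftarrow> R, (x1, x2) \<leftarrow> \<Delta> x, (r, s) \<leftarrow> \<rho>]"
    using tr unfolding triangular_def by blast
  note lift = tensor_eq_lift2[OF M Gl]
  from lift(1)[OF eq] have "sw M (\<Delta> x) (\<lambda>a b. G b a) =
    sw M R (\<lambda>a b. sw M (\<Delta> x) (\<lambda>x1 x2. sw M \<rho> (\<lambda>r s. G (a * x1 * r) (b * x2 * s))))"
    by (subst (asm) sw_concat3[OF ab lift(2)]) (auto simp: tensor_eq_def sw_def o_def case_prod_unfold)
  also have "\<dots> = sw M \<rho> (\<lambda>b a. sw M (\<Delta> x) (\<lambda>x1 x2. sw M \<rho> (\<lambda>r s. G (a * x1 * r) (b * x2 * s))))"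
    by (rule sw_rinv)
  also have "\<dots> = sw M \<rho> (\<lambda>b a. sw M (\<Delta> x) (\<lambda>x1 x2. sw M \<rho> (\<lambda>r' s'. sw M \<rho> (\<lambda>r s.
      F ((r' * a) * (x1 * r)) ((s' * b) * (x2 * s))))))"
    unfolding G_def mult.assoc by (rule sw_cong, rule sw_cong, rule sw_swap[OF ab]) simp
  also have "\<dots> = sw M \<rho> (\<lambda>b a. sw M \<rho> (\<lambda>r' s'. sw M (\<Delta> x) (\<lambda>x1 x2. sw M \<rho> (\<lambda>r s.
      F ((r' * a) * (x1 * r)) ((s' * b) * (x2 * s))))))"
    by (rule sw_cong, rule sw_swap[OF ab]) (simp add: sw_closed ab)
  also have "\<dots> = sw M \<rho> (\<lambda>r' s'. sw M \<rho> (\<lambda>b a. sw M (\<Delta> x) (\<lambda>x1 x2. sw M \<rho> (\<lambda>r s.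
      F ((r' * a) * (x1 * r)) ((s' * b) * (x2 * s))))))"
    by (rule sw_swap[OF ab]) (simp add: sw_closed ab)
  also have "\<dots> = sw M (\<Delta> x) (\<lambda>x1 x2. sw M \<rho> (\<lambda>r s. F (1 * (x1 * r)) (1 * (x2 * s))))"
    by (rule R_inv[OF M, where F = "\<lambda>p q. sw M (\<Delta> x) (\<lambda>x1 x2. sw M \<rho> (\<lambda>r s. F (p * (x1 * r)) (q * (x2 * s))))"])
      (intro lins l' M)+
  finally have "sw M (\<Delta> x) (\<lambda>a b. G b a) = sw M (\<Delta> x) (\<lambda>a b. sw M \<rho> (\<lambda>r s. F (a * r) (b * s)))"
    by simp
  moreover have "sw M (\<Delta> x) (\<lambda>a b. G b a) = sw M \<rho> (\<lambda>r s. sw M (\<Delta> x) (\<lambda>a b. F (r * b) (s * a)))"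
    unfolding G_def by (rule sw_swap[OF ab]) simp
  ultimately show ?thesis by simp
qed

end

text \<open>Applying \<epsilon> to the middle leg of a hexagon gives \<rho> = (e \<otimes> 1) \<rho>
  with e = (id \<otimes> \<epsilon>) \<rho>. Cancelling \<rho> leaves e = 1.\<close>

lemma R_counit_r:
  assumes f: "lin M f"
  shows "sw M \<rho> (\<lambda>r s. sc M (\<epsilon> s) (f r)) = f 1"
proof -
  note ab = scm_ab[OF M]
  have c [simp]: "f a \<in> carrier M" for a using linD(1)[OF f] by auto
  note l' = lins lin_comp[OF f] M c
  \<comment> \<open>Right multiplication by the inverse of \<rho>, followed by f \<otimes>
    \<epsilon>; summing \<open>F\<close> over \<rho> therefore returns f.\<close>
  define F where "F = (\<lambda>p q. sw M \<rho> (\<lambda>r s. sc M (\<epsilon> (q * r)) (f (p * s))))"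
  have Fl: "lin M (\<lambda>a. F a b)" "lin M (\<lambda>b. F a b)" for a b
    unfolding F_def by (intro l')+
  have Fc [simp]: "F a b \<in> carrier M" for a b using linD(1)[OF Fl(1)] by auto
  have inv: "sw M \<rho> (\<lambda>r s. F (p * r) s) = f p" for p
    unfolding F_def mult.assoc
    by (subst R_inv[OF M, where F = "\<lambda>a b. sc M (\<epsilon> b) (f (p * a))"]) (intro l' | simp add: M)+
  have "f 1 = sw M \<rho> (\<lambda>r s. F r s)" using inv[of 1] by simp
  also have "\<dots> = sw M \<rho> (\<lambda>r s. sw M (\<Delta> s) (\<lambda>a b. sc M (\<epsilon> a) (F r b)))"
    by (simp add: counit_l[OF Fl(2)])
  also have "\<dots> = sw M \<rho> (\<lambda>r s. sw M \<rho> (\<lambda>r' s'. sc M (\<epsilon> s) (F (r * r') s')))"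
    by (rule R_Delta2[OF M]) (intro l' Fl | simp)+
  also have "\<dots> = sw M \<rho> (\<lambda>r s. sc M (\<epsilon> s) (f r))"
    by (simp add: sc_sw[OF M, symmetric] inv)
  finally show ?thesis ..
qed

lemma R_counit_l:
  assumes f: "lin M f"
  shows "sw M \<rho> (\<lambda>r s. sc M (\<epsilon> r) (f s)) = f 1"
proof -
  note ab = scm_ab[OF M]
  have c [simp]: "f a \<in> carrier M" for a using linD(1)[OF f] by auto
  note l' = lins lin_comp[OF f] M c
  define F where "F = (\<lambda>p q. sw M \<rho> (\<lambda>r s. sc M (\<epsilon> (p * s)) (f (q * r))))"
  have Fl: "lin M (\<lambda>a. F a b)" "lin M (\<lambda>b. F a b)" for a b
    unfolding F_def by (intro l')+
  have Fc [simp]: "F a b \<in> carrier M" for a b using linD(1)[OF Fl(1)] by auto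
  have inv: "sw M \<rho> (\<lambda>r s. F r (p * s)) = f p" for p
    unfolding F_def mult.assoc
    by (subst R_inv[OF M, where F = "\<lambda>a b. sc M (\<epsilon> a) (f (p * b))"]) (intro l' | simp add: M)+
  have "f 1 = sw M \<rho> (\<lambda>r s. F r s)" using inv[of 1] by simp
  also have "\<dots> = sw M \<rho> (\<lambda>r s. sw M (\<Delta> r) (\<lambda>a b. sc M (\<epsilon> b) (F a s)))"
    by (simp add: counit_r[OF Fl(1)])
  also have "\<dots> = sw M \<rho> (\<lambda>r s. sw M \<rho> (\<lambda>r' s'. sc M (\<epsilon> r) (F r' (s * s'))))"
    by (rule R_Delta1[OF M]) (intro l' Fl | simp)+
  also have "\<dots> = sw M \<rho> (\<lambda>r s. sc M (\<epsilon> r) (f s))"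
    by (simp add: sc_sw[OF M, symmetric] inv)
  finally show ?thesis ..
qed

end

end

context thopf
begin

section \<open>Braided symmetric bimodules\<close>

abbreviation bsb :: "('a, 'h, 'm) bimod \<Rightarrow> bool" where
  "bsb M \<equiv> braided_symmetric_bimodule H R A M"

text \<open>A as a bimodule over itself, so that sums with values in A fall under the same calculus;
  \<open>sum_list_sw\<close> translates the sums of the definitions.\<close>

definition AA :: "('a, 'h, 'a) bimod" where
  "AA = \<lparr>carrier = UNIV, mult = (*), one = 1, zero = 0, add = (+), lact = (*), ract = (*), hact = aact A\<rparr>"

lemma AA_simps [simp]:
  "carrier AA = UNIV" "x \<oplus>\<^bsub>AA\<^esub> y = x + y" "\<zero>\<^bsub>AA\<^esub> = 0" "lact AA a b = a * b" "ract AA a b = a * b"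
  "hact AA z a = aact A z a"
  by (simp_all add: AA_def)

lemma lsum_AA: "lsum AA xs = sum_list xs"
  by (induction xs) auto

lemma sum_list_sw: "(\<Sum>(a, b)\<leftarrow>xs. F a b) = sw AA xs F"
  by (simp add: sw_def lsum_AA)

lemma ab_AA [simp]: "abelian_group AA"
proof (rule abelian_groupI)
  fix x :: 'a assume "x \<in> carrier AA"
  show "\<exists>y\<in>carrier AA. y \<oplus>\<^bsub>AA\<^esub> x = \<zero>\<^bsub>AA\<^esub>" by (auto intro!: exI[of _ "- x"])
qed (auto simp: ac_simps)

lemma asm_1: "asmult A c 1 * a = asmult A c a" "a * asmult A c 1 = asmult A c a"
  using asm by (metis k_algebra_def mult_1_left, metis k_algebra_def mult_1_right)

lemma asm_rules:
  "asmult A c (x + y) = asmult A c x + asmult A c y" "asmult A (c + d) x = asmult A c x + asmult A d x"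
  "asmult A (c * d) x = asmult A c (asmult A d x)" "asmult A 1 x = x"
  "asmult A c x * y = asmult A c (x * y)" "x * asmult A c y = asmult A c (x * y)"
  using asm by (auto simp: k_algebra_def)

lemma aact_add: "aact A x (a + b) = aact A x a + aact A x b"
  and aact_add': "aact A (x + y) a = aact A x a + aact A y a"
  and aact_scale: "aact A (hsmult H c x) a = asmult A c (aact A x a)"
  and aact_asm: "aact A x (asmult A c a) = asmult A c (aact A x a)"
  and aact_mult: "aact A (x * y) a = aact A x (aact A y a)"
  and aact_one [simp]: "aact A 1 a = a"
  and aact_1: "aact A x 1 = asmult A (\<epsilon> x) 1"
  using ma by (auto simp: module_algebra_def)

lemma aact_prod: "aact A x (a * b) = sw AA (\<Delta> x) (\<lambda>p q. aact A p a * aact A q b)"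
  using ma[unfolded module_algebra_def sum_list_sw] by blast

lemma braided_comm: "b * a = sw AA \<rho> (\<lambda>r s. aact A r a * aact A s b)"
  using bc[unfolded braided_commutative_def sum_list_sw] by blast

lemma scm_AA [simp]: "scm AA"
  by (simp add: scm_def asm_1) (simp add: asm_rules(1-4))

context
  fixes M :: "('a, 'h, 'm) bimod"
  assumes M: "bsb M"
begin

lemma bsb_ab [simp]: "abelian_group M"
  and lact_closed [simp]: "m \<in> carrier M \<Longrightarrow> lact M a m \<in> carrier M"
  and hact_closed [simp]: "m \<in> carrier M \<Longrightarrow> hact M x m \<in> carrier M"
  and lact_add: "m \<in> carrier M \<Longrightarrow> n \<in> carrier M \<Longrightarrow> lact M a (m \<oplus>\<^bsub>M\<^esub> n) = lact M a m \<oplus>\<^bsub>M\<^esub> lact M a n"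
  and ract_add: "m \<in> carrier M \<Longrightarrow> n \<in> carrier M \<Longrightarrow> ract M (m \<oplus>\<^bsub>M\<^esub> n) a = ract M m a \<oplus>\<^bsub>M\<^esub> ract M n a"
  and lact_add': "m \<in> carrier M \<Longrightarrow> lact M (a + b) m = lact M a m \<oplus>\<^bsub>M\<^esub> lact M b m"
  and lact_mult: "m \<in> carrier M \<Longrightarrow> lact M (a * b) m = lact M a (lact M b m)"
  and lact_one [simp]: "m \<in> carrier M \<Longrightarrow> lact M 1 m = m"
  and hact_add: "m \<in> carrier M \<Longrightarrow> n \<in> carrier M \<Longrightarrow> hact M x (m \<oplus>\<^bsub>M\<^esub> n) = hact M x m \<oplus>\<^bsub>M\<^esub> hact M x n"
  and hact_add': "m \<in> carrier M \<Longrightarrow> hact M (x + y) m = hact M x m \<oplus>\<^bsub>M\<^esub> hact M y m"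
  and hact_mult: "m \<in> carrier M \<Longrightarrow> hact M (x * y) m = hact M x (hact M y m)"
  and hact_one [simp]: "m \<in> carrier M \<Longrightarrow> hact M 1 m = m"
  and hact_scale: "m \<in> carrier M \<Longrightarrow> hact M (hsmult H c x) m = sc M c (hact M x m)"
  and ract_eq: "m \<in> carrier M \<Longrightarrow> ract M m a = sw M \<rho> (\<lambda>r s. lact M (aact A r a) (hact M s m))"
  using M unfolding braided_symmetric_bimodule_def sw_def by simp_all

lemma ract_closed [simp]: "m \<in> carrier M \<Longrightarrow> ract M m a \<in> carrier M"
  using M[unfolded braided_symmetric_bimodule_def, THEN conjunct2, THEN conjunct1] by simp

lemma ract_add': "m \<in> carrier M \<Longrightarrow> ract M m (a + b) = ract M m a \<oplus>\<^bsub>M\<^esub> ract M m b"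
  and ract_mult: "m \<in> carrier M \<Longrightarrow> ract M m (a * b) = ract M (ract M m a) b"
  and lact_ract: "m \<in> carrier M \<Longrightarrow> ract M (lact M a m) b = lact M a (ract M m b)"
  using M[unfolded braided_symmetric_bimodule_def, THEN conjunct2, THEN conjunct2, THEN conjunct2, THEN conjunct2, THEN conjunct1] by simp_all

lemma ract_one [simp]: "m \<in> carrier M \<Longrightarrow> ract M m 1 = m"
  using M[unfolded braided_symmetric_bimodule_def, THEN conjunct2, THEN conjunct2, THEN conjunct2, THEN conjunct2, THEN conjunct2, THEN conjunct1] by simp

lemma sc_ract: "m \<in> carrier M \<Longrightarrow> ract M m (asmult A c 1) = sc M c m"
  using M[unfolded braided_symmetric_bimodule_def, THEN conjunct2, THEN conjunct2, THEN conjunct2, THEN conjunct2, THEN conjunct2, THEN conjunct2, THEN conjunct1] by simp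

lemma hact_sc: "m \<in> carrier M \<Longrightarrow> hact M x (sc M c m) = sc M c (hact M x m)"
  using M[unfolded braided_symmetric_bimodule_def, THEN conjunct2, THEN conjunct2, THEN conjunct2, THEN conjunct2, THEN conjunct2, THEN conjunct2, THEN conjunct2, THEN conjunct2, THEN conjunct2, THEN conjunct2, THEN conjunct1] by simp

lemma scm_bsb [simp]: "scm M"
proof -
  have "asmult A (c * d) 1 = asmult A c 1 * asmult A d 1" for c d
    by (simp only: asm_1(1) asm_rules(3))
  then show ?thesis
    by (simp add: scm_def lact_add lact_add' asm_rules(2,4) lact_mult)
qed

lemma lin_hact [lins]: "m \<in> carrier M \<Longrightarrow> hl g \<Longrightarrow> lin M (\<lambda>x. hact M (g x) m)"
  by (auto simp: lin_def hl_def hact_add' hact_scale)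

lemma lin_hact_snd [lins]: "lin M f \<Longrightarrow> lin M (\<lambda>x. hact M y (f x))"
  by (auto simp: lin_def hact_add hact_sc)

lemma lin_lact [lins]: "lin AA f \<Longrightarrow> m \<in> carrier M \<Longrightarrow> lin M (\<lambda>x. lact M (f x) m)"
  by (auto simp: lin_def lact_add' lact_mult)

lemma lin_lact_snd [lins]: "lin M f \<Longrightarrow> lin M (\<lambda>x. lact M a (f x))"
proof -
  have "lact M a (sc M c m) = sc M c (lact M a m)" if "m \<in> carrier M" for c m
    by (simp flip: lact_mult add: asm_1 that)
  then show "lin M f \<Longrightarrow> ?thesis" by (auto simp: lin_def lact_add)
qed

lemma lin_ract_snd [lins]: "lin M f \<Longrightarrow> lin M (\<lambda>x. ract M (f x) a)"
  by (auto simp: lin_def ract_add lact_ract)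

lemma lin_ract [lins]: "lin AA f \<Longrightarrow> m \<in> carrier M \<Longrightarrow> lin M (\<lambda>x. ract M m (f x))"
  by (auto simp: lin_def ract_add' ract_mult sc_ract lact_ract)

lemma lact_sw: "(\<And>r s. F r s \<in> carrier M) \<Longrightarrow> lact M a (sw M xs F) = sw M xs (\<lambda>r s. lact M a (F r s))"
  by (rule sw_hom) (auto simp: lact_add)

lemma hact_sw: "(\<And>r s. F r s \<in> carrier M) \<Longrightarrow> hact M x (sw M xs F) = sw M xs (\<lambda>r s. hact M x (F r s))"
  by (rule sw_hom) (auto simp: hact_add)

lemma lact_sw': "m \<in> carrier M \<Longrightarrow> lact M (sw AA xs F) m = sw M xs (\<lambda>r s. lact M (F r s) m)"
  by (rule sw_hom[where \<phi> = "\<lambda>a. lact M a m"]) (auto simp: lact_add')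

end

lemma aact_0 [simp]: "aact A x 0 = 0"
  using aact_add[of x 0 0] by simp

lemma lin_aact [lins]: "hl g \<Longrightarrow> lin AA (\<lambda>x. aact A (g x) a)"
  by (auto simp: lin_def hl_def aact_add' aact_scale asm_1)

lemma lin_aact_snd [lins]: "lin AA f \<Longrightarrow> lin AA (\<lambda>x. aact A y (f x))"
  by (auto simp: lin_def aact_add aact_asm asm_1)

lemma lin_times [lins]: "lin AA f \<Longrightarrow> lin AA (\<lambda>x. f x * a)"
  and lin_times_snd [lins]: "lin AA f \<Longrightarrow> lin AA (\<lambda>x. a * f x)"
  by (auto simp: lin_def asm_1 asm_rules distrib_left distrib_right mult.assoc)

lemma times_sw: "a * sw AA xs F = sw AA xs (\<lambda>r s. a * F r s)"
  and times_sw': "sw AA xs F * a = sw AA xs (\<lambda>r s. F r s * a)"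
  and aact_sw: "aact A x (sw AA xs F) = sw AA xs (\<lambda>r s. aact A x (F r s))"
  by (rule sw_hom; auto simp: distrib_left distrib_right aact_add)+

lemma R_counit_aact: "sw AA \<rho> (\<lambda>r s. aact A r 1 * f s) = f 1" if "lin AA f"
  using R_counit_l[OF scm_AA that] by (simp add: aact_1)

lemma bsb_AA [simp]: "bsb AA"
proof -
  have bi: "aact A x (a * m * b) =
     lsum AA (concat (map (\<lambda>(x1, y). map (\<lambda>(x2, x3). aact A x1 a * aact A x2 m * aact A x3 b) (\<Delta> y)) (\<Delta> x)))"
    for x a m b
  proof -
    have "aact A x (a * m * b) = sw AA (\<Delta> x) (\<lambda>p q. sw AA (\<Delta> q) (\<lambda>r s. aact A p a * aact A r m * aact A s b))"
      by (simp add: mult.assoc aact_prod times_sw)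
    also have "\<dots> = lsum AA (concat (map (\<lambda>(x1, y). map (\<lambda>(x2, x3). aact A x1 a * aact A x2 m * aact A x3 b) (\<Delta> y)) (\<Delta> x)))"
      by (rule sw_concat[OF ab_AA, where \<phi> = "\<lambda>x. x", simplified, symmetric])
    finally show ?thesis .
  qed
  show ?thesis
    unfolding braided_symmetric_bimodule_def
  proof (intro conjI allI ballI)
    fix x a b m
    show "hact AA x (ract AA (lact AA a m) b) =
      lsum AA (concat (map (\<lambda>(x1, y). map (\<lambda>(x2, x3). ract AA (lact AA (aact A x1 a) (hact AA x2 m)) (aact A x3 b)) (\<Delta> y)) (\<Delta> x)))"
      by (simp only: AA_simps bi)
  next
    fix a m
    show "ract AA m a = lsum AA (map (\<lambda>(r, s). lact AA (aact A r a) (hact AA s m)) \<rho>)"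
      by (simp only: AA_simps) (rule braided_comm[unfolded sw_def])
  qed (simp_all add: asm_1 asm_rules(1-4) aact_add aact_add' aact_scale aact_asm aact_mult distrib_left distrib_right mult.assoc)
qed

lemma sc_ract_hact_counit: "bsb M \<Longrightarrow> m \<in> carrier M \<Longrightarrow> ract M m (aact A x 1) = sc M (\<epsilon> x) m"
  by (simp add: aact_1 sc_ract)

context
  fixes M :: "('a, 'h, 'm) bimod"
  assumes M [simp]: "bsb M"
begin

lemma hact_bimod: "m \<in> carrier M \<Longrightarrow> hact M x (ract M (lact M a m) b) =
  sw M (\<Delta> x) (\<lambda>p q. sw M (\<Delta> q) (\<lambda>r s. ract M (lact M (aact A p a) (hact M r m)) (aact A s b)))"
proof -
  assume m: "m \<in> carrier M"
  interpret abelian_group M by simp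
  \<comment> \<open>\<open>sw_concat\<close> wants a function with values in the carrier everywhere,
    so the identity is cut off by zero outside it.\<close>
  let ?g = "\<lambda>w. if w \<in> carrier M then w else \<zero>\<^bsub>M\<^esub>"
  let ?xs = "concat (map (\<lambda>(p, q). map (\<lambda>(r, s). ract M (lact M (aact A p a) (hact M r m)) (aact A s b)) (\<Delta> q)) (\<Delta> x))"
  have "hact M x (ract M (lact M a m) b) = lsum M ?xs"
    using M[unfolded braided_symmetric_bimodule_def, THEN conjunct2, THEN conjunct2, THEN conjunct2, THEN conjunct2, THEN conjunct2, THEN conjunct2, THEN conjunct2, THEN conjunct2, THEN conjunct2, THEN conjunct2, THEN conjunct2, THEN conjunct1] m by blast
  also have "?xs = map ?g ?xs"
    by (rule sym, rule map_idI) (use m in auto)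
  finally show ?thesis
    by (subst (asm) sw_concat) (auto simp: m)
qed

text \<open>Specialize the two-sided axiom to b = 1: the third leg acts on 1 by \<epsilon> and is
  absorbed by the counit axiom.\<close>

lemma hact_lact: "m \<in> carrier M \<Longrightarrow> hact M x (lact M a m) = sw M (\<Delta> x) (\<lambda>p q. lact M (aact A p a) (hact M q m))"
proof -
  assume m: "m \<in> carrier M"
  have "hact M x (lact M a m) = hact M x (ract M (lact M a m) 1)" by (simp add: m)
  also have "\<dots> = sw M (\<Delta> x) (\<lambda>p q. sw M (\<Delta> q) (\<lambda>r s. sc M (\<epsilon> s) (lact M (aact A p a) (hact M r m))))"
    by (subst hact_bimod) (simp_all add: m sc_ract_hact_counit)
  also have "\<dots> = sw M (\<Delta> x) (\<lambda>p q. lact M (aact A p a) (hact M q m))"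
    by (rule sw_cong, rule counit_r) (intro lins | simp add: m)+
  finally show ?thesis .
qed

lemma hact_ract: "m \<in> carrier M \<Longrightarrow> hact M x (ract M m a) = sw M (\<Delta> x) (\<lambda>p q. ract M (hact M p m) (aact A q a))"
proof -
  assume m: "m \<in> carrier M"
  have "hact M x (ract M m a) = hact M x (ract M (lact M 1 m) a)" by (simp add: m)
  also have "\<dots> = sw M (\<Delta> x) (\<lambda>p q. sc M (\<epsilon> p) (sw M (\<Delta> q) (\<lambda>r s. ract M (hact M r m) (aact A s a))))"
    by (subst hact_bimod) (simp_all add: m aact_1 lact_ract sc_sw)
  also have "\<dots> = sw M (\<Delta> x) (\<lambda>r s. ract M (hact M r m) (aact A s a))"
    by (rule counit_l) (intro lins | simp add: m)+
  finally show ?thesis .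
qed

lemma hact_zero [simp]: "hact M x \<zero>\<^bsub>M\<^esub> = \<zero>\<^bsub>M\<^esub>"
  by (rule additive_zero) (auto simp: hact_add)

lemma lact_zero [simp]: "lact M a \<zero>\<^bsub>M\<^esub> = \<zero>\<^bsub>M\<^esub>"
  by (rule additive_zero) (auto simp: lact_add)

end

section \<open>Adjoint actions\<close>

lemma adj_act_sw: "adj_act H A hv x \<Phi> v = sw AA (\<Delta> x) (\<lambda>p q. aact A p (\<Phi> (hv (S q) v)))"
  by (simp add: adj_act_def sum_list_sw)

text \<open>The adjoint action is designed for this: after coassociativity its antipode meets the
  leg that acts on the argument, and the two cancel.\<close>

lemma adj_act_eval:
  assumes W: "bsb W" and v: "v \<in> carrier W"
    and \<Phi>: "\<And>f. lin W f \<Longrightarrow> lin AA (\<lambda>x. \<Phi> (f x))"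
  shows "aact A x (\<Phi> v) = sw AA (\<Delta> x) (\<lambda>p q. adj_act H A (hact W) p \<Phi> (hact W q v))"
proof -
  note [simp] = W v
  have "sw AA (\<Delta> x) (\<lambda>p q. adj_act H A (hact W) p \<Phi> (hact W q v)) =
    sw AA (\<Delta> x) (\<lambda>p q. sw AA (\<Delta> p) (\<lambda>a b. aact A a (\<Phi> (hact W (S b * q) v))))"
    by (simp add: adj_act_sw hact_mult)
  also have "\<dots> = sw AA (\<Delta> x) (\<lambda>p q. sw AA (\<Delta> q) (\<lambda>a b. aact A p (\<Phi> (hact W (S a * b) v))))"
    by (rule coassoc) (intro lins \<Phi> | simp)+
  also have "\<dots> = aact A x (\<Phi> (hact W 1 v))"
    by (rule antipode_l_snd) (intro lins \<Phi> | simp)+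
  finally show ?thesis by simp
qed

text \<open>Evaluation at \<open>S x\<close> of the equivariance of a bilinear pairing: \<open>S\<close> reverses the coproduct.\<close>

lemma hact_antipode_ract:
  assumes M: "bsb M" and m: "m \<in> carrier M"
  shows "hact M (S x) (ract M m a) = sw M (\<Delta> x) (\<lambda>p q. ract M (hact M (S q) m) (aact A (S p) a))"
proof -
  note [simp] = M m
  define G where "G = (\<lambda>x. sw M (\<Delta> x) (\<lambda>p q. ract M (hact M (S q) m) (aact A (S p) a)))"
  have G: "lin M (\<lambda>x. G (g x))" if "hl g" for g
    unfolding G_def by (intro lins that | simp)+
  have Gc [simp]: "G x \<in> carrier M" for x using linD(1)[OF G[OF hl_id]] .
  \<comment> \<open>Uniqueness of convolution inverses: \<open>G\<close> is a right inverse of the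
    action on m a, the action through S is a left inverse, and evaluating the triple convolution in
    two ways identifies them.\<close>
  have *: "sw M (\<Delta> x) (\<lambda>p q. hact M p (G q)) = sc M (\<epsilon> x) (ract M m a)" for x
  proof -
    have "sw M (\<Delta> x) (\<lambda>p q. hact M p (G q)) =
      sw M (\<Delta> x) (\<lambda>p q. sw M (\<Delta> q) (\<lambda>c d. sw M (\<Delta> p) (\<lambda>e f. ract M (hact M (e * S d) m) (aact A (f * S c) a))))"
      by (simp add: G_def hact_sw hact_ract hact_mult aact_mult)
    also have "\<dots> = sw M (\<Delta> x) (\<lambda>p q. sw M (\<Delta> p) (\<lambda>e f. sw M (\<Delta> q) (\<lambda>c d. ract M (hact M (e * S d) m) (aact A (f * S c) a))))"
      by (rule sw_cong, rule sw_swap) simp_all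
    also have "\<dots> = sw M (\<Delta> x) (\<lambda>p q. sw M (\<Delta> q) (\<lambda>e f. sw M (\<Delta> f) (\<lambda>c d. ract M (hact M (p * S d) m) (aact A (e * S c) a))))"
      by (rule coassoc) (intro lins | simp)+
    also have "\<dots> = sw M (\<Delta> x) (\<lambda>p q. sw M (\<Delta> q) (\<lambda>e f. sw M (\<Delta> e) (\<lambda>c d. ract M (hact M (p * S f) m) (aact A (c * S d) a))))"
      by (rule sw_cong, rule coassoc[symmetric]) (intro lins | simp)+
    also have "\<dots> = sw M (\<Delta> x) (\<lambda>p q. ract M (hact M (p * S q) m) (aact A 1 a))"
      by (rule sw_cong, rule antipode_r_fst) (intro lins | simp)+
    also have "\<dots> = sc M (\<epsilon> x) (ract M (hact M 1 m) (aact A 1 a))"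
      by (rule antipode_r) (intro lins | simp)+
    finally show ?thesis by simp
  qed
  have "G x = hact M 1 (G x)" by simp
  also have "\<dots> = sw M (\<Delta> x) (\<lambda>p q. sw M (\<Delta> p) (\<lambda>c d. hact M (S c * d) (G q)))"
    by (rule antipode_l_fst[symmetric]) (intro lins G | simp)+
  also have "\<dots> = sw M (\<Delta> x) (\<lambda>p q. sw M (\<Delta> q) (\<lambda>c d. hact M (S p * c) (G d)))"
    by (rule coassoc) (intro lins G | simp)+
  also have "\<dots> = sw M (\<Delta> x) (\<lambda>p q. sc M (\<epsilon> q) (hact M (S p) (ract M m a)))"
    by (simp add: hact_mult * hact_sc flip: hact_sw)
  also have "\<dots> = hact M (S x) (ract M m a)"
    by (rule counit_r) (intro lins | simp)+
  finally show ?thesis by (simp add: G_def)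
qed

end

section \<open>A criterion for braided symmetric bimodules\<close>

context thopf
begin

text \<open>The right action is expressed by the left one and \<R>, so its covariance is a
  consequence of left covariance and \<open>R_cocomm\<close>; only left covariance has to be
  verified in applications.\<close>

lemma bsb_intro:
  fixes M :: "('a, 'h, 'm) bimod"
  assumes ab: "abelian_group M"
    and c: "\<And>a m. m \<in> carrier M \<Longrightarrow> lact M a m \<in> carrier M"
      "\<And>a m. m \<in> carrier M \<Longrightarrow> ract M m a \<in> carrier M"
      "\<And>x m. m \<in> carrier M \<Longrightarrow> hact M x m \<in> carrier M"
    and ladd: "\<And>a m n. m \<in> carrier M \<Longrightarrow> n \<in> carrier M \<Longrightarrow> lact M a (m \<oplus>\<^bsub>M\<^esub> n) = lact M a m \<oplus>\<^bsub>M\<^esub> lact M a n"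
    and radd: "\<And>a m n. m \<in> carrier M \<Longrightarrow> n \<in> carrier M \<Longrightarrow> ract M (m \<oplus>\<^bsub>M\<^esub> n) a = ract M m a \<oplus>\<^bsub>M\<^esub> ract M n a"
    and ladd': "\<And>a b m. m \<in> carrier M \<Longrightarrow> lact M (a + b) m = lact M a m \<oplus>\<^bsub>M\<^esub> lact M b m"
    and radd': "\<And>a b m. m \<in> carrier M \<Longrightarrow> ract M m (a + b) = ract M m a \<oplus>\<^bsub>M\<^esub> ract M m b"
    and lmult: "\<And>a b m. m \<in> carrier M \<Longrightarrow> lact M (a * b) m = lact M a (lact M b m)"
    and rmult: "\<And>a b m. m \<in> carrier M \<Longrightarrow> ract M m (a * b) = ract M (ract M m a) b"
    and lr: "\<And>a b m. m \<in> carrier M \<Longrightarrow> ract M (lact M a m) b = lact M a (ract M m b)"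
    and one: "\<And>m. m \<in> carrier M \<Longrightarrow> lact M 1 m = m" "\<And>m. m \<in> carrier M \<Longrightarrow> ract M m 1 = m"
    and sc: "\<And>c m. m \<in> carrier M \<Longrightarrow> sc M c m = ract M m (asmult A c 1)"
    and hadd: "\<And>x m n. m \<in> carrier M \<Longrightarrow> n \<in> carrier M \<Longrightarrow> hact M x (m \<oplus>\<^bsub>M\<^esub> n) = hact M x m \<oplus>\<^bsub>M\<^esub> hact M x n"
    and hadd': "\<And>x y m. m \<in> carrier M \<Longrightarrow> hact M (x + y) m = hact M x m \<oplus>\<^bsub>M\<^esub> hact M y m"
    and hmult: "\<And>x y m. m \<in> carrier M \<Longrightarrow> hact M (x * y) m = hact M x (hact M y m)"
    and hone: "\<And>m. m \<in> carrier M \<Longrightarrow> hact M 1 m = m"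
    and hsc: "\<And>c x m. m \<in> carrier M \<Longrightarrow> hact M (hsmult H c x) m = sc M c (hact M x m)"
      "\<And>c x m. m \<in> carrier M \<Longrightarrow> hact M x (sc M c m) = sc M c (hact M x m)"
    and hl': "\<And>x a m. m \<in> carrier M \<Longrightarrow>
      hact M x (lact M a m) = sw M (\<Delta> x) (\<lambda>p q. lact M (aact A p a) (hact M q m))"
    and r: "\<And>a m. m \<in> carrier M \<Longrightarrow> ract M m a = sw M \<rho> (\<lambda>r s. lact M (aact A r a) (hact M s m))"
  shows "bsb M"
proof -
  interpret abelian_group M by (rule ab)
  note [simp] = ab c
  have "asmult A (c * d) 1 = asmult A c 1 * asmult A d 1" for c d
    by (simp only: asm_1(1) asm_rules(3))
  then have scm [simp]: "scm M"
    by (simp add: scm_def ladd ladd' asm_rules(2,4) lmult one)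
  have lin1: "lin M (\<lambda>x. lact M (f x) m)" if "lin AA f" "m \<in> carrier M" for f m
    using that by (auto simp: lin_def ladd' lmult)
  have "lact M a (sc M c m) = sc M c (lact M a m)" if "m \<in> carrier M" for a c m
    by (simp flip: lmult add: asm_1 that)
  then have lin2: "lin M (\<lambda>x. lact M a (f x))" if "lin M f" for a f
    using that by (auto simp: lin_def ladd)
  have lin3: "lin M (\<lambda>x. hact M (g x) m)" if "hl g" "m \<in> carrier M" for g m
    using that by (auto simp: lin_def hl_def hadd' hsc)
  have hr: "hact M x (ract M m b) = sw M (\<Delta> x) (\<lambda>p q. ract M (hact M p m) (aact A q b))" if [simp]: "m \<in> carrier M" for x m b
  proof -
    have "hact M x (ract M m b) = sw M \<rho> (\<lambda>r s. sw M (\<Delta> x) (\<lambda>p q. lact M (aact A (p * r) b) (hact M (q * s) m)))"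
      by (subst r, simp, subst sw_hom[where M' = M]) (auto simp: hadd hl' hmult aact_mult)
    also have "\<dots> = sw M (\<Delta> x) (\<lambda>p q. sw M \<rho> (\<lambda>r s. lact M (aact A (p * r) b) (hact M (q * s) m)))"
      by (rule sw_swap) simp_all
    also have "\<dots> = sw M \<rho> (\<lambda>r s. sw M (\<Delta> x) (\<lambda>p q. lact M (aact A (r * q) b) (hact M (s * p) m)))"
      by (rule R_cocomm) (intro lins lin1 lin2 lin3 | simp)+
    also have "\<dots> = sw M (\<Delta> x) (\<lambda>p q. sw M \<rho> (\<lambda>r s. lact M (aact A (r * q) b) (hact M (s * p) m)))"
      by (rule sw_swap) simp_all
    also have "\<dots> = sw M (\<Delta> x) (\<lambda>p q. ract M (hact M p m) (aact A q b))"
      by (rule sw_cong) (simp add: r hmult aact_mult)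
    finally show ?thesis .
  qed
  have lin4: "lin M (\<lambda>x. ract M (f x) a)" if "lin M f" for f a
    using that by (auto simp: lin_def radd lr)
  have lin5: "lin M (\<lambda>x. ract M m (f x))" if "lin AA f" "m \<in> carrier M" for f m
    using that by (auto simp: lin_def radd' rmult sc[symmetric] lr)
  have bi: "hact M x (ract M (lact M a m) b) =
     sw M (\<Delta> x) (\<lambda>p q. sw M (\<Delta> q) (\<lambda>r s. ract M (lact M (aact A p a) (hact M r m)) (aact A s b)))"
    if [simp]: "m \<in> carrier M" for x a b m
  proof -
    have "hact M x (ract M (lact M a m) b) =
      sw M (\<Delta> x) (\<lambda>p q. sw M (\<Delta> p) (\<lambda>r s. ract M (lact M (aact A r a) (hact M s m)) (aact A q b)))"
      by (subst hr, simp, rule sw_cong, subst hl', simp, rule sw_hom[where \<phi> = "\<lambda>m. ract M m a" for a]) (auto simp: radd)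
    also have "\<dots> = sw M (\<Delta> x) (\<lambda>p q. sw M (\<Delta> q) (\<lambda>r s. ract M (lact M (aact A p a) (hact M r m)) (aact A s b)))"
      by (rule coassoc) (intro lins lin1 lin2 lin3 lin4 lin5 | simp)+
    finally show ?thesis .
  qed
  have bi': "hact M x (ract M (lact M a m) b) =
    lsum M (concat (map (\<lambda>(x1, y). map (\<lambda>(x2, x3). ract M (lact M (aact A x1 a) (hact M x2 m)) (aact A x3 b)) (\<Delta> y)) (\<Delta> x)))"
    if m: "m \<in> carrier M" for x a b m
  proof -
    let ?g = "\<lambda>w. if w \<in> carrier M then w else \<zero>\<^bsub>M\<^esub>"
    let ?xs = "concat (map (\<lambda>(p, q). map (\<lambda>(r, s). ract M (lact M (aact A p a) (hact M r m)) (aact A s b)) (\<Delta> q)) (\<Delta> x))"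
    have "?xs = map ?g ?xs"
      by (rule sym, rule map_idI) (use m in auto)
    then have "lsum M ?xs = lsum M (map ?g ?xs)" by simp
    then show ?thesis
      by (subst (asm) sw_concat) (auto simp: m bi)
  qed
  show ?thesis
    unfolding braided_symmetric_bimodule_def
  proof (intro conjI allI ballI)
    fix a m assume "m \<in> carrier M"
    then show "ract M m a = lsum M (map (\<lambda>(r, s). lact M (aact A r a) (hact M s m)) \<rho>)"
      using r by (simp only: sw_def)
  next
    fix x a b m assume "m \<in> carrier M"
    then show "hact M x (ract M (lact M a m) b) =
      lsum M (concat (map (\<lambda>(x1, y). map (\<lambda>(x2, x3). ract M (lact M (aact A x1 a) (hact M x2 m)) (aact A x3 b)) (\<Delta> y)) (\<Delta> x)))"
      by (rule bi')
  qed (fact assms | (rule c ladd radd ladd' radd' lmult rmult lr one sc hadd hadd' hmult hone hsc; assumption))+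
qed

text \<open>Braided symmetry can be inverted because R^-1 = R_21: inserting the formula for the
  right action puts \<rho> against its own flip.\<close>

lemma lact_eq:
  assumes [simp]: "bsb M" "m \<in> carrier M"
  shows "lact M a m = sw M \<rho> (\<lambda>r s. ract M (hact M r m) (aact A s a))"
proof -
  have "sw M \<rho> (\<lambda>r s. ract M (hact M r m) (aact A s a)) =
    sw M \<rho> (\<lambda>r s. sw M \<rho> (\<lambda>r' s'. lact M (aact A (r' * s) a) (hact M (s' * r) m)))"
    by (simp add: ract_eq aact_mult hact_mult)
  also have "\<dots> = sw M \<rho> (\<lambda>r' s'. sw M \<rho> (\<lambda>r s. lact M (aact A (r' * s) a) (hact M (s' * r) m)))"
    by (rule sw_swap) simp_all
  also have "\<dots> = lact M (aact A 1 a) (hact M 1 m)"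
    by (rule R_inv) (intro lins | simp)+
  finally show ?thesis by simp
qed

end

section \<open>Braided derivations and one-forms\<close>

text \<open>The bimodule axioms for derivations are assumed at this level. The main theorem obtains
  them from its hypothesis on \<open>N\<close>, since \<open>equivariant_cov_deriv\<close> contains
  them for the underlying module.\<close>

locale vfield_bimod = thopf H R A
  for H :: "('k::{comm_ring, comm_monoid_mult}, 'h::{ring, monoid_mult}) hopf"
    and R :: "('h \<times> 'h) list"
    and A :: "('k, 'h, 'a::{ring, monoid_mult}) malg" +
  assumes bsb_V [simp]: "braided_symmetric_bimodule H R A (vfields H R A)"
begin

abbreviation V where "V \<equiv> vfields H R A"
abbreviation W where "W \<equiv> full_forms1 H R A"

lemma V_simps:
  "carrier V = Der H R A" "X \<oplus>\<^bsub>V\<^esub> Y = (\<lambda>b. X b + Y b)" "\<zero>\<^bsub>V\<^esub> = (\<lambda>b. 0)"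
  "lact V a X = (\<lambda>b. a * X b)" "hact V = adj_act H A (aact A)"
  by (simp_all add: vfields_def)

lemma Der_add: "X \<in> carrier V \<Longrightarrow> X (a + b) = X a + X b"
  and Der_asm: "X \<in> carrier V \<Longrightarrow> X (asmult A c a) = asmult A c (X a)"
  by (auto simp: V_simps Der_def)

lemma Der_prod: "X \<in> carrier V \<Longrightarrow> X (a * b) = X a * b + sw AA \<rho> (\<lambda>r s. aact A r a * hact V s X b)"
  by (auto simp: V_simps Der_def sum_list_sw)

lemma lin_Der: "X \<in> carrier V \<Longrightarrow> lin AA f \<Longrightarrow> lin AA (\<lambda>x. X (f x))"
  by (auto simp: lin_def Der_add asm_1 Der_asm)

lemma lin_app: "lin V F \<Longrightarrow> lin AA (\<lambda>x. F x a)"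
  unfolding lin_def by (simp add: V_simps)

lemmas lin_hact_app [lins] = lin_hact[OF bsb_V, THEN lin_app]

lemma Der_sw: "X \<in> carrier V \<Longrightarrow> X (sw AA xs F) = sw AA xs (\<lambda>r s. X (F r s))"
  by (rule sw_hom) (auto simp: Der_add)

lemma Der_eval: "X \<in> carrier V \<Longrightarrow> aact A x (X a) = sw AA (\<Delta> x) (\<lambda>p q. hact V p X (aact A q a))"
  using adj_act_eval[OF bsb_AA, of a X x] lin_Der[of X]
  by (simp add: V_simps(5)) (simp add: AA_def)

lemma W_simps:
  "carrier W = one_forms H R A" "\<omega> \<oplus>\<^bsub>W\<^esub> \<eta> = (\<lambda>X. \<omega> X + \<eta> X)" "\<zero>\<^bsub>W\<^esub> = (\<lambda>X. 0)"
  "lact W a \<omega> = (\<lambda>X. a * \<omega> X)"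
  by (simp_all add: full_forms1_def)

lemma W_ract: "X \<in> carrier V \<Longrightarrow> ract W \<omega> a X = sw AA \<rho> (\<lambda>r s. \<omega> (hact V r X) * aact A s a)"
  and W_hact: "X \<in> carrier V \<Longrightarrow> hact W x \<omega> X = sw AA (\<Delta> x) (\<lambda>p q. aact A p (\<omega> (hact V (S q) X)))"
  and W_outside: "X \<notin> carrier V \<Longrightarrow> ract W \<omega> a X = 0" "X \<notin> carrier V \<Longrightarrow> hact W x \<omega> X = 0"
  by (simp_all add: full_forms1_def V_simps sum_list_sw adj_act_sw)

lemma sw_W: "sw W xs F X = sw AA xs (\<lambda>r s. F r s X)"
  by (induction xs) (auto simp: W_simps)

lemma form_add: "\<omega> \<in> carrier W \<Longrightarrow> X \<in> carrier V \<Longrightarrow> Y \<in> carrier V \<Longrightarrow> \<omega> (X \<oplus>\<^bsub>V\<^esub> Y) = \<omega> X + \<omega> Y"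
  and form_ract: "\<omega> \<in> carrier W \<Longrightarrow> X \<in> carrier V \<Longrightarrow> \<omega> (ract V X a) = \<omega> X * a"
  and form_outside: "\<omega> \<in> carrier W \<Longrightarrow> X \<notin> carrier V \<Longrightarrow> \<omega> X = 0"
  by (auto simp: W_simps one_forms_def V_simps)

lemma sc_V: "sc V c X = (\<lambda>b. asmult A c (X b))"
  by (simp add: V_simps asm_1)

lemma form_sc: "\<omega> \<in> carrier W \<Longrightarrow> X \<in> carrier V \<Longrightarrow> \<omega> (sc V c X) = asmult A c (\<omega> X)"
  unfolding sc_V by (auto simp: W_simps one_forms_def V_simps)

lemma form_intro:
  assumes "\<And>X Y. X \<in> carrier V \<Longrightarrow> Y \<in> carrier V \<Longrightarrow> \<omega> (X \<oplus>\<^bsub>V\<^esub> Y) = \<omega> X + \<omega> Y"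
    and "\<And>c X. X \<in> carrier V \<Longrightarrow> \<omega> (sc V c X) = asmult A c (\<omega> X)"
    and "\<And>a X. X \<in> carrier V \<Longrightarrow> \<omega> (ract V X a) = \<omega> X * a"
    and "\<And>X. X \<notin> carrier V \<Longrightarrow> \<omega> X = 0"
  shows "\<omega> \<in> carrier W"
  using assms unfolding sc_V by (auto simp: W_simps one_forms_def V_simps)

lemma lin_form: "\<omega> \<in> carrier W \<Longrightarrow> lin V f \<Longrightarrow> lin AA (\<lambda>x. \<omega> (f x))"
  by (auto simp: lin_def form_add form_sc asm_1 simp del: lact_mult)

lemma form_sw: "\<omega> \<in> carrier W \<Longrightarrow> (\<And>r s. F r s \<in> carrier V) \<Longrightarrow> \<omega> (sw V xs F) = sw AA xs (\<lambda>r s. \<omega> (F r s))"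
  by (rule sw_hom[where M = V and M' = AA and \<phi> = \<omega>]) (auto simp: form_add)

lemma form_eval:
  "\<omega> \<in> carrier W \<Longrightarrow> X \<in> carrier V \<Longrightarrow> aact A x (\<omega> X) = sw AA (\<Delta> x) (\<lambda>p q. hact W p \<omega> (hact V q X))"
  using adj_act_eval[OF bsb_V, of X \<omega> x] lin_form[of \<omega>] by (simp add: W_hact adj_act_sw)

text \<open>Rewriting a X by the right action makes right linearity of \<omega> applicable, and what
  results is the definition of the right action on forms.\<close>

lemma form_lact: "\<omega> \<in> carrier W \<Longrightarrow> X \<in> carrier V \<Longrightarrow> \<omega> (lact V a X) = ract W \<omega> a X"
  by (simp add: lact_eq[OF bsb_V, of X a] form_sw form_ract W_ract)

end

section \<open>The antipode as an antihomomorphism on modules\<close>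

context thopf
begin

lemma sw_diff: "sw AA xs (\<lambda>r s. F r s - G r s) = sw AA xs F - sw AA xs G"
  by (induction xs) auto

lemma sw_const_zero [simp]: "sw AA xs (\<lambda>r s. 0) = 0"
  by (induction xs) auto

lemma asm_zero [simp]: "asmult A c 0 = 0"
  using asm_rules(1)[of c 0 0] by simp

lemma asm_minus: "asmult A c (- a) = - asmult A c a"
  using asm_rules(1)[of c a "- a"] by (simp add: eq_neg_iff_add_eq_0 add.commute)

lemma asm_sw: "asmult A c (sw AA xs F) = sw AA xs (\<lambda>r s. asmult A c (F r s))"
  by (rule sw_hom) (auto simp: asm_rules)

lemma hact_antipode_one:
  assumes [simp]: "bsb M" "m \<in> carrier M"
  shows "hact M (S 1) m = m"
proof -
  have "hact M (S 1) m = sw M (\<Delta> 1) (\<lambda>p q. hact M (S p * q) m)"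
    by (subst coprod_one) (intro lins | simp)+
  also have "\<dots> = sc M (\<epsilon> 1) (hact M 1 m)"
    by (rule antipode_l) (intro lins | simp)+
  finally show ?thesis by simp
qed

text \<open>The usual convolution argument, carried out on a fixed m because the rules concern sums
  in modules. Inserting \<epsilon>(x y) as S of one leg times the other puts S(x y) on the left; the
  remaining legs then cancel against S(y) and S(x), beginning with those of y.\<close>

lemma hact_antipode_mult:
  assumes [simp]: "bsb M" "m \<in> carrier M"
  shows "hact M (S (x * y)) m = hact M (S y) (hact M (S x) m)"
proof -
  define G where "G = (\<lambda>x y. hact M (S y * S x) m)"
  have G: "lin M (\<lambda>z. G (g z) y)" "lin M (\<lambda>z. G x (g z))" if "hl g" for g x y
    unfolding G_def by (intro lins that | simp)+
  have [simp]: "G x y \<in> carrier M" for x y by (simp add: G_def)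
  have "G x y = sw M (\<Delta> x) (\<lambda>p q. sc M (\<epsilon> p) (G q y))"
    by (rule counit_l[symmetric]) (intro lins G | simp)+
  also have "\<dots> = sw M (\<Delta> x) (\<lambda>p q. sc M (\<epsilon> p) (sw M (\<Delta> y) (\<lambda>r s. sc M (\<epsilon> r) (G q s))))"
    by (rule sw_cong, rule arg_cong[where f = "sc M c" for c], rule counit_l[symmetric]) (intro lins G | simp)+
  also have "\<dots> = sw M (\<Delta> x) (\<lambda>p q. sw M (\<Delta> y) (\<lambda>r s. sc M (\<epsilon> (p * r)) (hact M 1 (G q s))))"
    by (simp add: sc_sw counit_mult scm_mult)
  also have "\<dots> = sw M (\<Delta> x) (\<lambda>p q. sw M (\<Delta> y) (\<lambda>r s. sw M (\<Delta> (p * r)) (\<lambda>c d. hact M (S c * d) (G q s))))"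
    by (rule sw_cong, rule sw_cong, rule antipode_l[symmetric]) (intro lins G | simp)+
  also have "\<dots> = sw M (\<Delta> x) (\<lambda>p q. sw M (\<Delta> y) (\<lambda>r s. sw M (\<Delta> p) (\<lambda>c d. sw M (\<Delta> r) (\<lambda>e f.
      hact M (S (c * e) * (d * f * S s * S q)) m))))"
    by (rule sw_cong, rule sw_cong, subst coprod_mult) (intro lins G | simp add: G_def hact_mult)+
  also have "\<dots> = sw M (\<Delta> x) (\<lambda>p q. sw M (\<Delta> p) (\<lambda>c d. sw M (\<Delta> y) (\<lambda>r s. sw M (\<Delta> r) (\<lambda>e f.
      hact M (S (c * e) * (d * f * S s * S q)) m))))"
    by (rule sw_cong, rule sw_swap) (simp_all add: sw_closed)
  also have "\<dots> = sw M (\<Delta> x) (\<lambda>p q. sw M (\<Delta> p) (\<lambda>c d. sw M (\<Delta> y) (\<lambda>r s. sw M (\<Delta> s) (\<lambda>e f.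
      hact M (S (c * r) * (d * (e * S f) * S q)) m))))"
    unfolding mult.assoc by (rule sw_cong, rule sw_cong, rule coassoc) (intro lins | simp)+
  also have "\<dots> = sw M (\<Delta> x) (\<lambda>p q. sw M (\<Delta> p) (\<lambda>c d. hact M (S (c * y) * (d * 1 * S q)) m))"
    by (rule sw_cong, rule sw_cong, rule antipode_r_snd) (intro lins | simp)+
  also have "\<dots> = sw M (\<Delta> x) (\<lambda>p q. sw M (\<Delta> q) (\<lambda>c d. hact M (S (p * y) * (c * S d)) m))"
    unfolding mult_1_right by (rule coassoc) (intro lins | simp)+
  also have "\<dots> = hact M (S (x * y) * 1) m"
    by (rule antipode_r_snd) (intro lins | simp)+
  finally show ?thesis by (simp add: G_def hact_mult)
qed

end

section \<open>One-forms as a braided symmetric bimodule\<close>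

context vfield_bimod
begin

lemma ab_W [simp]: "abelian_group W"
proof (rule abelian_groupI)
  fix \<omega> \<eta> \<theta> assume *: "\<omega> \<in> carrier W" "\<eta> \<in> carrier W"
  show "\<omega> \<oplus>\<^bsub>W\<^esub> \<eta> \<in> carrier W"
    using * by (intro form_intro) (simp_all add: W_simps(2) form_add form_sc form_ract form_outside asm_rules distrib_right)
next
  show "\<zero>\<^bsub>W\<^esub> \<in> carrier W"
    by (rule form_intro) (simp_all add: W_simps(3))
next
  fix \<omega> assume *: "\<omega> \<in> carrier W"
  then have "(\<lambda>X. - \<omega> X) \<in> carrier W"
    by (intro form_intro) (simp_all add: form_add form_sc form_ract form_outside asm_minus)
  then show "\<exists>\<eta>\<in>carrier W. \<eta> \<oplus>\<^bsub>W\<^esub> \<omega> = \<zero>\<^bsub>W\<^esub>"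
    by (rule bexI[rotated]) (simp add: W_simps)
qed (simp_all add: W_simps ac_simps)

lemma V_add_closed [simp]: "X \<in> carrier V \<Longrightarrow> Y \<in> carrier V \<Longrightarrow> X \<oplus>\<^bsub>V\<^esub> Y \<in> carrier V"
  using abelian_group.axioms(1)[OF bsb_ab[OF bsb_V]] by (simp add: abelian_monoid.a_closed)

lemma W_lact_closed: "\<omega> \<in> carrier W \<Longrightarrow> lact W a \<omega> \<in> carrier W"
  by (intro form_intro)
    (simp_all add: W_simps(4) form_add form_sc form_ract form_outside distrib_left asm_rules mult.assoc)

lemma W_hact_closed:
  assumes [simp]: "\<omega> \<in> carrier W"
  shows "hact W x \<omega> \<in> carrier W"
proof (rule form_intro)
  note lf = lin_form[OF assms]
  fix X a assume [simp]: "X \<in> carrier V"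
  have "hact W x \<omega> X * a = sw AA (\<Delta> x) (\<lambda>p q. aact A p (\<omega> (hact V (S q) X)) * a)"
    by (simp add: W_hact times_sw')
  \<comment> \<open>The factor a is pulled under the action: (p b) a is the sum of p1 (b (S(p2) a)).
    The antipode then acts on both X and a in reversed order, which is how it acts on X a.\<close>
  also have "\<dots> = sw AA (\<Delta> x) (\<lambda>p q. sw AA (\<Delta> p) (\<lambda>c d. aact A c (\<omega> (hact V (S q) X) * aact A (S d) a)))"
  proof (rule sw_cong)
    fix p q
    let ?b = "\<omega> (hact V (S q) X)"
    have "aact A p ?b * aact A 1 a = sw AA (\<Delta> p) (\<lambda>c d. sw AA (\<Delta> d) (\<lambda>e f. aact A c ?b * aact A (e * S f) a))"
      by (rule antipode_r_snd[symmetric]) (intro lins lf | simp)+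
    also have "\<dots> = sw AA (\<Delta> p) (\<lambda>c d. sw AA (\<Delta> c) (\<lambda>e f. aact A e ?b * aact A (f * S d) a))"
      by (rule coassoc[symmetric]) (intro lins lf | simp)+
    also have "\<dots> = sw AA (\<Delta> p) (\<lambda>c d. aact A c (?b * aact A (S d) a))"
      by (simp add: aact_prod aact_mult)
    finally show "aact A p ?b * a = sw AA (\<Delta> p) (\<lambda>c d. aact A c (?b * aact A (S d) a))" by simp
  qed
  also have "\<dots> = sw AA (\<Delta> x) (\<lambda>p q. sw AA (\<Delta> q) (\<lambda>c d. aact A p (\<omega> (hact V (S d) X) * aact A (S c) a)))"
    by (rule coassoc) (intro lins lf | simp)+
  also have "\<dots> = sw AA (\<Delta> x) (\<lambda>p q. aact A p (\<omega> (hact V (S q) (ract V X a))))"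
    by (simp add: hact_antipode_ract form_sw form_ract aact_sw)
  finally show "hact W x \<omega> (ract V X a) = hact W x \<omega> X * a"
    by (simp add: W_hact)
qed (simp_all add: W_hact W_outside hact_add form_add aact_add sw_add[of AA, simplified]
  hact_sc form_sc aact_asm asm_sw)

text \<open>Braided commutativity of A moves the scalar to the left of the value \<omega>(X). The
  action on that value splits over \<omega> and X by \<open>form_eval\<close>, and the leg that
  reaches X cancels the copy of \<rho> in the definition of the right action.\<close>

lemma W_ract_eq:
  assumes [simp]: "\<omega> \<in> carrier W"
  shows "ract W \<omega> a = sw W \<rho> (\<lambda>r s. lact W (aact A r a) (hact W s \<omega>))"
proof (rule ext)
  fix X
  note [simp] = W_hact_closed
  note lf = lin_form[OF assms] lin_form[OF W_hact_closed[OF assms]]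
  show "ract W \<omega> a X = sw W \<rho> (\<lambda>r s. lact W (aact A r a) (hact W s \<omega>)) X"
  proof (cases "X \<in> carrier V")
    case False
    then show ?thesis by (simp add: W_outside sw_W W_simps)
  next
    case True
    note [simp] = this
    have lH: "lin AA (\<lambda>x. hact W (g x) \<omega> Y)" if "hl g" "Y \<in> carrier V" for g Y
      unfolding W_hact[OF that(2)] by (intro lins lf that | simp add: that)+
    have "ract W \<omega> a X = sw AA \<rho> (\<lambda>r s. sw AA \<rho> (\<lambda>r' s'. sw AA (\<Delta> s') (\<lambda>p q.
        aact A (r' * s) a * hact W p \<omega> (hact V (q * r) X))))"
      by (simp add: W_ract aact_mult hact_mult braided_comm[of "\<omega> Y" "aact A s a" for Y s] form_eval times_sw)
    also have "\<dots> = sw AA \<rho> (\<lambda>r s. sw AA \<rho> (\<lambda>r' s'. sw AA \<rho> (\<lambda>r'' s''.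
        aact A (r' * r'' * s) a * hact W s' \<omega> (hact V (s'' * r) X))))"
      by (rule sw_cong, rule R_Delta2) (intro lins lf lH | simp)+
    also have "\<dots> = sw AA \<rho> (\<lambda>r' s'. sw AA \<rho> (\<lambda>r s. sw AA \<rho> (\<lambda>r'' s''.
        aact A (r' * r'' * s) a * hact W s' \<omega> (hact V (s'' * r) X))))"
      by (rule sw_swap) simp_all
    also have "\<dots> = sw AA \<rho> (\<lambda>r' s'. sw AA \<rho> (\<lambda>r'' s''. sw AA \<rho> (\<lambda>r s.
        aact A (r' * (r'' * s)) a * hact W s' \<omega> (hact V (s'' * r) X))))"
      unfolding mult.assoc by (rule sw_cong, rule sw_swap) simp_all
    also have "\<dots> = sw AA \<rho> (\<lambda>r' s'. aact A (r' * 1) a * hact W s' \<omega> (hact V 1 X))"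
      by (rule sw_cong, rule R_inv) (intro lins lf lH | simp)+
    finally show ?thesis by (simp add: sw_W W_simps)
  qed
qed

lemma lin_W_hact_app [lins]:
  assumes "\<omega> \<in> carrier W" "hl g"
  shows "lin AA (\<lambda>x. hact W (g x) \<omega> Y)"
proof (cases "Y \<in> carrier V")
  case True
  show ?thesis unfolding W_hact[OF True] by (intro lins assms lin_form[OF assms(1)] | simp add: True assms)+
next
  case False
  then show ?thesis by (simp add: W_outside lin_def)
qed

lemma bsb_W [simp]: "bsb W"
proof (rule bsb_intro)
  note [simp] = W_hact_closed W_lact_closed
  fix a b x y c and \<omega> \<eta> assume [simp]: "\<omega> \<in> carrier W" "\<eta> \<in> carrier W"
  note lf = lin_form[OF \<open>\<omega> \<in> carrier W\<close>]
  show "ract W \<omega> a \<in> carrier W"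
    by (simp add: W_ract_eq sw_closed)
  show "ract W \<omega> a = sw W \<rho> (\<lambda>r s. lact W (aact A r a) (hact W s \<omega>))"
    by (rule W_ract_eq) simp
  show "lact W (a + b) \<omega> = lact W a \<omega> \<oplus>\<^bsub>W\<^esub> lact W b \<omega>" "lact W (a * b) \<omega> = lact W a (lact W b \<omega>)"
    "lact W a (\<omega> \<oplus>\<^bsub>W\<^esub> \<eta>) = lact W a \<omega> \<oplus>\<^bsub>W\<^esub> lact W a \<eta>" "lact W 1 \<omega> = \<omega>"
    by (simp_all add: W_simps algebra_simps)
  show "lact W a \<omega> \<in> carrier W" "hact W x \<omega> \<in> carrier W" by simp_all
  have ext0: "f = g" if "\<And>X. X \<in> carrier V \<Longrightarrow> f X = g X" "\<And>X. X \<notin> carrier V \<Longrightarrow> f X = g X" for f g :: "('a \<Rightarrow> 'a) \<Rightarrow> 'a"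
    using that by blast
  show "ract W (\<omega> \<oplus>\<^bsub>W\<^esub> \<eta>) a = ract W \<omega> a \<oplus>\<^bsub>W\<^esub> ract W \<eta> a"
    by (rule ext0) (simp_all add: W_simps(2) W_ract W_outside distrib_right sw_add[of AA, simplified])
  show "ract W \<omega> (a + b) = ract W \<omega> a \<oplus>\<^bsub>W\<^esub> ract W \<omega> b"
    by (rule ext0) (simp_all add: W_simps(2) W_ract W_outside distrib_left aact_add sw_add[of AA, simplified])
  show "ract W (lact W a \<omega>) b = lact W a (ract W \<omega> b)"
    by (rule ext0) (simp_all add: W_simps(4) W_ract W_outside times_sw mult.assoc)
  have rsc: "sw AA \<rho> (\<lambda>r s. \<omega> (hact V r X) * aact A s (asmult A c 1)) = asmult A c (\<omega> X)" if [simp]: "X \<in> carrier V" for X c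
  proof -
    have "sw AA \<rho> (\<lambda>r s. sc AA (\<epsilon> s) (\<omega> (hact V r X))) = \<omega> (hact V 1 X)"
      by (rule R_counit_r) (intro lins lf | simp)+
    then show ?thesis
      by (simp add: asm_1 aact_asm aact_1 asm_rules(6) flip: asm_sw)
  qed
  show "sc W c \<omega> = ract W \<omega> (asmult A c 1)"
    by (rule ext0) (simp_all add: W_simps(4) W_ract W_outside rsc asm_1 form_outside)
  have "asmult A 1 1 = (1 :: 'a)" by (rule asm_rules)
  then show "ract W \<omega> 1 = \<omega>"
    using rsc[of _ 1] by (intro ext0) (simp_all add: W_ract W_outside form_outside asm_rules)
  show "ract W \<omega> (a * b) = ract W (ract W \<omega> a) b"
  proof (rule ext0)
    fix X assume [simp]: "X \<in> carrier V"
    have "ract W \<omega> (a * b) X = sw AA \<rho> (\<lambda>r s. sw AA (\<Delta> s) (\<lambda>p q. \<omega> (hact V r X) * aact A p a * aact A q b))"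
      by (simp add: W_ract aact_prod times_sw mult.assoc)
    also have "\<dots> = sw AA \<rho> (\<lambda>r s. sw AA \<rho> (\<lambda>r' s'. \<omega> (hact V (r * r') X) * aact A s a * aact A s' b))"
      by (rule R_Delta2) (intro lins lf | simp)+
    also have "\<dots> = sw AA \<rho> (\<lambda>r' s'. sw AA \<rho> (\<lambda>r s. \<omega> (hact V (r * r') X) * aact A s a * aact A s' b))"
      by (rule sw_swap) simp_all
    also have "\<dots> = ract W (ract W \<omega> a) b X"
      by (simp add: W_ract hact_mult times_sw')
    finally show "ract W \<omega> (a * b) X = ract W (ract W \<omega> a) b X" .
  qed (simp add: W_outside)
  show "hact W x (\<omega> \<oplus>\<^bsub>W\<^esub> \<eta>) = hact W x \<omega> \<oplus>\<^bsub>W\<^esub> hact W x \<eta>"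
    by (rule ext0) (simp_all add: W_simps(2) W_hact W_outside aact_add sw_add[of AA, simplified])
  show "hact W (x + y) \<omega> = hact W x \<omega> \<oplus>\<^bsub>W\<^esub> hact W y \<omega>"
    using lin_W_hact_app[OF _ hl_id, of \<omega>] by (simp add: lin_def W_simps(2) fun_eq_iff)
  show "hact W (hsmult H c x) \<omega> = sc W c (hact W x \<omega>)"
    using lin_W_hact_app[OF _ hl_id, of \<omega>] by (simp add: lin_def W_simps(4) fun_eq_iff)
  show "hact W x (sc W c \<omega>) = sc W c (hact W x \<omega>)"
    by (rule ext0) (simp_all add: W_simps(4) W_hact W_outside asm_1 aact_asm asm_sw)
  show "hact W 1 \<omega> = \<omega>"
  proof (rule ext0)
    fix X assume [simp]: "X \<in> carrier V"
    have "hact W 1 \<omega> X = aact A 1 (\<omega> (hact V (S 1) X))"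
      by (simp only: W_hact[OF \<open>X \<in> carrier V\<close>], rule coprod_one) (intro lins lf | simp)+
    then show "hact W 1 \<omega> X = \<omega> X" by (simp add: hact_antipode_one)
  qed (simp add: W_outside form_outside)
  show "hact W (x * y) \<omega> = hact W x (hact W y \<omega>)"
  proof (rule ext0)
    fix X assume [simp]: "X \<in> carrier V"
    have "hact W (x * y) \<omega> X = sw AA (\<Delta> x) (\<lambda>p q. sw AA (\<Delta> y) (\<lambda>r s. aact A (p * r) (\<omega> (hact V (S (q * s)) X))))"
      by (simp only: W_hact[OF \<open>X \<in> carrier V\<close>], rule coprod_mult) (intro lins lf | simp)+
    then show "hact W (x * y) \<omega> X = hact W x (hact W y \<omega>) X"
      by (simp add: W_hact aact_sw aact_mult hact_antipode_mult)
  qed (simp add: W_outside)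
  show "hact W x (lact W a \<omega>) = sw W (\<Delta> x) (\<lambda>p q. lact W (aact A p a) (hact W q \<omega>))"
  proof (rule ext0)
    fix X assume [simp]: "X \<in> carrier V"
    have "hact W x (lact W a \<omega>) X = sw AA (\<Delta> x) (\<lambda>p q. sw AA (\<Delta> p) (\<lambda>c d. aact A c a * aact A d (\<omega> (hact V (S q) X))))"
      by (simp add: W_hact W_simps(4) aact_prod)
    also have "\<dots> = sw AA (\<Delta> x) (\<lambda>p q. sw AA (\<Delta> q) (\<lambda>c d. aact A p a * aact A c (\<omega> (hact V (S d) X))))"
      by (rule coassoc) (intro lins lf | simp)+
    also have "\<dots> = sw W (\<Delta> x) (\<lambda>p q. lact W (aact A p a) (hact W q \<omega>)) X"
      by (simp add: sw_W W_simps(4) W_hact times_sw)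
    finally show "hact W x (lact W a \<omega>) X = sw W (\<Delta> x) (\<lambda>p q. lact W (aact A p a) (hact W q \<omega>)) X" .
  qed (simp add: W_outside sw_W W_simps(4))
qed (rule ab_W)

end

section \<open>Equivariant covariant derivatives\<close>

context vfield_bimod
begin

abbreviation ecd :: "('a, 'h, 'm) bimod \<Rightarrow> (('a \<Rightarrow> 'a) \<Rightarrow> 'm \<Rightarrow> 'm) \<Rightarrow> bool" where
  "ecd M N \<equiv> equivariant_cov_deriv H R A M N"

text \<open>k-linearity in the section comes out of the Leibniz rule for a = c 1: a derivation kills
  1, and the surviving term is evaluated by the counit on the first leg of \<rho>.\<close>

lemma ecd_intro:
  assumes M [simp]: "bsb M"
    and c: "\<And>X s. X \<in> carrier V \<Longrightarrow> s \<in> carrier M \<Longrightarrow> N X s \<in> carrier M"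
    and addX: "\<And>X Y s. X \<in> carrier V \<Longrightarrow> Y \<in> carrier V \<Longrightarrow> s \<in> carrier M \<Longrightarrow>
      N (X \<oplus>\<^bsub>V\<^esub> Y) s = N X s \<oplus>\<^bsub>M\<^esub> N Y s"
    and add: "\<And>X s t. X \<in> carrier V \<Longrightarrow> s \<in> carrier M \<Longrightarrow> t \<in> carrier M \<Longrightarrow>
      N X (s \<oplus>\<^bsub>M\<^esub> t) = N X s \<oplus>\<^bsub>M\<^esub> N X t"
    and eqv: "\<And>x X s. X \<in> carrier V \<Longrightarrow> s \<in> carrier M \<Longrightarrow>
      hact M x (N X s) = sw M (\<Delta> x) (\<lambda>p q. N (hact V p X) (hact M q s))"
    and lact: "\<And>a X s. X \<in> carrier V \<Longrightarrow> s \<in> carrier M \<Longrightarrow> N (lact V a X) s = lact M a (N X s)"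
    and leib: "\<And>a X s. X \<in> carrier V \<Longrightarrow> s \<in> carrier M \<Longrightarrow>
      N X (lact M a s) = lact M (X a) s \<oplus>\<^bsub>M\<^esub> sw M \<rho> (\<lambda>r s'. lact M (aact A r a) (N (hact V s' X) s))"
  shows "ecd M N"
proof -
  interpret abelian_group M by simp
  note [simp] = c
  have scX: "N (sc V c X) s = sc M c (N X s)" if "X \<in> carrier V" "s \<in> carrier M" for X s c
    using that by (rule lact)
  have lin1: "lin M (\<lambda>x. N (f x) s)" if "lin V f" "s \<in> carrier M" for f s
    using that by (auto simp: lin_def addX scX)
  have "N X (sc M c s) = sc M c (N X s)" if [simp]: "X \<in> carrier V" "s \<in> carrier M" for X s c
  proof -
    have "X (1 * 1) = X 1 * 1 + sw AA \<rho> (\<lambda>r s. aact A r 1 * hact V s X 1)"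
      by (rule Der_prod) simp
    also have "sw AA \<rho> (\<lambda>r s. aact A r 1 * hact V s X 1) = hact V 1 X 1"
      by (rule R_counit_aact) (intro lins | simp)+
    finally have X1: "X 1 = 0" by simp
    have "N X (sc M c s) = lact M 0 s \<oplus>\<^bsub>M\<^esub> sw M \<rho> (\<lambda>r s'. sc M (\<epsilon> r) (sc M c (N (hact V s' X) s)))"
      by (simp add: leib Der_asm X1 aact_asm aact_1 asm_rules(6) flip: lact_mult asm_rules(3))
    also have "sw M \<rho> (\<lambda>r s'. sc M (\<epsilon> r) (sc M c (N (hact V s' X) s))) = sc M c (N (hact V 1 X) s)"
      by (rule R_counit_l) (intro lins lin1 | simp)+
    also have "lact M 0 s = \<zero>\<^bsub>M\<^esub>"
      using lact_add'[OF M, of s 0 0] add.r_cancel_one[of "lact M 0 s" "lact M 0 s"] by simp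
    finally show ?thesis by simp
  qed
  then show ?thesis
    unfolding equivariant_cov_deriv_def Let_def
    using assms scX by (simp add: sw_def)
qed

context
  fixes M :: "('a, 'h, 'm) bimod" and N :: "('a \<Rightarrow> 'a) \<Rightarrow> 'm \<Rightarrow> 'm"
  assumes N: "ecd M N"
begin

lemma ecd_bsb: "bsb M"
  using N by (simp add: equivariant_cov_deriv_def)

lemma cd_closed: "X \<in> carrier V \<Longrightarrow> s \<in> carrier M \<Longrightarrow> N X s \<in> carrier M"
  and cd_addX: "X \<in> carrier V \<Longrightarrow> Y \<in> carrier V \<Longrightarrow> s \<in> carrier M \<Longrightarrow> N (X \<oplus>\<^bsub>V\<^esub> Y) s = N X s \<oplus>\<^bsub>M\<^esub> N Y s"
  and cd_add: "X \<in> carrier V \<Longrightarrow> s \<in> carrier M \<Longrightarrow> t \<in> carrier M \<Longrightarrow> N X (s \<oplus>\<^bsub>M\<^esub> t) = N X s \<oplus>\<^bsub>M\<^esub> N X t"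
  and cd_lact: "X \<in> carrier V \<Longrightarrow> s \<in> carrier M \<Longrightarrow> N (lact V a X) s = lact M a (N X s)"
  using N by (simp_all add: equivariant_cov_deriv_def Let_def)

lemma cd_sc: "X \<in> carrier V \<Longrightarrow> s \<in> carrier M \<Longrightarrow> N X (sc M c s) = sc M c (N X s)"
  using N unfolding equivariant_cov_deriv_def Let_def by blast

lemma cd_equiv: "X \<in> carrier V \<Longrightarrow> s \<in> carrier M \<Longrightarrow>
    hact M x (N X s) = sw M (\<Delta> x) (\<lambda>p q. N (hact V p X) (hact M q s))"
  and cd_leibniz: "X \<in> carrier V \<Longrightarrow> s \<in> carrier M \<Longrightarrow>
    N X (lact M a s) = lact M (X a) s \<oplus>\<^bsub>M\<^esub> sw M \<rho> (\<lambda>r s'. lact M (aact A r a) (N (hact V s' X) s))"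
  using N by (simp_all add: equivariant_cov_deriv_def Let_def sw_def)

lemma lin_cd: "lin V f \<Longrightarrow> s \<in> carrier M \<Longrightarrow> lin M (\<lambda>x. N (f x) s)"
  and lin_cd_snd: "lin M g \<Longrightarrow> X \<in> carrier V \<Longrightarrow> lin M (\<lambda>x. N X (g x))"
  by (auto simp: lin_def cd_closed cd_addX cd_add cd_sc cd_lact)

lemma cd_sw: "X \<in> carrier V \<Longrightarrow> (\<And>r s. F r s \<in> carrier M) \<Longrightarrow> N X (sw M xs F) = sw M xs (\<lambda>r s. N X (F r s))"
  by (rule sw_hom) (auto simp: ecd_bsb cd_closed cd_add)

lemma cd_sw': "s \<in> carrier M \<Longrightarrow> (\<And>r s. F r s \<in> carrier V) \<Longrightarrow> N (sw V xs F) s = sw M xs (\<lambda>p q. N (F p q) s)"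
  by (rule sw_hom[where \<phi> = "\<lambda>X. N X s"]) (auto simp: ecd_bsb cd_closed cd_addX)

text \<open>Both summands move \<open>a\<close> past \<open>s\<close>; the second copy of \<open>\<R>\<close> cancels because \<open>\<R>\<^sup>-\<^sup>1 = \<R>\<^sub>2\<^sub>1\<close>.\<close>

lemma cd_ract:
  assumes [simp]: "X \<in> carrier V" "s \<in> carrier M"
  shows "N X (ract M s a) = ract M (N X s) a \<oplus>\<^bsub>M\<^esub> sw M \<rho> (\<lambda>r s'. ract M (hact M r s) (hact V s' X a))"
proof -
  note [simp] = ecd_bsb cd_closed
  interpret abelian_group M by simp
  have "N X (ract M s a) = sw M \<rho> (\<lambda>r t. lact M (X (aact A r a)) (hact M t s) \<oplus>\<^bsub>M\<^esub>
      sw M \<rho> (\<lambda>r' t'. lact M (aact A (r' * r) a) (N (hact V t' X) (hact M t s))))"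
    by (simp add: ract_eq cd_sw cd_leibniz aact_mult)
  also have "\<dots> = sw M \<rho> (\<lambda>r t. lact M (X (aact A r a)) (hact M t s)) \<oplus>\<^bsub>M\<^esub>
      sw M \<rho> (\<lambda>r t. sw M \<rho> (\<lambda>r' t'. lact M (aact A (r' * r) a) (N (hact V t' X) (hact M t s))))"
    by (rule sw_add) (simp_all add: sw_closed)
  also have "sw M \<rho> (\<lambda>r t. sw M \<rho> (\<lambda>r' t'. lact M (aact A (r' * r) a) (N (hact V t' X) (hact M t s)))) = ract M (N X s) a"
  proof -
    have "ract M (N X s) a = sw M \<rho> (\<lambda>r t. sw M (\<Delta> t) (\<lambda>p q. lact M (aact A r a) (N (hact V p X) (hact M q s))))"
      by (simp add: ract_eq cd_equiv lact_sw)
    also have "\<dots> = sw M \<rho> (\<lambda>r t. sw M \<rho> (\<lambda>r' t'. lact M (aact A (r * r') a) (N (hact V t X) (hact M t' s))))"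
      by (rule R_Delta2) (intro lins lin_cd lin_cd_snd | simp)+
    also have "\<dots> = sw M \<rho> (\<lambda>r t. sw M \<rho> (\<lambda>r' t'. lact M (aact A (r' * r) a) (N (hact V t' X) (hact M t s))))"
      by (rule sw_swap) simp_all
    finally show ?thesis ..
  qed
  also have "sw M \<rho> (\<lambda>r t. lact M (X (aact A r a)) (hact M t s)) = sw M \<rho> (\<lambda>r s'. ract M (hact M r s) (hact V s' X a))"
  proof -
    have "sw M \<rho> (\<lambda>r s'. ract M (hact M r s) (hact V s' X a)) =
      sw M \<rho> (\<lambda>r t. sw M \<rho> (\<lambda>r' t'. sw M (\<Delta> r') (\<lambda>p q. lact M (hact V (p * t) X (aact A q a)) (hact M (t' * r) s))))"
      by (simp add: ract_eq Der_eval lact_sw' hact_mult)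
    also have "\<dots> = sw M \<rho> (\<lambda>r t. sw M \<rho> (\<lambda>r' t'. sw M \<rho> (\<lambda>r'' t''. lact M (hact V (r'' * t) X (aact A r' a)) (hact M (t' * t'' * r) s))))"
      by (rule sw_cong, rule R_Delta1) (intro lins lin_Der[OF hact_closed[OF bsb_V]] | simp)+
    also have "\<dots> = sw M \<rho> (\<lambda>r' t'. sw M \<rho> (\<lambda>r t. sw M \<rho> (\<lambda>r'' t''. lact M (hact V (r'' * t) X (aact A r' a)) (hact M (t' * t'' * r) s))))"
      by (rule sw_swap) (simp_all add: sw_closed)
    also have "\<dots> = sw M \<rho> (\<lambda>r' t'. sw M \<rho> (\<lambda>r'' t''. sw M \<rho> (\<lambda>r t. lact M (hact V (r'' * t) X (aact A r' a)) (hact M (t' * (t'' * r)) s))))"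
      unfolding mult.assoc by (rule sw_cong, rule sw_swap) simp_all
    also have "\<dots> = sw M \<rho> (\<lambda>r' t'. lact M (hact V 1 X (aact A r' a)) (hact M (t' * 1) s))"
      by (rule sw_cong, rule R_inv) (intro lins lin_Der[OF hact_closed[OF bsb_V]] | simp)+
    finally show ?thesis by simp
  qed
  finally show ?thesis
    by (simp add: a_comm sw_closed)
qed

end

end

section \<open>The dual covariant derivative on one-forms\<close>

locale vfield_cov_deriv = vfield_bimod H R A
  for H :: "('k::{comm_ring, comm_monoid_mult}, 'h::{ring, monoid_mult}) hopf"
    and R :: "('h \<times> 'h) list"
    and A :: "('k, 'h, 'a::{ring, monoid_mult}) malg" +
  fixes N :: "('a \<Rightarrow> 'a) \<Rightarrow> ('a \<Rightarrow> 'a) \<Rightarrow> ('a \<Rightarrow> 'a)"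
  assumes ecd_N: "equivariant_cov_deriv H R A (vfields H R A) N"
begin

lemmas N_closed [simp] = cd_closed[OF ecd_N]
lemmas lin_N = lin_cd[OF ecd_N] lin_cd_snd[OF ecd_N]

text \<open>The value zero off \<open>Der\<close> is the convention by which
  \<open>one_forms\<close> represents functions on \<open>Der\<close>.\<close>

definition NF :: "('a \<Rightarrow> 'a) \<Rightarrow> (('a \<Rightarrow> 'a) \<Rightarrow> 'a) \<Rightarrow> ('a \<Rightarrow> 'a) \<Rightarrow> 'a" where
  "NF X \<omega> Y = (if Y \<in> carrier V then
     X (\<omega> Y) - sw AA \<rho> (\<lambda>r s. hact W r \<omega> (N (hact V s X) Y)) else 0)"

lemma NF_eq: "Y \<in> carrier V \<Longrightarrow> NF X \<omega> Y = X (\<omega> Y) - sw AA \<rho> (\<lambda>r s. hact W r \<omega> (N (hact V s X) Y))"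
  by (simp add: NF_def)

text \<open>Right linearity is the point. The Leibniz rule for X at \<omega>(Y) a and the rule
  \<open>cd_ract\<close> for the derivative of Y a each produce one term in which a is
  differentiated; these agree and cancel in the difference.\<close>

lemma NF_closed [simp]:
  assumes [simp]: "X \<in> carrier V" "\<omega> \<in> carrier W"
  shows "NF X \<omega> \<in> carrier W"
proof (rule form_intro)
  fix Y Z assume [simp]: "Y \<in> carrier V" "Z \<in> carrier V"
  show "NF X \<omega> (Y \<oplus>\<^bsub>V\<^esub> Z) = NF X \<omega> Y + NF X \<omega> Z"
    by (simp add: NF_eq form_add Der_add cd_add[OF ecd_N] sw_add[of AA, simplified])
next
  fix Y c assume [simp]: "Y \<in> carrier V"
  have diff: "asmult A c (x - y) = asmult A c x - asmult A c y" for x y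
    using asm_rules(1)[of c "x - y" y] by (simp add: eq_diff_eq)
  show "NF X \<omega> (sc V c Y) = asmult A c (NF X \<omega> Y)"
    by (simp add: NF_eq form_sc Der_asm cd_sc[OF ecd_N] asm_sw diff)
next
  fix Y a assume [simp]: "Y \<in> carrier V"
  have "sw AA \<rho> (\<lambda>r s. aact A r (\<omega> Y) * hact V s X a) =
    sw AA \<rho> (\<lambda>r s. sw AA (\<Delta> r) (\<lambda>p q. hact W p \<omega> (hact V q Y) * hact V s X a))"
    by (simp add: form_eval times_sw')
  also have "\<dots> = sw AA \<rho> (\<lambda>r s. sw AA \<rho> (\<lambda>r' s'. hact W r' \<omega> (hact V r Y) * hact V (s * s') X a))"
    by (rule R_Delta1) (intro lins lin_form[OF hact_closed[OF bsb_W]] | simp)+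
  also have "\<dots> = sw AA \<rho> (\<lambda>r' s'. sw AA \<rho> (\<lambda>r s. hact W r' \<omega> (hact V r Y) * hact V (s * s') X a))"
    by (rule sw_swap) simp_all
  finally have 1: "sw AA \<rho> (\<lambda>r s. aact A r (\<omega> Y) * hact V s X a) =
    sw AA \<rho> (\<lambda>r' s'. sw AA \<rho> (\<lambda>r s. hact W r' \<omega> (hact V r Y) * hact V (s * s') X a))" .
  have "X (\<omega> Y * a) = X (\<omega> Y) * a + sw AA \<rho> (\<lambda>r s. aact A r (\<omega> Y) * hact V s X a)"
    by (rule Der_prod) simp
  then show "NF X \<omega> (ract V Y a) = NF X \<omega> Y * a"
    by (simp add: NF_eq form_ract cd_ract[OF ecd_N] form_add form_sw 1 sw_closed hact_mult times_sw'
      left_diff_distrib sw_add[of AA, simplified])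
qed (simp add: NF_def)

lemma lin_appW: "lin W F \<Longrightarrow> lin AA (\<lambda>x. F x Y)"
  unfolding lin_def by (simp add: W_simps)

lemma lin_ract_app: "lin W f \<Longrightarrow> lin AA (\<lambda>x. ract W (f x) a Y)"
    "lin AA g \<Longrightarrow> \<omega> \<in> carrier W \<Longrightarrow> lin AA (\<lambda>x. ract W \<omega> (g x) Y)"
  by (rule lin_appW[where F = "\<lambda>x. ract W (f x) a"], intro lins; simp)
    (rule lin_appW[where F = "\<lambda>x. ract W \<omega> (g x)"], intro lins; simp)

lemma W_add_app: "(\<omega> \<oplus>\<^bsub>W\<^esub> \<eta>) Y = \<omega> Y + \<eta> Y"
  and W_lact_app: "lact W a \<omega> Y = a * \<omega> Y"
  and V_add_app: "(X \<oplus>\<^bsub>V\<^esub> X') b = X b + X' b"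
  by (simp_all add: W_simps V_simps)

lemma NF_addX: "X \<in> carrier V \<Longrightarrow> Y \<in> carrier V \<Longrightarrow> \<omega> \<in> carrier W \<Longrightarrow> NF (X \<oplus>\<^bsub>V\<^esub> Y) \<omega> = NF X \<omega> \<oplus>\<^bsub>W\<^esub> NF Y \<omega>"
  and NF_add: "X \<in> carrier V \<Longrightarrow> \<omega> \<in> carrier W \<Longrightarrow> \<eta> \<in> carrier W \<Longrightarrow> NF X (\<omega> \<oplus>\<^bsub>W\<^esub> \<eta>) = NF X \<omega> \<oplus>\<^bsub>W\<^esub> NF X \<eta>"
  by (rule ext, simp add: NF_def W_add_app V_add_app hact_add Der_add cd_addX[OF ecd_N] form_add sw_add[of AA, simplified])+

text \<open>Linearity in X has to carry a past \<omega>. The scalar leaves the argument of \<omega>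
  as a right action, by \<open>form_lact\<close>, and the copy of \<rho> that accompanies it turns
  it into the left action, by \<open>lact_eq\<close>.\<close>

lemma NF_lact:
  assumes [simp]: "X \<in> carrier V" "\<omega> \<in> carrier W"
  shows "NF (lact V a X) \<omega> = lact W a (NF X \<omega>)"
proof (rule ext)
  fix Y
  show "NF (lact V a X) \<omega> Y = lact W a (NF X \<omega>) Y"
  proof (cases "Y \<in> carrier V")
    case True
    note [simp] = this
    have "sw AA \<rho> (\<lambda>r s. hact W r \<omega> (N (hact V s (lact V a X)) Y)) =
      sw AA \<rho> (\<lambda>r s. sw AA (\<Delta> s) (\<lambda>p q. ract W (hact W r \<omega>) (aact A p a) (N (hact V q X) Y)))"
      by (simp add: hact_lact cd_sw'[OF ecd_N] cd_lact[OF ecd_N] form_sw form_lact)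
    also have "\<dots> = sw AA \<rho> (\<lambda>r s. sw AA \<rho> (\<lambda>r' s'. ract W (hact W (r * r') \<omega>) (aact A s a) (N (hact V s' X) Y)))"
      by (rule R_Delta2) (intro lins lin_ract_app lin_N lin_form[OF ract_closed[OF bsb_W]] | simp)+
    also have "\<dots> = sw AA \<rho> (\<lambda>r' s'. sw AA \<rho> (\<lambda>r s. ract W (hact W (r * r') \<omega>) (aact A s a) (N (hact V s' X) Y)))"
      by (rule sw_swap) simp_all
    also have "\<dots> = sw AA \<rho> (\<lambda>r' s'. lact W a (hact W r' \<omega>) (N (hact V s' X) Y))"
      by (simp add: lact_eq[OF bsb_W, of "hact W r' \<omega>" a for r'] sw_W hact_mult)
    finally show ?thesis
      by (simp add: NF_eq W_simps(4) V_simps(4) right_diff_distrib times_sw)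
  qed (simp add: NF_def W_simps(4))
qed

lemma NF_leibniz:
  assumes [simp]: "X \<in> carrier V" "\<omega> \<in> carrier W"
  shows "NF X (lact W a \<omega>) = lact W (X a) \<omega> \<oplus>\<^bsub>W\<^esub> sw W \<rho> (\<lambda>r s. lact W (aact A r a) (NF (hact V s X) \<omega>))"
proof (rule ext)
  fix Y
  show "NF X (lact W a \<omega>) Y = (lact W (X a) \<omega> \<oplus>\<^bsub>W\<^esub> sw W \<rho> (\<lambda>r s. lact W (aact A r a) (NF (hact V s X) \<omega>))) Y"
  proof (cases "Y \<in> carrier V")
    case True
    note [simp] = this
    have "sw AA \<rho> (\<lambda>r s. hact W r (lact W a \<omega>) (N (hact V s X) Y)) =
      sw AA \<rho> (\<lambda>r s. sw AA (\<Delta> r) (\<lambda>p q. aact A p a * hact W q \<omega> (N (hact V s X) Y)))"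
      by (simp add: hact_lact sw_W W_lact_app)
    also have "\<dots> = sw AA \<rho> (\<lambda>r s. sw AA \<rho> (\<lambda>r' s'. aact A r' a * hact W r \<omega> (N (hact V (s * s') X) Y)))"
      by (rule R_Delta1) (intro lins lin_N lin_form[OF hact_closed[OF bsb_W]] | simp)+
    also have "\<dots> = sw AA \<rho> (\<lambda>r' s'. sw AA \<rho> (\<lambda>r s. aact A r' a * hact W r \<omega> (N (hact V (s * s') X) Y)))"
      by (rule sw_swap) simp_all
    finally show ?thesis
      by (simp add: NF_eq W_add_app W_lact_app Der_prod sw_W right_diff_distrib times_sw hact_mult sw_diff)
  qed (simp add: NF_def W_add_app W_lact_app sw_W form_outside)
qed

lemma NF_sc: "X \<in> carrier V \<Longrightarrow> \<omega> \<in> carrier W \<Longrightarrow> NF X (sc W c \<omega>) = sc W c (NF X \<omega>)"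
proof (rule ext)
  fix Y
  have diff: "asmult A c (x - y) = asmult A c x - asmult A c y" for x y
    using asm_rules(1)[of c "x - y" y] by (simp add: eq_diff_eq)
  show "X \<in> carrier V \<Longrightarrow> \<omega> \<in> carrier W \<Longrightarrow> NF X (sc W c \<omega>) Y = sc W c (NF X \<omega>) Y"
    by (simp add: NF_def hact_sc W_lact_app asm_1 Der_asm asm_sw diff)
qed

lemma lin_NF: "lin V f \<Longrightarrow> \<omega> \<in> carrier W \<Longrightarrow> lin W (\<lambda>x. NF (f x) \<omega>)"
  and lin_NF_snd: "lin W g \<Longrightarrow> X \<in> carrier V \<Longrightarrow> lin W (\<lambda>x. NF X (g x))"
  by (auto simp: lin_def NF_addX NF_add NF_sc NF_lact)

lemmas lin_NF_app = lin_NF[THEN lin_appW] lin_NF_snd[THEN lin_appW]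

text \<open>In the subtracted term \<omega> precedes X, whereas equivariance distributes x to X
  first. \<open>R_cocomm\<close> reorders the two legs.\<close>

lemma NF_eval:
  assumes [simp]: "X \<in> carrier V" "\<omega> \<in> carrier W" "Y \<in> carrier V"
  shows "aact A x (NF X \<omega> Y) = sw AA (\<Delta> x) (\<lambda>p q. sw AA (\<Delta> q) (\<lambda>c d. NF (hact V p X) (hact W c \<omega>) (hact V d Y)))"
proof -
  have diff: "aact A x (a - b) = aact A x a - aact A x b" for a b
    using aact_add[of x "a - b" b] by (simp add: eq_diff_eq)
  have 1: "aact A x (X (\<omega> Y)) = sw AA (\<Delta> x) (\<lambda>p q. sw AA (\<Delta> q) (\<lambda>c d. hact V p X (hact W c \<omega> (hact V d Y))))"
    by (simp add: Der_eval form_eval Der_sw)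
  have "aact A x (sw AA \<rho> (\<lambda>r s. hact W r \<omega> (N (hact V s X) Y))) =
    sw AA \<rho> (\<lambda>r s. sw AA (\<Delta> x) (\<lambda>p q. sw AA (\<Delta> q) (\<lambda>c d. hact W (p * r) \<omega> (N (hact V (c * s) X) (hact V d Y)))))"
    by (simp add: aact_sw form_eval cd_equiv[OF ecd_N] form_sw hact_mult)
  also have "\<dots> = sw AA \<rho> (\<lambda>r s. sw AA (\<Delta> x) (\<lambda>p q. sw AA (\<Delta> p) (\<lambda>c d. hact W (c * r) \<omega> (N (hact V (d * s) X) (hact V q Y)))))"
    by (rule sw_cong, rule coassoc[symmetric]) (intro lins lin_N lin_form[OF hact_closed[OF bsb_W]] | simp)+
  also have "\<dots> = sw AA (\<Delta> x) (\<lambda>p q. sw AA \<rho> (\<lambda>r s. sw AA (\<Delta> p) (\<lambda>c d. hact W (c * r) \<omega> (N (hact V (d * s) X) (hact V q Y)))))"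
    by (rule sw_swap) simp_all
  also have "\<dots> = sw AA (\<Delta> x) (\<lambda>p q. sw AA (\<Delta> p) (\<lambda>c d. sw AA \<rho> (\<lambda>r s. hact W (c * r) \<omega> (N (hact V (d * s) X) (hact V q Y)))))"
    by (rule sw_cong, rule sw_swap) simp_all
  also have "\<dots> = sw AA (\<Delta> x) (\<lambda>p q. sw AA \<rho> (\<lambda>r s. sw AA (\<Delta> p) (\<lambda>c d. hact W (r * d) \<omega> (N (hact V (s * c) X) (hact V q Y)))))"
    by (rule sw_cong, rule R_cocomm) (intro lins lin_N lin_form[OF hact_closed[OF bsb_W]] | simp)+
  also have "\<dots> = sw AA (\<Delta> x) (\<lambda>p q. sw AA (\<Delta> p) (\<lambda>c d. sw AA \<rho> (\<lambda>r s. hact W (r * d) \<omega> (N (hact V (s * c) X) (hact V q Y)))))"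
    by (rule sw_cong, rule sw_swap) simp_all
  also have "\<dots> = sw AA (\<Delta> x) (\<lambda>p q. sw AA (\<Delta> q) (\<lambda>c d. sw AA \<rho> (\<lambda>r s. hact W (r * c) \<omega> (N (hact V (s * p) X) (hact V d Y)))))"
    by (rule coassoc) (intro lins lin_N lin_form[OF hact_closed[OF bsb_W]] | simp)+
  finally show ?thesis
    by (simp add: NF_eq diff 1 hact_mult sw_diff)
qed

text \<open>Expanding the adjoint action gives \<open>NF_eval\<close> at the argument S(x2) Y; the
  last leg produced there cancels this antipode.\<close>

lemma NF_equiv:
  assumes [simp]: "X \<in> carrier V" "\<omega> \<in> carrier W"
  shows "hact W x (NF X \<omega>) = sw W (\<Delta> x) (\<lambda>p q. NF (hact V p X) (hact W q \<omega>))"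
proof (rule ext)
  fix Y
  show "hact W x (NF X \<omega>) Y = sw W (\<Delta> x) (\<lambda>p q. NF (hact V p X) (hact W q \<omega>)) Y"
  proof (cases "Y \<in> carrier V")
    case True
    note [simp] = this
    note l = lins lin_NF_app lin_form[OF NF_closed] lin_form[OF hact_closed[OF bsb_W]]
    have "hact W x (NF X \<omega>) Y = sw AA (\<Delta> x) (\<lambda>p q. sw AA (\<Delta> p) (\<lambda>a b. sw AA (\<Delta> b)
        (\<lambda>c d. NF (hact V a X) (hact W c \<omega>) (hact V (d * S q) Y))))"
      by (simp add: W_hact[of Y] NF_eval hact_mult)
    also have "\<dots> = sw AA (\<Delta> x) (\<lambda>a z. sw AA (\<Delta> z) (\<lambda>b q. sw AA (\<Delta> b)
        (\<lambda>c d. NF (hact V a X) (hact W c \<omega>) (hact V (d * S q) Y))))"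
      by (rule coassoc) (intro l | simp)+
    also have "\<dots> = sw AA (\<Delta> x) (\<lambda>a z. sw AA (\<Delta> z) (\<lambda>c b. sw AA (\<Delta> b)
        (\<lambda>d q. NF (hact V a X) (hact W c \<omega>) (hact V (d * S q) Y))))"
      by (rule sw_cong, rule coassoc) (intro l | simp)+
    also have "\<dots> = sw AA (\<Delta> x) (\<lambda>a z. NF (hact V a X) (hact W z \<omega>) (hact V 1 Y))"
      by (rule sw_cong, rule antipode_r_snd) (intro l | simp)+
    finally show ?thesis by (simp add: sw_W)
  qed (simp add: sw_W W_outside NF_def)
qed

lemma ecd_NF: "ecd W NF"
  by (rule ecd_intro) (simp_all add: NF_addX NF_add NF_equiv NF_lact NF_leibniz)

end

section \<open>The tensor algebra\<close>

locale tensor_bimod = thopf H R A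
  for H :: "('k::{comm_ring, comm_monoid_mult}, 'h::{ring, monoid_mult}) hopf"
    and R :: "('h \<times> 'h) list"
    and A :: "('k, 'h, 'a::{ring, monoid_mult}) malg" +
  fixes M :: "('a, 'h, 'm) bimod"
  assumes bsb_M [simp]: "braided_symmetric_bimodule H R A M"
begin

abbreviation T where "T \<equiv> tensor_algebra H A M"
abbreviation cl where "cl \<equiv> tensor_class M"
abbreviation wrd :: "'m list \<Rightarrow> bool" where "wrd w \<equiv> set w \<subseteq> carrier M"

definition K :: "('m list \<Rightarrow>\<^sub>0 int) set" where
  "K = tensor_null (carrier M) (add M) (lact M) (ract M)"

definition good :: "('m list \<Rightarrow>\<^sub>0 int) \<Rightarrow> bool" where
  "good f \<longleftrightarrow> (\<forall>w\<in>Poly_Mapping.keys f. w \<noteq> [] \<and> wrd w)"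

lemma ab_M [simp]: "abelian_group M" by simp

lemma add_closed_M [simp]: "x \<in> carrier M \<Longrightarrow> y \<in> carrier M \<Longrightarrow> x \<oplus>\<^bsub>M\<^esub> y \<in> carrier M"
  by (metis ab_M abelian_group.axioms(1) abelian_monoid.a_closed)

lemma good_zero [simp]: "good 0"
  and good_of [simp]: "good (frag_of w) \<longleftrightarrow> w \<noteq> [] \<and> wrd w"
  by (auto simp: good_def)

lemma good_add [simp]: "good f \<Longrightarrow> good g \<Longrightarrow> good (f + g)"
  and good_diff [simp]: "good f \<Longrightarrow> good g \<Longrightarrow> good (f - g)"
  using keys_add[of f g] keys_diff[of f g] by (auto simp: good_def)

lemma good_minus [simp]: "good f \<Longrightarrow> good (- f)"
  using good_diff[of 0 f] by simp

lemma good_induct [consumes 1, case_names zero diff of]: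
  assumes "good f" "P 0" "\<And>f g. good f \<Longrightarrow> good g \<Longrightarrow> P f \<Longrightarrow> P g \<Longrightarrow> P (f - g)"
    "\<And>w. w \<noteq> [] \<Longrightarrow> wrd w \<Longrightarrow> P (frag_of w)"
  shows "P f"
proof -
  have "Poly_Mapping.keys f \<subseteq> {w. w \<noteq> [] \<and> wrd w}"
    using assms(1) by (auto simp: good_def)
  then show ?thesis
    by (rule free_Abelian_group_induct[where P = P]) (use assms(2-4) in \<open>auto simp: good_def subset_iff\<close>)
qed

lemma K_zero [simp]: "0 \<in> K"
  and K_diff: "f \<in> K \<Longrightarrow> g \<in> K \<Longrightarrow> f - g \<in> K"
  and K_add: "f \<in> K \<Longrightarrow> g \<in> K \<Longrightarrow> f + g \<in> K"
  by (auto simp: K_def tensor_null_def intro: group_closure.diff group_closure_add)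

lemma rel_add: "wrd u \<Longrightarrow> wrd v \<Longrightarrow> x \<in> carrier M \<Longrightarrow> y \<in> carrier M \<Longrightarrow>
    frag_of (u @ (x \<oplus>\<^bsub>M\<^esub> y) # v) - frag_of (u @ x # v) - frag_of (u @ y # v) \<in> K"
  and rel_bal: "wrd u \<Longrightarrow> wrd v \<Longrightarrow> x \<in> carrier M \<Longrightarrow> y \<in> carrier M \<Longrightarrow>
    frag_of (u @ ract M x c # y # v) - frag_of (u @ x # lact M c y # v) \<in> K"
proof -
  assume *: "wrd u" "wrd v" "x \<in> carrier M" "y \<in> carrier M"
  have "frag_of (u @ [x \<oplus>\<^bsub>M\<^esub> y] @ v) - frag_of (u @ [x] @ v) - frag_of (u @ [y] @ v) \<in> K"
    unfolding K_def tensor_null_def tensor_relators_def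
    by (rule group_closure.base) (use * in blast)
  then show "frag_of (u @ (x \<oplus>\<^bsub>M\<^esub> y) # v) - frag_of (u @ x # v) - frag_of (u @ y # v) \<in> K" by simp
  have "frag_of (u @ [ract M x c, y] @ v) - frag_of (u @ [x, lact M c y] @ v) \<in> K"
    unfolding K_def tensor_null_def tensor_relators_def
    by (rule group_closure.base) (use * in blast)
  then show "frag_of (u @ ract M x c # y # v) - frag_of (u @ x # lact M c y # v) \<in> K" by simp
qed

lemma K_induct [consumes 1, case_names zero diff add bal]:
  assumes "f \<in> K" "P 0" "\<And>f g. f \<in> K \<Longrightarrow> g \<in> K \<Longrightarrow> P f \<Longrightarrow> P g \<Longrightarrow> P (f - g)"
    and "\<And>u v x y. wrd u \<Longrightarrow> wrd v \<Longrightarrow> x \<in> carrier M \<Longrightarrow> y \<in> carrier M \<Longrightarrow>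
      P (frag_of (u @ (x \<oplus>\<^bsub>M\<^esub> y) # v) - frag_of (u @ x # v) - frag_of (u @ y # v))"
    and "\<And>u v x y c. wrd u \<Longrightarrow> wrd v \<Longrightarrow> x \<in> carrier M \<Longrightarrow> y \<in> carrier M \<Longrightarrow>
      P (frag_of (u @ ract M x c # y # v) - frag_of (u @ x # lact M c y # v))"
  shows "P f"
  using assms(1) unfolding K_def tensor_null_def
proof (induction rule: group_closure.induct)
  case (base s)
  then show ?case
    unfolding tensor_relators_def using assms(2,4,5) by fastforce
next
  case (diff s t)
  then show ?case using assms(3) by (simp add: K_def tensor_null_def)
qed

lemma K_good: "f \<in> K \<Longrightarrow> good f"
  by (induction rule: K_induct) auto

lemma cl_eq_iff: "cl f = cl g \<longleftrightarrow> f - g \<in> K"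
proof
  assume "cl f = cl g"
  then have "f \<in> cl g"
    by (metis (mono_tags) K_def K_zero diff_self mem_Collect_eq tensor_class_def)
  then show "f - g \<in> K" by (simp add: tensor_class_def K_def)
next
  assume *: "f - g \<in> K"
  have "h - f \<in> K \<longleftrightarrow> h - g \<in> K" for h
    using K_add[OF _ *, of "h - f"] K_diff[OF _ *, of "h - g"] by (auto simp: algebra_simps)
  then show "cl f = cl g" by (auto simp: tensor_class_def K_def)
qed

lemma mem_cl: "f' \<in> cl f \<longleftrightarrow> f' - f \<in> K"
  by (simp add: tensor_class_def K_def)

lemma cl_self [simp]: "f \<in> cl f" by (simp add: mem_cl)

text \<open>The operations of \<open>tensor_algebra\<close> are unions over all representatives of a
  class; this collapses them to one representative.\<close>

lemma UN_cl:
  assumes "\<And>f'. f' - f \<in> K \<Longrightarrow> cl (F f') = cl (F f)"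
  shows "(\<Union>f'\<in>cl f. cl (F f')) = cl (F f)"
proof (rule SUP_eq_const)
  show "cl f \<noteq> {}" using cl_self by blast
qed (rule assms, simp only: mem_cl)

lemma frag_extend_K:
  assumes "f \<in> K"
    and "\<And>u v x y. wrd u \<Longrightarrow> wrd v \<Longrightarrow> x \<in> carrier M \<Longrightarrow> y \<in> carrier M \<Longrightarrow>
      g (u @ (x \<oplus>\<^bsub>M\<^esub> y) # v) - g (u @ x # v) - g (u @ y # v) \<in> K"
    and "\<And>u v x y c. wrd u \<Longrightarrow> wrd v \<Longrightarrow> x \<in> carrier M \<Longrightarrow> y \<in> carrier M \<Longrightarrow>
      g (u @ ract M x c # y # v) - g (u @ x # lact M c y # v) \<in> K"
  shows "frag_extend g f \<in> K"
  using assms(1)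
  by (induction rule: K_induct) (simp_all add: frag_extend_diff K_diff assms(2,3))

lemma frag_extend_fun_diff: "frag_extend (\<lambda>u. p u - q u) f = frag_extend p f - frag_extend q f"
proof -
  have "Poly_Mapping.keys f \<subseteq> UNIV" by simp
  then show ?thesis
    by (induction f rule: frag_induction) (simp_all add: frag_extend_diff)
qed

lemma frag_extend_zero: "frag_extend (\<lambda>u. 0) f = 0"
  by (simp add: frag_extend_eq_0)

lemma word_mult_of: "word_mult (frag_of u) g = frag_extend (\<lambda>v. frag_of (u @ v)) g"
  and word_mult_diff_l: "word_mult (f - f') g = word_mult f g - word_mult f' g"
  and word_mult_diff_r: "word_mult f (g - g') = word_mult f g - word_mult f g'"
  and word_mult_add_l: "word_mult (f + f') g = word_mult f g + word_mult f' g"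
  and word_mult_zero: "word_mult 0 g = 0" "word_mult f 0 = 0"
  by (simp_all add: word_mult_def frag_extend_diff frag_extend_add frag_extend_fun_diff frag_extend_zero)

lemma word_mult_of_of: "word_mult (frag_of u) (frag_of v) = frag_of (u @ v)"
  by (simp add: word_mult_of)

lemma word_mult_add_r: "word_mult f (g + g') = word_mult f g + word_mult f g'"
  using word_mult_diff_r[of f "g + g'" g'] by simp

lemma word_lact_diff: "word_lact M a (f - g) = word_lact M a f - word_lact M a g"
  and word_lact_add: "word_lact M a (f + g) = word_lact M a f + word_lact M a g"
  and word_lact_of: "word_lact M a (frag_of w) = frag_of (lact M a (hd w) # tl w)"
  and word_lact_zero: "word_lact M a 0 = 0"
  and word_ract_diff: "word_ract M (f - g) a = word_ract M f a - word_ract M g a"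
  and word_ract_add: "word_ract M (f + g) a = word_ract M f a + word_ract M g a"
  and word_ract_of: "word_ract M (frag_of w) a = frag_of (butlast w @ [ract M (last w) a])"
  and word_ract_zero: "word_ract M 0 a = 0"
  by (simp_all add: word_lact_def word_ract_def frag_extend_diff frag_extend_add)

lemmas word_simps = word_mult_diff_l word_mult_diff_r word_mult_zero
  word_lact_diff word_lact_of word_lact_zero word_ract_diff word_ract_of word_ract_zero

lemma last_wrd: "w \<noteq> [] \<Longrightarrow> wrd w \<Longrightarrow> last w \<in> carrier M"
  and hd_wrd: "w \<noteq> [] \<Longrightarrow> wrd w \<Longrightarrow> hd w \<in> carrier M"
  and butlast_wrd: "wrd w \<Longrightarrow> wrd (butlast w)"
  and tl_wrd: "wrd w \<Longrightarrow> wrd (tl w)"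
  using last_in_set[of w] hd_in_set[of w] in_set_butlastD[of _ w] list.set_sel(2)[of w]
  by (blast+, cases w, auto)

lemma good_word_lact [simp]: "good f \<Longrightarrow> good (word_lact M a f)"
  by (induction f rule: good_induct) (simp_all add: word_simps hd_wrd tl_wrd)

lemma good_word_ract [simp]: "good f \<Longrightarrow> good (word_ract M f a)"
  by (induction f rule: good_induct) (simp_all add: word_simps last_wrd butlast_wrd)

lemma good_word_mult [simp]: "good f \<Longrightarrow> good g \<Longrightarrow> good (word_mult f g)"
proof (induction f rule: good_induct)
  case (of u)
  from of(3) show ?case
    by (induction g rule: good_induct) (use of(1,2) in \<open>simp_all add: word_simps word_mult_of_of\<close>)
qed (simp_all add: word_simps)

lemma K_word_lact: "f \<in> K \<Longrightarrow> word_lact M a f \<in> K"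
  unfolding word_lact_def
proof (erule frag_extend_K)
  fix u v x y c assume *: "wrd u" "wrd v" "x \<in> carrier M" "y \<in> carrier M"
  show "frag_of (lact M a (hd (u @ (x \<oplus>\<^bsub>M\<^esub> y) # v)) # tl (u @ (x \<oplus>\<^bsub>M\<^esub> y) # v)) -
        frag_of (lact M a (hd (u @ x # v)) # tl (u @ x # v)) -
        frag_of (lact M a (hd (u @ y # v)) # tl (u @ y # v)) \<in> K"
    using * rel_add[of "lact M a (hd u) # tl u" v x y] rel_add[of "[]" v "lact M a x" "lact M a y"]
    by (cases u) (auto simp: lact_add)
  show "frag_of (lact M a (hd (u @ ract M x c # y # v)) # tl (u @ ract M x c # y # v)) -
        frag_of (lact M a (hd (u @ x # lact M c y # v)) # tl (u @ x # lact M c y # v)) \<in> K"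
    using * rel_bal[of "lact M a (hd u) # tl u" v x y c] rel_bal[of "[]" v "lact M a x" y c]
    by (cases u) (auto simp: lact_ract)
qed

lemma K_word_ract: "f \<in> K \<Longrightarrow> word_ract M f a \<in> K"
  unfolding word_ract_def
proof (erule frag_extend_K)
  fix u v x y c assume *: "wrd u" "wrd v" "x \<in> carrier M" "y \<in> carrier M"
  show "frag_of (butlast (u @ (x \<oplus>\<^bsub>M\<^esub> y) # v) @ [ract M (last (u @ (x \<oplus>\<^bsub>M\<^esub> y) # v)) a]) -
        frag_of (butlast (u @ x # v) @ [ract M (last (u @ x # v)) a]) -
        frag_of (butlast (u @ y # v) @ [ract M (last (u @ y # v)) a]) \<in> K"
    using * rel_add[of u "butlast v @ [ract M (last v) a]" x y] rel_add[of u "[]" "ract M x a" "ract M y a"]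
    by (cases "v = []") (auto simp: ract_add butlast_append last_wrd butlast_wrd)
  show "frag_of (butlast (u @ ract M x c # y # v) @ [ract M (last (u @ ract M x c # y # v)) a]) -
        frag_of (butlast (u @ x # lact M c y # v) @ [ract M (last (u @ x # lact M c y # v)) a]) \<in> K"
    using * rel_bal[of u "butlast v @ [ract M (last v) a]" x y c] rel_bal[of u "[]" x "ract M y a" c]
    by (cases "v = []") (auto simp: lact_ract butlast_append last_wrd butlast_wrd)
qed

lemma K_word_mult_r: "good f \<Longrightarrow> g \<in> K \<Longrightarrow> word_mult f g \<in> K"
proof (induction f rule: good_induct)
  case (of w)
  then show ?case
    unfolding word_mult_of
    by (elim frag_extend_K) (use rel_add[of "w @ u" for u] rel_bal[of "w @ u" for u] in auto)
qed (simp_all add: word_simps K_diff)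

lemma K_word_mult_l: "good g \<Longrightarrow> f \<in> K \<Longrightarrow> word_mult f g \<in> K"
proof (induction g rule: good_induct)
  case (of w)
  then have "word_mult f (frag_of w) \<in> K"
    unfolding word_mult_def frag_extend_of
    by (elim frag_extend_K) (use rel_add[of _ "v @ w" for v] rel_bal[of _ "v @ w" for v] in auto)
  then show ?case .
qed (simp_all add: word_simps K_diff)

lemma carrier_T: "carrier T = {(a, cl f) | a f. good f}"
  by (auto simp: tensor_algebra_def good_def)

lemma T_zero: "\<zero>\<^bsub>T\<^esub> = (0, cl 0)" and T_one: "\<one>\<^bsub>T\<^esub> = (1, cl 0)"
  by (simp_all add: tensor_algebra_def)

lemma T_closed [simp]: "good f \<Longrightarrow> (a, cl f) \<in> carrier T"
  by (auto simp: carrier_T)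

lemma T_cases: "t \<in> carrier T \<Longrightarrow> (\<And>a f. t = (a, cl f) \<Longrightarrow> good f \<Longrightarrow> P) \<Longrightarrow> P"
  by (auto simp: carrier_T)

lemma T_add: "(a, cl f) \<oplus>\<^bsub>T\<^esub> (b, cl g) = (a + b, cl (f + g))"
proof -
  have "(\<Union>g'\<in>cl g. cl (f' + g')) = cl (f' + g)" for f'
    by (rule UN_cl) (simp add: cl_eq_iff)
  then have "(\<Union>f'\<in>cl f. \<Union>g'\<in>cl g. cl (f' + g')) = (\<Union>f'\<in>cl f. cl (f' + g))" by simp
  also have "\<dots> = cl (f + g)" by (rule UN_cl) (simp add: cl_eq_iff)
  finally show ?thesis by (simp add: tensor_algebra_def)
qed

lemma T_mult:
  assumes "good f" "good g"
  shows "(a, cl f) \<otimes>\<^bsub>T\<^esub> (b, cl g) = (a * b, cl (word_lact M a g + word_ract M f b + word_mult f g))"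
proof -
  have "(\<Union>g'\<in>cl g. cl (word_lact M a g' + word_ract M f' b + word_mult f' g')) =
    cl (word_lact M a g + word_ract M f' b + word_mult f' g)" if "f' - f \<in> K" for f'
  proof (rule UN_cl)
    fix g' assume *: "g' - g \<in> K"
    have "good (f' - f + f)" using that assms(1) by (intro good_add) (simp_all add: K_good)
    then have "word_lact M a (g' - g) + word_mult f' (g' - g) \<in> K"
      by (intro K_add K_word_lact K_word_mult_r *) simp
    then show "cl (word_lact M a g' + word_ract M f' b + word_mult f' g') =
      cl (word_lact M a g + word_ract M f' b + word_mult f' g)"
      by (simp add: cl_eq_iff word_simps algebra_simps)
  qed
  then have "(\<Union>f'\<in>cl f. \<Union>g'\<in>cl g. cl (word_lact M a g' + word_ract M f' b + word_mult f' g')) =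
    (\<Union>f'\<in>cl f. cl (word_lact M a g + word_ract M f' b + word_mult f' g))"
    by (simp add: mem_cl)
  also have "\<dots> = cl (word_lact M a g + word_ract M f b + word_mult f g)"
  proof (rule UN_cl)
    fix f' assume *: "f' - f \<in> K"
    have "word_ract M (f' - f) b + word_mult (f' - f) g \<in> K"
      by (intro K_add K_word_ract K_word_mult_l * assms)
    then show "cl (word_lact M a g + word_ract M f' b + word_mult f' g) =
      cl (word_lact M a g + word_ract M f b + word_mult f g)"
      by (simp add: cl_eq_iff word_simps algebra_simps)
  qed
  finally show ?thesis by (simp add: tensor_algebra_def)
qed

lemma ab_T: "abelian_group T"
proof (rule abelian_groupI)
  fix s assume "s \<in> carrier T"
  then obtain a f where s: "s = (a, cl f)" "good f" by (auto elim: T_cases)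
  then show "\<exists>t\<in>carrier T. t \<oplus>\<^bsub>T\<^esub> s = \<zero>\<^bsub>T\<^esub>"
    by (intro bexI[of _ "(- a, cl (- f))"]) (simp_all add: T_add T_zero)
qed (auto elim!: T_cases simp: T_add T_zero ac_simps)

lemma word_lact_mult: "good f \<Longrightarrow> word_lact M (a * b) f = word_lact M a (word_lact M b f)"
  by (induction f rule: good_induct) (simp_all add: word_simps lact_mult hd_wrd)

lemma word_lact_one: "good f \<Longrightarrow> word_lact M 1 f = f"
  by (induction f rule: good_induct) (simp_all add: word_simps hd_wrd)

lemma word_ract_mult: "good f \<Longrightarrow> word_ract M f (a * b) = word_ract M (word_ract M f a) b"
  by (induction f rule: good_induct) (simp_all add: word_simps ract_mult last_wrd)

lemma word_ract_one: "good f \<Longrightarrow> word_ract M f 1 = f"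
  by (induction f rule: good_induct) (simp_all add: word_simps last_wrd)

lemma word_lact_ract: "good f \<Longrightarrow> word_ract M (word_lact M a f) b = word_lact M a (word_ract M f b)"
proof (induction f rule: good_induct)
  case (of w)
  then show ?case
    by (cases w; cases "tl w = []") (simp_all add: word_simps lact_ract)
qed (simp_all add: word_simps)

lemma word_lact_add': "good f \<Longrightarrow> word_lact M (a + b) f - word_lact M a f - word_lact M b f \<in> K"
proof (induction f rule: good_induct)
  case (diff f g)
  have "word_lact M (a + b) (f - g) - word_lact M a (f - g) - word_lact M b (f - g) =
    (word_lact M (a + b) f - word_lact M a f - word_lact M b f) - (word_lact M (a + b) g - word_lact M a g - word_lact M b g)"
    by (simp add: word_simps)
  then show ?case using diff by (simp only: K_diff)
next
  case (of w)
  then show ?case using rel_add[of "[]" "tl w" "lact M a (hd w)" "lact M b (hd w)"]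
    by (simp add: word_simps hd_wrd tl_wrd lact_add')
qed (simp add: word_simps)

lemma word_ract_add': "good f \<Longrightarrow> word_ract M f (a + b) - word_ract M f a - word_ract M f b \<in> K"
proof (induction f rule: good_induct)
  case (diff f g)
  have "word_ract M (f - g) (a + b) - word_ract M (f - g) a - word_ract M (f - g) b =
    (word_ract M f (a + b) - word_ract M f a - word_ract M f b) - (word_ract M g (a + b) - word_ract M g a - word_ract M g b)"
    by (simp add: word_simps)
  then show ?case using diff by (simp only: K_diff)
next
  case (of w)
  then show ?case using rel_add[of "butlast w" "[]" "ract M (last w) a" "ract M (last w) b"]
    by (simp add: word_simps last_wrd butlast_wrd ract_add')
qed (simp add: word_simps)

lemma word_mult_lact: "good f \<Longrightarrow> good g \<Longrightarrow> word_mult (word_lact M a f) g = word_lact M a (word_mult f g)"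
proof (induction f rule: good_induct)
  case (of u)
  from of(3) show ?case
    by (induction g rule: good_induct) (use of(1) in \<open>simp_all add: word_simps word_mult_of_of\<close>)
qed (simp_all add: word_simps)

lemma word_mult_ract: "good f \<Longrightarrow> good g \<Longrightarrow> word_ract M (word_mult f g) a = word_mult f (word_ract M g a)"
proof (induction f rule: good_induct)
  case (of u)
  from of(3) show ?case
    by (induction g rule: good_induct) (use of(1) in \<open>simp_all add: word_simps word_mult_of_of butlast_append\<close>)
qed (simp_all add: word_simps)

lemma word_mult_assoc: "word_mult (word_mult f g) h = word_mult f (word_mult g h)"
proof -
  have of: "word_mult (word_mult (frag_of u) (frag_of v)) h = word_mult (frag_of u) (word_mult (frag_of v) h)" for u v
  proof -
    have "Poly_Mapping.keys h \<subseteq> UNIV" by simp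
    then show ?thesis
      by (induction h rule: frag_induction) (simp_all add: word_simps word_mult_of_of)
  qed
  have of': "word_mult (word_mult (frag_of u) g) h = word_mult (frag_of u) (word_mult g h)" for u
  proof -
    have "Poly_Mapping.keys g \<subseteq> UNIV" by simp
    then show ?thesis
      by (induction g rule: frag_induction) (simp_all add: word_simps of)
  qed
  have "Poly_Mapping.keys f \<subseteq> UNIV" by simp
  then show ?thesis
    by (induction f rule: frag_induction) (simp_all add: word_simps of')
qed

lemma word_mult_balanced: "good f \<Longrightarrow> good g \<Longrightarrow> word_mult (word_ract M f a) g - word_mult f (word_lact M a g) \<in> K"
proof (induction f rule: good_induct)
  case (diff f f')
  have "word_mult (word_ract M (f - f') a) g - word_mult (f - f') (word_lact M a g) =
    (word_mult (word_ract M f a) g - word_mult f (word_lact M a g)) - (word_mult (word_ract M f' a) g - word_mult f' (word_lact M a g))"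
    by (simp add: word_simps)
  then show ?case using diff by (simp only: K_diff)
next
  case (of u)
  from of(3) show ?case
  proof (induction g rule: good_induct)
    case (diff g g')
    have "word_mult (word_ract M (frag_of u) a) (g - g') - word_mult (frag_of u) (word_lact M a (g - g')) =
      (word_mult (word_ract M (frag_of u) a) g - word_mult (frag_of u) (word_lact M a g)) -
      (word_mult (word_ract M (frag_of u) a) g' - word_mult (frag_of u) (word_lact M a g'))"
      by (simp only: word_simps) simp
    then show ?case using diff by (simp only: K_diff)
  next
    case (of v)
    have bl: "butlast u @ last u # z = u @ z" for z
      using append_butlast_last_id[OF \<open>u \<noteq> []\<close>] by (metis append.assoc append_Cons append_Nil)
    then show ?case
      using of \<open>u \<noteq> []\<close> \<open>wrd u\<close> rel_bal[of "butlast u" "tl v" "last u" "hd v" a]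
      by (simp add: bl word_simps word_mult_of_of last_wrd butlast_wrd hd_wrd tl_wrd)
  qed (simp add: word_simps)
qed (simp add: word_simps)

lemma ring_T: "ring T"
proof (rule ringI)
  show "abelian_group T" by (rule ab_T)
  show "Group.monoid T"
  proof (rule monoidI)
    fix s t u assume "s \<in> carrier T" "t \<in> carrier T" "u \<in> carrier T"
    then obtain a f b g c h where *: "s = (a, cl f)" "t = (b, cl g)" "u = (c, cl h)" "good f" "good g" "good h"
      by (auto elim!: T_cases)
    \<comment> \<open>Balancing enters in one term only, the one where the scalar b of t stands
      between the words of s and those of u.\<close>
    show "s \<otimes>\<^bsub>T\<^esub> t \<otimes>\<^bsub>T\<^esub> u = s \<otimes>\<^bsub>T\<^esub> (t \<otimes>\<^bsub>T\<^esub> u)"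
      using * word_mult_balanced[of f h b]
      by (simp add: T_mult mult.assoc cl_eq_iff word_lact_add word_ract_add word_mult_add_l word_mult_add_r
        word_lact_mult word_ract_mult word_lact_ract word_mult_lact word_mult_ract word_mult_assoc algebra_simps)
  qed (auto elim!: T_cases simp: T_one T_mult word_lact_one word_ract_one word_simps)
next
  fix s t u assume "s \<in> carrier T" "t \<in> carrier T" "u \<in> carrier T"
  then obtain a f b g c h where *: "s = (a, cl f)" "t = (b, cl g)" "u = (c, cl h)" "good f" "good g" "good h"
    by (auto elim!: T_cases)
  show "(s \<oplus>\<^bsub>T\<^esub> t) \<otimes>\<^bsub>T\<^esub> u = s \<otimes>\<^bsub>T\<^esub> u \<oplus>\<^bsub>T\<^esub> t \<otimes>\<^bsub>T\<^esub> u"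
    using * word_lact_add'[of h a b]
    by (simp add: T_mult T_add distrib_right cl_eq_iff word_lact_add word_ract_add word_mult_add_l algebra_simps)
  show "u \<otimes>\<^bsub>T\<^esub> (s \<oplus>\<^bsub>T\<^esub> t) = u \<otimes>\<^bsub>T\<^esub> s \<oplus>\<^bsub>T\<^esub> u \<otimes>\<^bsub>T\<^esub> t"
    using * word_ract_add'[of h a b]
    by (simp add: T_mult T_add distrib_left cl_eq_iff word_lact_add word_ract_add word_mult_add_r algebra_simps)
qed

end

section \<open>Words as products, and additive maps out of the tensor algebra\<close>

context tensor_bimod
begin

sublocale T: ring "tensor_algebra H A M"
  by (rule ring_T)

definition in0 :: "'a \<Rightarrow> 'a \<times> ('m list \<Rightarrow>\<^sub>0 int) set" where
  "in0 a = (a, cl 0)"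

text \<open>Formal sums in positive degree contain no empty word; sending it to the unit makes
  \<open>cw\<close> multiplicative on all words.\<close>

definition cw :: "'m list \<Rightarrow> 'a \<times> ('m list \<Rightarrow>\<^sub>0 int) set" where
  "cw w = (if w = [] then \<one>\<^bsub>T\<^esub> else (0, cl (frag_of w)))"

lemma T_minus: "(a, cl f) \<ominus>\<^bsub>T\<^esub> (b, cl g) = (a - b, cl (f - g))" if "good f" "good g"
proof -
  have "(a, cl f) \<ominus>\<^bsub>T\<^esub> (b, cl g) = (a - b, cl (f - g)) \<oplus>\<^bsub>T\<^esub> (b, cl g) \<ominus>\<^bsub>T\<^esub> (b, cl g)"
    by (simp add: T_add)
  also have "\<dots> = (a - b, cl (f - g))"
    by (rule T.add_minus_cancel') (use that in simp_all)
  finally show ?thesis .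
qed

lemma in0_closed [simp]: "in0 a \<in> carrier T"
  and in0_add: "in0 (a + b) = in0 a \<oplus>\<^bsub>T\<^esub> in0 b"
  and in0_mult: "in0 (a * b) = in0 a \<otimes>\<^bsub>T\<^esub> in0 b"
  and in0_one: "in0 1 = \<one>\<^bsub>T\<^esub>"
  and in0_zero: "in0 0 = \<zero>\<^bsub>T\<^esub>"
  by (simp_all add: in0_def T_add T_mult T_one T_zero word_simps)

lemma cw_Nil [simp]: "cw [] = \<one>\<^bsub>T\<^esub>"
  by (simp add: cw_def)

lemma cw_closed [simp]: "wrd w \<Longrightarrow> cw w \<in> carrier T"
  by (simp add: cw_def)

lemma cw_append: "wrd u \<Longrightarrow> wrd v \<Longrightarrow> cw (u @ v) = cw u \<otimes>\<^bsub>T\<^esub> cw v"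
proof -
  assume *: "wrd u" "wrd v"
  \<comment> \<open>The product of two elements with degree-zero part 0 still carries the formal
    sums 0 g and f 0. They are not zero as formal sums, only null.\<close>
  have K: "- (word_lact M 0 f + word_ract M g 0) \<in> K" if "good f" "good g" for f g
    using word_lact_add'[OF that(1), of 0 0] word_ract_add'[OF that(2), of 0 0] K_add by fastforce
  show ?thesis
    using K[of "frag_of v" "frag_of u"] *
    by (cases "u = []"; cases "v = []") (simp_all, simp add: cw_def T_mult word_mult_of_of cl_eq_iff)
qed

lemma cw_Cons: "m \<in> carrier M \<Longrightarrow> wrd w \<Longrightarrow> cw (m # w) = cw [m] \<otimes>\<^bsub>T\<^esub> cw w"
  using cw_append[of "[m]" w] by simp

lemma cw_add: "m \<in> carrier M \<Longrightarrow> n \<in> carrier M \<Longrightarrow> cw [m \<oplus>\<^bsub>M\<^esub> n] = cw [m] \<oplus>\<^bsub>T\<^esub> cw [n]"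
  using rel_add[of "[]" "[]" m n] by (simp add: cw_def T_add cl_eq_iff algebra_simps)

lemma cw_lact: "m \<in> carrier M \<Longrightarrow> cw [lact M a m] = in0 a \<otimes>\<^bsub>T\<^esub> cw [m]"
  and cw_ract: "m \<in> carrier M \<Longrightarrow> cw [ract M m a] = cw [m] \<otimes>\<^bsub>T\<^esub> in0 a"
  by (simp_all add: cw_def in0_def T_mult word_simps)

lemma T_decomp: "good f \<Longrightarrow> (a, cl f) = in0 a \<oplus>\<^bsub>T\<^esub> (0, cl f)"
  by (simp add: in0_def T_add)

lemma T_induct_words [consumes 1, case_names in0 cw minus]:
  assumes t: "t \<in> carrier T"
    and in0: "\<And>a. P (in0 a)"
    and cw: "\<And>w. w \<noteq> [] \<Longrightarrow> wrd w \<Longrightarrow> P (cw w)"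
    and minus: "\<And>s t. s \<in> carrier T \<Longrightarrow> t \<in> carrier T \<Longrightarrow> P s \<Longrightarrow> P t \<Longrightarrow> P (s \<ominus>\<^bsub>T\<^esub> t)"
  shows "P t"
proof -
  obtain a f where t: "t = (a, cl f)" and f: "good f" using t by (auto elim: T_cases)
  have "P (0, cl f)" using f
  proof (induction rule: good_induct)
    case zero
    then show ?case using in0[of 0] by (simp add: in0_def)
  next
    case (diff f g)
    then show ?case using minus[of "(0, cl f)" "(0, cl g)"] by (simp add: T_minus)
  next
    case (of w)
    then show ?case using cw[of w] by (simp add: cw_def)
  qed
  \<comment> \<open>Only differences are known to preserve P, so the sum of the two components is
    written as \<open>in0 a\<close> minus the negative of the other.\<close>
  then have "P (\<zero>\<^bsub>T\<^esub> \<ominus>\<^bsub>T\<^esub> (0, cl f))"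
    using minus[of "\<zero>\<^bsub>T\<^esub>" "(0, cl f)"] in0[of 0] f by (simp add: in0_zero)
  then have "P (in0 a \<ominus>\<^bsub>T\<^esub> (\<zero>\<^bsub>T\<^esub> \<ominus>\<^bsub>T\<^esub> (0, cl f)))"
    using minus[of "in0 a" "\<zero>\<^bsub>T\<^esub> \<ominus>\<^bsub>T\<^esub> (0, cl f)"] in0[of a] f by simp
  then show ?thesis
    using f by (simp add: t T_minus T_zero in0_def)
qed

lemma T_induct [consumes 1, case_names in0 Cons minus]:
  assumes t: "t \<in> carrier T"
    and in0: "\<And>a. P (in0 a)"
    and Cons: "\<And>m t. m \<in> carrier M \<Longrightarrow> t \<in> carrier T \<Longrightarrow> P t \<Longrightarrow> P (cw [m] \<otimes>\<^bsub>T\<^esub> t)"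
    and minus: "\<And>s t. s \<in> carrier T \<Longrightarrow> t \<in> carrier T \<Longrightarrow> P s \<Longrightarrow> P t \<Longrightarrow> P (s \<ominus>\<^bsub>T\<^esub> t)"
  shows "P t"
  using t
proof (induction rule: T_induct_words)
  case (cw w)
  have "P (cw w)" if "wrd w" for w
    using that
  proof (induction w)
    case Nil
    then show ?case using in0[of 1] by (simp add: in0_one)
  next
    case (Cons m w)
    then show ?case by (subst cw_Cons) (simp_all add: assms(3))
  qed
  then show ?case using cw by blast
qed (auto intro: in0 minus)

text \<open>The representative is arbitrary; \<open>tensor_map\<close> collects the conditions on
  \<alpha> and \<phi> under which the choice does not matter. The zero on other words makes the word
  function total with values in the carrier.\<close>

definition tlift :: "('b, 'z) ring_scheme \<Rightarrow> ('a \<Rightarrow> 'b) \<Rightarrow> ('m list \<Rightarrow> 'b) \<Rightarrow> 'a \<times> ('m list \<Rightarrow>\<^sub>0 int) set \<Rightarrow> 'b" where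
  "tlift B \<alpha> \<phi> t = \<alpha> (fst t) \<oplus>\<^bsub>B\<^esub>
     wlift B (\<lambda>w. if w \<noteq> [] \<and> wrd w then \<phi> w else \<zero>\<^bsub>B\<^esub>) (SOME f. f \<in> snd t)"

end

locale tensor_map = tensor_bimod H R A M
  for H :: "('k::{comm_ring, comm_monoid_mult}, 'h::{ring, monoid_mult}) hopf"
    and R :: "('h \<times> 'h) list"
    and A :: "('k, 'h, 'a::{ring, monoid_mult}) malg"
    and M :: "('a, 'h, 'm) bimod" +
  fixes B :: "('b, 'z) ring_scheme" and \<alpha> :: "'a \<Rightarrow> 'b" and \<phi> :: "'m list \<Rightarrow> 'b"
  assumes B: "abelian_group B"
    and \<alpha>: "\<And>a. \<alpha> a \<in> carrier B" "\<And>a b. \<alpha> (a + b) = \<alpha> a \<oplus>\<^bsub>B\<^esub> \<alpha> b"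
    and \<phi>: "\<And>w. w \<noteq> [] \<Longrightarrow> wrd w \<Longrightarrow> \<phi> w \<in> carrier B"
      "\<And>u v x y. wrd u \<Longrightarrow> wrd v \<Longrightarrow> x \<in> carrier M \<Longrightarrow> y \<in> carrier M \<Longrightarrow>
        \<phi> (u @ (x \<oplus>\<^bsub>M\<^esub> y) # v) = \<phi> (u @ x # v) \<oplus>\<^bsub>B\<^esub> \<phi> (u @ y # v)"
      "\<And>u v x y c. wrd u \<Longrightarrow> wrd v \<Longrightarrow> x \<in> carrier M \<Longrightarrow> y \<in> carrier M \<Longrightarrow>
        \<phi> (u @ ract M x c # y # v) = \<phi> (u @ x # lact M c y # v)"
begin

interpretation B: abelian_group B by (rule B)

definition "\<psi> w = (if w \<noteq> [] \<and> wrd w then \<phi> w else \<zero>\<^bsub>B\<^esub>)" for w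

interpretation word_lift B \<psi>
  by unfold_locales (simp add: \<psi>_def \<phi>(1))

lemma wlift_null: "f \<in> K \<Longrightarrow> wlift B \<psi> f = \<zero>\<^bsub>B\<^esub>"
  unfolding K_def using \<phi>(2,3)
  by (intro wlift_tensor_null[where e = "\<lambda>w. w"]) (auto simp: \<psi>_def)

lemma tlift_eq: "good f \<Longrightarrow> tlift B \<alpha> \<phi> (a, cl f) = \<alpha> a \<oplus>\<^bsub>B\<^esub> wlift B \<psi> f"
proof -
  have "(SOME g. g \<in> cl f) \<in> cl f" by (rule someI[of _ f]) simp
  then have "wlift B \<psi> ((SOME g. g \<in> cl f) - f) = \<zero>\<^bsub>B\<^esub>"
    by (simp add: mem_cl wlift_null)
  from this[unfolded wlift_diff] have "wlift B \<psi> (SOME g. g \<in> cl f) = wlift B \<psi> f"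
    by (rule B.eq_if_minus_eq_zero[OF wlift_closed wlift_closed])
  then show ?thesis by (simp add: tlift_def \<psi>_def[abs_def])
qed

lemma tlift_closed: "t \<in> carrier T \<Longrightarrow> tlift B \<alpha> \<phi> t \<in> carrier B"
  by (auto elim!: T_cases simp: tlift_eq \<alpha>)

lemma tlift_add: "s \<in> carrier T \<Longrightarrow> t \<in> carrier T \<Longrightarrow> tlift B \<alpha> \<phi> (s \<oplus>\<^bsub>T\<^esub> t) = tlift B \<alpha> \<phi> s \<oplus>\<^bsub>B\<^esub> tlift B \<alpha> \<phi> t"
  by (auto elim!: T_cases simp: tlift_eq T_add \<alpha> wlift_add B.a_ac)

lemma tlift_in0: "tlift B \<alpha> \<phi> (in0 a) = \<alpha> a"
  by (simp add: in0_def tlift_eq \<alpha>)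

lemma tlift_cw: "w \<noteq> [] \<Longrightarrow> wrd w \<Longrightarrow> tlift B \<alpha> \<phi> (cw w) = \<phi> w"
proof -
  have "\<alpha> 0 \<oplus>\<^bsub>B\<^esub> \<alpha> 0 = \<alpha> 0" using \<alpha>(2)[of 0 0] by simp
  then have "\<alpha> 0 = \<zero>\<^bsub>B\<^esub>" using B.add.r_cancel_one[of "\<alpha> 0" "\<alpha> 0"] \<alpha>(1) by simp
  then show "w \<noteq> [] \<Longrightarrow> wrd w \<Longrightarrow> tlift B \<alpha> \<phi> (cw w) = \<phi> w"
    by (simp add: cw_def tlift_eq \<psi>_def \<phi>(1))
qed

lemma tlift_cl: "good f \<Longrightarrow> tlift B \<alpha> \<phi> (a, cl f) = \<alpha> a \<oplus>\<^bsub>B\<^esub> wlift B (\<lambda>w. if w \<noteq> [] \<and> wrd w then \<phi> w else \<zero>\<^bsub>B\<^esub>) f"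
  using tlift_eq[of f a] by (simp add: \<psi>_def[abs_def])

end

context tensor_bimod
begin

lemma T_lact: "t \<in> carrier T \<Longrightarrow> lact T a t = in0 a \<otimes>\<^bsub>T\<^esub> t"
proof (elim T_cases)
  fix b f assume *: "t = (b, cl f)" "good f"
  have "tensor_lift M (word_lact M a) (cl f) = cl (word_lact M a f)"
    unfolding tensor_lift_def
    by (rule UN_cl) (simp add: cl_eq_iff K_word_lact flip: word_lact_diff)
  then show "lact T a t = in0 a \<otimes>\<^bsub>T\<^esub> t"
    using * by (simp add: in0_def T_mult word_simps) (simp add: tensor_algebra_def)
qed

lemma T_ract: "t \<in> carrier T \<Longrightarrow> ract T t a = t \<otimes>\<^bsub>T\<^esub> in0 a"
proof (elim T_cases)
  fix b f assume *: "t = (b, cl f)" "good f"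
  have "tensor_lift M (\<lambda>f. word_ract M f a) (cl f) = cl (word_ract M f a)"
    unfolding tensor_lift_def
    by (rule UN_cl) (simp add: cl_eq_iff K_word_ract flip: word_ract_diff)
  then show "ract T t a = t \<otimes>\<^bsub>T\<^esub> in0 a"
    using * by (simp add: in0_def T_mult word_simps) (simp add: tensor_algebra_def)
qed

lemma in0_central: "t \<in> carrier T \<Longrightarrow> in0 (asmult A c 1) \<otimes>\<^bsub>T\<^esub> t = t \<otimes>\<^bsub>T\<^esub> in0 (asmult A c 1)"
proof (induction rule: T_induct)
  case (Cons m t)
  have "in0 (asmult A c 1) \<otimes>\<^bsub>T\<^esub> cw [m] = cw [m] \<otimes>\<^bsub>T\<^esub> in0 (asmult A c 1)"
    using Cons(1) by (simp add: sc_ract flip: cw_lact cw_ract)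
  then show ?case using Cons by (simp add: T.m_assoc flip: Cons(3)) (simp flip: T.m_assoc)
qed (simp_all add: T.minus_eq T.r_distr T.l_distr T.r_minus T.l_minus asm_1 flip: in0_mult)

lemma scm_T [simp]: "scm T"
proof -
  have "asmult A (c * d) 1 = asmult A c 1 * asmult A d 1" for c d
    by (simp only: asm_1(1) asm_rules(3))
  then show ?thesis
    by (simp add: scm_def T_lact T.abelian_group_axioms T.r_distr T.l_distr asm_rules(2,4) in0_add in0_mult in0_one T.m_assoc)
qed

lemma T_sc: "t \<in> carrier T \<Longrightarrow> sc T c t = in0 (asmult A c 1) \<otimes>\<^bsub>T\<^esub> t"
  by (rule T_lact)

lemma lin_T_mult [lins]: "lin T f \<Longrightarrow> t \<in> carrier T \<Longrightarrow> lin T (\<lambda>x. f x \<otimes>\<^bsub>T\<^esub> t)"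
  by (auto simp: lin_def T_sc T.l_distr T.m_assoc)

lemma lin_T_mult_snd [lins]: "lin T f \<Longrightarrow> t \<in> carrier T \<Longrightarrow> lin T (\<lambda>x. t \<otimes>\<^bsub>T\<^esub> f x)"
  by (auto simp: lin_def T_sc T.r_distr in0_central T.m_assoc)

lemma lin_in0 [lins]: "lin AA f \<Longrightarrow> lin T (\<lambda>x. in0 (f x))"
  by (auto simp: lin_def T_sc in0_add in0_mult)

lemma lin_cw [lins]: "lin M f \<Longrightarrow> lin T (\<lambda>x. cw [f x])"
  by (auto simp: lin_def T_sc cw_add cw_lact)

lemma T_mult_sw: "t \<in> carrier T \<Longrightarrow> (\<And>r s. F r s \<in> carrier T) \<Longrightarrow> t \<otimes>\<^bsub>T\<^esub> sw T xs F = sw T xs (\<lambda>r s. t \<otimes>\<^bsub>T\<^esub> F r s)"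
  by (rule sw_hom) (auto simp: T.abelian_group_axioms T.r_distr)

lemma T_mult_sw': "t \<in> carrier T \<Longrightarrow> (\<And>r s. F r s \<in> carrier T) \<Longrightarrow> sw T xs F \<otimes>\<^bsub>T\<^esub> t = sw T xs (\<lambda>r s. F r s \<otimes>\<^bsub>T\<^esub> t)"
  by (rule sw_hom[where \<phi> = "\<lambda>s. s \<otimes>\<^bsub>T\<^esub> t"]) (auto simp: T.abelian_group_axioms T.l_distr)

lemma in0_sw: "in0 (sw AA xs F) = sw T xs (\<lambda>r s. in0 (F r s))"
  by (rule sw_hom) (auto simp: T.abelian_group_axioms in0_add)

lemma cw_sw: "(\<And>r s. F r s \<in> carrier M) \<Longrightarrow> cw [sw M xs F] = sw T xs (\<lambda>r s. cw [F r s])"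
  by (rule sw_hom[where \<phi> = "\<lambda>m. cw [m]"]) (auto simp: T.abelian_group_axioms cw_add)

lemma sw_T_closed [simp]: "(\<And>r s. F r s \<in> carrier T) \<Longrightarrow> sw T xs F \<in> carrier T"
  by (rule sw_closed) (rule T.abelian_group_axioms)

section \<open>The Hopf action on the tensor algebra\<close>

text \<open>In contrast to \<open>word_hact_list\<close> the recursion runs down to the empty word,
  where x acts on the unit through the counit. Every letter is thereby treated alike, and
  \<open>hw_single\<close> shows that the additional coproduct has no effect.\<close>

fun hw :: "'h \<Rightarrow> 'm list \<Rightarrow> 'a \<times> ('m list \<Rightarrow>\<^sub>0 int) set" where
  "hw x [] = in0 (aact A x 1)"
| "hw x (m # w) = sw T (\<Delta> x) (\<lambda>p q. cw [hact M p m] \<otimes>\<^bsub>T\<^esub> hw q w)"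

lemma hw_closed [simp]: "wrd w \<Longrightarrow> hw x w \<in> carrier T"
  by (induction w arbitrary: x) auto

lemma lin_hw [lins]: "wrd w \<Longrightarrow> hl g \<Longrightarrow> lin T (\<lambda>x. hw (g x) w)"
proof (induction w arbitrary: g)
  case Nil
  then show ?case by (simp only: hw.simps) (intro lins)
next
  case (Cons m w)
  then show ?case by (simp only: hw.simps) (intro lins Cons.IH | simp)+
qed

lemma hw_single: "m \<in> carrier M \<Longrightarrow> hw x [m] = cw [hact M x m]"
proof -
  assume [simp]: "m \<in> carrier M"
  have "hw x [m] = sw T (\<Delta> x) (\<lambda>p q. sc T (\<epsilon> q) (cw [hact M p m]))"
    by (simp add: aact_1 T_sc in0_central)
  also have "\<dots> = cw [hact M x m]"
    by (rule counit_r) (intro lins | simp)+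
  finally show ?thesis .
qed

lemma hw_add: "wrd u \<Longrightarrow> wrd v \<Longrightarrow> m \<in> carrier M \<Longrightarrow> n \<in> carrier M \<Longrightarrow>
  hw x (u @ (m \<oplus>\<^bsub>M\<^esub> n) # v) = hw x (u @ m # v) \<oplus>\<^bsub>T\<^esub> hw x (u @ n # v)"
  by (induction u arbitrary: x)
    (simp_all add: hact_add cw_add T.l_distr T.r_distr sw_add[OF T.abelian_group_axioms])

text \<open>By coassociativity both sides become the expression in which one leg of x acts on m, the
  next on c, and the rest on the remaining word.\<close>

lemma hw_balanced_head:
  assumes [simp]: "wrd v" "m \<in> carrier M" "n \<in> carrier M"
  shows "hw x (ract M m c # n # v) = hw x (m # lact M c n # v)"
proof -
  have "hw x (ract M m c # n # v) = sw T (\<Delta> x) (\<lambda>p q. sw T (\<Delta> p) (\<lambda>d e.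
      cw [hact M d m] \<otimes>\<^bsub>T\<^esub> (in0 (aact A e c) \<otimes>\<^bsub>T\<^esub> hw q (n # v))))"
    by (subst hw.simps(2)) (simp add: hact_ract cw_sw cw_ract T_mult_sw' T.m_assoc del: hw.simps)
  also have "\<dots> = sw T (\<Delta> x) (\<lambda>p q. sw T (\<Delta> q) (\<lambda>d e.
      cw [hact M p m] \<otimes>\<^bsub>T\<^esub> (in0 (aact A d c) \<otimes>\<^bsub>T\<^esub> hw e (n # v))))"
    by (rule coassoc) (intro lins | simp del: hw.simps)+
  also have "\<dots> = sw T (\<Delta> x) (\<lambda>p q. cw [hact M p m] \<otimes>\<^bsub>T\<^esub> hw q (lact M c n # v))"
  proof (rule sw_cong)
    fix p q
    have "sw T (\<Delta> q) (\<lambda>d e. in0 (aact A d c) \<otimes>\<^bsub>T\<^esub> hw e (n # v)) =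
      sw T (\<Delta> q) (\<lambda>d e. sw T (\<Delta> e) (\<lambda>f g. in0 (aact A d c) \<otimes>\<^bsub>T\<^esub> (cw [hact M f n] \<otimes>\<^bsub>T\<^esub> hw g v)))"
      by (simp add: T_mult_sw)
    also have "\<dots> = sw T (\<Delta> q) (\<lambda>d e. sw T (\<Delta> d) (\<lambda>f g. in0 (aact A f c) \<otimes>\<^bsub>T\<^esub> (cw [hact M g n] \<otimes>\<^bsub>T\<^esub> hw e v)))"
      by (rule coassoc[symmetric]) (intro lins | simp)+
    also have "\<dots> = hw q (lact M c n # v)"
      by (simp add: hact_lact cw_sw cw_lact T_mult_sw' T.m_assoc)
    finally show "sw T (\<Delta> q) (\<lambda>d e. cw [hact M p m] \<otimes>\<^bsub>T\<^esub> (in0 (aact A d c) \<otimes>\<^bsub>T\<^esub> hw e (n # v))) =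
      cw [hact M p m] \<otimes>\<^bsub>T\<^esub> hw q (lact M c n # v)"
      by (subst T_mult_sw[symmetric]) (simp_all del: hw.simps)
  qed
  finally show ?thesis by (simp only: hw.simps)
qed

lemma hw_balanced: "wrd u \<Longrightarrow> wrd v \<Longrightarrow> m \<in> carrier M \<Longrightarrow> n \<in> carrier M \<Longrightarrow>
  hw x (u @ ract M m c # n # v) = hw x (u @ m # lact M c n # v)"
proof (induction u arbitrary: x)
  case Nil
  then show ?case using hw_balanced_head by (simp del: hw.simps)
qed simp

lemma lsum_concat_T: "(\<And>xs. xs \<in> set xss \<Longrightarrow> set xs \<subseteq> carrier T) \<Longrightarrow>
  lsum T (concat xss) = lsum T (map (lsum T) xss)"
proof (induction xss)
  case (Cons xs xss)
  then show ?case
    by (simp add: T.lsum_append UN_subset_iff)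
qed simp

lemma word_hact_list_wrd:
  "wrd w \<Longrightarrow> \<forall>w'\<in>set (word_hact_list H M x w). w' \<noteq> [] \<and> wrd w'"
proof (induction w arbitrary: x rule: induct_list012)
  case (3 m n w)
  show ?case
  proof
    fix w' assume "w' \<in> set (word_hact_list H M x (m # n # w))"
    then obtain p q v where w': "w' = hact M p m # v" and v: "v \<in> set (word_hact_list H M q (n # w))"
      by auto
    have "wrd v" using 3(2)[of q] 3(3) v by simp
    then show "w' \<noteq> [] \<and> wrd w'" using 3(3) by (simp add: w')
  qed
qed simp_all

lemma hw_word_hact_list:
  "w \<noteq> [] \<Longrightarrow> wrd w \<Longrightarrow> lsum T (map cw (word_hact_list H M x w)) = hw x w"
proof (induction w arbitrary: x rule: induct_list012)
  case (2 m)
  then show ?case by (simp add: hw_single del: hw.simps)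
next
  case (3 m n w)
  have inner: "lsum T (map (\<lambda>w'. cw (hact M p m # w')) (word_hact_list H M q (n # w))) =
    cw [hact M p m] \<otimes>\<^bsub>T\<^esub> hw q (n # w)" for p q
  proof -
    have wl: "wrd w'" if "w' \<in> set (word_hact_list H M q (n # w))" for w'
      using word_hact_list_wrd[of "n # w" q] that 3 by auto
    have m1: "map (\<lambda>w'. cw (hact M p m # w')) (word_hact_list H M q (n # w)) =
      map (\<lambda>t. cw [hact M p m] \<otimes>\<^bsub>T\<^esub> t) (map cw (word_hact_list H M q (n # w)))"
      unfolding map_map o_def by (rule map_cong[OF refl], rule cw_Cons) (use wl 3 in auto)
    have m2: "cw [hact M p m] \<otimes>\<^bsub>T\<^esub> lsum T (map cw (word_hact_list H M q (n # w))) =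
      lsum T (map (\<lambda>t. cw [hact M p m] \<otimes>\<^bsub>T\<^esub> t) (map cw (word_hact_list H M q (n # w))))"
      by (rule lsum_hom) (use wl 3 in \<open>auto simp: T.abelian_group_axioms T.r_distr\<close>)
    have m3: "lsum T (map cw (word_hact_list H M q (n # w))) = hw q (n # w)"
      by (rule 3(2)) (use 3(4) in simp_all)
    show ?thesis by (simp only: m1 m2[symmetric] m3)
  qed
  have wl: "set (map (\<lambda>w'. cw (hact M p m # w')) (word_hact_list H M q (n # w))) \<subseteq> carrier T" for p q
    using word_hact_list_wrd[of "n # w" q] 3 by auto
  have "lsum T (map cw (word_hact_list H M x (m # n # w))) =
    lsum T (concat (map (\<lambda>(p, q). map (\<lambda>w'. cw (hact M p m # w')) (word_hact_list H M q (n # w))) (\<Delta> x)))"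
    by (simp add: map_concat o_def case_prod_unfold)
  also have "\<dots> = lsum T (map (lsum T) (map (\<lambda>(p, q). map (\<lambda>w'. cw (hact M p m # w')) (word_hact_list H M q (n # w))) (\<Delta> x)))"
  proof (rule lsum_concat_T)
    fix xs assume "xs \<in> set (map (\<lambda>(p, q). map (\<lambda>w'. cw (hact M p m # w')) (word_hact_list H M q (n # w))) (\<Delta> x))"
    then obtain p q where "xs = map (\<lambda>w'. cw (hact M p m # w')) (word_hact_list H M q (n # w))" by auto
    then show "set xs \<subseteq> carrier T" using wl by simp
  qed
  also have "\<dots> = sw T (\<Delta> x) (\<lambda>p q. lsum T (map (\<lambda>w'. cw (hact M p m # w')) (word_hact_list H M q (n # w))))"
    by (simp add: sw_def o_def case_prod_unfold)
  finally show ?case by (simp only: inner hw.simps)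
qed simp

lemma word_hact_diff: "word_hact H M x (f - g) = word_hact H M x f - word_hact H M x g"
  by (simp add: word_hact_def frag_extend_diff)

lemma good_word_hact: "good f \<Longrightarrow> good (word_hact H M x f)"
proof (induction rule: good_induct)
  case (of w)
  have "good (\<Sum>w'\<leftarrow>ws. frag_of w')" if "\<forall>w'\<in>set ws. w' \<noteq> [] \<and> wrd w'" for ws
    using that by (induction ws) auto
  then show ?case using word_hact_list_wrd[of w x] of by (simp add: word_hact_def)
qed (simp_all add: word_hact_diff, simp add: word_hact_def)

lemma cl_word_hact:
  assumes "good f"
  shows "(0, cl (word_hact H M x f)) = wlift T (\<lambda>w. if w \<noteq> [] \<and> wrd w then hw x w else \<zero>\<^bsub>T\<^esub>) f"
proof -
  interpret word_lift T "\<lambda>w. if w \<noteq> [] \<and> wrd w then hw x w else \<zero>\<^bsub>T\<^esub>"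
    by (intro word_lift.intro word_lift_axioms.intro T.abelian_group_axioms) simp
  have sum: "(0, cl (\<Sum>w'\<leftarrow>ws. frag_of w')) = lsum T (map cw ws)" if "\<forall>w'\<in>set ws. w' \<noteq> [] \<and> wrd w'" for ws
    using that
  proof (induction ws)
    case (Cons w ws)
    have "cw w = (0, cl (frag_of w))" using Cons.prems by (simp add: cw_def)
    moreover have "lsum T (map cw ws) = (0, cl (\<Sum>w'\<leftarrow>ws. frag_of w'))" using Cons by simp
    ultimately show ?case by (simp add: T_add)
  qed (simp add: T_zero)
  show ?thesis using assms
  proof (induction rule: good_induct)
    case (diff f g)
    then show ?case
      by (simp add: wlift_diff word_hact_diff T_minus good_word_hact flip: diff(3,4))
  next
    case (of w)
    then show ?case
      using sum[of "word_hact_list H M x w"] word_hact_list_wrd[of w x]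
      by (simp add: word_hact_def hw_word_hact_list del: hw.simps)
  qed (simp add: word_hact_def T_zero)
qed

lemma tensor_map_hw: "tensor_map H R A M T (\<lambda>a. in0 (aact A x a)) (hw x)"
  by unfold_locales (simp_all add: T.abelian_group_axioms aact_add in0_add hw_add hw_balanced del: hw.simps)

lemma T_hact: "t \<in> carrier T \<Longrightarrow> hact T x t = tlift T (\<lambda>a. in0 (aact A x a)) (hw x) t"
proof (elim T_cases)
  fix b f assume *: "t = (b, cl f)" "good f"
  \<comment> \<open>The right-hand side sees g only through its class. Independence of the
    representative in the definition of the action is thus inherited from
    \<open>tlift\<close>.\<close>
  have cl_hw: "(a, cl (word_hact H M x g)) = tlift T (\<lambda>a. in0 (aact A x a)) (hw x) (b, cl g)"
    if "good g" "a = aact A x b" for g a b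
    unfolding tensor_map.tlift_cl[OF tensor_map_hw that(1)] cl_word_hact[OF that(1), symmetric] that(2)
    by (rule T_decomp) (simp add: good_word_hact that)
  have "tensor_lift M (word_hact H M x) (cl f) = cl (word_hact H M x f)"
    unfolding tensor_lift_def
  proof (rule UN_cl)
    fix f' assume f': "f' - f \<in> K"
    have "good (f' - f + f)" using f' *(2) by (intro good_add) (simp_all add: K_good)
    then have g: "good f'" by simp
    have "cl f' = cl f" using f' by (simp add: cl_eq_iff)
    then have "(aact A x 0, cl (word_hact H M x f')) = (aact A x 0, cl (word_hact H M x f))"
      by (simp only: cl_hw[OF g refl] cl_hw[OF *(2) refl])
    then show "cl (word_hact H M x f') = cl (word_hact H M x f)" by simp
  qed
  then have "hact T x t = (aact A x b, cl (word_hact H M x f))"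
    using * by (simp add: tensor_algebra_def)
  then show ?thesis using cl_hw[OF *(2) refl] * by simp
qed

lemma T_hact_closed [simp]: "t \<in> carrier T \<Longrightarrow> hact T x t \<in> carrier T"
  unfolding T_hact by (rule tensor_map.tlift_closed[OF tensor_map_hw])

lemma T_hact_add: "s \<in> carrier T \<Longrightarrow> t \<in> carrier T \<Longrightarrow> hact T x (s \<oplus>\<^bsub>T\<^esub> t) = hact T x s \<oplus>\<^bsub>T\<^esub> hact T x t"
  by (simp add: T_hact tensor_map.tlift_add[OF tensor_map_hw])

lemma T_hact_in0: "hact T x (in0 a) = in0 (aact A x a)"
  by (simp add: T_hact tensor_map.tlift_in0[OF tensor_map_hw])

lemma T_hact_cw: "wrd w \<Longrightarrow> hact T x (cw w) = hw x w"
proof (cases "w = []")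
  case True
  then show ?thesis using T_hact_in0[of x 1] by (simp add: in0_one)
qed (simp add: T_hact tensor_map.tlift_cw[OF tensor_map_hw] del: hw.simps)

lemma T_hact_minus: "s \<in> carrier T \<Longrightarrow> t \<in> carrier T \<Longrightarrow> hact T x (s \<ominus>\<^bsub>T\<^esub> t) = hact T x s \<ominus>\<^bsub>T\<^esub> hact T x t"
  by (rule additive_minus[where \<phi> = "hact T x"]) (simp_all add: T.abelian_group_axioms T_hact_add)

lemma T_hact_sw: "(\<And>r s. F r s \<in> carrier T) \<Longrightarrow> hact T x (sw T xs F) = sw T xs (\<lambda>r s. hact T x (F r s))"
  by (rule sw_hom[where \<phi> = "hact T x" and M' = T]) (auto simp: T.abelian_group_axioms T_hact_add)

end

context abelian_group
begin

lemma minus_add_minus: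
  "a \<in> carrier G \<Longrightarrow> b \<in> carrier G \<Longrightarrow> c \<in> carrier G \<Longrightarrow> d \<in> carrier G \<Longrightarrow>
    (a \<ominus> b) \<oplus> (c \<ominus> d) = (a \<oplus> c) \<ominus> (b \<oplus> d)"
  by (simp add: minus_eq minus_add a_ac)

end

lemma sw_minus:
  assumes "abelian_group M" "\<And>a b. F a b \<in> carrier M" "\<And>a b. G a b \<in> carrier M"
  shows "sw M xs (\<lambda>a b. F a b \<ominus>\<^bsub>M\<^esub> G a b) = sw M xs F \<ominus>\<^bsub>M\<^esub> sw M xs G"
proof -
  interpret abelian_group M by fact
  show ?thesis
  proof (induction xs)
    case Nil
    show ?case by (simp only: sw_Nil minus_eq r_neg zero_closed)
  next
    case (Cons p xs)
    then show ?case
      by (cases p) (simp add: assms sw_closed[OF assms(1)] minus_add_minus)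
  qed
qed

section \<open>Covariance of the product and the bimodule axioms for the tensor algebra\<close>

context tensor_bimod
begin

lemma T_r_minus: "x \<in> carrier T \<Longrightarrow> s \<in> carrier T \<Longrightarrow> t \<in> carrier T \<Longrightarrow> x \<otimes>\<^bsub>T\<^esub> (s \<ominus>\<^bsub>T\<^esub> t) = x \<otimes>\<^bsub>T\<^esub> s \<ominus>\<^bsub>T\<^esub> x \<otimes>\<^bsub>T\<^esub> t"
  and T_l_minus: "x \<in> carrier T \<Longrightarrow> s \<in> carrier T \<Longrightarrow> t \<in> carrier T \<Longrightarrow> (s \<ominus>\<^bsub>T\<^esub> t) \<otimes>\<^bsub>T\<^esub> x = s \<otimes>\<^bsub>T\<^esub> x \<ominus>\<^bsub>T\<^esub> t \<otimes>\<^bsub>T\<^esub> x"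
  by (simp_all add: T.minus_eq T.r_distr T.l_distr T.r_minus T.l_minus)

lemmas T_ab [simp] = T.abelian_group_axioms
lemmas T_minus_simps = T_r_minus T_l_minus sw_minus[OF T_ab] T.minus_add_minus

lemma lin_T_minus: "lin T f \<Longrightarrow> lin T g \<Longrightarrow> lin T (\<lambda>x. f x \<ominus>\<^bsub>T\<^esub> g x)"
  by (auto simp: lin_def T_sc T_r_minus T.minus_add_minus)

lemma lin_T_hact: "t \<in> carrier T \<Longrightarrow> hl g \<Longrightarrow> lin T (\<lambda>x. hact T (g x) t)"
proof (induction rule: T_induct_words)
  case (in0 a)
  then show ?case by (simp only: T_hact_in0) (intro lins)
next
  case (cw w)
  then show ?case by (simp only: T_hact_cw) (intro lins)
next
  case (minus s t)
  then show ?case by (simp add: T_hact_minus lin_T_minus)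
qed

lemma T_hact_Cons:
  assumes [simp]: "m \<in> carrier M" and "t \<in> carrier T"
  shows "hact T x (cw [m] \<otimes>\<^bsub>T\<^esub> t) = sw T (\<Delta> x) (\<lambda>p q. cw [hact M p m] \<otimes>\<^bsub>T\<^esub> hact T q t)"
  using assms(2)
proof (induction rule: T_induct_words)
  case (in0 a)
  have "hact T x (cw [ract M m a]) = cw [hact M x (ract M m a)]"
    by (simp add: T_hact_cw hw_single del: hw.simps)
  then show ?case
    by (simp add: cw_ract T_hact_in0 hact_ract cw_sw)
next
  case (cw w)
  then have "hact T x (cw (m # w)) = hw x (m # w)" by (intro T_hact_cw) simp
  then show ?case using cw by (simp add: T_hact_cw cw_Cons[of m w])
qed (simp add: T_minus_simps T_hact_minus)

lemma T_hact_prod: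
  assumes "s \<in> carrier T" and [simp]: "t \<in> carrier T"
  shows "hact T x (s \<otimes>\<^bsub>T\<^esub> t) = sw T (\<Delta> x) (\<lambda>p q. hact T p s \<otimes>\<^bsub>T\<^esub> hact T q t)"
  using assms(1)
proof (induction arbitrary: x rule: T_induct)
  case (in0 a)
  show ?case
    using assms(2)
  proof (induction arbitrary: x rule: T_induct)
    case (in0 b)
    have "hact T x (in0 (a * b)) = in0 (aact A x (a * b))" by (rule T_hact_in0)
    then show ?case by (simp add: in0_mult T_hact_in0 aact_prod in0_sw)
  next
    case (Cons m t)
    note [simp] = Cons(1,2)
    have "hact T x (in0 a \<otimes>\<^bsub>T\<^esub> (cw [m] \<otimes>\<^bsub>T\<^esub> t)) = hact T x (cw [lact M a m] \<otimes>\<^bsub>T\<^esub> t)"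
      by (simp add: cw_lact T.m_assoc)
    also have "\<dots> = sw T (\<Delta> x) (\<lambda>p q. sw T (\<Delta> p) (\<lambda>c d. in0 (aact A c a) \<otimes>\<^bsub>T\<^esub> (cw [hact M d m] \<otimes>\<^bsub>T\<^esub> hact T q t)))"
      by (subst T_hact_Cons) (simp_all add: hact_lact cw_sw cw_lact T_mult_sw' T.m_assoc)
    also have "\<dots> = sw T (\<Delta> x) (\<lambda>p q. sw T (\<Delta> q) (\<lambda>c d. in0 (aact A p a) \<otimes>\<^bsub>T\<^esub> (cw [hact M c m] \<otimes>\<^bsub>T\<^esub> hact T d t)))"
      by (rule coassoc) (intro lins lin_T_hact | simp)+
    finally show ?case
      by (simp add: T_hact_Cons T_hact_in0 T_mult_sw)
  qed (simp add: T_minus_simps T_hact_minus)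
next
  case (Cons m s)
  note [simp] = Cons(1,2)
  have "hact T x (cw [m] \<otimes>\<^bsub>T\<^esub> s \<otimes>\<^bsub>T\<^esub> t) =
    sw T (\<Delta> x) (\<lambda>p q. sw T (\<Delta> q) (\<lambda>c d. cw [hact M p m] \<otimes>\<^bsub>T\<^esub> hact T c s \<otimes>\<^bsub>T\<^esub> hact T d t))"
    by (simp add: T.m_assoc T_hact_Cons Cons(3) T_mult_sw)
  also have "\<dots> = sw T (\<Delta> x) (\<lambda>p q. sw T (\<Delta> p) (\<lambda>c d. cw [hact M c m] \<otimes>\<^bsub>T\<^esub> hact T d s \<otimes>\<^bsub>T\<^esub> hact T q t))"
    by (rule coassoc[symmetric]) (intro lins lin_T_hact | simp)+
  finally show ?case
    by (simp add: T_hact_Cons T_mult_sw')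
qed (simp add: T_minus_simps T_hact_minus)

lemma T_hact_mult: "t \<in> carrier T \<Longrightarrow> hact T (x * y) t = hact T x (hact T y t)"
proof (induction arbitrary: x y rule: T_induct)
  case (Cons m t)
  note [simp] = Cons(1,2)
  have "hact T (x * y) (cw [m] \<otimes>\<^bsub>T\<^esub> t) = sw T (\<Delta> (x * y)) (\<lambda>p q. cw [hact M p m] \<otimes>\<^bsub>T\<^esub> hact T q t)"
    by (rule T_hact_Cons) simp_all
  also have "\<dots> = sw T (\<Delta> x) (\<lambda>a b. sw T (\<Delta> y) (\<lambda>c d. cw [hact M (a * c) m] \<otimes>\<^bsub>T\<^esub> hact T (b * d) t))"
    by (rule coprod_mult) (intro lins lin_T_hact | simp)+
  also have "\<dots> = sw T (\<Delta> y) (\<lambda>c d. sw T (\<Delta> x) (\<lambda>a b. cw [hact M (a * c) m] \<otimes>\<^bsub>T\<^esub> hact T (b * d) t))"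
    by (rule sw_swap) simp_all
  finally show ?case
    by (simp add: T_hact_Cons T_hact_sw hact_mult Cons(3))
qed (simp_all add: T_hact_in0 aact_mult T_hact_minus)

lemma T_hact_one: "t \<in> carrier T \<Longrightarrow> hact T 1 t = t"
proof (induction rule: T_induct)
  case (Cons m t)
  note [simp] = Cons
  have "hact T 1 (cw [m] \<otimes>\<^bsub>T\<^esub> t) = sw T (\<Delta> 1) (\<lambda>p q. cw [hact M p m] \<otimes>\<^bsub>T\<^esub> hact T q t)"
    by (rule T_hact_Cons) simp_all
  also have "\<dots> = cw [hact M 1 m] \<otimes>\<^bsub>T\<^esub> hact T 1 t"
    by (rule coprod_one) (intro lins lin_T_hact | simp)+
  finally show ?case by simp
qed (simp_all add: T_hact_in0 T_hact_minus)

text \<open>Moving a scalar to the left past one letter uses one copy of \<rho>; the hexagon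
  \<open>R_Delta2\<close> assembles the copies for successive letters into one acting on the whole
  tensor.\<close>

lemma T_ract_eq: "t \<in> carrier T \<Longrightarrow> t \<otimes>\<^bsub>T\<^esub> in0 a = sw T \<rho> (\<lambda>r s. in0 (aact A r a) \<otimes>\<^bsub>T\<^esub> hact T s t)"
proof (induction arbitrary: a rule: T_induct)
  case (in0 b)
  have "in0 (b * a) = sw T \<rho> (\<lambda>r s. in0 (aact A r a * aact A s b))"
    by (subst braided_comm) (rule in0_sw)
  then show ?case by (simp add: T_hact_in0 in0_mult)
next
  case (Cons m t)
  note [simp] = Cons(1,2)
  have "sw T \<rho> (\<lambda>r s. in0 (aact A r a) \<otimes>\<^bsub>T\<^esub> hact T s (cw [m] \<otimes>\<^bsub>T\<^esub> t)) =
    sw T \<rho> (\<lambda>r s. sw T (\<Delta> s) (\<lambda>p q. in0 (aact A r a) \<otimes>\<^bsub>T\<^esub> cw [hact M p m] \<otimes>\<^bsub>T\<^esub> hact T q t))"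
    by (simp add: T_hact_Cons T_mult_sw T.m_assoc)
  also have "\<dots> = sw T \<rho> (\<lambda>r s. sw T \<rho> (\<lambda>r' s'. in0 (aact A (r * r') a) \<otimes>\<^bsub>T\<^esub> cw [hact M s m] \<otimes>\<^bsub>T\<^esub> hact T s' t))"
    by (rule R_Delta2) (intro lins lin_T_hact | simp)+
  also have "\<dots> = sw T \<rho> (\<lambda>r' s'. sw T \<rho> (\<lambda>r s. in0 (aact A (r * r') a) \<otimes>\<^bsub>T\<^esub> cw [hact M s m] \<otimes>\<^bsub>T\<^esub> hact T s' t))"
    by (rule sw_swap) simp_all
  also have "\<dots> = sw T \<rho> (\<lambda>r' s'. cw [ract M m (aact A r' a)] \<otimes>\<^bsub>T\<^esub> hact T s' t)"
    by (simp add: ract_eq[OF bsb_M] cw_sw cw_lact T_mult_sw' aact_mult)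
  also have "\<dots> = cw [m] \<otimes>\<^bsub>T\<^esub> t \<otimes>\<^bsub>T\<^esub> in0 a"
    by (simp add: T.m_assoc Cons(3) cw_ract T_mult_sw)
  finally show ?case ..
qed (simp_all add: T_minus_simps T_hact_minus)

lemma sc_assoc:
  "t \<in> carrier T \<Longrightarrow> in0 (asmult A c 1) \<otimes>\<^bsub>T\<^esub> (in0 (asmult A d 1) \<otimes>\<^bsub>T\<^esub> t) = in0 (asmult A d (asmult A c 1)) \<otimes>\<^bsub>T\<^esub> t"
  by (simp add: asm_1 flip: T.m_assoc in0_mult)

lemma bsb_T [simp]: "bsb T"
proof (rule bsb_intro)
  fix a b x y c s t assume [simp]: "s \<in> carrier T" "t \<in> carrier T"
  show "hact T (x + y) s = hact T x s \<oplus>\<^bsub>T\<^esub> hact T y s" "hact T (hsmult H c x) s = sc T c (hact T x s)"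
    using linD[OF lin_T_hact[OF _ hl_id, of s]] by simp_all
  show "hact T x (sc T c s) = sc T c (hact T x s)"
  proof -
    have "hact T x (sc T c s) = sw T (\<Delta> x) (\<lambda>p q. sc T (\<epsilon> p) (sc T c (hact T q s)))"
      by (simp add: T_lact T_hact_prod T_hact_in0 aact_asm aact_1 sc_assoc)
    also have "\<dots> = sc T c (hact T x s)"
      by (rule counit_l) (intro lins lin_T_hact | simp)+
    finally show ?thesis .
  qed
  show "ract T s a = sw T \<rho> (\<lambda>r s'. lact T (aact A r a) (hact T s' s))"
    by (simp add: T_lact T_ract T_ract_eq)
  show "sc T c s = ract T s (asmult A c 1)"
    by (simp add: T_lact T_ract in0_central)
qed (simp_all add: T_lact T_ract T.r_distr T.l_distr in0_add in0_mult T.m_assoc in0_one T_hact_add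
  T_hact_mult T_hact_one T_hact_prod T_hact_in0)

end

section \<open>Extension of a covariant derivative to the tensor algebra\<close>

locale tensor_cov_deriv = vfield_bimod H R A + tensor_bimod H R A M
  for H :: "('k::{comm_ring, comm_monoid_mult}, 'h::{ring, monoid_mult}) hopf"
    and R :: "('h \<times> 'h) list"
    and A :: "('k, 'h, 'a::{ring, monoid_mult}) malg"
    and M :: "('a, 'h, 'm) bimod" +
  fixes N :: "('a \<Rightarrow> 'a) \<Rightarrow> 'm \<Rightarrow> 'm"
  assumes ecd_M: "equivariant_cov_deriv H R A M N"
begin

lemmas N_closed [simp] = cd_closed[OF ecd_M]
lemmas lin_N = lin_cd[OF ecd_M] lin_cd_snd[OF ecd_M]

fun dw :: "('a \<Rightarrow> 'a) \<Rightarrow> 'm list \<Rightarrow> 'a \<times> ('m list \<Rightarrow>\<^sub>0 int) set" where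
  "dw X [] = \<zero>\<^bsub>T\<^esub>"
| "dw X (m # w) = cw [N X m] \<otimes>\<^bsub>T\<^esub> cw w \<oplus>\<^bsub>T\<^esub> sw T \<rho> (\<lambda>r s. cw [hact M r m] \<otimes>\<^bsub>T\<^esub> dw (hact V s X) w)"

lemma dw_closed [simp]: "wrd w \<Longrightarrow> X \<in> carrier V \<Longrightarrow> dw X w \<in> carrier T"
  by (induction w arbitrary: X) auto

lemma dw_addX: "wrd w \<Longrightarrow> X \<in> carrier V \<Longrightarrow> Y \<in> carrier V \<Longrightarrow> dw (X \<oplus>\<^bsub>V\<^esub> Y) w = dw X w \<oplus>\<^bsub>T\<^esub> dw Y w"
  by (induction w arbitrary: X Y)
    (simp_all add: cd_addX[OF ecd_M] cw_add T.l_distr T.r_distr hact_add sw_add[OF T_ab] T.a_ac)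

lemma dw_scX: "wrd w \<Longrightarrow> X \<in> carrier V \<Longrightarrow> dw (sc V c X) w = sc T c (dw X w)"
proof (induction w arbitrary: X)
  case (Cons m w)
  have "in0 (asmult A c 1) \<otimes>\<^bsub>T\<^esub> (s \<otimes>\<^bsub>T\<^esub> t) = s \<otimes>\<^bsub>T\<^esub> (in0 (asmult A c 1) \<otimes>\<^bsub>T\<^esub> t)"
    if "s \<in> carrier T" "t \<in> carrier T" for s t
    using in0_central[OF that(1), of c] that by (metis T.m_assoc in0_closed)
  then show ?case
    using Cons by (simp add: cd_lact[OF ecd_M] hact_sc cw_lact T_lact T.r_distr T.m_assoc T_mult_sw)
qed (simp add: T_lact)

lemma lin_dw: "lin V f \<Longrightarrow> wrd w \<Longrightarrow> lin T (\<lambda>x. dw (f x) w)"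
  by (simp add: lin_def dw_addX dw_scX)

lemma dw_add: "wrd u \<Longrightarrow> wrd v \<Longrightarrow> m \<in> carrier M \<Longrightarrow> n \<in> carrier M \<Longrightarrow> X \<in> carrier V \<Longrightarrow>
  dw X (u @ (m \<oplus>\<^bsub>M\<^esub> n) # v) = dw X (u @ m # v) \<oplus>\<^bsub>T\<^esub> dw X (u @ n # v)"
proof (induction u arbitrary: X)
  case Nil
  then show ?case
    by (simp add: cd_add[OF ecd_M] hact_add cw_add T.l_distr sw_add[OF T_ab] T.a_ac)
next
  case (Cons l u)
  have "cw (u @ (m \<oplus>\<^bsub>M\<^esub> n) # v) = cw (u @ m # v) \<oplus>\<^bsub>T\<^esub> cw (u @ n # v)"
    using Cons.prems by (simp add: cw_append cw_Cons[of _ v] cw_add T.l_distr T.r_distr)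
  then show ?case
    using Cons by (simp add: T.r_distr sw_add[OF T_ab] T.a_ac)
qed

lemma dw_lact_head:
  assumes [simp]: "wrd v" "n \<in> carrier M" "X \<in> carrier V"
  shows "dw X (lact M c n # v) = in0 (X c) \<otimes>\<^bsub>T\<^esub> cw (n # v) \<oplus>\<^bsub>T\<^esub> sw T \<rho> (\<lambda>r s. in0 (aact A r c) \<otimes>\<^bsub>T\<^esub> dw (hact V s X) (n # v))"
proof -
  have "sw T \<rho> (\<lambda>r s. cw [hact M r (lact M c n)] \<otimes>\<^bsub>T\<^esub> dw (hact V s X) v) =
    sw T \<rho> (\<lambda>r s. sw T (\<Delta> r) (\<lambda>p q. in0 (aact A p c) \<otimes>\<^bsub>T\<^esub> (cw [hact M q n] \<otimes>\<^bsub>T\<^esub> dw (hact V s X) v)))"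
    by (simp add: hact_lact cw_sw cw_lact T_mult_sw' T.m_assoc)
  also have "\<dots> = sw T \<rho> (\<lambda>r s. sw T \<rho> (\<lambda>r' s'. in0 (aact A r' c) \<otimes>\<^bsub>T\<^esub> (cw [hact M r n] \<otimes>\<^bsub>T\<^esub> dw (hact V (s * s') X) v)))"
    by (rule R_Delta1) (intro lins lin_dw | simp)+
  also have "\<dots> = sw T \<rho> (\<lambda>r' s'. sw T \<rho> (\<lambda>r s. in0 (aact A r' c) \<otimes>\<^bsub>T\<^esub> (cw [hact M r n] \<otimes>\<^bsub>T\<^esub> dw (hact V (s * s') X) v)))"
    by (rule sw_swap) simp_all
  finally show ?thesis
    by (simp add: cd_leibniz[OF ecd_M] sw_closed cw_add cw_sw cw_lact T.l_distr T.r_distr T_mult_sw T_mult_sw' T.m_assoc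
      cw_Cons[of n v] sw_add[OF T_ab] hact_mult T.a_assoc)
qed

text \<open>Neither summand of \<open>dw\<close> is balanced alone. On the left, the derivative of m
  c contains a term with c differentiated, by \<open>cd_ract\<close>; on the right the same term
  comes from the Leibniz rule for c n.\<close>

lemma dw_balanced_head:
  assumes [simp]: "wrd v" "m \<in> carrier M" "n \<in> carrier M" "X \<in> carrier V"
  shows "dw X (ract M m c # n # v) = dw X (m # lact M c n # v)"
proof -
  have [simp]: "cw (n # v) \<in> carrier T" "cw (lact M c n # v) \<in> carrier T" by simp_all
  have "sw T \<rho> (\<lambda>r s. cw [hact M r (ract M m c)] \<otimes>\<^bsub>T\<^esub> dw (hact V s X) (n # v)) =
    sw T \<rho> (\<lambda>r s. sw T (\<Delta> r) (\<lambda>p q. cw [hact M p m] \<otimes>\<^bsub>T\<^esub> (in0 (aact A q c) \<otimes>\<^bsub>T\<^esub> dw (hact V s X) (n # v))))"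
    by (simp add: hact_ract cw_sw cw_ract T_mult_sw' T.m_assoc del: dw.simps)
  also have "\<dots> = sw T \<rho> (\<lambda>r s. sw T \<rho> (\<lambda>r' s'. cw [hact M r' m] \<otimes>\<^bsub>T\<^esub> (in0 (aact A r c) \<otimes>\<^bsub>T\<^esub> dw (hact V (s * s') X) (n # v))))"
    by (rule R_Delta1) (intro lins lin_dw | simp del: dw.simps)+
  also have "\<dots> = sw T \<rho> (\<lambda>r' s'. sw T \<rho> (\<lambda>r s. cw [hact M r' m] \<otimes>\<^bsub>T\<^esub> (in0 (aact A r c) \<otimes>\<^bsub>T\<^esub> dw (hact V (s * s') X) (n # v))))"
    by (rule sw_swap) (simp_all del: dw.simps)
  finally have 1: "sw T \<rho> (\<lambda>r s. cw [hact M r (ract M m c)] \<otimes>\<^bsub>T\<^esub> dw (hact V s X) (n # v)) =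
    sw T \<rho> (\<lambda>r' s'. sw T \<rho> (\<lambda>r s. cw [hact M r' m] \<otimes>\<^bsub>T\<^esub> (in0 (aact A r c) \<otimes>\<^bsub>T\<^esub> dw (hact V (s * s') X) (n # v))))" .
  have 2: "cw (lact M c n # v) = in0 c \<otimes>\<^bsub>T\<^esub> cw (n # v)"
    by (simp add: cw_Cons[of _ v] cw_lact T.m_assoc)
  have "dw X (ract M m c # n # v) = cw [N X m] \<otimes>\<^bsub>T\<^esub> in0 c \<otimes>\<^bsub>T\<^esub> cw (n # v) \<oplus>\<^bsub>T\<^esub>
      sw T \<rho> (\<lambda>r s. cw [hact M r m] \<otimes>\<^bsub>T\<^esub> in0 (hact V s X c) \<otimes>\<^bsub>T\<^esub> cw (n # v)) \<oplus>\<^bsub>T\<^esub>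
      sw T \<rho> (\<lambda>r' s'. sw T \<rho> (\<lambda>r s. cw [hact M r' m] \<otimes>\<^bsub>T\<^esub> (in0 (aact A r c) \<otimes>\<^bsub>T\<^esub> dw (hact V (s * s') X) (n # v))))"
    by (subst dw.simps(2)) (simp add: 1 cd_ract[OF ecd_M] sw_closed cw_add cw_sw cw_ract T.l_distr T_mult_sw' del: dw.simps)
  also have "\<dots> = dw X (m # lact M c n # v)"
    by (subst (2) dw.simps(2)) (simp add: 2 dw_lact_head T.r_distr T_mult_sw sw_add[OF T_ab] T.m_assoc T.a_assoc hact_mult del: dw.simps)
  finally show ?thesis .
qed

lemma dw_balanced: "wrd u \<Longrightarrow> wrd v \<Longrightarrow> m \<in> carrier M \<Longrightarrow> n \<in> carrier M \<Longrightarrow> X \<in> carrier V \<Longrightarrow>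
  dw X (u @ ract M m c # n # v) = dw X (u @ m # lact M c n # v)"
proof (induction u arbitrary: X)
  case Nil
  then show ?case using dw_balanced_head by (simp del: dw.simps)
next
  case (Cons l u)
  have "cw (ract M m c # n # v) = cw (m # lact M c n # v)"
    using Cons.prems by (simp add: cw_Cons[of _ "_ # v"] cw_Cons[of _ v] cw_ract cw_lact T.m_assoc)
  then have "cw (u @ ract M m c # n # v) = cw (u @ m # lact M c n # v)"
    using Cons.prems by (simp add: cw_append)
  then show ?case
    using Cons by simp
qed

definition D :: "('a \<Rightarrow> 'a) \<Rightarrow> 'a \<times> ('m list \<Rightarrow>\<^sub>0 int) set \<Rightarrow> 'a \<times> ('m list \<Rightarrow>\<^sub>0 int) set" where
  "D X = tlift T (\<lambda>a. in0 (X a)) (dw X)"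

lemma tensor_map_dw: "X \<in> carrier V \<Longrightarrow> tensor_map H R A M T (\<lambda>a. in0 (X a)) (dw X)"
  by unfold_locales (simp_all add: Der_add in0_add dw_add dw_balanced del: dw.simps)

lemma Der_one: "X \<in> carrier V \<Longrightarrow> X 1 = 0"
proof -
  assume [simp]: "X \<in> carrier V"
  have "X (1 * 1) = X 1 * 1 + sw AA \<rho> (\<lambda>r s. aact A r 1 * hact V s X 1)"
    by (rule Der_prod) simp
  also have "sw AA \<rho> (\<lambda>r s. aact A r 1 * hact V s X 1) = hact V 1 X 1"
    by (rule R_counit_aact) (intro lins | simp)+
  finally show ?thesis by simp
qed

context
  fixes X assumes X [simp]: "X \<in> carrier V"
begin

lemma D_closed [simp]: "t \<in> carrier T \<Longrightarrow> D X t \<in> carrier T"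
  unfolding D_def by (rule tensor_map.tlift_closed[OF tensor_map_dw]) simp_all

lemma D_add: "s \<in> carrier T \<Longrightarrow> t \<in> carrier T \<Longrightarrow> D X (s \<oplus>\<^bsub>T\<^esub> t) = D X s \<oplus>\<^bsub>T\<^esub> D X t"
  unfolding D_def by (rule tensor_map.tlift_add[OF tensor_map_dw]) simp_all

lemma D_in0: "D X (in0 a) = in0 (X a)"
  unfolding D_def by (rule tensor_map.tlift_in0[OF tensor_map_dw]) simp_all

lemma D_cw: "wrd w \<Longrightarrow> D X (cw w) = dw X w"
proof (cases "w = []")
  case True
  then show ?thesis using D_in0[of 1] by (simp add: in0_one Der_one in0_zero)
next
  case False
  then show "wrd w \<Longrightarrow> ?thesis"
    unfolding D_def by (intro tensor_map.tlift_cw[OF tensor_map_dw]) simp_all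
qed

lemma D_minus: "s \<in> carrier T \<Longrightarrow> t \<in> carrier T \<Longrightarrow> D X (s \<ominus>\<^bsub>T\<^esub> t) = D X s \<ominus>\<^bsub>T\<^esub> D X t"
  by (rule additive_minus[where \<phi> = "D X"]) (simp_all add: D_add)

lemma D_sw: "(\<And>r s. F r s \<in> carrier T) \<Longrightarrow> D X (sw T xs F) = sw T xs (\<lambda>r s. D X (F r s))"
  by (rule sw_hom[where \<phi> = "D X" and M' = T]) (auto simp: D_add)

end

text \<open>The recursion of \<open>dw\<close> with an arbitrary tensor as tail. For a tail in A it
  is the rule \<open>cd_ract\<close> for the right action.\<close>

lemma D_Cons:
  assumes [simp]: "X \<in> carrier V" "m \<in> carrier M" and "t \<in> carrier T"
  shows "D X (cw [m] \<otimes>\<^bsub>T\<^esub> t) = cw [N X m] \<otimes>\<^bsub>T\<^esub> t \<oplus>\<^bsub>T\<^esub> sw T \<rho> (\<lambda>r s. cw [hact M r m] \<otimes>\<^bsub>T\<^esub> D (hact V s X) t)"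
  using assms(3)
proof (induction rule: T_induct_words)
  case (in0 a)
  have "D X (cw [ract M m a]) = cw [N X (ract M m a)]"
    by (simp add: D_cw sw_zero)
  then show ?case
    by (simp add: cw_ract D_in0 cd_ract[OF ecd_M] cw_add cw_sw sw_closed)
next
  case (cw w)
  then have "D X (cw (m # w)) = dw X (m # w)" by (intro D_cw) simp_all
  then show ?case using cw by (simp add: D_cw cw_Cons[of m w])
qed (simp add: T_minus_simps D_minus)

lemma lin_D: "t \<in> carrier T \<Longrightarrow> lin V f \<Longrightarrow> lin T (\<lambda>x. D (f x) t)"
proof (induction rule: T_induct_words)
  case (in0 a)
  then show ?case by (simp add: D_in0 linD(1)) (intro lins lin_app)
next
  case (cw w)
  then show ?case by (simp add: D_cw linD(1) lin_dw del: dw.simps)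
next
  case (minus s t)
  then show ?case by (simp add: D_minus linD(1) lin_T_minus)
qed

lemma D_addX: "t \<in> carrier T \<Longrightarrow> X \<in> carrier V \<Longrightarrow> Y \<in> carrier V \<Longrightarrow> D (X \<oplus>\<^bsub>V\<^esub> Y) t = D X t \<oplus>\<^bsub>T\<^esub> D Y t"
proof (induction rule: T_induct_words)
  case (in0 a)
  then show ?case by (simp add: D_in0 in0_add[symmetric]) (simp add: V_simps)
qed (simp_all add: D_cw dw_addX D_minus T.minus_add_minus del: dw.simps)

lemma D_sw': "t \<in> carrier T \<Longrightarrow> (\<And>r s. F r s \<in> carrier V) \<Longrightarrow> D (sw V xs F) t = sw T xs (\<lambda>p q. D (F p q) t)"
  by (rule sw_hom[where \<phi> = "\<lambda>X. D X t" and M' = T]) (auto simp: D_addX)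

lemma D_leibniz_in0:
  assumes [simp]: "X \<in> carrier V" and "t \<in> carrier T"
  shows "D X (in0 a \<otimes>\<^bsub>T\<^esub> t) = in0 (X a) \<otimes>\<^bsub>T\<^esub> t \<oplus>\<^bsub>T\<^esub> sw T \<rho> (\<lambda>r s. in0 (aact A r a) \<otimes>\<^bsub>T\<^esub> D (hact V s X) t)"
  using assms(2)
proof (induction rule: T_induct)
  case (in0 b)
  have "D X (in0 (a * b)) = in0 (X (a * b))" by (rule D_in0) simp
  then show ?case by (simp add: in0_mult D_in0 Der_prod in0_add in0_sw)
next
  case (Cons m t)
  note [simp] = Cons(1,2)
  have "sw T \<rho> (\<lambda>r s. cw [hact M r (lact M a m)] \<otimes>\<^bsub>T\<^esub> D (hact V s X) t) =
    sw T \<rho> (\<lambda>r s. sw T (\<Delta> r) (\<lambda>p q. in0 (aact A p a) \<otimes>\<^bsub>T\<^esub> (cw [hact M q m] \<otimes>\<^bsub>T\<^esub> D (hact V s X) t)))"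
    by (simp add: hact_lact cw_sw cw_lact T_mult_sw' T.m_assoc)
  also have "\<dots> = sw T \<rho> (\<lambda>r s. sw T \<rho> (\<lambda>r' s'. in0 (aact A r' a) \<otimes>\<^bsub>T\<^esub> (cw [hact M r m] \<otimes>\<^bsub>T\<^esub> D (hact V (s * s') X) t)))"
    by (rule R_Delta1) (intro lins lin_D | simp)+
  also have "\<dots> = sw T \<rho> (\<lambda>r' s'. sw T \<rho> (\<lambda>r s. in0 (aact A r' a) \<otimes>\<^bsub>T\<^esub> (cw [hact M r m] \<otimes>\<^bsub>T\<^esub> D (hact V (s * s') X) t)))"
    by (rule sw_swap) simp_all
  finally have 1: "sw T \<rho> (\<lambda>r s. cw [hact M r (lact M a m)] \<otimes>\<^bsub>T\<^esub> D (hact V s X) t) =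
    sw T \<rho> (\<lambda>r' s'. sw T \<rho> (\<lambda>r s. in0 (aact A r' a) \<otimes>\<^bsub>T\<^esub> (cw [hact M r m] \<otimes>\<^bsub>T\<^esub> D (hact V (s * s') X) t)))" .
  have "D X (in0 a \<otimes>\<^bsub>T\<^esub> (cw [m] \<otimes>\<^bsub>T\<^esub> t)) = D X (cw [lact M a m] \<otimes>\<^bsub>T\<^esub> t)"
    by (simp add: cw_lact T.m_assoc)
  also have "\<dots> = cw [N X (lact M a m)] \<otimes>\<^bsub>T\<^esub> t \<oplus>\<^bsub>T\<^esub> sw T \<rho> (\<lambda>r s. cw [hact M r (lact M a m)] \<otimes>\<^bsub>T\<^esub> D (hact V s X) t)"
    by (rule D_Cons) simp_all
  also have "\<dots> = in0 (X a) \<otimes>\<^bsub>T\<^esub> (cw [m] \<otimes>\<^bsub>T\<^esub> t) \<oplus>\<^bsub>T\<^esub> sw T \<rho> (\<lambda>r s. in0 (aact A r a) \<otimes>\<^bsub>T\<^esub> D (hact V s X) (cw [m] \<otimes>\<^bsub>T\<^esub> t))"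
    by (simp add: 1 D_Cons cd_leibniz[OF ecd_M] sw_closed cw_add cw_sw cw_lact T.l_distr T.r_distr T_mult_sw T_mult_sw' T.m_assoc
      sw_add[OF T_ab] hact_mult T.a_assoc)
  finally show ?case .
qed (simp add: T_minus_simps D_minus)

lemma D_leibniz:
  assumes "s \<in> carrier T" and [simp]: "t \<in> carrier T" and "X \<in> carrier V"
  shows "D X (s \<otimes>\<^bsub>T\<^esub> t) = D X s \<otimes>\<^bsub>T\<^esub> t \<oplus>\<^bsub>T\<^esub> sw T \<rho> (\<lambda>r s'. hact T r s \<otimes>\<^bsub>T\<^esub> D (hact V s' X) t)"
  using assms(1,3)
proof (induction arbitrary: X rule: T_induct)
  case (in0 a)
  then show ?case by (simp add: D_leibniz_in0 D_in0 T_hact_in0)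
next
  case (Cons m s)
  note [simp] = Cons(1,2,4)
  have "sw T \<rho> (\<lambda>r s'. hact T r (cw [m] \<otimes>\<^bsub>T\<^esub> s) \<otimes>\<^bsub>T\<^esub> D (hact V s' X) t) =
    sw T \<rho> (\<lambda>r s'. sw T (\<Delta> r) (\<lambda>p q. cw [hact M p m] \<otimes>\<^bsub>T\<^esub> (hact T q s \<otimes>\<^bsub>T\<^esub> D (hact V s' X) t)))"
    by (simp add: T_hact_Cons T_mult_sw' T.m_assoc)
  also have "\<dots> = sw T \<rho> (\<lambda>r s1. sw T \<rho> (\<lambda>r' s'. cw [hact M r' m] \<otimes>\<^bsub>T\<^esub> (hact T r s \<otimes>\<^bsub>T\<^esub> D (hact V (s1 * s') X) t)))"
    by (rule R_Delta1) (intro lins lin_D | simp)+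
  also have "\<dots> = sw T \<rho> (\<lambda>r' s'. sw T \<rho> (\<lambda>r s1. cw [hact M r' m] \<otimes>\<^bsub>T\<^esub> (hact T r s \<otimes>\<^bsub>T\<^esub> D (hact V (s1 * s') X) t)))"
    by (rule sw_swap) simp_all
  finally show ?case
    by (simp add: T.m_assoc D_Cons Cons(3) T.l_distr T.r_distr T_mult_sw T_mult_sw' sw_add[OF T_ab] hact_mult[OF bsb_V] T.a_assoc)
qed (simp add: T_minus_simps D_minus T_hact_minus)

lemma D_sc:
  assumes [simp]: "X \<in> carrier V" "t \<in> carrier T"
  shows "D X (sc T c t) = sc T c (D X t)"
proof -
  have "D X (sc T c t) = sw T \<rho> (\<lambda>r s. sc T (\<epsilon> r) (sc T c (D (hact V s X) t)))"
    by (simp add: T_lact D_leibniz_in0 Der_asm Der_one in0_zero aact_asm aact_1 asm_rules(5) asm_1 sc_assoc)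
  also have "\<dots> = sc T c (D (hact V 1 X) t)"
    by (rule R_counit_l) (intro lins lin_D | simp)+
  finally show ?thesis by simp
qed

lemma lin_D_snd: "lin T f \<Longrightarrow> X \<in> carrier V \<Longrightarrow> lin T (\<lambda>x. D X (f x))"
  by (simp add: lin_def D_add D_sc)

text \<open>In the term where D acts on the tail, the letter m precedes the vector field, while x
  has to reach the vector field first; \<open>R_cocomm\<close> makes the exchange.\<close>

lemma D_equiv:
  assumes "t \<in> carrier T" "X \<in> carrier V"
  shows "hact T x (D X t) = sw T (\<Delta> x) (\<lambda>p q. D (hact V p X) (hact T q t))"
  using assms
proof (induction arbitrary: X x rule: T_induct)
  case (in0 a)
  then show ?case by (simp add: D_in0 T_hact_in0 Der_eval in0_sw)
next
  case (Cons m t)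
  note [simp] = Cons(1,2,4)
  have 1: "sw T (\<Delta> x) (\<lambda>p q. sw T (\<Delta> p) (\<lambda>c d. cw [N (hact V c X) (hact M d m)] \<otimes>\<^bsub>T\<^esub> hact T q t)) =
    sw T (\<Delta> x) (\<lambda>p q. sw T (\<Delta> q) (\<lambda>c d. cw [N (hact V p X) (hact M c m)] \<otimes>\<^bsub>T\<^esub> hact T d t))"
    by (rule coassoc) (intro lins lin_N | simp)+
  have "hact T x (sw T \<rho> (\<lambda>r s. cw [hact M r m] \<otimes>\<^bsub>T\<^esub> D (hact V s X) t)) =
    sw T \<rho> (\<lambda>r s. sw T (\<Delta> x) (\<lambda>p q. sw T (\<Delta> q) (\<lambda>c d. cw [hact M (p * r) m] \<otimes>\<^bsub>T\<^esub> D (hact V (c * s) X) (hact T d t))))"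
    by (simp add: T_hact_sw T_hact_Cons Cons(3) T_mult_sw hact_mult)
  also have "\<dots> = sw T \<rho> (\<lambda>r s. sw T (\<Delta> x) (\<lambda>p q. sw T (\<Delta> p) (\<lambda>c d. cw [hact M (c * r) m] \<otimes>\<^bsub>T\<^esub> D (hact V (d * s) X) (hact T q t))))"
    by (rule sw_cong, rule coassoc[symmetric]) (intro lins lin_D lin_D_snd | simp)+
  also have "\<dots> = sw T (\<Delta> x) (\<lambda>p q. sw T \<rho> (\<lambda>r s. sw T (\<Delta> p) (\<lambda>c d. cw [hact M (c * r) m] \<otimes>\<^bsub>T\<^esub> D (hact V (d * s) X) (hact T q t))))"
    by (rule sw_swap) simp_all
  also have "\<dots> = sw T (\<Delta> x) (\<lambda>p q. sw T (\<Delta> p) (\<lambda>c d. sw T \<rho> (\<lambda>r s. cw [hact M (c * r) m] \<otimes>\<^bsub>T\<^esub> D (hact V (d * s) X) (hact T q t))))"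
    by (rule sw_cong, rule sw_swap) simp_all
  also have "\<dots> = sw T (\<Delta> x) (\<lambda>p q. sw T \<rho> (\<lambda>r s. sw T (\<Delta> p) (\<lambda>c d. cw [hact M (r * d) m] \<otimes>\<^bsub>T\<^esub> D (hact V (s * c) X) (hact T q t))))"
    by (rule sw_cong, rule R_cocomm) (intro lins lin_D | simp)+
  also have "\<dots> = sw T (\<Delta> x) (\<lambda>p q. sw T (\<Delta> p) (\<lambda>c d. sw T \<rho> (\<lambda>r s. cw [hact M (r * d) m] \<otimes>\<^bsub>T\<^esub> D (hact V (s * c) X) (hact T q t))))"
    by (rule sw_cong, rule sw_swap) simp_all
  also have "\<dots> = sw T (\<Delta> x) (\<lambda>p q. sw T (\<Delta> q) (\<lambda>c d. sw T \<rho> (\<lambda>r s. cw [hact M (r * c) m] \<otimes>\<^bsub>T\<^esub> D (hact V (s * p) X) (hact T d t))))"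
    by (rule coassoc) (intro lins lin_D lin_D_snd | simp)+
  finally have 2: "hact T x (sw T \<rho> (\<lambda>r s. cw [hact M r m] \<otimes>\<^bsub>T\<^esub> D (hact V s X) t)) =
    sw T (\<Delta> x) (\<lambda>p q. sw T (\<Delta> q) (\<lambda>c d. sw T \<rho> (\<lambda>r s. cw [hact M (r * c) m] \<otimes>\<^bsub>T\<^esub> D (hact V (s * p) X) (hact T d t))))" .
  show ?case
    by (simp add: D_Cons T_hact_add T_hact_Cons 2 cd_equiv[OF ecd_M] cw_sw T_mult_sw' 1 D_sw sw_add[OF T_ab] hact_mult)
qed (simp add: T_minus_simps D_minus T_hact_minus)

lemma D_lact:
  assumes "t \<in> carrier T" "X \<in> carrier V"
  shows "D (lact V a X) t = in0 a \<otimes>\<^bsub>T\<^esub> D X t"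
  using assms
proof (induction arbitrary: X a rule: T_induct)
  case (in0 b)
  then show ?case by (simp add: D_in0 in0_mult[symmetric]) (simp add: V_simps)
next
  case (Cons m t)
  note [simp] = Cons(1,2,4)
  have "sw T \<rho> (\<lambda>r s. cw [hact M r m] \<otimes>\<^bsub>T\<^esub> D (hact V s (lact V a X)) t) =
    sw T \<rho> (\<lambda>r s. sw T (\<Delta> s) (\<lambda>p q. cw [hact M r m] \<otimes>\<^bsub>T\<^esub> (in0 (aact A p a) \<otimes>\<^bsub>T\<^esub> D (hact V q X) t)))"
    by (simp add: hact_lact D_sw' Cons(3) T_mult_sw)
  also have "\<dots> = sw T \<rho> (\<lambda>r s. sw T \<rho> (\<lambda>r' s'. cw [hact M (r * r') m] \<otimes>\<^bsub>T\<^esub> (in0 (aact A s a) \<otimes>\<^bsub>T\<^esub> D (hact V s' X) t)))"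
    by (rule R_Delta2) (intro lins lin_D | simp)+
  also have "\<dots> = sw T \<rho> (\<lambda>r' s'. sw T \<rho> (\<lambda>r s. cw [hact M (r * r') m] \<otimes>\<^bsub>T\<^esub> (in0 (aact A s a) \<otimes>\<^bsub>T\<^esub> D (hact V s' X) t)))"
    by (rule sw_swap) simp_all
  also have "\<dots> = sw T \<rho> (\<lambda>r' s'. cw [lact M a (hact M r' m)] \<otimes>\<^bsub>T\<^esub> D (hact V s' X) t)"
    by (simp add: lact_eq[OF bsb_M, of "hact M r' m" a for r'] cw_sw cw_ract T_mult_sw' hact_mult T.m_assoc)
  finally show ?case
    by (simp add: D_Cons cd_lact[OF ecd_M] cw_lact T.r_distr T_mult_sw T.m_assoc)
qed (simp add: T_minus_simps D_minus)

lemma ecd_D: "ecd T D"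
  by (rule ecd_intro) (simp_all add: D_addX D_add D_equiv D_lact D_leibniz_in0 T_lact)

end

section \<open>The braided exchange\<close>

context tensor_cov_deriv
begin

text \<open>The braiding followed by multiplication in T. Taking it as an operation on T puts it on
  the same footing as the product and avoids tensor products of T with itself.\<close>

definition braid where
  "braid s t = sw T \<rho> (\<lambda>r r'. hact T r t \<otimes>\<^bsub>T\<^esub> hact T r' s)"

lemma braid_closed [simp]: "s \<in> carrier T \<Longrightarrow> t \<in> carrier T \<Longrightarrow> braid s t \<in> carrier T"
  by (simp add: braid_def)

text \<open>The properties shared by the product and the braided flip that the exchange argument uses.\<close>

definition equivariant_op where
  "equivariant_op \<beta> \<longleftrightarrow>
     (\<forall>s\<in>carrier T. \<forall>t\<in>carrier T. \<beta> s t \<in> carrier T) \<and>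
     (\<forall>s\<in>carrier T. \<forall>s'\<in>carrier T. \<forall>t\<in>carrier T. \<beta> (s \<oplus>\<^bsub>T\<^esub> s') t = \<beta> s t \<oplus>\<^bsub>T\<^esub> \<beta> s' t) \<and>
     (\<forall>s\<in>carrier T. \<forall>t\<in>carrier T. \<forall>t'\<in>carrier T. \<beta> s (t \<oplus>\<^bsub>T\<^esub> t') = \<beta> s t \<oplus>\<^bsub>T\<^esub> \<beta> s t') \<and>
     (\<forall>c. \<forall>s\<in>carrier T. \<forall>t\<in>carrier T. \<beta> (sc T c s) t = sc T c (\<beta> s t) \<and> \<beta> s (sc T c t) = sc T c (\<beta> s t)) \<and>
     (\<forall>x. \<forall>s\<in>carrier T. \<forall>t\<in>carrier T. hact T x (\<beta> s t) = sw T (\<Delta> x) (\<lambda>p q. \<beta> (hact T p s) (hact T q t))) \<and>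
     (\<forall>X\<in>carrier V. \<forall>s\<in>carrier T. \<forall>t\<in>carrier T.
       D X (\<beta> s t) = \<beta> (D X s) t \<oplus>\<^bsub>T\<^esub> sw T \<rho> (\<lambda>r r'. \<beta> (hact T r s) (D (hact V r' X) t)))"

lemma equivariant_op_mult: "equivariant_op (\<lambda>s t. s \<otimes>\<^bsub>T\<^esub> t)"
  unfolding equivariant_op_def
  by (auto simp: T.l_distr T.r_distr T_lact T.m_assoc T_hact_prod D_leibniz)
    (metis T.m_assoc in0_central in0_closed)

lemma equivariant_op_braid: "equivariant_op braid"
proof -
  have add: "braid (s \<oplus>\<^bsub>T\<^esub> s') t = braid s t \<oplus>\<^bsub>T\<^esub> braid s' t" "braid t (s \<oplus>\<^bsub>T\<^esub> s') = braid t s \<oplus>\<^bsub>T\<^esub> braid t s'"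
    if "s \<in> carrier T" "s' \<in> carrier T" "t \<in> carrier T" for s s' t
    using that by (simp_all add: braid_def T_hact_add T.r_distr T.l_distr sw_add[OF T_ab])
  have com: "s \<otimes>\<^bsub>T\<^esub> sc T c t = sc T c (s \<otimes>\<^bsub>T\<^esub> t)" "sc T c s \<otimes>\<^bsub>T\<^esub> t = sc T c (s \<otimes>\<^bsub>T\<^esub> t)"
    if "s \<in> carrier T" "t \<in> carrier T" for s t c
    using equivariant_op_mult that unfolding equivariant_op_def by blast+
  have sc: "braid (sc T c s) t = sc T c (braid s t)" "braid s (sc T c t) = sc T c (braid s t)"
    if "s \<in> carrier T" "t \<in> carrier T" for s t c
    using that by (simp_all add: braid_def hact_sc[OF bsb_T] com sc_sw)
  have h: "hact T x (braid s t) = sw T (\<Delta> x) (\<lambda>p q. braid (hact T p s) (hact T q t))"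
    if [simp]: "s \<in> carrier T" "t \<in> carrier T" for s t x
  proof -
    have "hact T x (braid s t) = sw T \<rho> (\<lambda>r r'. sw T (\<Delta> x) (\<lambda>p q. hact T (p * r) t \<otimes>\<^bsub>T\<^esub> hact T (q * r') s))"
      by (simp add: braid_def T_hact_sw T_hact_prod T_hact_mult)
    also have "\<dots> = sw T (\<Delta> x) (\<lambda>p q. sw T \<rho> (\<lambda>r r'. hact T (p * r) t \<otimes>\<^bsub>T\<^esub> hact T (q * r') s))"
      by (rule sw_swap) simp_all
    also have "\<dots> = sw T \<rho> (\<lambda>r r'. sw T (\<Delta> x) (\<lambda>p q. hact T (r * q) t \<otimes>\<^bsub>T\<^esub> hact T (r' * p) s))"
      by (rule R_cocomm) (intro lins | simp)+
    also have "\<dots> = sw T (\<Delta> x) (\<lambda>p q. sw T \<rho> (\<lambda>r r'. hact T (r * q) t \<otimes>\<^bsub>T\<^esub> hact T (r' * p) s))"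
      by (rule sw_swap) simp_all
    finally show ?thesis by (simp add: braid_def T_hact_mult)
  qed
  \<comment> \<open>As t stands first in \<open>braid s t\<close>, the two Leibniz terms match
    crosswise. The term that differentiates s is the first summand, by the equivariance of D and a
    hexagon; the term that differentiates t is the second, after two copies of \<rho>
    cancel.\<close>
  have d: "D X (braid s t) = braid (D X s) t \<oplus>\<^bsub>T\<^esub> sw T \<rho> (\<lambda>r r'. braid (hact T r s) (D (hact V r' X) t))"
    if [simp]: "X \<in> carrier V" "s \<in> carrier T" "t \<in> carrier T" for X s t
  proof -
    have "D X (braid s t) = sw T \<rho> (\<lambda>r r'. D X (hact T r t) \<otimes>\<^bsub>T\<^esub> hact T r' s) \<oplus>\<^bsub>T\<^esub>
      sw T \<rho> (\<lambda>r r'. sw T \<rho> (\<lambda>p p'. hact T (p * r) t \<otimes>\<^bsub>T\<^esub> D (hact V p' X) (hact T r' s)))"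
      by (simp add: braid_def D_sw D_leibniz T_hact_mult sw_add[OF T_ab])
    also have "sw T \<rho> (\<lambda>r r'. sw T \<rho> (\<lambda>p p'. hact T (p * r) t \<otimes>\<^bsub>T\<^esub> D (hact V p' X) (hact T r' s))) = braid (D X s) t"
    proof -
      have "braid (D X s) t = sw T \<rho> (\<lambda>r r'. sw T (\<Delta> r') (\<lambda>p q. hact T r t \<otimes>\<^bsub>T\<^esub> D (hact V p X) (hact T q s)))"
        by (simp add: braid_def D_equiv T_mult_sw)
      also have "\<dots> = sw T \<rho> (\<lambda>r r'. sw T \<rho> (\<lambda>p p'. hact T (r * p) t \<otimes>\<^bsub>T\<^esub> D (hact V r' X) (hact T p' s)))"
        by (rule R_Delta2) (intro lins lin_D lin_D_snd | simp)+
      also have "\<dots> = sw T \<rho> (\<lambda>p p'. sw T \<rho> (\<lambda>r r'. hact T (r * p) t \<otimes>\<^bsub>T\<^esub> D (hact V r' X) (hact T p' s)))"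
        by (rule sw_swap) simp_all
      finally show ?thesis ..
    qed
    also have "sw T \<rho> (\<lambda>r r'. D X (hact T r t) \<otimes>\<^bsub>T\<^esub> hact T r' s) = sw T \<rho> (\<lambda>r r'. braid (hact T r s) (D (hact V r' X) t))"
    proof -
      have "sw T \<rho> (\<lambda>r r'. braid (hact T r s) (D (hact V r' X) t)) =
        sw T \<rho> (\<lambda>r r'. sw T \<rho> (\<lambda>p p'. sw T (\<Delta> p) (\<lambda>c d. D (hact V (c * r') X) (hact T d t) \<otimes>\<^bsub>T\<^esub> hact T (p' * r) s)))"
        by (simp add: braid_def D_equiv T_mult_sw' T_hact_mult hact_mult[OF bsb_V])
      also have "\<dots> = sw T \<rho> (\<lambda>r r'. sw T \<rho> (\<lambda>p p'. sw T \<rho> (\<lambda>c c'. D (hact V (c * r') X) (hact T p t) \<otimes>\<^bsub>T\<^esub> hact T (p' * c' * r) s)))"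
        by (rule sw_cong, rule R_Delta1) (intro lins lin_D lin_D_snd | simp)+
      also have "\<dots> = sw T \<rho> (\<lambda>p p'. sw T \<rho> (\<lambda>r r'. sw T \<rho> (\<lambda>c c'. D (hact V (c * r') X) (hact T p t) \<otimes>\<^bsub>T\<^esub> hact T (p' * c' * r) s)))"
        by (rule sw_swap) simp_all
      also have "\<dots> = sw T \<rho> (\<lambda>p p'. sw T \<rho> (\<lambda>c c'. sw T \<rho> (\<lambda>r r'. D (hact V (c * r') X) (hact T p t) \<otimes>\<^bsub>T\<^esub> hact T (p' * (c' * r)) s)))"
        unfolding mult.assoc by (rule sw_cong, rule sw_swap) simp_all
      also have "\<dots> = sw T \<rho> (\<lambda>p p'. D (hact V 1 X) (hact T p t) \<otimes>\<^bsub>T\<^esub> hact T (p' * 1) s)"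
        by (rule sw_cong, rule R_inv) (intro lins lin_D lin_D_snd | simp)+
      finally show ?thesis by simp
    qed
    finally show ?thesis by (simp add: T.a_comm)
  qed
  show ?thesis
    unfolding equivariant_op_def using add sc h d by simp
qed

text \<open>\<open>hF F x w\<close> and \<open>dF F X w\<close> are the values on \<open>w\<close> of a multilinear word function \<open>F\<close>
  precomposed with the action of \<open>x\<close> and with the covariant derivative along \<open>X\<close>.\<close>

primrec hF :: "('m list \<Rightarrow> 'a \<times> ('m list \<Rightarrow>\<^sub>0 int) set) \<Rightarrow> 'h \<Rightarrow> 'm list \<Rightarrow> 'a \<times> ('m list \<Rightarrow>\<^sub>0 int) set" where
  "hF F x [] = sc T (\<epsilon> x) (F [])"
| "hF F x (m # w) = sw T (\<Delta> x) (\<lambda>p q. hF (\<lambda>w'. F (hact M p m # w')) q w)"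

primrec dF :: "('m list \<Rightarrow> 'a \<times> ('m list \<Rightarrow>\<^sub>0 int) set) \<Rightarrow> ('a \<Rightarrow> 'a) \<Rightarrow> 'm list \<Rightarrow> 'a \<times> ('m list \<Rightarrow>\<^sub>0 int) set" where
  "dF F X [] = \<zero>\<^bsub>T\<^esub>"
| "dF F X (m # w) = F (N X m # w) \<oplus>\<^bsub>T\<^esub> sw T \<rho> (\<lambda>r s. dF (\<lambda>w'. F (hact M r m # w')) (hact V s X) w)"

text \<open>Linear over k in each slot, with no balancing over A. This weak notion is enough for the
  Sweedler rules and lets the exchange be treated as a function of words.\<close>

definition multilin :: "nat \<Rightarrow> ('m list \<Rightarrow> 'a \<times> ('m list \<Rightarrow>\<^sub>0 int) set) \<Rightarrow> bool" where
  "multilin n F \<longleftrightarrow> (\<forall>w. wrd w \<longrightarrow> length w = n \<longrightarrow> F w \<in> carrier T) \<and>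
    (\<forall>u v. \<forall>m\<in>carrier M. \<forall>m'\<in>carrier M. wrd u \<longrightarrow> wrd v \<longrightarrow> Suc (length u + length v) = n \<longrightarrow>
       F (u @ (m \<oplus>\<^bsub>M\<^esub> m') # v) = F (u @ m # v) \<oplus>\<^bsub>T\<^esub> F (u @ m' # v)) \<and>
    (\<forall>u v c. \<forall>m\<in>carrier M. wrd u \<longrightarrow> wrd v \<longrightarrow> Suc (length u + length v) = n \<longrightarrow>
       F (u @ (sc M c m) # v) = sc T c (F (u @ m # v)))"

lemma multilin_closed: "multilin n F \<Longrightarrow> wrd w \<Longrightarrow> length w = n \<Longrightarrow> F w \<in> carrier T"
  by (simp add: multilin_def)

lemma multilin_Cons: "multilin (Suc n) F \<Longrightarrow> m \<in> carrier M \<Longrightarrow> multilin n (\<lambda>w. F (m # w))"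
proof -
  assume F: "multilin (Suc n) F" and m: "m \<in> carrier M"
  show ?thesis
    unfolding multilin_def
  proof (intro conjI allI ballI impI)
    fix u v c l l' assume *: "wrd u" "wrd v" "Suc (length u + length v) = n" "l \<in> carrier M"
    then show "F (m # u @ sc M c l # v) = sc T c (F (m # u @ l # v))"
      using F m unfolding multilin_def by (elim conjE) (drule spec[of _ "m # u"], simp)
    show "l' \<in> carrier M \<Longrightarrow> F (m # u @ (l \<oplus>\<^bsub>M\<^esub> l') # v) = F (m # u @ l # v) \<oplus>\<^bsub>T\<^esub> F (m # u @ l' # v)"
      using * F m unfolding multilin_def by (elim conjE) (drule spec[of _ "m # u"], simp)
  qed (use F m in \<open>simp add: multilin_def\<close>)
qed

lemma multilin_head:
  assumes "multilin (Suc n) F" "wrd w" "length w = n" "m \<in> carrier M"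
  shows "m' \<in> carrier M \<Longrightarrow> F ((m \<oplus>\<^bsub>M\<^esub> m') # w) = F (m # w) \<oplus>\<^bsub>T\<^esub> F (m' # w)"
    and "F (sc M c m # w) = sc T c (F (m # w))"
  using assms(1)[unfolded multilin_def, THEN conjunct2, THEN conjunct1, THEN spec[of _ "[]"], THEN spec[of _ w]]
    assms(1)[unfolded multilin_def, THEN conjunct2, THEN conjunct2, THEN spec[of _ "[]"], THEN spec[of _ w]] assms(2-4)
  by simp_all

lemma hF_closed [simp]: "multilin (length w) F \<Longrightarrow> wrd w \<Longrightarrow> hF F x w \<in> carrier T"
proof (induction w arbitrary: F x)
  case (Cons m w)
  then show ?case by (simp only: hF.simps) (intro sw_T_closed Cons.IH multilin_Cons; simp)
qed (simp add: multilin_closed)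

lemma dF_closed [simp]: "multilin (length w) F \<Longrightarrow> wrd w \<Longrightarrow> X \<in> carrier V \<Longrightarrow> dF F X w \<in> carrier T"
proof (induction w arbitrary: F X)
  case (Cons m w)
  then show ?case
    by (simp only: dF.simps) (intro sw_T_closed T.a_closed multilin_closed[OF Cons.prems(1)] Cons.IH multilin_Cons; simp)
qed simp

lemma hF_cong: "(\<And>v. wrd v \<Longrightarrow> length v = length w \<Longrightarrow> F v = G v) \<Longrightarrow> wrd w \<Longrightarrow> hF F x w = hF G x w"
proof (induction w arbitrary: F G x)
  case (Cons m w)
  have "hF (\<lambda>w'. F (hact M p m # w')) q w = hF (\<lambda>w'. G (hact M p m # w')) q w" for p q
    using Cons.prems by (intro Cons.IH) auto
  then show ?case by simp
qed simp

lemma dF_cong: "(\<And>v. wrd v \<Longrightarrow> length v = length w \<Longrightarrow> F v = G v) \<Longrightarrow> wrd w \<Longrightarrow> X \<in> carrier V \<Longrightarrow> dF F X w = dF G X w"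
proof (induction w arbitrary: F G X)
  case (Cons m w)
  have "dF (\<lambda>w'. F (hact M r m # w')) (hact V s X) w = dF (\<lambda>w'. G (hact M r m # w')) (hact V s X) w" for r s
    using Cons.prems by (intro Cons.IH) auto
  then show ?case using Cons.prems by simp
qed simp

definition klin :: "('a \<times> ('m list \<Rightarrow>\<^sub>0 int) set \<Rightarrow> 'a \<times> ('m list \<Rightarrow>\<^sub>0 int) set) \<Rightarrow> bool" where
  "klin \<phi> \<longleftrightarrow> (\<forall>s\<in>carrier T. \<phi> s \<in> carrier T) \<and> (\<forall>s\<in>carrier T. \<forall>t\<in>carrier T. \<phi> (s \<oplus>\<^bsub>T\<^esub> t) = \<phi> s \<oplus>\<^bsub>T\<^esub> \<phi> t) \<and>
     (\<forall>c. \<forall>s\<in>carrier T. \<phi> (sc T c s) = sc T c (\<phi> s))"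

lemma klin_sw: "klin \<phi> \<Longrightarrow> (\<And>a b. F a b \<in> carrier T) \<Longrightarrow> \<phi> (sw T xs F) = sw T xs (\<lambda>a b. \<phi> (F a b))"
  by (rule sw_hom[where M' = T]) (auto simp: klin_def)

lemma klin_zero: "klin \<phi> \<Longrightarrow> \<phi> \<zero>\<^bsub>T\<^esub> = \<zero>\<^bsub>T\<^esub>"
  by (rule additive_zero[where \<phi> = \<phi>]) (auto simp: klin_def)

lemma hF_klin: "klin \<phi> \<Longrightarrow> multilin (length w) F \<Longrightarrow> wrd w \<Longrightarrow> hF (\<lambda>v. \<phi> (F v)) x w = \<phi> (hF F x w)"
proof (induction w arbitrary: F x)
  case Nil
  then show ?case by (simp add: klin_def multilin_closed)
next
  case (Cons m w)
  then show ?case by (simp add: klin_sw multilin_Cons)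
qed

lemma dF_klin: "klin \<phi> \<Longrightarrow> multilin (length w) F \<Longrightarrow> wrd w \<Longrightarrow> X \<in> carrier V \<Longrightarrow> dF (\<lambda>v. \<phi> (F v)) X w = \<phi> (dF F X w)"
proof (induction w arbitrary: F X)
  case Nil
  then show ?case by (simp add: klin_zero)
next
  case (Cons m w)
  have "\<phi> (s \<oplus>\<^bsub>T\<^esub> t) = \<phi> s \<oplus>\<^bsub>T\<^esub> \<phi> t" if "s \<in> carrier T" "t \<in> carrier T" for s t
    using Cons.prems that by (simp add: klin_def)
  then show ?case using Cons by (simp add: klin_sw multilin_Cons multilin_closed)
qed

lemma lin_hF: "multilin (length w) F \<Longrightarrow> wrd w \<Longrightarrow> hl g \<Longrightarrow> lin T (\<lambda>x. hF F (g x) w)"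
  and lin_hF_fun: "multilin (Suc (length w)) F \<Longrightarrow> wrd w \<Longrightarrow> lin M f \<Longrightarrow> lin T (\<lambda>x. hF (\<lambda>v. F (f x # v)) y w)"
proof -
  have hF_add: "hF (\<lambda>v. F v \<oplus>\<^bsub>T\<^esub> G v) y w = hF F y w \<oplus>\<^bsub>T\<^esub> hF G y w"
    if "multilin (length w) F" "multilin (length w) G" "wrd w" for F G y w
    using that
    by (induction w arbitrary: F G y) (simp_all add: multilin_closed T_lact T.r_distr multilin_Cons sw_add[OF T_ab])
  have fun_lin: "lin T (\<lambda>x. hF (\<lambda>v. F (f x # v)) y w)"
    if F: "multilin (Suc (length w)) F" and w: "wrd w" and f: "lin M f" for F f y w
    unfolding lin_def
  proof (intro conjI allI)
    note f = linD[OF f]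
    fix x x' c
    note ml = multilin_Cons[OF F f(1)]
    show "hF (\<lambda>v. F (f x # v)) y w \<in> carrier T" using ml w by simp
    have "hF (\<lambda>v. F (f (x + x') # v)) y w = hF (\<lambda>v. F (f x # v) \<oplus>\<^bsub>T\<^esub> F (f x' # v)) y w"
      by (rule hF_cong) (simp_all add: f w multilin_head[OF F])
    also have "\<dots> = hF (\<lambda>v. F (f x # v)) y w \<oplus>\<^bsub>T\<^esub> hF (\<lambda>v. F (f x' # v)) y w"
      using ml w by (simp add: hF_add)
    finally show "hF (\<lambda>v. F (f (x + x') # v)) y w = hF (\<lambda>v. F (f x # v)) y w \<oplus>\<^bsub>T\<^esub> hF (\<lambda>v. F (f x' # v)) y w" .
    have "hF (\<lambda>v. F (f (hsmult H c x) # v)) y w = hF (\<lambda>v. sc T c (F (f x # v))) y w"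
      by (rule hF_cong) (simp_all add: f w multilin_head[OF F])
    also have "\<dots> = sc T c (hF (\<lambda>v. F (f x # v)) y w)"
      using ml w by (intro hF_klin) (simp_all add: klin_def scm_add sc_commute)
    finally show "hF (\<lambda>v. F (f (hsmult H c x) # v)) y w = sc T c (hF (\<lambda>v. F (f x # v)) y w)" .
  qed
  then show "multilin (Suc (length w)) F \<Longrightarrow> wrd w \<Longrightarrow> lin M f \<Longrightarrow> lin T (\<lambda>x. hF (\<lambda>v. F (f x # v)) y w)"
    by blast
  show "multilin (length w) F \<Longrightarrow> wrd w \<Longrightarrow> hl g \<Longrightarrow> lin T (\<lambda>x. hF F (g x) w)"
  proof (induction w arbitrary: F g)
    case Nil
    then show ?case by (simp only: hF.simps) (intro lins scm_T multilin_closed[of 0], simp_all)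
  next
    case (Cons m w)
    then show ?case
      by (simp only: hF.simps) (intro lin_coprod scm_T Cons.IH fun_lin lins multilin_Cons | simp)+
  qed
qed

lemma lin_dF: "multilin (length w) F \<Longrightarrow> wrd w \<Longrightarrow> lin V f \<Longrightarrow> lin T (\<lambda>x. dF F (f x) w)"
proof (induction w arbitrary: F f)
  case Nil
  then show ?case by (simp add: lin_def)
next
  case (Cons m w)
  have "lin T (\<lambda>x. F (N (f x) m # w))"
    using Cons.prems linD[OF Cons.prems(3)] by (auto simp: lin_def cd_addX[OF ecd_M] cd_lact[OF ecd_M] multilin_head multilin_closed)
  then show ?case
    unfolding dF.simps using Cons.prems
    by (intro lin_add lin_sw scm_T Cons.IH multilin_Cons lins) simp_all
qed

text \<open>Cuts the word at position a and joins the two values by \<beta>; nesting such cuts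
  describes a permutation of blocks of letters.\<close>

definition comb where
  "comb \<beta> a F1 F2 w = \<beta> (F1 (take a w)) (F2 (drop a w))"

context
  fixes \<beta> assumes \<beta>: "equivariant_op \<beta>"
begin

lemma op_closed [simp]: "s \<in> carrier T \<Longrightarrow> t \<in> carrier T \<Longrightarrow> \<beta> s t \<in> carrier T"
  and op_add_l: "s \<in> carrier T \<Longrightarrow> s' \<in> carrier T \<Longrightarrow> t \<in> carrier T \<Longrightarrow> \<beta> (s \<oplus>\<^bsub>T\<^esub> s') t = \<beta> s t \<oplus>\<^bsub>T\<^esub> \<beta> s' t"
  and op_add_r: "s \<in> carrier T \<Longrightarrow> t \<in> carrier T \<Longrightarrow> t' \<in> carrier T \<Longrightarrow> \<beta> s (t \<oplus>\<^bsub>T\<^esub> t') = \<beta> s t \<oplus>\<^bsub>T\<^esub> \<beta> s t'"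
  and op_sc_l: "s \<in> carrier T \<Longrightarrow> t \<in> carrier T \<Longrightarrow> \<beta> (sc T c s) t = sc T c (\<beta> s t)"
  and op_sc_r: "s \<in> carrier T \<Longrightarrow> t \<in> carrier T \<Longrightarrow> \<beta> s (sc T c t) = sc T c (\<beta> s t)"
  and op_hact: "s \<in> carrier T \<Longrightarrow> t \<in> carrier T \<Longrightarrow> hact T x (\<beta> s t) = sw T (\<Delta> x) (\<lambda>p q. \<beta> (hact T p s) (hact T q t))"
  and op_D: "X \<in> carrier V \<Longrightarrow> s \<in> carrier T \<Longrightarrow> t \<in> carrier T \<Longrightarrow>
      D X (\<beta> s t) = \<beta> (D X s) t \<oplus>\<^bsub>T\<^esub> sw T \<rho> (\<lambda>r r'. \<beta> (hact T r s) (D (hact V r' X) t))"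
  using \<beta> unfolding equivariant_op_def by blast+

lemma klin_op: "t \<in> carrier T \<Longrightarrow> klin (\<lambda>s. \<beta> s t)" "s \<in> carrier T \<Longrightarrow> klin (\<lambda>t. \<beta> s t)"
  by (simp_all add: klin_def op_add_l op_add_r op_sc_l op_sc_r)

lemma lin_op: "lin T f \<Longrightarrow> t \<in> carrier T \<Longrightarrow> lin T (\<lambda>x. \<beta> (f x) t)"
  and lin_op_snd: "lin T f \<Longrightarrow> s \<in> carrier T \<Longrightarrow> lin T (\<lambda>x. \<beta> s (f x))"
  by (auto simp: lin_def op_add_l op_add_r op_sc_l op_sc_r)

lemma op_sw_l: "t \<in> carrier T \<Longrightarrow> (\<And>a b. F a b \<in> carrier T) \<Longrightarrow> \<beta> (sw T xs F) t = sw T xs (\<lambda>a b. \<beta> (F a b) t)"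
  by (rule klin_sw[OF klin_op(1)])

lemma wrd_take: "wrd w \<Longrightarrow> wrd (take a w)" and wrd_drop: "wrd w \<Longrightarrow> wrd (drop a w)"
  using set_take_subset[of a w] set_drop_subset[of a w] by auto

lemma multilin_comb:
  assumes F1: "multilin a F1" and F2: "multilin b F2"
  shows "multilin (a + b) (comb \<beta> a F1 F2)"
  unfolding multilin_def
proof (intro conjI allI ballI impI)
  fix w assume "wrd w" "length w = a + b"
  then show "comb \<beta> a F1 F2 w \<in> carrier T"
    by (simp add: comb_def multilin_closed[OF F1] multilin_closed[OF F2] wrd_take wrd_drop)
next
  fix u v c m assume *: "wrd u" "wrd v" "Suc (length u + length v) = a + b" "m \<in> carrier M"
  have split: "(\<exists>k. a = Suc (length u + k) \<and> k \<le> length v) \<or> a \<le> length u"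
    using *(3) by presburger
  show "m' \<in> carrier M \<Longrightarrow> comb \<beta> a F1 F2 (u @ (m \<oplus>\<^bsub>M\<^esub> m') # v) = comb \<beta> a F1 F2 (u @ m # v) \<oplus>\<^bsub>T\<^esub> comb \<beta> a F1 F2 (u @ m' # v)" for m'
    using split
  proof (elim disjE exE conjE)
    assume m': "m' \<in> carrier M"
    fix k assume a: "a = Suc (length u + k)" "k \<le> length v"
    have "F1 (u @ (m \<oplus>\<^bsub>M\<^esub> m') # take k v) = F1 (u @ m # take k v) \<oplus>\<^bsub>T\<^esub> F1 (u @ m' # take k v)"
      using F1 * a m' wrd_take[of v k] unfolding multilin_def by simp
    moreover have "F1 (u @ l # take k v) \<in> carrier T" if "l \<in> carrier M" for l
      using F1 * a that wrd_take[of v k] by (intro multilin_closed[OF F1]) simp_all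
    moreover have "F2 (drop k v) \<in> carrier T"
      using * a wrd_drop[of v k] by (intro multilin_closed[OF F2]) simp_all
    ultimately show ?thesis
      using m' * by (simp add: comb_def a(1) op_add_l)
  next
    assume m': "m' \<in> carrier M" and a: "a \<le> length u"
    have "F2 (drop a u @ (m \<oplus>\<^bsub>M\<^esub> m') # v) = F2 (drop a u @ m # v) \<oplus>\<^bsub>T\<^esub> F2 (drop a u @ m' # v)"
      using F2 * a m' wrd_drop[of u a] unfolding multilin_def by simp
    moreover have "F2 (drop a u @ l # v) \<in> carrier T" if "l \<in> carrier M" for l
      using * a that wrd_drop[of u a] by (intro multilin_closed[OF F2]) simp_all
    moreover have "F1 (take a u) \<in> carrier T"
      using * a wrd_take[of u a] by (intro multilin_closed[OF F1]) simp_all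
    ultimately show ?thesis
      using m' a * by (simp add: comb_def op_add_r)
  qed
  show "comb \<beta> a F1 F2 (u @ sc M c m # v) = sc T c (comb \<beta> a F1 F2 (u @ m # v))"
    using split
  proof (elim disjE exE conjE)
    fix k assume a: "a = Suc (length u + k)" "k \<le> length v"
    have "F1 (u @ sc M c m # take k v) = sc T c (F1 (u @ m # take k v))"
      using F1 * a wrd_take[of v k] unfolding multilin_def by simp
    moreover have "F1 (u @ m # take k v) \<in> carrier T"
      using F1 * a wrd_take[of v k] by (intro multilin_closed[OF F1]) simp_all
    moreover have "F2 (drop k v) \<in> carrier T"
      using * a wrd_drop[of v k] by (intro multilin_closed[OF F2]) simp_all
    ultimately show ?thesis
      using * by (simp add: comb_def a(1) op_sc_l)
  next
    assume a: "a \<le> length u"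
    have "F2 (drop a u @ sc M c m # v) = sc T c (F2 (drop a u @ m # v))"
      using F2 * a wrd_drop[of u a] unfolding multilin_def by simp
    moreover have "F2 (drop a u @ m # v) \<in> carrier T"
      using * a wrd_drop[of u a] by (intro multilin_closed[OF F2]) simp_all
    moreover have "F1 (take a u) \<in> carrier T"
      using * a wrd_take[of u a] by (intro multilin_closed[OF F1]) simp_all
    ultimately show ?thesis
      using a * by (simp add: comb_def op_sc_r)
  qed
qed

lemma comb_Cons: "comb \<beta> (Suc a) F1 F2 (m # w) = comb \<beta> a (\<lambda>v. F1 (m # v)) F2 w"
  by (simp add: comb_def)

lemma hF_comb:
  assumes "multilin a F1" and F2: "multilin b F2" and "wrd w" "length w = a + b"
  shows "hF (comb \<beta> a F1 F2) x w = sw T (\<Delta> x) (\<lambda>p q. \<beta> (hF F1 p (take a w)) (hF F2 q (drop a w)))"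
  using assms(1,3,4)
proof (induction a arbitrary: F1 w x)
  case 0
  have [simp]: "F1 [] \<in> carrier T" using 0 by (simp add: multilin_closed)
  have [simp]: "hF F2 y w \<in> carrier T" for y using 0 F2 by simp
  have "hF (comb \<beta> 0 F1 F2) x w = \<beta> (F1 []) (hF F2 x w)"
    unfolding comb_def take_0 drop_0 using 0 F2 by (intro hF_klin klin_op) simp_all
  also have "\<dots> = sw T (\<Delta> x) (\<lambda>p q. sc T (\<epsilon> p) (\<beta> (F1 []) (hF F2 q w)))"
    by (rule counit_l[symmetric]) (use 0 F2 in \<open>(intro lin_op_snd lin_hF lins | simp)+\<close>)
  finally show ?case by (simp add: op_sc_l)
next
  case (Suc a)
  then obtain m v where w: "w = m # v" by (cases w) auto
  have [simp]: "wrd (take a v)" "wrd (drop a v)" "m \<in> carrier M" "length v = a + b"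
    using Suc.prems wrd_take[of v a] wrd_drop[of v a] by (auto simp: w)
  note ml = multilin_Cons[OF Suc.prems(1)]
  have [simp]: "hF F2 y (drop a v) \<in> carrier T" for y using F2 by simp
  have [simp]: "hF (\<lambda>u. F1 (hact M p m # u)) y (take a v) \<in> carrier T" for y p
    using ml[of "hact M p m"] by simp
  have "hF (comb \<beta> (Suc a) F1 F2) x w =
    sw T (\<Delta> x) (\<lambda>p q. sw T (\<Delta> q) (\<lambda>c d. \<beta> (hF (\<lambda>u. F1 (hact M p m # u)) c (take a v)) (hF F2 d (drop a v))))"
    using Suc.prems by (simp add: w comb_Cons Suc.IH[OF ml])
  also have "\<dots> = sw T (\<Delta> x) (\<lambda>p q. sw T (\<Delta> p) (\<lambda>c d. \<beta> (hF (\<lambda>u. F1 (hact M c m # u)) d (take a v)) (hF F2 q (drop a v))))"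
    by (rule coassoc[symmetric])
      (use Suc.prems(1) F2 ml in \<open>(intro lin_op lin_op_snd lin_hF lin_hF_fun lins | simp)+\<close>)
  finally show ?case by (simp add: w op_sw_l)
qed

text \<open>The Leibniz rule across the cut. A letter moved to the left part contributes one more
  copy of \<rho>, merged by \<open>R_Delta1\<close>; with an empty left part the copy of \<rho>
  vanishes by the counit.\<close>

lemma dF_comb:
  assumes "multilin a F1" and F2: "multilin b F2" and "wrd w" "length w = a + b" "X \<in> carrier V"
  shows "dF (comb \<beta> a F1 F2) X w = \<beta> (dF F1 X (take a w)) (F2 (drop a w)) \<oplus>\<^bsub>T\<^esub>
    sw T \<rho> (\<lambda>r s. \<beta> (hF F1 r (take a w)) (dF F2 (hact V s X) (drop a w)))"
  using assms(1,3,4,5)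
proof (induction a arbitrary: F1 w X)
  case 0
  note [simp] = 0(4)
  have [simp]: "F1 [] \<in> carrier T" using 0 by (simp add: multilin_closed)
  have [simp]: "dF F2 Y w \<in> carrier T" if "Y \<in> carrier V" for Y using 0 F2 that by simp
  have [simp]: "F2 w \<in> carrier T" using 0 F2 by (simp add: multilin_closed)
  have "dF (comb \<beta> 0 F1 F2) X w = \<beta> (F1 []) (dF F2 X w)"
    unfolding comb_def take_0 drop_0 using 0 F2 by (intro dF_klin klin_op) simp_all
  also have "\<dots> = \<beta> (F1 []) (dF F2 (hact V 1 X) w)" by simp
  also have "\<dots> = sw T \<rho> (\<lambda>r s. sc T (\<epsilon> r) (\<beta> (F1 []) (dF F2 (hact V s X) w)))"
    by (rule R_counit_l[symmetric]) (use 0 F2 in \<open>(intro lin_op_snd lin_dF lins | simp)+\<close>)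
  finally show ?case by (simp add: op_sc_l klin_zero[OF klin_op(1)])
next
  case (Suc a)
  note [simp] = Suc.prems(4)
  obtain m v where w: "w = m # v" using Suc.prems by (cases w) auto
  have [simp]: "wrd (take a v)" "wrd (drop a v)" "m \<in> carrier M" "length v = a + b"
    using Suc.prems wrd_take[of v a] wrd_drop[of v a] by (auto simp: w)
  note ml = multilin_Cons[OF Suc.prems(1)]
  have [simp]: "dF F2 Y (drop a v) \<in> carrier T" if "Y \<in> carrier V" for Y using F2 that by simp
  have [simp]: "F2 (drop a v) \<in> carrier T" using F2 by (simp add: multilin_closed)
  have [simp]: "hF (\<lambda>u. F1 (hact M p m # u)) y (take a v) \<in> carrier T" for y p
    using ml[of "hact M p m"] by simp
  have [simp]: "dF (\<lambda>u. F1 (hact M p m # u)) Y (take a v) \<in> carrier T" if "Y \<in> carrier V" for Y p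
    using ml[of "hact M p m"] that by simp
  have [simp]: "F1 (l # take a v) \<in> carrier T" if "l \<in> carrier M" for l
    using multilin_closed[OF Suc.prems(1)] that by simp
  have "sw T \<rho> (\<lambda>r s. sw T \<rho> (\<lambda>r' s'. \<beta> (hF (\<lambda>u. F1 (hact M r m # u)) r' (take a v)) (dF F2 (hact V (s' * s) X) (drop a v)))) =
    sw T \<rho> (\<lambda>r' s'. sw T \<rho> (\<lambda>r s. \<beta> (hF (\<lambda>u. F1 (hact M r m # u)) r' (take a v)) (dF F2 (hact V (s' * s) X) (drop a v))))"
    by (rule sw_swap) simp_all
  also have "\<dots> = sw T \<rho> (\<lambda>r s. sw T (\<Delta> r) (\<lambda>p q. \<beta> (hF (\<lambda>u. F1 (hact M p m # u)) q (take a v)) (dF F2 (hact V s X) (drop a v))))"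
    by (rule R_Delta1[symmetric])
      (use Suc.prems(1) F2 ml in \<open>(intro lin_op lin_op_snd lin_hF lin_hF_fun lin_dF lins | simp)+\<close>)
  finally have 1: "sw T \<rho> (\<lambda>r s. sw T \<rho> (\<lambda>r' s'. \<beta> (hF (\<lambda>u. F1 (hact M r m # u)) r' (take a v)) (dF F2 (hact V (s' * s) X) (drop a v)))) =
    sw T \<rho> (\<lambda>r s. \<beta> (hF F1 r (m # take a v)) (dF F2 (hact V s X) (drop a v)))"
    by (simp add: op_sw_l)
  have c: "comb \<beta> a (\<lambda>u. F1 (N X m # u)) F2 v = \<beta> (F1 (N X m # take a v)) (F2 (drop a v))"
    by (simp add: comb_def)
  have "dF (comb \<beta> (Suc a) F1 F2) X w = \<beta> (F1 (N X m # take a v)) (F2 (drop a v)) \<oplus>\<^bsub>T\<^esub>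
    sw T \<rho> (\<lambda>r s. dF (comb \<beta> a (\<lambda>u. F1 (hact M r m # u)) F2) (hact V s X) v)"
    by (simp add: w comb_Cons c)
  also have "\<dots> = \<beta> (F1 (N X m # take a v)) (F2 (drop a v)) \<oplus>\<^bsub>T\<^esub>
    (sw T \<rho> (\<lambda>r s. \<beta> (dF (\<lambda>u. F1 (hact M r m # u)) (hact V s X) (take a v)) (F2 (drop a v))) \<oplus>\<^bsub>T\<^esub>
     sw T \<rho> (\<lambda>r s. \<beta> (hF F1 r (m # take a v)) (dF F2 (hact V s X) (drop a v))))"
    using Suc.prems by (simp add: w Suc.IH[OF ml] sw_add[OF T_ab] hact_mult[OF bsb_V, symmetric] 1 del: hF.simps)
  finally show ?case
    by (simp add: w op_add_l op_sw_l T.a_assoc sw_closed del: hF.simps) (simp add: op_sw_l T.a_assoc sw_closed)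
qed

end

end

section \<open>Word functions that commute with the action and the derivative\<close>

context tensor_cov_deriv
begin

text \<open>Acting on the letters and then evaluating agrees with evaluating and then acting, for H
  and for every derivation. By \<open>natural_comb\<close> the property passes through products and
  braids, which is how the exchange acquires it.\<close>

definition natural :: "nat \<Rightarrow> ('m list \<Rightarrow> 'a \<times> ('m list \<Rightarrow>\<^sub>0 int) set) \<Rightarrow> bool" where
  "natural n F \<longleftrightarrow> multilin n F \<and> (\<forall>w. wrd w \<longrightarrow> length w = n \<longrightarrow>
     (\<forall>x. hF F x w = hact T x (F w)) \<and> (\<forall>X\<in>carrier V. dF F X w = D X (F w)))"

lemma multilin_cw: "multilin n cw"
  unfolding multilin_def
proof (intro conjI allI ballI impI)
  fix u v c m m' assume [simp]: "wrd u" "wrd v" "m \<in> carrier M"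
  have split: "cw (u @ l # v) = cw u \<otimes>\<^bsub>T\<^esub> (cw [l] \<otimes>\<^bsub>T\<^esub> cw v)" if "l \<in> carrier M" for l
    using cw_append[of u "l # v"] cw_Cons[OF that, of v] that by simp
  show "m' \<in> carrier M \<Longrightarrow> cw (u @ (m \<oplus>\<^bsub>M\<^esub> m') # v) = cw (u @ m # v) \<oplus>\<^bsub>T\<^esub> cw (u @ m' # v)"
    by (simp add: split cw_add T.l_distr T.r_distr)
  have "cw u \<otimes>\<^bsub>T\<^esub> (in0 (asmult A c 1) \<otimes>\<^bsub>T\<^esub> t) = in0 (asmult A c 1) \<otimes>\<^bsub>T\<^esub> (cw u \<otimes>\<^bsub>T\<^esub> t)"
    if "t \<in> carrier T" for t
    using that in0_central[of "cw u" c] by (simp flip: T.m_assoc)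
  then show "cw (u @ sc M c m # v) = sc T c (cw (u @ m # v))"
    by (simp add: split cw_lact T_lact T.m_assoc)
qed simp

lemma hF_cw: "wrd w \<Longrightarrow> hF cw x w = hw x w"
proof (induction w arbitrary: x)
  case Nil
  then show ?case by (simp add: T_lact aact_1)
next
  case (Cons m w)
  have "hF (\<lambda>w'. cw (hact M p m # w')) q w = cw [hact M p m] \<otimes>\<^bsub>T\<^esub> hw q w" for p q
  proof -
    have "hF (\<lambda>w'. cw (hact M p m # w')) q w = hF (\<lambda>w'. cw [hact M p m] \<otimes>\<^bsub>T\<^esub> cw w') q w"
      by (rule hF_cong, rule cw_Cons) (use Cons.prems in simp_all)
    also have "\<dots> = cw [hact M p m] \<otimes>\<^bsub>T\<^esub> hF cw q w"
      by (rule hF_klin[OF klin_op(2)[OF equivariant_op_mult]]) (use Cons.prems in \<open>simp_all add: multilin_cw\<close>)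
    finally show ?thesis using Cons by simp
  qed
  then show ?case by simp
qed

lemma dF_cw: "wrd w \<Longrightarrow> X \<in> carrier V \<Longrightarrow> dF cw X w = dw X w"
proof (induction w arbitrary: X)
  case (Cons m w)
  have *: "dF (\<lambda>w'. cw (hact M r m # w')) (hact V s X) w = cw [hact M r m] \<otimes>\<^bsub>T\<^esub> dw (hact V s X) w" for r s
  proof -
    have "dF (\<lambda>w'. cw (hact M r m # w')) (hact V s X) w = dF (\<lambda>w'. cw [hact M r m] \<otimes>\<^bsub>T\<^esub> cw w') (hact V s X) w"
      by (rule dF_cong, rule cw_Cons) (use Cons.prems in simp_all)
    also have "\<dots> = cw [hact M r m] \<otimes>\<^bsub>T\<^esub> dF cw (hact V s X) w"
      by (rule dF_klin[OF klin_op(2)[OF equivariant_op_mult]]) (use Cons.prems in \<open>simp_all add: multilin_cw\<close>)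
    finally show ?thesis using Cons by simp
  qed
  have "cw (N X m # w) = cw [N X m] \<otimes>\<^bsub>T\<^esub> cw w"
    by (rule cw_Cons) (use Cons.prems in simp_all)
  then show ?case by (simp only: dF.simps dw.simps *)
qed simp

lemma natural_cw: "natural n cw"
  by (simp add: natural_def multilin_cw hF_cw dF_cw T_hact_cw D_cw)

lemma natural_comb:
  assumes \<beta>: "equivariant_op \<beta>" and F: "natural a F1" "natural b F2"
  shows "natural (a + b) (comb \<beta> a F1 F2)"
proof -
  have ml: "multilin a F1" "multilin b F2" using F by (auto simp: natural_def)
  have F1: "F1 (take a w) \<in> carrier T" "hF F1 x (take a w) = hact T x (F1 (take a w))"
    "X \<in> carrier V \<Longrightarrow> dF F1 X (take a w) = D X (F1 (take a w))"
    if "wrd w" "length w = a + b" for x X w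
    using F(1) that wrd_take[OF \<beta>, of w a] multilin_closed[OF ml(1), of "take a w"] by (simp_all add: natural_def)
  have F2: "F2 (drop a w) \<in> carrier T" "hF F2 x (drop a w) = hact T x (F2 (drop a w))"
    "X \<in> carrier V \<Longrightarrow> dF F2 X (drop a w) = D X (F2 (drop a w))"
    if "wrd w" "length w = a + b" for x X w
    using F(2) that wrd_drop[OF \<beta>, of w a] multilin_closed[OF ml(2), of "drop a w"] by (simp_all add: natural_def)
  show ?thesis
    unfolding natural_def
    by (auto simp: multilin_comb[OF \<beta> ml] hF_comb[OF \<beta> ml] dF_comb[OF \<beta> ml] F1 F2 op_hact[OF \<beta>] op_D[OF \<beta>])
      (simp_all add: comb_def op_hact[OF \<beta>] op_D[OF \<beta>] F1 F2)
qed

subsection \<open>The exchange of two factors as a natural word function\<close>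

text \<open>On a word p m mid n q, with m and n at positions i and j, this is p * braid(m,
  braid(mid, n)) * q: first n crosses the letters in between, then m crosses the result. The block
  from m to n has length \<open>Suc (j - i)\<close>.\<close>

definition exT :: "nat \<Rightarrow> nat \<Rightarrow> 'm list \<Rightarrow> 'a \<times> ('m list \<Rightarrow>\<^sub>0 int) set" where
  "exT i j = comb (\<lambda>s t. s \<otimes>\<^bsub>T\<^esub> t) i cw
     (comb (\<lambda>s t. s \<otimes>\<^bsub>T\<^esub> t) (Suc (j - i)) (comb braid 1 cw (comb braid (j - Suc i) cw cw)) cw)"

lemma natural_exT:
  assumes "i < j" "j < n"
  shows "natural n (exT i j)"
proof -
  have "natural (i + ((1 + ((j - Suc i) + 1)) + (n - Suc j)))
    (comb (\<lambda>s t. s \<otimes>\<^bsub>T\<^esub> t) i cw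
     (comb (\<lambda>s t. s \<otimes>\<^bsub>T\<^esub> t) (1 + ((j - Suc i) + 1)) (comb braid 1 cw (comb braid (j - Suc i) cw cw)) cw))"
    by (intro natural_comb natural_cw equivariant_op_mult equivariant_op_braid)
  moreover have "1 + ((j - Suc i) + 1) = Suc (j - i)" "i + ((1 + ((j - Suc i) + 1)) + (n - Suc j)) = n"
    using assms by simp_all
  ultimately show ?thesis by (simp only: exT_def)
qed

lemma lsum_cw_context:
  assumes "\<And>z. z \<in> set L \<Longrightarrow> wrd z" "wrd p" "wrd q"
  shows "lsum T (map (\<lambda>z. cw (p @ z @ q)) L) = cw p \<otimes>\<^bsub>T\<^esub> lsum T (map cw L) \<otimes>\<^bsub>T\<^esub> cw q"
proof -
  have "cw p \<otimes>\<^bsub>T\<^esub> lsum T (map cw L) \<otimes>\<^bsub>T\<^esub> cw q = lsum T (map (\<lambda>t. cw p \<otimes>\<^bsub>T\<^esub> t \<otimes>\<^bsub>T\<^esub> cw q) (map cw L))"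
    by (rule lsum_hom[where \<phi> = "\<lambda>t. cw p \<otimes>\<^bsub>T\<^esub> t \<otimes>\<^bsub>T\<^esub> cw q"]) (use assms in \<open>auto simp: T.r_distr T.l_distr\<close>)
  also have "map (\<lambda>t. cw p \<otimes>\<^bsub>T\<^esub> t \<otimes>\<^bsub>T\<^esub> cw q) (map cw L) = map (\<lambda>z. cw (p @ z @ q)) L"
    using assms by (simp add: cw_append T.m_assoc)
  finally show ?thesis ..
qed

lemma lsum_concat_sw:
  assumes "\<And>r s x. x \<in> set (G r s) \<Longrightarrow> F x \<in> carrier T"
  shows "lsum T (map F (concat (map (\<lambda>(r, s). G r s) xs))) = sw T xs (\<lambda>r s. lsum T (map F (G r s)))"
proof -
  have "lsum T (map F (concat (map (\<lambda>(r, s). G r s) xs))) = lsum T (concat (map (\<lambda>(r, s). map F (G r s)) xs))"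
    by (simp add: map_concat o_def case_prod_unfold)
  also have "\<dots> = lsum T (map (lsum T) (map (\<lambda>(r, s). map F (G r s)) xs))"
  proof (rule lsum_concat_T)
    fix ys assume "ys \<in> set (map (\<lambda>(r, s). map F (G r s)) xs)"
    then obtain r s where "ys = map F (G r s)" by auto
    then show "set ys \<subseteq> carrier T" using assms by auto
  qed
  also have "\<dots> = sw T xs (\<lambda>r s. lsum T (map F (G r s)))"
    by (simp add: sw_def o_def case_prod_unfold)
  finally show ?thesis .
qed

lemma exchange_word_cw:
  assumes w: "wrd p" "wrd mid" "wrd q" "m \<in> carrier M" "n \<in> carrier M"
    and ij: "i = length p" "j = Suc (length p + length mid)"
  shows "lsum T (map cw (exchange_word H R M i j (p @ m # mid @ n # q))) = exT i j (p @ m # mid @ n # q)" (is ?sum)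
    and "\<forall>v\<in>set (exchange_word H R M i j (p @ m # mid @ n # q)). v \<noteq> [] \<and> wrd v" (is ?wrd)
proof -
  note [simp] = w
  define inner where "inner = (if mid = [] then [[n]]
     else concat (map (\<lambda>(r, s). map (\<lambda>z. hact M r n # z) (word_hact_list H M s mid)) \<rho>))"
  have inner: "z \<noteq> []" "wrd z" if z: "z \<in> set inner" for z
  proof -
    consider "z = [n]" | r s v where "mid \<noteq> []" "z = hact M r n # v" "v \<in> set (word_hact_list H M s mid)"
      using z by (auto simp: inner_def split: if_splits)
    then have "z \<noteq> [] \<and> wrd z"
    proof cases
      case (2 r s v)
      then have "wrd v" using word_hact_list_wrd[OF w(2), of s] by blast
      then show ?thesis using 2 by simp
    qed simp
    then show "z \<noteq> []" "wrd z" by simp_all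
  qed
  have ex: "exchange_word H R M i j (p @ m # mid @ n # q) =
    concat (map (\<lambda>(r, s). concat (map (\<lambda>z. map (\<lambda>z'. p @ z' @ hact M s m # q) (word_hact_list H M r z)) inner)) \<rho>)"
    by (simp add: exchange_word_def Let_def ij inner_def nth_append)
  have whl: "z' \<noteq> []" "wrd z'" if "z \<in> set inner" "z' \<in> set (word_hact_list H M r z)" for z z' r
    using word_hact_list_wrd[of z r] inner[OF that(1)] that(2) by auto
  show ?wrd
  proof
    fix v assume "v \<in> set (exchange_word H R M i j (p @ m # mid @ n # q))"
    then obtain s z z' r where "v = p @ z' @ hact M s m # q" "z \<in> set inner" "z' \<in> set (word_hact_list H M r z)"
      by (auto simp: ex)
    then show "v \<noteq> [] \<and> wrd v" using whl(2)[of z z' r] by simp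
  qed
  have B: "lsum T (map cw inner) = braid (cw mid) (cw [n])"
  proof (cases "mid = []")
    \<comment> \<open>With nothing in between, \<open>exchange_word\<close> omits the inner
      braiding. It agrees with braiding against the unit, which is trivial by the counit on the
      second leg of \<rho>.\<close>
    case True
    have "sw T \<rho> (\<lambda>r s. sc T (\<epsilon> s) (hact T r (cw [n]))) = hact T 1 (cw [n])"
      by (rule R_counit_r) (intro lins | simp)+
    moreover have "hact T x (in0 1) = in0 (asmult A (\<epsilon> x) 1)" for x
      by (simp add: T_hact_in0 aact_1)
    ultimately show ?thesis
      using True by (simp add: inner_def braid_def T_lact in0_central flip: in0_one)
  next
    case False
    have "lsum T (map cw inner) = sw T \<rho> (\<lambda>r s. lsum T (map cw (map (\<lambda>z. hact M r n # z) (word_hact_list H M s mid))))"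
      unfolding inner_def using False word_hact_list_wrd[of mid]
      by (simp only: if_False) (rule lsum_concat_sw, auto)
    also have "\<dots> = sw T \<rho> (\<lambda>r s. cw [hact M r n] \<otimes>\<^bsub>T\<^esub> hw s mid)"
    proof (rule sw_cong)
      fix r s
      have "\<And>z. z \<in> set (word_hact_list H M s mid) \<Longrightarrow> wrd z" using word_hact_list_wrd[of mid s] by auto
      then show "lsum T (map cw (map (\<lambda>z. hact M r n # z) (word_hact_list H M s mid))) = cw [hact M r n] \<otimes>\<^bsub>T\<^esub> hw s mid"
        using lsum_cw_context[of "word_hact_list H M s mid" "[hact M r n]" "[]"] False
        by (simp add: o_def hw_word_hact_list)
    qed
    also have "\<dots> = braid (cw mid) (cw [n])"
      by (simp add: braid_def T_hact_cw hw_single del: hw.simps)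
    finally show ?thesis .
  qed
  have cwi: "set (map cw inner) \<subseteq> carrier T" using inner by auto
  have "lsum T (map cw (exchange_word H R M i j (p @ m # mid @ n # q))) =
    sw T \<rho> (\<lambda>r s. lsum T (map cw (concat (map (\<lambda>z. map (\<lambda>z'. p @ z' @ hact M s m # q) (word_hact_list H M r z)) inner))))"
    unfolding ex by (rule lsum_concat_sw) (use whl in auto)
  also have "\<dots> = sw T \<rho> (\<lambda>r s. cw p \<otimes>\<^bsub>T\<^esub> hact T r (lsum T (map cw inner)) \<otimes>\<^bsub>T\<^esub> cw (hact M s m # q))"
  proof (rule sw_cong)
    fix r s
    have "lsum T (map cw (concat (map (\<lambda>z. map (\<lambda>z'. p @ z' @ hact M s m # q) (word_hact_list H M r z)) inner))) =
      lsum T (concat (map (\<lambda>z. map (\<lambda>z'. cw (p @ z' @ hact M s m # q)) (word_hact_list H M r z)) inner))"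
      by (simp add: map_concat o_def)
    also have "\<dots> = lsum T (map (lsum T) (map (\<lambda>z. map (\<lambda>z'. cw (p @ z' @ hact M s m # q)) (word_hact_list H M r z)) inner))"
      by (rule lsum_concat_T) (use whl in auto)
    also have "\<dots> = lsum T (map (\<lambda>t. cw p \<otimes>\<^bsub>T\<^esub> hact T r t \<otimes>\<^bsub>T\<^esub> cw (hact M s m # q)) (map cw inner))"
    proof -
      have "lsum T (map (\<lambda>z'. cw (p @ z' @ hact M s m # q)) (word_hact_list H M r z)) =
        cw p \<otimes>\<^bsub>T\<^esub> hact T r (cw z) \<otimes>\<^bsub>T\<^esub> cw (hact M s m # q)" if "z \<in> set inner" for z
        by (subst lsum_cw_context) (use inner[OF that] whl[OF that] in \<open>simp_all add: hw_word_hact_list T_hact_cw\<close>)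
      then show ?thesis by (simp add: o_def cong: map_cong)
    qed
    also have "\<dots> = cw p \<otimes>\<^bsub>T\<^esub> hact T r (lsum T (map cw inner)) \<otimes>\<^bsub>T\<^esub> cw (hact M s m # q)"
      by (rule lsum_hom[symmetric, where \<phi> = "\<lambda>t. cw p \<otimes>\<^bsub>T\<^esub> hact T r t \<otimes>\<^bsub>T\<^esub> cw (hact M s m # q)"])
        (use cwi in \<open>auto simp: T_hact_add T.r_distr T.l_distr\<close>)
    finally show "lsum T (map cw (concat (map (\<lambda>z. map (\<lambda>z'. p @ z' @ hact M s m # q) (word_hact_list H M r z)) inner))) =
      cw p \<otimes>\<^bsub>T\<^esub> hact T r (lsum T (map cw inner)) \<otimes>\<^bsub>T\<^esub> cw (hact M s m # q)" .
  qed
  also have "\<dots> = cw p \<otimes>\<^bsub>T\<^esub> (braid (cw [m]) (braid (cw mid) (cw [n])) \<otimes>\<^bsub>T\<^esub> cw q)"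
    by (simp add: B braid_def[of "cw [m]"] T_hact_cw[of "[m]"] hw_single T_mult_sw T_mult_sw' cw_Cons[of _ q] T.m_assoc del: hw.simps)
  also have "\<dots> = exT i j (p @ m # mid @ n # q)"
    by (simp add: exT_def comb_def ij)
  finally show ?sum .
qed

lemma exchange_word_sum:
  assumes "wrd w" "i < j" "j < length w"
  shows "lsum T (map cw (exchange_word H R M i j w)) = exT i j w"
    and "\<forall>v\<in>set (exchange_word H R M i j w). v \<noteq> [] \<and> wrd v"
proof -
  define p mid q where "p = take i w" and "mid = take (j - Suc i) (drop (Suc i) w)" and "q = drop (Suc j) w"
  have w1: "w = p @ w ! i # drop (Suc i) w"
    unfolding p_def using assms by (intro id_take_nth_drop) simp
  have "drop (Suc i) w = mid @ drop (Suc i) w ! (j - Suc i) # drop (Suc (j - Suc i)) (drop (Suc i) w)"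
    unfolding mid_def using assms by (intro id_take_nth_drop) simp
  then have w2: "drop (Suc i) w = mid @ w ! j # q"
    using assms by (simp add: q_def)
  have w: "w = p @ w ! i # mid @ w ! j # q" using w1 w2 by simp
  have "set p \<subseteq> set w" "set mid \<subseteq> set w" "set q \<subseteq> set w" "w ! i \<in> set w" "w ! j \<in> set w"
    using assms unfolding p_def mid_def q_def
    by (auto dest: in_set_takeD in_set_dropD)
  then have c: "wrd p" "wrd mid" "wrd q" "w ! i \<in> carrier M" "w ! j \<in> carrier M" using assms(1) by auto
  have l: "i = length p" "j = Suc (length p + length mid)"
    using assms by (simp_all add: p_def mid_def)
  show "lsum T (map cw (exchange_word H R M i j w)) = exT i j w"
    "\<forall>v\<in>set (exchange_word H R M i j w). v \<noteq> [] \<and> wrd v"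
    using exchange_word_cw[OF c l, folded w] .
qed

text \<open>The counterpart of \<open>word_hact_list\<close> for the derivative. Fixedness under an
  exchange is a property of representatives in words of one length, so D has to be lifted to words
  without changing the length.\<close>

fun nw :: "('a \<Rightarrow> 'a) \<Rightarrow> 'm list \<Rightarrow> 'm list list" where
  "nw X [] = []"
| "nw X (m # w) = (N X m # w) # concat (map (\<lambda>(r, s). map (\<lambda>v. hact M r m # v) (nw (hact V s X) w)) \<rho>)"

lemma nw_wrd: "wrd w \<Longrightarrow> X \<in> carrier V \<Longrightarrow> \<forall>v\<in>set (nw X w). wrd v \<and> length v = length w"
proof (induction w arbitrary: X)
  case (Cons m w)
  have IH: "\<forall>v\<in>set (nw (hact V s X) w). wrd v \<and> length v = length w" for s
    by (rule Cons.IH) (use Cons.prems in simp_all)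
  show ?case
  proof
    fix v assume "v \<in> set (nw X (m # w))"
    then consider "v = N X m # w" | r s u where "v = hact M r m # u" "u \<in> set (nw (hact V s X) w)" by auto
    then show "wrd v \<and> length v = length (m # w)"
      using IH Cons.prems by cases auto
  qed
qed simp

lemma lsum_nw: "multilin (length w) F \<Longrightarrow> wrd w \<Longrightarrow> X \<in> carrier V \<Longrightarrow> lsum T (map F (nw X w)) = dF F X w"
proof (induction w arbitrary: F X)
  case (Cons m w)
  have "lsum T (map F (concat (map (\<lambda>(r, s). map (\<lambda>v. hact M r m # v) (nw (hact V s X) w)) \<rho>))) =
    sw T \<rho> (\<lambda>r s. lsum T (map F (map (\<lambda>v. hact M r m # v) (nw (hact V s X) w))))"
  proof (rule lsum_concat_sw)
    fix r s v assume "v \<in> set (map (\<lambda>v. hact M r m # v) (nw (hact V s X) w))"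
    then obtain u where "v = hact M r m # u" "u \<in> set (nw (hact V s X) w)" by auto
    then show "F v \<in> carrier T"
      using Cons.prems nw_wrd[of w "hact V s X"] by (intro multilin_closed[OF Cons.prems(1)]) simp_all
  qed
  also have "\<dots> = sw T \<rho> (\<lambda>r s. dF (\<lambda>v. F (hact M r m # v)) (hact V s X) w)"
    by (rule sw_cong) (use Cons.prems in \<open>simp add: o_def Cons.IH[symmetric] multilin_Cons\<close>)
  finally show ?case by simp
qed simp

lemma word_hact_list_length: "\<forall>v\<in>set (word_hact_list H M x w). length v = length w"
proof (induction w arbitrary: x rule: induct_list012)
  case (3 m n w)
  show ?case
  proof
    fix v assume "v \<in> set (word_hact_list H M x (m # n # w))"
    then obtain p q u where "v = hact M p m # u" "u \<in> set (word_hact_list H M q (n # w))" by auto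
    then show "length v = length (m # n # w)" using 3(2)[of q] by simp
  qed
qed simp_all

lemma lsum_word_hact_list: "w \<noteq> [] \<Longrightarrow> multilin (length w) F \<Longrightarrow> wrd w \<Longrightarrow> lsum T (map F (word_hact_list H M x w)) = hF F x w"
proof (induction w arbitrary: F x rule: induct_list012)
  case (2 m)
  have "hF F x [m] = sw T (\<Delta> x) (\<lambda>p q. sc T (\<epsilon> q) (F [hact M p m]))" by simp
  also have "\<dots> = F [hact M x m]"
  proof (rule counit_r)
    have "F [l] \<in> carrier T" if "l \<in> carrier M" for l
      using 2 that by (intro multilin_closed[of 1]) simp_all
    then show "lin T (\<lambda>x. F [hact M x m])"
      using 2 multilin_head[of 0 F "[]"] by (auto simp: lin_def hact_add' hact_scale)
  qed simp
  moreover have "F [hact M x m] \<in> carrier T" using 2 by (intro multilin_closed[of 1]) simp_all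
  ultimately show ?case by simp
next
  case (3 m n w)
  have "lsum T (map F (word_hact_list H M x (m # n # w))) =
    sw T (\<Delta> x) (\<lambda>p q. lsum T (map F (map (\<lambda>v. hact M p m # v) (word_hact_list H M q (n # w)))))"
    unfolding word_hact_list.simps
  proof (rule lsum_concat_sw)
    fix p q v assume "v \<in> set (map (\<lambda>v. hact M p m # v) (word_hact_list H M q (n # w)))"
    then obtain u where "v = hact M p m # u" "u \<in> set (word_hact_list H M q (n # w))" by auto
    then show "F v \<in> carrier T"
      using 3(4,5) word_hact_list_wrd[of "n # w" q] word_hact_list_length[of q "n # w"]
      by (intro multilin_closed[OF 3(4)]) simp_all
  qed
  also have "\<dots> = sw T (\<Delta> x) (\<lambda>p q. hF (\<lambda>v. F (hact M p m # v)) q (n # w))"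
  proof (rule sw_cong)
    fix p q
    have "lsum T (map (\<lambda>v. F (hact M p m # v)) (word_hact_list H M q (n # w))) = hF (\<lambda>v. F (hact M p m # v)) q (n # w)"
      by (rule 3(2)) (use 3(4,5) in \<open>simp_all add: multilin_Cons\<close>)
    then show "lsum T (map F (map (\<lambda>v. hact M p m # v) (word_hact_list H M q (n # w)))) = hF (\<lambda>v. F (hact M p m # v)) q (n # w)"
      by (simp add: o_def)
  qed
  finally show ?case by simp
qed simp

subsection \<open>Stability of the exchange-fixed elements\<close>

text \<open>Translates a list-valued operation on formal sums into an additive map with values in T.
  The predicate \<open>P\<close> confines it to words on which the lists are known to be well
  formed; later these are the words of one length.\<close>

lemma cl_frag_extend:
  assumes g: "\<And>w v. P w \<Longrightarrow> v \<in> set (g w) \<Longrightarrow> v \<noteq> [] \<and> wrd v" and f: "Poly_Mapping.keys f \<subseteq> Collect P"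
  shows "good (frag_extend (\<lambda>w. \<Sum>v\<leftarrow>g w. frag_of v) f) \<and>
    (0, cl (frag_extend (\<lambda>w. \<Sum>v\<leftarrow>g w. frag_of v) f)) = wlift T (\<lambda>w. if P w then lsum T (map cw (g w)) else \<zero>\<^bsub>T\<^esub>) f"
proof -
  have cwg: "set (map cw (g w)) \<subseteq> carrier T" if "P w" for w using g[OF that] by auto
  interpret word_lift T "\<lambda>w. if P w then lsum T (map cw (g w)) else \<zero>\<^bsub>T\<^esub>"
    by (intro word_lift.intro word_lift_axioms.intro T_ab) (use cwg T.lsum_closed in auto)
  have sum: "good (\<Sum>v\<leftarrow>vs. frag_of v) \<and> (0, cl (\<Sum>v\<leftarrow>vs. frag_of v)) = lsum T (map cw vs)"
    if "\<And>v. v \<in> set vs \<Longrightarrow> v \<noteq> [] \<and> wrd v" for vs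
    using that
  proof (induction vs)
    case (Cons v vs)
    then have IH: "good (\<Sum>v\<leftarrow>vs. frag_of v)" "lsum T (map cw vs) = (0, cl (\<Sum>v\<leftarrow>vs. frag_of v))"
      and v: "v \<noteq> []" "wrd v" by simp_all
    have "cw v = (0, cl (frag_of v))" using v by (simp add: cw_def)
    then show ?case using IH v by (simp add: T_add)
  qed (simp add: T_zero)
  show ?thesis
    using f
  proof (rule free_Abelian_group_induct)
    fix f h
    let ?E = "frag_extend (\<lambda>w. \<Sum>v\<leftarrow>g w. frag_of v)" and ?L = "wlift T (\<lambda>w. if P w then lsum T (map cw (g w)) else \<zero>\<^bsub>T\<^esub>)"
    assume *: "good (?E f) \<and> (0, cl (?E f)) = ?L f" "good (?E h) \<and> (0, cl (?E h)) = ?L h"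
    then have "(0, cl (?E f - ?E h)) = ?L f \<ominus>\<^bsub>T\<^esub> ?L h"
      using T_minus[of "?E f" "?E h" 0 0] by simp
    then show "good (?E (f - h)) \<and> (0, cl (?E (f - h))) = ?L (f - h)"
      unfolding frag_extend_diff wlift_diff using * by simp
  next
    fix w assume "w \<in> Collect P"
    then show "good (frag_extend (\<lambda>w. \<Sum>v\<leftarrow>g w. frag_of v) (frag_of w)) \<and>
        (0, cl (frag_extend (\<lambda>w. \<Sum>v\<leftarrow>g w. frag_of v) (frag_of w))) = wlift T (\<lambda>w. if P w then lsum T (map cw (g w)) else \<zero>\<^bsub>T\<^esub>) (frag_of w)"
      using sum[of "g w"] g by simp
  qed (simp add: T_zero)
qed

lemma frag_extend_compose:
  "frag_extend (\<lambda>w. \<Sum>v\<leftarrow>h w. frag_of v) (frag_extend (\<lambda>w. \<Sum>v\<leftarrow>g w. frag_of v) f) =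
   frag_extend (\<lambda>w. \<Sum>v\<leftarrow>concat (map h (g w)). frag_of v) f"
proof -
  have sum: "frag_extend (\<lambda>w. \<Sum>v\<leftarrow>h w. frag_of v) (\<Sum>v\<leftarrow>vs. frag_of v) = (\<Sum>v\<leftarrow>concat (map h vs). frag_of v)" for vs
    by (induction vs) (simp_all add: frag_extend_add)
  have "Poly_Mapping.keys f \<subseteq> UNIV" by simp
  then show ?thesis
    by (induction f rule: frag_induction) (simp_all only: frag_extend_diff frag_extend_of sum frag_extend_0)
qed

lemma wlift_comp:
  assumes "\<And>s. s \<in> carrier T \<Longrightarrow> \<phi> s \<in> carrier T"
    and "\<And>s t. s \<in> carrier T \<Longrightarrow> t \<in> carrier T \<Longrightarrow> \<phi> (s \<oplus>\<^bsub>T\<^esub> t) = \<phi> s \<oplus>\<^bsub>T\<^esub> \<phi> t"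
    and "\<And>w. F w \<in> carrier T"
  shows "wlift T (\<lambda>w. \<phi> (F w)) f = \<phi> (wlift T F f)"
proof -
  interpret F: word_lift T F by (intro word_lift.intro word_lift_axioms.intro T_ab assms(3))
  interpret G: word_lift T "\<lambda>w. \<phi> (F w)" by (intro word_lift.intro word_lift_axioms.intro T_ab assms)
  have minus: "\<phi> (s \<ominus>\<^bsub>T\<^esub> t) = \<phi> s \<ominus>\<^bsub>T\<^esub> \<phi> t" if "s \<in> carrier T" "t \<in> carrier T" for s t
    by (rule additive_minus[where \<phi> = \<phi>]) (simp_all add: assms that)
  have zero: "\<phi> \<zero>\<^bsub>T\<^esub> = \<zero>\<^bsub>T\<^esub>" by (rule additive_zero[where \<phi> = \<phi>]) (simp_all add: assms)
  have "Poly_Mapping.keys f \<subseteq> UNIV" by simp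
  then show ?thesis
    by (induction f rule: frag_induction) (simp_all add: F.wlift_diff G.wlift_diff minus zero)
qed

text \<open>Let f' be f with every word replaced by its list under g. Naturality of
  \<open>cw\<close> says that f' represents the image of f under \<phi>, and naturality of
  \<open>exT\<close> says that the exchange of f' represents the image of the exchange of f. If f
  and its exchange have one class, so have f' and its exchange.\<close>

lemma exchange_fixed_stable:
  assumes \<phi>: "\<And>s. s \<in> carrier T \<Longrightarrow> \<phi> s \<in> carrier T"
    "\<And>s t. s \<in> carrier T \<Longrightarrow> t \<in> carrier T \<Longrightarrow> \<phi> (s \<oplus>\<^bsub>T\<^esub> t) = \<phi> s \<oplus>\<^bsub>T\<^esub> \<phi> t"
    and g: "\<And>w v. w \<noteq> [] \<Longrightarrow> wrd w \<Longrightarrow> v \<in> set (g w) \<Longrightarrow> wrd v \<and> length v = length w"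
    and nat: "\<And>F w. w \<noteq> [] \<Longrightarrow> wrd w \<Longrightarrow> natural (length w) F \<Longrightarrow> lsum T (map F (g w)) = \<phi> (F w)"
    and t: "t \<in> exchange_fixed H R M"
  shows "\<phi> t \<in> exchange_fixed H R M"
proof -
  obtain f i j k where t: "t = (0, cl f)" and ij: "i < j" "j < k"
    and f: "\<And>w. w \<in> Poly_Mapping.keys f \<Longrightarrow> length w = k \<and> wrd w" and fixd: "cl (exchange H R M i j f) = cl f"
    using t unfolding exchange_fixed_def by blast
  define P where "P w \<longleftrightarrow> wrd w \<and> length w = k" for w
  have P: "w \<noteq> []" "wrd w" "length w = k" if "P w" for w using that ij by (auto simp: P_def)
  have keys: "Poly_Mapping.keys f \<subseteq> Collect P" using f by (auto simp: P_def)
  have gP: "P v" if "P w" "v \<in> set (g w)" for v w using g[of w v] P[OF that(1)] that by (auto simp: P_def)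
  have phi_zero: "\<phi> \<zero>\<^bsub>T\<^esub> = \<zero>\<^bsub>T\<^esub>" by (rule additive_zero[where \<phi> = \<phi>]) (simp_all add: \<phi>)
  define f' where "f' = frag_extend (\<lambda>w. \<Sum>v\<leftarrow>g w. frag_of v) f"
  have nex: "natural k (exT i j)" by (rule natural_exT) (use ij in simp_all)
  have exc: "exT i j w \<in> carrier T" if "P w" for w
    using nex P[OF that] by (auto simp: natural_def multilin_def)
  have exw: "v \<noteq> [] \<and> wrd v" if "P w" "v \<in> set (exchange_word H R M i j w)" for w v
    using exchange_word_sum(2)[of w i j] P[OF that(1)] ij that(2) by simp
  have exs: "lsum T (map cw (exchange_word H R M i j w)) = exT i j w" if "P w" for w
    using exchange_word_sum(1)[of w i j] P[OF that] ij by simp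
  have ex: "(0, cl (exchange H R M i j f)) = wlift T (\<lambda>w. if P w then exT i j w else \<zero>\<^bsub>T\<^esub>) f"
  proof -
    have "(\<lambda>w. if P w then lsum T (map cw (exchange_word H R M i j w)) else \<zero>\<^bsub>T\<^esub>) = (\<lambda>w. if P w then exT i j w else \<zero>\<^bsub>T\<^esub>)"
      using exs by (intro ext) simp
    then show ?thesis
      using cl_frag_extend[of P "exchange_word H R M i j" f, OF exw keys]
      by (simp add: exchange_def)
  qed
  have id: "(0, cl f) = wlift T (\<lambda>w. if P w then cw w else \<zero>\<^bsub>T\<^esub>) f"
  proof -
    have "frag_extend (\<lambda>w. \<Sum>v\<leftarrow>[w]. frag_of v) f = f"
      using frag_expansion[of f] by simp
    moreover have "(\<lambda>w. if P w then lsum T (map cw [w]) else \<zero>\<^bsub>T\<^esub>) = (\<lambda>w. if P w then cw w else \<zero>\<^bsub>T\<^esub>)"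
      using P by (intro ext) auto
    ultimately show ?thesis
      using cl_frag_extend[of P "\<lambda>w. [w]" f] P keys by auto
  qed
  have 1: "(0, cl f') = \<phi> (0, cl f)"
  proof -
    have "(0, cl f') = wlift T (\<lambda>w. if P w then lsum T (map cw (g w)) else \<zero>\<^bsub>T\<^esub>) f"
      using cl_frag_extend[of P g f] P gP keys by (auto simp: f'_def)
    also have "(\<lambda>w. if P w then lsum T (map cw (g w)) else \<zero>\<^bsub>T\<^esub>) = (\<lambda>w. \<phi> (if P w then cw w else \<zero>\<^bsub>T\<^esub>))"
      using nat[OF _ _ natural_cw] P phi_zero by (intro ext) auto
    also have "wlift T \<dots> f = \<phi> (0, cl f)"
      unfolding id by (rule wlift_comp) (use \<phi> P in auto)
    finally show ?thesis .
  qed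
  have 2: "(0, cl (exchange H R M i j f')) = \<phi> (0, cl (exchange H R M i j f))"
  proof -
    have gw: "v \<noteq> [] \<and> wrd v" if w: "P w" and v: "v \<in> set (concat (map (exchange_word H R M i j) (g w)))" for v w
    proof -
      obtain u where "u \<in> set (g w)" "v \<in> set (exchange_word H R M i j u)" using v by auto
      then show ?thesis using exw gP[OF w] by blast
    qed
    have "(0, cl (exchange H R M i j f')) =
      wlift T (\<lambda>w. if P w then lsum T (map cw (concat (map (exchange_word H R M i j) (g w)))) else \<zero>\<^bsub>T\<^esub>) f"
      using cl_frag_extend[of P "\<lambda>w. concat (map (exchange_word H R M i j) (g w))" f] gw keys
      by (auto simp: exchange_def f'_def frag_extend_compose)
    also have "(\<lambda>w. if P w then lsum T (map cw (concat (map (exchange_word H R M i j) (g w)))) else \<zero>\<^bsub>T\<^esub>) =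
      (\<lambda>w. \<phi> (if P w then exT i j w else \<zero>\<^bsub>T\<^esub>))"
    proof (rule ext)
      fix w
      have "lsum T (map cw (concat (map (exchange_word H R M i j) (g w)))) = \<phi> (exT i j w)" if w: "P w"
      proof -
        have cwx: "cw v \<in> carrier T" if "u \<in> set (g w)" "v \<in> set (exchange_word H R M i j u)" for u v
          using exw[OF gP[OF w that(1)] that(2)] by simp
        have "lsum T (map cw (concat (map (exchange_word H R M i j) (g w)))) =
          lsum T (map (lsum T) (map (\<lambda>v. map cw (exchange_word H R M i j v)) (g w)))"
          unfolding map_concat map_map o_def
          by (subst lsum_concat_T) (use cwx in \<open>auto simp: o_def\<close>)
        also have "map (lsum T) (map (\<lambda>v. map cw (exchange_word H R M i j v)) (g w)) = map (exT i j) (g w)"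
          using exs gP[OF w] by simp
        also have "lsum T \<dots> = \<phi> (exT i j w)"
          by (rule nat) (use P[OF w] nex in auto)
        finally show ?thesis .
      qed
      then show "(if P w then lsum T (map cw (concat (map (exchange_word H R M i j) (g w)))) else \<zero>\<^bsub>T\<^esub>) =
        \<phi> (if P w then exT i j w else \<zero>\<^bsub>T\<^esub>)" by (simp add: phi_zero)
    qed
    also have "wlift T \<dots> f = \<phi> (0, cl (exchange H R M i j f))"
      unfolding ex by (rule wlift_comp) (use \<phi> exc in auto)
    finally show ?thesis .
  qed
  have keys': "length w = k \<and> wrd w" if "w \<in> Poly_Mapping.keys f'" for w
  proof -
    have "Poly_Mapping.keys (\<Sum>v\<leftarrow>vs. frag_of v) \<subseteq> set vs" for vs :: "'m list list"
      by (induction vs) (use keys_add in fastforce)+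
    then have "w \<in> (\<Union>x\<in>Poly_Mapping.keys f. set (g x))"
      using keys_frag_extend[of "\<lambda>w. \<Sum>v\<leftarrow>g w. frag_of v" f] that unfolding f'_def by blast
    then show ?thesis using gP keys P by blast
  qed
  have "cl (exchange H R M i j f') = cl f'"
    using 1 2 fixd by (metis prod.inject)
  then show ?thesis
    unfolding exchange_fixed_def t 1[symmetric] using ij keys' by blast
qed

lemma hact_exchange_fixed: "t \<in> exchange_fixed H R M \<Longrightarrow> hact T x t \<in> exchange_fixed H R M"
proof (rule exchange_fixed_stable[where g = "word_hact_list H M x" and \<phi> = "hact T x"])
  fix F w assume "w \<noteq> []" "wrd w" "natural (length w) F"
  then show "lsum T (map F (word_hact_list H M x w)) = hact T x (F w)"
    by (simp add: natural_def lsum_word_hact_list)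
next
  fix w v assume "wrd w" "v \<in> set (word_hact_list H M x w)"
  then show "wrd v \<and> length v = length w"
    using word_hact_list_wrd[of w x] word_hact_list_length[of x w] by blast
qed (simp_all add: T_hact_add)

lemma D_exchange_fixed: "X \<in> carrier V \<Longrightarrow> t \<in> exchange_fixed H R M \<Longrightarrow> D X t \<in> exchange_fixed H R M"
proof (rule exchange_fixed_stable[where g = "nw X" and \<phi> = "D X"])
  fix F w assume "X \<in> carrier V" "w \<noteq> []" "wrd w" "natural (length w) F"
  then show "lsum T (map F (nw X w)) = D X (F w)"
    by (simp add: natural_def lsum_nw)
next
  fix w v assume "X \<in> carrier V" "wrd w" "v \<in> set (nw X w)"
  then show "wrd v \<and> length v = length w"
    using nw_wrd[of w X] by blast
qed (simp_all add: D_add)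

end

section \<open>The braided exterior algebra\<close>

context tensor_cov_deriv
begin

abbreviation Id where "Id \<equiv> ext_ideal H R A M"
abbreviation L where "L \<equiv> ext_algebra H R A M"
abbreviation q where "q \<equiv> ext_coset H R A M"

lemma exchange_fixed_closed: "exchange_fixed H R M \<subseteq> carrier T"
proof
  fix t assume "t \<in> exchange_fixed H R M"
  then obtain f k j where t: "t = (0, cl f)" and "j < k" and f: "\<And>w. w \<in> Poly_Mapping.keys f \<Longrightarrow> length w = k \<and> wrd w"
    unfolding exchange_fixed_def by blast
  have "w \<noteq> []" if "w \<in> Poly_Mapping.keys f" for w
    using f[OF that] \<open>j < k\<close> by force
  then have "good f" using f by (simp add: good_def)
  then show "t \<in> carrier T" by (simp add: t)
qed

sublocale I: ideal "ext_ideal H R A M" "tensor_algebra H A M"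
  unfolding ext_ideal_def by (rule T.genideal_ideal[OF exchange_fixed_closed])

lemma Id_T: "t \<in> Id \<Longrightarrow> t \<in> carrier T"
  using I.a_subset by blast

lemma sw_Id: "(\<And>r s. F r s \<in> Id) \<Longrightarrow> sw T xs F \<in> Id"
  by (induction xs) auto

text \<open>Induction over the generated ideal: the members of \<open>Id\<close> that satisfy P form
  an ideal containing the generators.\<close>

lemma Id_minimal:
  assumes fixed: "\<And>t. t \<in> exchange_fixed H R M \<Longrightarrow> P t"
    and add: "\<And>s t. s \<in> Id \<Longrightarrow> t \<in> Id \<Longrightarrow> P s \<Longrightarrow> P t \<Longrightarrow> P (s \<oplus>\<^bsub>T\<^esub> t)"
    and inv: "\<And>s. s \<in> Id \<Longrightarrow> P s \<Longrightarrow> P (\<ominus>\<^bsub>T\<^esub> s)"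
    and zero: "P \<zero>\<^bsub>T\<^esub>"
    and l: "\<And>s t. s \<in> Id \<Longrightarrow> P s \<Longrightarrow> t \<in> carrier T \<Longrightarrow> P (t \<otimes>\<^bsub>T\<^esub> s)"
    and r: "\<And>s t. s \<in> Id \<Longrightarrow> P s \<Longrightarrow> t \<in> carrier T \<Longrightarrow> P (s \<otimes>\<^bsub>T\<^esub> t)"
    and t: "t \<in> Id"
  shows "P t"
proof -
  have "ideal {t \<in> Id. P t} T"
  proof (rule idealI[OF ring_T])
    show "subgroup {t \<in> Id. P t} (add_monoid T)"
    proof (rule T.add.subgroupI)
      show "{t \<in> Id. P t} \<subseteq> carrier T" using Id_T by blast
      have "\<zero>\<^bsub>T\<^esub> \<in> {t \<in> Id. P t}" using zero I.zero_closed by blast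
      then show "{t \<in> Id. P t} \<noteq> {}" by blast
      show "\<ominus>\<^bsub>T\<^esub> s \<in> {t \<in> Id. P t}" if "s \<in> {t \<in> Id. P t}" for s
        using that inv I.a_inv_closed by blast
      show "s \<oplus>\<^bsub>T\<^esub> t \<in> {t \<in> Id. P t}" if "s \<in> {t \<in> Id. P t}" "t \<in> {t \<in> Id. P t}" for s t
        using that add I.a_closed by blast
    qed
    fix s t assume "s \<in> {t \<in> Id. P t}" and t: "t \<in> carrier T"
    then have s: "s \<in> Id" "P s" by blast+
    show "t \<otimes>\<^bsub>T\<^esub> s \<in> {t \<in> Id. P t}" using I.I_l_closed[OF s(1) t] l[OF s t] by blast
    show "s \<otimes>\<^bsub>T\<^esub> t \<in> {t \<in> Id. P t}" using I.I_r_closed[OF s(1) t] r[OF s t] by blast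
  qed
  then have "Id \<subseteq> {t \<in> Id. P t}"
    using fixed T.genideal_self[OF exchange_fixed_closed]
    unfolding ext_ideal_def by (intro T.genideal_minimal) auto
  then show ?thesis using t by blast
qed

lemma T_hact_inv: "t \<in> carrier T \<Longrightarrow> hact T x (\<ominus>\<^bsub>T\<^esub> t) = \<ominus>\<^bsub>T\<^esub> hact T x t"
  using T_hact_minus[of "\<zero>\<^bsub>T\<^esub>" t x] by (simp add: T.minus_eq)

lemma D_inv: "X \<in> carrier V \<Longrightarrow> t \<in> carrier T \<Longrightarrow> D X (\<ominus>\<^bsub>T\<^esub> t) = \<ominus>\<^bsub>T\<^esub> D X t"
  using D_minus[of X "\<zero>\<^bsub>T\<^esub>" t] klin_zero[of "D X"]
  by (simp add: T.minus_eq klin_def D_add D_sc)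

lemma D_zero: "X \<in> carrier V \<Longrightarrow> D X \<zero>\<^bsub>T\<^esub> = \<zero>\<^bsub>T\<^esub>"
  by (rule klin_zero) (simp add: klin_def D_add D_sc)

lemma exchange_fixed_Id: "t \<in> exchange_fixed H R M \<Longrightarrow> t \<in> Id"
  using T.genideal_self[OF exchange_fixed_closed] unfolding ext_ideal_def by blast

lemma Id_hact: "t \<in> Id \<Longrightarrow> hact T x t \<in> Id"
proof -
  assume "t \<in> Id"
  \<comment> \<open>The claim must range over all x at once, because the action on a product
    involves the legs of \<Delta>(x) in place of x.\<close>
  then have "\<forall>x. hact T x t \<in> Id"
  proof (rule Id_minimal[rotated -1])
    fix s t assume "s \<in> Id" "\<forall>x. hact T x s \<in> Id" "t \<in> carrier T"
    then show "\<forall>x. hact T x (t \<otimes>\<^bsub>T\<^esub> s) \<in> Id" "\<forall>x. hact T x (s \<otimes>\<^bsub>T\<^esub> t) \<in> Id"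
      by (simp_all add: T_hact_prod Id_T sw_Id I.I_l_closed I.I_r_closed)
  qed (simp_all add: T_hact_add T_hact_inv Id_T exchange_fixed_Id hact_exchange_fixed hact_zero[OF bsb_T])
  then show ?thesis by blast
qed

lemma Id_D: "t \<in> Id \<Longrightarrow> X \<in> carrier V \<Longrightarrow> D X t \<in> Id"
proof -
  assume t: "t \<in> Id" "X \<in> carrier V"
  from t(1) have "\<forall>X\<in>carrier V. D X t \<in> Id"
  proof (rule Id_minimal[rotated -1])
    fix s t assume "s \<in> Id" "\<forall>X\<in>carrier V. D X s \<in> Id" "t \<in> carrier T"
    then show "\<forall>X\<in>carrier V. D X (t \<otimes>\<^bsub>T\<^esub> s) \<in> Id" "\<forall>X\<in>carrier V. D X (s \<otimes>\<^bsub>T\<^esub> t) \<in> Id"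
      by (simp_all add: D_leibniz Id_T Id_hact sw_Id I.I_l_closed I.I_r_closed)
  qed (simp_all add: D_add D_inv D_zero Id_T exchange_fixed_Id D_exchange_fixed)
  then show ?thesis using t(2) by blast
qed

lemma q_def: "q t = Id +>\<^bsub>T\<^esub> t"
  by (simp add: ext_coset_def)

lemma L_fields: "carrier L = carrier (T Quot Id)" "mult L = mult (T Quot Id)" "one L = one (T Quot Id)"
  "zero L = zero (T Quot Id)" "add L = add (T Quot Id)"
  "lact L a P = (\<Union>t\<in>P. q (lact T a t))" "ract L P a = (\<Union>t\<in>P. q (ract T t a))" "hact L x P = (\<Union>t\<in>P. q (hact T x t))"
  by (simp_all add: ext_algebra_def Let_def)

lemma q_closed [simp]: "t \<in> carrier T \<Longrightarrow> q t \<in> carrier L"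
  and q_mult: "s \<in> carrier T \<Longrightarrow> t \<in> carrier T \<Longrightarrow> q s \<otimes>\<^bsub>L\<^esub> q t = q (s \<otimes>\<^bsub>T\<^esub> t)"
  and q_add: "s \<in> carrier T \<Longrightarrow> t \<in> carrier T \<Longrightarrow> q s \<oplus>\<^bsub>L\<^esub> q t = q (s \<oplus>\<^bsub>T\<^esub> t)"
  and q_one: "\<one>\<^bsub>L\<^esub> = q \<one>\<^bsub>T\<^esub>"
  using ring_hom_closed[OF I.rcos_ring_hom, of t] ring_hom_mult[OF I.rcos_ring_hom, of s t]
    ring_hom_add[OF I.rcos_ring_hom, of s t] ring_hom_one[OF I.rcos_ring_hom]
  by (simp_all add: L_fields q_def)

lemma q_zero: "\<zero>\<^bsub>L\<^esub> = q \<zero>\<^bsub>T\<^esub>"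
  using I.a_rcos_const[OF I.zero_closed] by (simp add: L_fields FactRing_def q_def)

lemma L_cases: "s \<in> carrier L \<Longrightarrow> (\<And>t. t \<in> carrier T \<Longrightarrow> s = q t \<Longrightarrow> P) \<Longrightarrow> P"
  by (auto simp: L_fields FactRing_def A_RCOSETS_def' q_def)

lemma q_eq: "s \<in> carrier T \<Longrightarrow> t \<in> carrier T \<Longrightarrow> q s = q t \<longleftrightarrow> s \<ominus>\<^bsub>T\<^esub> t \<in> Id"
  unfolding q_def using T.quotient_eq_iff_same_a_r_cos[OF I.ideal_axioms] by blast

lemma UN_q:
  assumes t: "t \<in> carrier T" and \<phi>: "\<And>s. s \<in> carrier T \<Longrightarrow> \<phi> s \<in> carrier T"
    "\<And>s t. s \<in> carrier T \<Longrightarrow> t \<in> carrier T \<Longrightarrow> \<phi> (s \<oplus>\<^bsub>T\<^esub> t) = \<phi> s \<oplus>\<^bsub>T\<^esub> \<phi> t" "\<And>s. s \<in> Id \<Longrightarrow> \<phi> s \<in> Id"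
  shows "(\<Union>s\<in>q t. q (\<phi> s)) = q (\<phi> t)"
proof (rule SUP_eq_const)
  show "q t \<noteq> {}" using I.a_rcos_self[OF t] by (auto simp: q_def)
  fix s assume "s \<in> q t"
  then obtain i where i: "i \<in> Id" "s = i \<oplus>\<^bsub>T\<^esub> t" by (auto simp: q_def a_r_coset_def')
  then have "\<phi> s \<ominus>\<^bsub>T\<^esub> \<phi> t = \<phi> i"
    using t \<phi> Id_T[OF i(1)] by (simp add: T.add_minus_cancel')
  then show "q (\<phi> s) = q (\<phi> t)"
    using t \<phi> i Id_T[OF i(1)] by (simp add: q_eq)
qed

lemma q_lact: "t \<in> carrier T \<Longrightarrow> lact L a (q t) = q (lact T a t)"
  unfolding L_fields by (rule UN_q) (simp_all add: lact_add[OF bsb_T] T_lact Id_T I.I_l_closed T.r_distr)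

lemma q_ract: "t \<in> carrier T \<Longrightarrow> ract L (q t) a = q (ract T t a)"
  unfolding L_fields by (rule UN_q) (simp_all add: T_ract Id_T I.I_r_closed T.l_distr)

lemma q_hact: "t \<in> carrier T \<Longrightarrow> hact L x (q t) = q (hact T x t)"
  unfolding L_fields by (rule UN_q) (simp_all add: T_hact_add Id_hact)

lemma ring_L: "ring L"
proof (rule ringI)
  show "abelian_group L"
  proof (rule abelian_groupI)
    fix s assume "s \<in> carrier L"
    then obtain t where "t \<in> carrier T" "s = q t" by (rule L_cases)
    then show "\<exists>u\<in>carrier L. u \<oplus>\<^bsub>L\<^esub> s = \<zero>\<^bsub>L\<^esub>"
      by (intro bexI[of _ "q (\<ominus>\<^bsub>T\<^esub> t)"]) (simp_all add: q_add q_zero T.l_neg)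
  qed (auto elim!: L_cases simp: q_add q_zero T.a_ac)
  show "Group.monoid L"
    by (rule monoidI) (auto elim!: L_cases simp: q_mult q_one T.m_assoc)
qed (auto elim!: L_cases simp: q_mult q_add T.l_distr T.r_distr)

sublocale L: ring "ext_algebra H R A M"
  by (rule ring_L)

lemmas L_ab [simp] = L.abelian_group_axioms

lemma q_sw: "(\<And>a b. F a b \<in> carrier T) \<Longrightarrow> q (sw T xs F) = sw L xs (\<lambda>a b. q (F a b))"
  by (rule sw_hom[where \<phi> = q]) (auto simp: q_add)

lemma bsb_L: "bsb L"
proof (rule bsb_intro)
  fix a b x y c s t assume "s \<in> carrier L" "t \<in> carrier L"
  then obtain s' t' where [simp]: "s' \<in> carrier T" "t' \<in> carrier T" "s = q s'" "t = q t'"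
    by (auto elim!: L_cases)
  note [simp] = q_lact q_ract q_hact q_add
  show "lact L a s \<in> carrier L" "ract L s a \<in> carrier L" "hact L x s \<in> carrier L" by simp_all
  show "lact L a (s \<oplus>\<^bsub>L\<^esub> t) = lact L a s \<oplus>\<^bsub>L\<^esub> lact L a t" "ract L (s \<oplus>\<^bsub>L\<^esub> t) a = ract L s a \<oplus>\<^bsub>L\<^esub> ract L t a"
    "hact L x (s \<oplus>\<^bsub>L\<^esub> t) = hact L x s \<oplus>\<^bsub>L\<^esub> hact L x t"
    by (simp_all add: lact_add[OF bsb_T] ract_add[OF bsb_T] hact_add[OF bsb_T])
  show "lact L (a + b) s = lact L a s \<oplus>\<^bsub>L\<^esub> lact L b s" "ract L s (a + b) = ract L s a \<oplus>\<^bsub>L\<^esub> ract L s b"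
    "hact L (x + y) s = hact L x s \<oplus>\<^bsub>L\<^esub> hact L y s"
    by (simp_all add: lact_add'[OF bsb_T] ract_add'[OF bsb_T] hact_add'[OF bsb_T])
  show "lact L (a * b) s = lact L a (lact L b s)" "ract L s (a * b) = ract L (ract L s a) b"
    "hact L (x * y) s = hact L x (hact L y s)" "ract L (lact L a s) b = lact L a (ract L s b)"
    by (simp_all add: lact_mult[OF bsb_T] ract_mult[OF bsb_T] hact_mult[OF bsb_T] lact_ract[OF bsb_T])
  show "lact L 1 s = s" "ract L s 1 = s" "hact L 1 s = s" "sc L c s = ract L s (asmult A c 1)"
    "hact L (hsmult H c x) s = sc L c (hact L x s)" "hact L x (sc L c s) = sc L c (hact L x s)"
    by (simp_all add: sc_ract[OF bsb_T] hact_scale[OF bsb_T] hact_sc[OF bsb_T])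
  show "hact L x (lact L a s) = sw L (\<Delta> x) (\<lambda>p q. lact L (aact A p a) (hact L q s))"
    by (simp add: hact_lact[OF bsb_T] q_sw)
  show "ract L s a = sw L \<rho> (\<lambda>r s'. lact L (aact A r a) (hact L s' s))"
    by (simp add: ract_eq[OF bsb_T] q_sw)
qed (rule L_ab)

text \<open>Any preimage in T serves, because D maps \<open>Id\<close> into itself.\<close>

definition NL where
  "NL X s = q (D X (SOME t. t \<in> carrier T \<and> q t = s))"

lemma NL_q: "X \<in> carrier V \<Longrightarrow> t \<in> carrier T \<Longrightarrow> NL X (q t) = q (D X t)"
proof -
  assume X [simp]: "X \<in> carrier V" and t: "t \<in> carrier T"
  define u where "u = (SOME u. u \<in> carrier T \<and> q u = q t)"
  have u: "u \<in> carrier T \<and> q u = q t"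
    unfolding u_def by (rule someI[of _ t]) (use t in simp)
  then have "D X (u \<ominus>\<^bsub>T\<^esub> t) \<in> Id" using t q_eq[of u t] by (intro Id_D) simp_all
  then show "NL X (q t) = q (D X t)"
    using u t by (simp add: NL_def flip: u_def) (simp add: q_eq D_minus)
qed

lemma ecd_NL: "ecd L NL"
proof (rule ecd_intro)
  note [simp] = NL_q q_add q_lact q_hact
  fix X Y s t x a assume [simp]: "X \<in> carrier V" "Y \<in> carrier V" and "s \<in> carrier L" "t \<in> carrier L"
  then obtain s' t' where [simp]: "s' \<in> carrier T" "t' \<in> carrier T" "s = q s'" "t = q t'"
    by (auto elim!: L_cases)
  show "NL X s \<in> carrier L" "NL (X \<oplus>\<^bsub>V\<^esub> Y) s = NL X s \<oplus>\<^bsub>L\<^esub> NL Y s" "NL X (s \<oplus>\<^bsub>L\<^esub> t) = NL X s \<oplus>\<^bsub>L\<^esub> NL X t"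
    "NL (lact V a X) s = lact L a (NL X s)"
    by (simp_all add: D_addX D_add cd_lact[OF ecd_D])
  show "hact L x (NL X s) = sw L (\<Delta> x) (\<lambda>p q. NL (hact V p X) (hact L q s))"
    by (simp add: D_equiv q_sw)
  show "NL X (lact L a s) = lact L (X a) s \<oplus>\<^bsub>L\<^esub> sw L \<rho> (\<lambda>r s'. lact L (aact A r a) (NL (hact V s' X) s))"
    by (simp add: cd_leibniz[OF ecd_D] q_sw[symmetric] sw_closed)
qed (rule bsb_L)

lemma ext_in0_q: "ext_in0 H R A M a = q (in0 a)"
  and ext_in1_q: "ext_in1 H R A M m = q (cw [m])"
  by (simp_all add: ext_in0_def ext_in1_def in0_def cw_def)

lemma NL_leibniz:
  "X \<in> carrier V \<Longrightarrow> s \<in> carrier L \<Longrightarrow> t \<in> carrier L \<Longrightarrow>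
    NL X (s \<otimes>\<^bsub>L\<^esub> t) = (NL X s \<otimes>\<^bsub>L\<^esub> t) \<oplus>\<^bsub>L\<^esub> sw L \<rho> (\<lambda>r s'. hact L r s \<otimes>\<^bsub>L\<^esub> NL (hact V s' X) t)"
  by (auto elim!: L_cases simp: NL_q q_mult q_hact D_leibniz q_sw[symmetric] q_add)

lemma NL_in0: "X \<in> carrier V \<Longrightarrow> NL X (ext_in0 H R A M a) = ext_in0 H R A M (X a)"
  and NL_in1: "X \<in> carrier V \<Longrightarrow> m \<in> carrier M \<Longrightarrow> NL X (ext_in1 H R A M m) = ext_in1 H R A M (N X m)"
  by (simp_all add: ext_in0_q ext_in1_q NL_q D_in0 D_cw sw_zero)

lemma NL_extension: "braided_derivation_extension H R A M L (ext_in0 H R A M) (ext_in1 H R A M) N NL"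
  unfolding braided_derivation_extension_def
  using ecd_NL NL_in0 NL_in1 NL_leibniz by (auto simp: V_simps(1) sw_def)

end

section \<open>Restriction to sub-bimodules\<close>

context thopf
begin

text \<open>Lets additive inverses be produced by the left action, so a subset closed under addition
  and this action is a subgroup.\<close>

lemma lact_minus_one:
  assumes M [simp]: "bsb M" and [simp]: "m \<in> carrier M"
  shows "lact M (- 1) m = \<ominus>\<^bsub>M\<^esub> m"
proof -
  interpret abelian_group M by simp
  have "lact M (- 1) m \<oplus>\<^bsub>M\<^esub> m = lact M 0 m"
    using lact_add'[OF M, of m "- 1" 1] by simp
  also have "lact M 0 m = \<zero>\<^bsub>M\<^esub>"
    using lact_add'[OF M, of m 0 0] add.r_cancel_one[of "lact M 0 m" "lact M 0 m"] by simp
  finally show ?thesis using minus_equality[of "lact M (- 1) m" m] by simp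
qed

lemma bsb_restrict:
  assumes M: "bsb M" and S: "C \<subseteq> carrier M" "\<zero>\<^bsub>M\<^esub> \<in> C" "\<And>m n. m \<in> C \<Longrightarrow> n \<in> C \<Longrightarrow> m \<oplus>\<^bsub>M\<^esub> n \<in> C"
    and l: "\<And>a m. m \<in> C \<Longrightarrow> lact M a m \<in> C" and r: "\<And>a m. m \<in> C \<Longrightarrow> ract M m a \<in> C"
    and h: "\<And>x m. m \<in> C \<Longrightarrow> hact M x m \<in> C"
  shows "bsb (M\<lparr>carrier := C\<rparr>)"
proof -
  interpret abelian_group M using M by simp
  have inv: "\<exists>n\<in>C. n \<oplus>\<^bsub>M\<^esub> m = \<zero>\<^bsub>M\<^esub>" if "m \<in> C" for m
  proof
    show "lact M (- 1) m \<in> C" by (rule l) fact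
    show "lact M (- 1) m \<oplus>\<^bsub>M\<^esub> m = \<zero>\<^bsub>M\<^esub>"
      using that S(1) by (subst lact_minus_one[OF M]) (auto simp: l_neg)
  qed
  let ?C = "M\<lparr>carrier := C\<rparr>"
  have "abelian_group ?C"
    by (rule abelian_groupI) (use S inv in \<open>auto simp: a_ac subset_iff\<close>)
  then show ?thesis
  proof (rule bsb_intro)
    fix a b x y c s t assume C: "s \<in> carrier ?C" "t \<in> carrier ?C"
    then have [simp]: "s \<in> carrier M" "t \<in> carrier M" using S(1) by auto
    show "lact ?C a s \<in> carrier ?C" "ract ?C s a \<in> carrier ?C" "hact ?C x s \<in> carrier ?C"
      using C l r h by simp_all
    show "lact ?C a (s \<oplus>\<^bsub>?C\<^esub> t) = lact ?C a s \<oplus>\<^bsub>?C\<^esub> lact ?C a t"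
      "ract ?C (s \<oplus>\<^bsub>?C\<^esub> t) a = ract ?C s a \<oplus>\<^bsub>?C\<^esub> ract ?C t a"
      "hact ?C x (s \<oplus>\<^bsub>?C\<^esub> t) = hact ?C x s \<oplus>\<^bsub>?C\<^esub> hact ?C x t"
      by (simp_all add: lact_add[OF M] ract_add[OF M] hact_add[OF M])
    show "lact ?C (a + b) s = lact ?C a s \<oplus>\<^bsub>?C\<^esub> lact ?C b s"
      "ract ?C s (a + b) = ract ?C s a \<oplus>\<^bsub>?C\<^esub> ract ?C s b"
      "hact ?C (x + y) s = hact ?C x s \<oplus>\<^bsub>?C\<^esub> hact ?C y s"
      by (simp_all add: lact_add'[OF M] ract_add'[OF M] hact_add'[OF M])
    show "lact ?C (a * b) s = lact ?C a (lact ?C b s)" "ract ?C s (a * b) = ract ?C (ract ?C s a) b"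
      "hact ?C (x * y) s = hact ?C x (hact ?C y s)" "ract ?C (lact ?C a s) b = lact ?C a (ract ?C s b)"
      by (simp_all add: lact_mult[OF M] ract_mult[OF M] hact_mult[OF M] lact_ract[OF M])
    show "lact ?C 1 s = s" "ract ?C s 1 = s" "hact ?C 1 s = s" "sc ?C c s = ract ?C s (asmult A c 1)"
      "hact ?C (hsmult H c x) s = sc ?C c (hact ?C x s)" "hact ?C x (sc ?C c s) = sc ?C c (hact ?C x s)"
      using M by (simp_all add: sc_ract[OF M] hact_scale[OF M] hact_sc[OF M])
    show "hact ?C x (lact ?C a s) = sw ?C (\<Delta> x) (\<lambda>p q. lact ?C (aact A p a) (hact ?C q s))"
      by (simp add: hact_lact[OF M])
    show "ract ?C s a = sw ?C \<rho> (\<lambda>r s'. lact ?C (aact A r a) (hact ?C s' s))"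
      by (simp add: ract_eq[OF M])
  qed
qed

text \<open>Solves equivariance for the action on the second argument: legs of the form c S(d) are
  inserted by the counit axiom, \<open>eqv\<close> combines the first two legs into an action on the
  value, and a remaining antipode cancels it. The pairing with S(y) m is thereby known from pairings
  with m.\<close>

lemma pairing_antipode:
  assumes [simp]: "bsb U" "bsb M" and X [simp]: "X \<in> carrier U" and m [simp]: "m \<in> carrier M"
    and lin1: "\<And>f m. lin U f \<Longrightarrow> m \<in> carrier M \<Longrightarrow> lin AA (\<lambda>x. B (f x) m)"
    and lin2: "\<And>f X. lin M f \<Longrightarrow> X \<in> carrier U \<Longrightarrow> lin AA (\<lambda>x. B X (f x))"
    and eqv: "\<And>x X m. X \<in> carrier U \<Longrightarrow> m \<in> carrier M \<Longrightarrow>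
      aact A x (B X m) = sw AA (\<Delta> x) (\<lambda>p q. B (hact U p X) (hact M q m))"
  shows "B X (hact M (S y) m) = sw AA (\<Delta> y) (\<lambda>p q. aact A (S p) (B (hact U q X) m))"
proof -
  have "sw AA (\<Delta> y) (\<lambda>p q. aact A (S p) (B (hact U q X) m)) =
    sw AA (\<Delta> y) (\<lambda>p q. sw AA (\<Delta> q) (\<lambda>a b. sw AA (\<Delta> b) (\<lambda>c d. aact A (S p) (B (hact U a X) (hact M (c * S d) m)))))"
    by (subst antipode_r_snd[where F = "\<lambda>a b. aact A (S p) (B (hact U a X) (hact M b m))" for p])
      (intro lins lin1 lin2 | simp)+
  also have "\<dots> = sw AA (\<Delta> y) (\<lambda>p q. sw AA (\<Delta> q) (\<lambda>a b. sw AA (\<Delta> a) (\<lambda>c d. aact A (S p) (B (hact U c X) (hact M (d * S b) m)))))"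
    by (subst coassoc[where F = "\<lambda>a b c. aact A (S p) (B (hact U a X) (hact M (b * S c) m))" for p])
      (intro lins lin1 lin2 | simp)+
  also have "\<dots> = sw AA (\<Delta> y) (\<lambda>p q. sw AA (\<Delta> q) (\<lambda>a b. aact A (S p * a) (B X (hact M (S b) m))))"
    by (simp add: aact_mult eqv aact_sw hact_mult)
  also have "\<dots> = sw AA (\<Delta> y) (\<lambda>p q. sw AA (\<Delta> p) (\<lambda>a b. aact A (S a * b) (B X (hact M (S q) m))))"
    by (rule coassoc[symmetric]) (intro lins lin1 lin2 | simp)+
  also have "\<dots> = aact A 1 (B X (hact M (S y) m))"
    by (rule antipode_l_fst[where F = "\<lambda>a q. aact A a (B X (hact M (S q) m))"]) (intro lins lin1 lin2 | simp)+
  finally show ?thesis by simp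
qed

text \<open>\<open>pairing_antipode\<close> treats the action of elements S y; with this it covers
  every x in H.\<close>

lemma antipode_surj: obtains y where "x = S y"
proof -
  have "bij S" using ha unfolding hopf_algebra_def by blast
  then show ?thesis using that by (metis bij_pointE)
qed

end

context vfield_bimod
begin

lemma ecd_restrict:
  assumes "ecd M N" "bsb (M\<lparr>carrier := C\<rparr>)" "C \<subseteq> carrier M" "\<And>X s. X \<in> carrier V \<Longrightarrow> s \<in> C \<Longrightarrow> N X s \<in> C"
  shows "ecd (M\<lparr>carrier := C\<rparr>) N"
proof (rule ecd_intro[OF assms(2)])
  note N = assms(1,4) subsetD[OF assms(3)]
  fix X Y s t x a assume "X \<in> carrier V" "Y \<in> carrier V" "s \<in> carrier (M\<lparr>carrier := C\<rparr>)" "t \<in> carrier (M\<lparr>carrier := C\<rparr>)"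
  then have *: "X \<in> carrier V" "Y \<in> carrier V" "s \<in> carrier M" "t \<in> carrier M" "s \<in> C" using N(3) by auto
  show "N X s \<in> carrier (M\<lparr>carrier := C\<rparr>)" using * N by simp
  show "N (X \<oplus>\<^bsub>V\<^esub> Y) s = N X s \<oplus>\<^bsub>M\<lparr>carrier := C\<rparr>\<^esub> N Y s"
    "N X (s \<oplus>\<^bsub>M\<lparr>carrier := C\<rparr>\<^esub> t) = N X s \<oplus>\<^bsub>M\<lparr>carrier := C\<rparr>\<^esub> N X t"
    "N (lact V a X) s = lact (M\<lparr>carrier := C\<rparr>) a (N X s)"
    using * by (simp_all add: cd_addX[OF N(1)] cd_add[OF N(1)] cd_lact[OF N(1)])
  show "hact (M\<lparr>carrier := C\<rparr>) x (N X s) = sw (M\<lparr>carrier := C\<rparr>) (\<Delta> x) (\<lambda>p q. N (hact V p X) (hact (M\<lparr>carrier := C\<rparr>) q s))"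
    using * by (simp add: cd_equiv[OF N(1)])
  show "N X (lact (M\<lparr>carrier := C\<rparr>) a s) = lact (M\<lparr>carrier := C\<rparr>) (X a) s \<oplus>\<^bsub>M\<lparr>carrier := C\<rparr>\<^esub>
      sw (M\<lparr>carrier := C\<rparr>) \<rho> (\<lambda>r s'. lact (M\<lparr>carrier := C\<rparr>) (aact A r a) (N (hact V s' X) s))"
    using * by (simp add: cd_leibniz[OF N(1)])
qed

lemma extension_restrict:
  assumes "braided_derivation_extension H R A M L \<iota>0 \<iota>1 N N'" "ecd (L\<lparr>carrier := C\<rparr>) N'"
    and "C \<subseteq> carrier L" "B \<subseteq> carrier M"
  shows "braided_derivation_extension H R A (M\<lparr>carrier := B\<rparr>) (L\<lparr>carrier := C\<rparr>) \<iota>0 \<iota>1 N N'"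
  using assms unfolding braided_derivation_extension_def
  by (simp add: subset_iff)

end

section \<open>The pairing of vector fields and one-forms\<close>

context vfield_cov_deriv
begin

lemma lin_hact_form: "lin W g \<Longrightarrow> lin AA (\<lambda>x. hact W r (g x) Y)"
  by (rule lin_appW[where F = "\<lambda>x. hact W r (g x)"]) (intro lins; simp)

text \<open>The expression by which \<open>braided_differential\<close> prescribes \<open>d\<close>
  on functions: evaluation after X, standing first, has been braided past \<omega>.\<close>

definition pairing where
  "pairing X \<omega> = sw AA \<rho> (\<lambda>r s. hact W r \<omega> (hact V s X))"

lemma lin_pairing: "lin V f \<Longrightarrow> \<omega> \<in> carrier W \<Longrightarrow> lin AA (\<lambda>x. pairing (f x) \<omega>)"
  and lin_pairing_snd: "lin W g \<Longrightarrow> X \<in> carrier V \<Longrightarrow> lin AA (\<lambda>x. pairing X (g x))"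
  unfolding pairing_def
  by (intro lins lin_form[OF hact_closed[OF bsb_W]] | simp)+
    (rule lin_hact_form)

lemma pairing_eval:
  assumes [simp]: "X \<in> carrier V" "\<omega> \<in> carrier W"
  shows "aact A x (pairing X \<omega>) = sw AA (\<Delta> x) (\<lambda>p q. pairing (hact V p X) (hact W q \<omega>))"
proof -
  have "aact A x (pairing X \<omega>) = sw AA \<rho> (\<lambda>r s. sw AA (\<Delta> x) (\<lambda>p q. hact W (p * r) \<omega> (hact V (q * s) X)))"
    by (simp add: pairing_def aact_sw form_eval hact_mult)
  also have "\<dots> = sw AA (\<Delta> x) (\<lambda>p q. sw AA \<rho> (\<lambda>r s. hact W (p * r) \<omega> (hact V (q * s) X)))"
    by (rule sw_swap) simp_all
  also have "\<dots> = sw AA \<rho> (\<lambda>r s. sw AA (\<Delta> x) (\<lambda>p q. hact W (r * q) \<omega> (hact V (s * p) X)))"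
    by (rule R_cocomm[where F = "\<lambda>a b. hact W a \<omega> (hact V b X)"])
      (intro lins lin_form[OF hact_closed[OF bsb_W]] lin_appW | simp)+
  also have "\<dots> = sw AA (\<Delta> x) (\<lambda>p q. sw AA \<rho> (\<lambda>r s. hact W (r * q) \<omega> (hact V (s * p) X)))"
    by (rule sw_swap) simp_all
  finally show ?thesis by (simp add: pairing_def hact_mult)
qed

lemma pairing_antipode_form:
  "X \<in> carrier V \<Longrightarrow> \<omega> \<in> carrier W \<Longrightarrow>
    pairing X (hact W (S y) \<omega>) = sw AA (\<Delta> y) (\<lambda>p q. aact A (S p) (pairing (hact V q X) \<omega>))"
  by (rule pairing_antipode[where B = pairing and U = V and M = W]) (auto intro: lin_pairing lin_pairing_snd pairing_eval)

text \<open>The pairing uses \<open>\<R>\<^sup>-\<^sup>1\<close>, so it determines \<open>\<omega>\<close> by applying \<open>\<R>\<close>.\<close>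

lemma pairing_inject:
  assumes [simp]: "\<omega> \<in> carrier W" "\<eta> \<in> carrier W" and eq: "\<And>X. X \<in> carrier V \<Longrightarrow> pairing X \<omega> = pairing X \<eta>"
  shows "\<omega> = \<eta>"
proof
  fix X
  have hact: "pairing Y (hact W x \<omega>) = pairing Y (hact W x \<eta>)" if "Y \<in> carrier V" for x Y
    using that by (rule_tac antipode_surj[of x]) (simp add: pairing_antipode_form eq)
  \<comment> \<open>Evaluation recovered from the pairing: the copy of \<rho> used here meets the
    crossed copy inside \<open>pairing\<close> and cancels by \<open>R_inv\<close>.\<close>
  have inv: "\<theta> X = sw AA \<rho> (\<lambda>r s. pairing (hact V r X) (hact W s \<theta>))" if [simp]: "\<theta> \<in> carrier W" "X \<in> carrier V" for \<theta>
  proof -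
    have "hact W 1 \<theta> (hact V 1 X) = sw AA \<rho> (\<lambda>r s. sw AA \<rho> (\<lambda>r' s'. hact W (r * s') \<theta> (hact V (s * r') X)))"
      by (rule R_inv[symmetric, where F = "\<lambda>a b. hact W a \<theta> (hact V b X)"])
        (intro lins lin_form[OF hact_closed[OF bsb_W]] lin_appW | simp)+
    also have "\<dots> = sw AA \<rho> (\<lambda>r' s'. sw AA \<rho> (\<lambda>r s. hact W (r * s') \<theta> (hact V (s * r') X)))"
      by (rule sw_swap) simp_all
    finally show ?thesis by (simp add: pairing_def hact_mult)
  qed
  show "\<omega> X = \<eta> X"
  proof (cases "X \<in> carrier V")
    case True
    then show ?thesis by (simp add: inv hact)
  qed (simp add: form_outside)
qed

text \<open>In effect x acts on d a as d of x acting on a. Both the pairing and the evaluation of X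
  at a are equivariant, so \<open>pairing_antipode\<close> turns both sides into the same
  sum.\<close>

lemma pairing_exact_hact:
  assumes [simp]: "\<omega> \<in> carrier W" "\<eta> \<in> carrier W"
    and \<omega>: "\<And>X. X \<in> carrier V \<Longrightarrow> pairing X \<omega> = X a"
    and \<eta>: "\<And>X. X \<in> carrier V \<Longrightarrow> pairing X \<eta> = X (aact A x a)"
  shows "hact W x \<omega> = \<eta>"
proof (rule antipode_surj[of x], rule pairing_inject)
  fix y X assume x: "x = S y" and [simp]: "X \<in> carrier V"
  have "X (hact AA (S y) a) = sw AA (\<Delta> y) (\<lambda>p q. aact A (S p) (hact V q X a))"
    by (rule pairing_antipode[where B = "\<lambda>X a. X a"]) (auto intro: lin_app lin_Der Der_eval)
  then show "pairing X (hact W x \<omega>) = pairing X \<eta>"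
    by (simp add: x[symmetric] \<eta>) (simp add: x pairing_antipode_form \<omega>)
qed simp_all

end

section \<open>The copies of A and M inside the exterior algebra\<close>

context tensor_cov_deriv
begin

abbreviation i0 where "i0 \<equiv> ext_in0 H R A M"
abbreviation i1 where "i1 \<equiv> ext_in1 H R A M"

lemma i0_closed [simp]: "i0 a \<in> carrier L"
  and i1_closed [simp]: "m \<in> carrier M \<Longrightarrow> i1 m \<in> carrier L"
  and i0_one: "i0 1 = \<one>\<^bsub>L\<^esub>"
  and i1_add: "m \<in> carrier M \<Longrightarrow> n \<in> carrier M \<Longrightarrow> i1 (m \<oplus>\<^bsub>M\<^esub> n) = i1 m \<oplus>\<^bsub>L\<^esub> i1 n"
  and i1_lact: "m \<in> carrier M \<Longrightarrow> i1 (lact M a m) = i0 a \<otimes>\<^bsub>L\<^esub> i1 m"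
  and i1_ract: "m \<in> carrier M \<Longrightarrow> i1 (ract M m a) = i1 m \<otimes>\<^bsub>L\<^esub> i0 a"
  and i0_hact: "hact L x (i0 a) = i0 (aact A x a)"
  by (simp_all add: ext_in0_q ext_in1_q q_mult q_one in0_one cw_add q_add cw_lact cw_ract
      q_hact T_hact_in0)

lemma i1_hact: "m \<in> carrier M \<Longrightarrow> hact L x (i1 m) = i1 (hact M x m)"
  using T_hact_cw[of "[m]" x] hw_single[of m x] by (simp add: ext_in1_q q_hact del: hw.simps)

lemma L_lact: "s \<in> carrier L \<Longrightarrow> lact L a s = i0 a \<otimes>\<^bsub>L\<^esub> s"
  and L_ract: "s \<in> carrier L \<Longrightarrow> ract L s a = s \<otimes>\<^bsub>L\<^esub> i0 a"
  by (auto elim!: L_cases simp: ext_in0_q q_mult q_lact q_ract T_lact T_ract)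

lemma L_hact_prod: "s \<in> carrier L \<Longrightarrow> t \<in> carrier L \<Longrightarrow>
    hact L x (s \<otimes>\<^bsub>L\<^esub> t) = sw L (\<Delta> x) (\<lambda>p q. hact L p s \<otimes>\<^bsub>L\<^esub> hact L q t)"
  by (auto elim!: L_cases simp: q_mult q_hact T_hact_prod q_sw)

lemma homogeneous_word: "wrd w \<Longrightarrow> q (in0 a \<otimes>\<^bsub>T\<^esub> cw w) \<in> ext_degree H R A M (length w)"
proof (cases w)
  case Nil
  then show ?thesis
    unfolding ext_degree_def in0_def by (intro CollectI exI[of _ a] exI[of _ 0]) (simp flip: in0_def)
next
  case (Cons m v)
  moreover assume "wrd w"
  ultimately have "in0 a \<otimes>\<^bsub>T\<^esub> cw w = cw (lact M a m # v)"
    using cw_Cons[of m v] cw_Cons[of "lact M a m" v] by (simp add: cw_lact T.m_assoc)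
  then have "q (in0 a \<otimes>\<^bsub>T\<^esub> cw w) = q (0, cl (frag_of (lact M a m # v)))"
    by (simp add: cw_def)
  then show ?thesis
    using Cons \<open>wrd w\<close> unfolding ext_degree_def
    by (intro CollectI exI[of _ 0] exI[of _ "frag_of (lact M a m # v)"]) simp
qed

end

context vfield_cov_deriv
begin

text \<open>The extension theory is set up for an arbitrary bimodule and used twice: here for forms
  with the dual derivative, in the main theorem for vector fields with \<open>N\<close>.\<close>

sublocale F: tensor_cov_deriv H R A "full_forms1 H R A" NF
  by unfold_locales (rule bsb_W ecd_NF)+

end

section \<open>Braided differential forms\<close>

locale braided_forms = vfield_cov_deriv H R A N
  for H :: "('k::{comm_ring, comm_monoid_mult}, 'h::{ring, monoid_mult}) hopf"
    and R :: "('h \<times> 'h) list"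
    and A :: "('k, 'h, 'a::{ring, monoid_mult}) malg"
    and N :: "('a \<Rightarrow> 'a) \<Rightarrow> ('a \<Rightarrow> 'a) \<Rightarrow> ('a \<Rightarrow> 'a)" +
  fixes d
  assumes diff: "braided_differential H R A d"
begin

abbreviation L where "L \<equiv> full_forms H R A"
abbreviation i0 where "i0 \<equiv> ext_in0 H R A W"
abbreviation i1 where "i1 \<equiv> ext_in1 H R A W"

lemma d_closed [simp]: "s \<in> carrier L \<Longrightarrow> d s \<in> carrier L"
  using diff[unfolded braided_differential_def Let_def, THEN conjunct1] by blast

lemma d_add: "s \<in> carrier L \<Longrightarrow> t \<in> carrier L \<Longrightarrow> d (s \<oplus>\<^bsub>L\<^esub> t) = d s \<oplus>\<^bsub>L\<^esub> d t"
  using diff[unfolded braided_differential_def Let_def, THEN conjunct2, THEN conjunct1] by blast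

lemma d_i0: "\<exists>\<alpha>\<in>carrier W. d (i0 a) = i1 \<alpha> \<and> (\<forall>X\<in>carrier V. (\<Sum>(r, s)\<leftarrow>\<rho>. hact W r \<alpha> (hact V s X)) = X a)"
  using diff[unfolded braided_differential_def Let_def, THEN conjunct2, THEN conjunct2, THEN conjunct2, THEN conjunct2, THEN conjunct1] by blast

lemma d_prod: "s \<in> ext_degree H R A W k \<Longrightarrow> t \<in> carrier L \<Longrightarrow> d (s \<otimes>\<^bsub>L\<^esub> t) =
    (if even k then (d s \<otimes>\<^bsub>L\<^esub> t) \<oplus>\<^bsub>L\<^esub> (s \<otimes>\<^bsub>L\<^esub> d t) else (d s \<otimes>\<^bsub>L\<^esub> t) \<ominus>\<^bsub>L\<^esub> (s \<otimes>\<^bsub>L\<^esub> d t))"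
  using diff[unfolded braided_differential_def Let_def, THEN conjunct2, THEN conjunct2, THEN conjunct2, THEN conjunct2, THEN conjunct2, THEN conjunct2, THEN conjunct1] by simp

lemma d_d: "s \<in> carrier L \<Longrightarrow> d (d s) = \<zero>\<^bsub>L\<^esub>"
  using diff[unfolded braided_differential_def Let_def, THEN conjunct2, THEN conjunct2, THEN conjunct2, THEN conjunct2, THEN conjunct2, THEN conjunct2, THEN conjunct2] by blast

definition exact where "exact a = (SOME \<alpha>. \<alpha> \<in> carrier W \<and> d (i0 a) = i1 \<alpha> \<and> (\<forall>X\<in>carrier V. pairing X \<alpha> = X a))"

lemma exact_closed [simp]: "exact a \<in> carrier W"
  and d_i0_exact: "d (i0 a) = i1 (exact a)"
  and pairing_exact: "X \<in> carrier V \<Longrightarrow> pairing X (exact a) = X a"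
proof -
  have "\<exists>\<alpha>. \<alpha> \<in> carrier W \<and> d (i0 a) = i1 \<alpha> \<and> (\<forall>X\<in>carrier V. pairing X \<alpha> = X a)"
    using d_i0[of a] unfolding pairing_def sum_list_sw by blast
  from someI_ex[OF this]
  show "exact a \<in> carrier W" "d (i0 a) = i1 (exact a)" "X \<in> carrier V \<Longrightarrow> pairing X (exact a) = X a"
    unfolding exact_def by blast+
qed

lemma hact_exact: "hact W x (exact a) = exact (aact A x a)"
  by (rule pairing_exact_hact) (simp_all add: pairing_exact)

text \<open>\<open>word_sums\<close> describes \<open>forms\<close> from below: the intersection in the definition of \<open>forms\<close>
  has no induction principle.\<close>

inductive_set words where
  one: "\<one>\<^bsub>L\<^esub> \<in> words"
| scale: "s \<in> words \<Longrightarrow> i0 a \<otimes>\<^bsub>L\<^esub> s \<in> words"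
| exact: "s \<in> words \<Longrightarrow> i1 (exact a) \<otimes>\<^bsub>L\<^esub> s \<in> words"

inductive_set word_sums where
  zero: "\<zero>\<^bsub>L\<^esub> \<in> word_sums"
| add: "w \<in> words \<Longrightarrow> s \<in> word_sums \<Longrightarrow> w \<oplus>\<^bsub>L\<^esub> s \<in> word_sums"

lemma words_closed [simp]: "w \<in> words \<Longrightarrow> w \<in> carrier L"
  by (induction rule: words.induct) simp_all

lemma sums_closed [simp]: "s \<in> word_sums \<Longrightarrow> s \<in> carrier L"
  by (induction rule: word_sums.induct) simp_all

lemma sums_zero [simp]: "\<zero>\<^bsub>L\<^esub> \<in> word_sums"
  by (rule word_sums.zero)

lemma words_sums [simp]: "w \<in> words \<Longrightarrow> w \<in> word_sums"
  using word_sums.add[OF _ word_sums.zero, of w] by simp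

lemma sums_add [simp]: "s \<in> word_sums \<Longrightarrow> t \<in> word_sums \<Longrightarrow> s \<oplus>\<^bsub>L\<^esub> t \<in> word_sums"
  by (induction rule: word_sums.induct) (simp_all add: F.L.a_assoc word_sums.add)

text \<open>Reduces stability under an additive map to products of generators; action, differential
  and derivative all go through it.\<close>

lemma sums_hom:
  assumes "\<And>s. s \<in> carrier L \<Longrightarrow> \<phi> s \<in> carrier L"
    and "\<And>s t. s \<in> carrier L \<Longrightarrow> t \<in> carrier L \<Longrightarrow> \<phi> (s \<oplus>\<^bsub>L\<^esub> t) = \<phi> s \<oplus>\<^bsub>L\<^esub> \<phi> t"
    and "\<And>w. w \<in> words \<Longrightarrow> \<phi> w \<in> word_sums" and "s \<in> word_sums"
  shows "\<phi> s \<in> word_sums"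
  using assms(4)
proof induction
  case zero
  have "\<phi> \<zero>\<^bsub>L\<^esub> = \<zero>\<^bsub>L\<^esub>" by (rule additive_zero[of L L]) (simp_all add: assms)
  then show ?case by simp
qed (simp add: assms)

lemma sums_fun: "s \<in> word_sums \<Longrightarrow> i0 a \<otimes>\<^bsub>L\<^esub> s \<in> word_sums"
  by (rule sums_hom[where \<phi> = "\<lambda>s. i0 a \<otimes>\<^bsub>L\<^esub> s"]) (simp_all add: F.L.r_distr words.scale)

lemma sums_exact: "s \<in> word_sums \<Longrightarrow> i1 (exact a) \<otimes>\<^bsub>L\<^esub> s \<in> word_sums"
  by (rule sums_hom[where \<phi> = "\<lambda>s. i1 (exact a) \<otimes>\<^bsub>L\<^esub> s"]) (simp_all add: F.L.r_distr words.exact)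

lemma words_mult: "w \<in> words \<Longrightarrow> s \<in> word_sums \<Longrightarrow> w \<otimes>\<^bsub>L\<^esub> s \<in> word_sums"
  by (induction rule: words.induct) (simp_all add: F.L.m_assoc sums_fun sums_exact)

lemma sums_mult [simp]: "s \<in> word_sums \<Longrightarrow> t \<in> word_sums \<Longrightarrow> s \<otimes>\<^bsub>L\<^esub> t \<in> word_sums"
  by (rule sums_hom[where \<phi> = "\<lambda>s. s \<otimes>\<^bsub>L\<^esub> t"]) (simp_all add: F.L.l_distr words_mult)

lemma sums_i0 [simp]: "i0 a \<in> word_sums"
  using words_sums[OF words.scale[OF words.one, of a]] by simp

lemma sums_i1_exact [simp]: "i1 (exact a) \<in> word_sums"
  using words_sums[OF words.exact[OF words.one, of a]] by simp

text \<open>The generating words carry coefficients from A, so the sign is the coefficient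
  -1.\<close>

lemma sums_minus [simp]: "s \<in> word_sums \<Longrightarrow> \<ominus>\<^bsub>L\<^esub> s \<in> word_sums"
  using sums_fun[of s "- 1"] by (simp flip: F.L_lact) (simp add: lact_minus_one[OF F.bsb_L])

lemma sums_sw: "(\<And>r s. F r s \<in> word_sums) \<Longrightarrow> sw L xs F \<in> word_sums"
  by (induction xs) (simp_all split: prod.split add: split_paired_all)

lemma sums_hact [simp]: "s \<in> word_sums \<Longrightarrow> hact L x s \<in> word_sums"
proof (rule sums_hom[where \<phi> = "hact L x"])
  show "hact L x w \<in> word_sums" if "w \<in> words" for w
    using that
    by (induction arbitrary: x)
      (simp_all add: F.L_hact_prod F.i0_hact F.i1_hact hact_exact sums_sw flip: F.i0_one)
qed (simp_all add: hact_add[OF F.bsb_L] hact_closed[OF F.bsb_L])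

text \<open>A coefficient standing after a letter is absorbed into that letter as a right action.
  Each product of generators thus comes from one word with one coefficient in front, hence is
  homogeneous, as \<open>dg_subalgebra\<close> demands.\<close>

lemma word_form: "w \<in> words \<Longrightarrow> \<exists>a v. F.wrd v \<and> w = F.q (F.in0 a \<otimes>\<^bsub>F.T\<^esub> F.cw v)"
proof (induction rule: words.induct)
  case one
  then show ?case
    by (intro exI[of _ 1] exI[of _ "[]"]) (simp add: F.in0_one F.q_one)
next
  case (scale s b)
  then obtain a v where "F.wrd v" "s = F.q (F.in0 a \<otimes>\<^bsub>F.T\<^esub> F.cw v)" by blast
  then show ?case
    by (intro exI[of _ "b * a"] exI[of _ v]) (simp add: F.ext_in0_q F.q_mult F.in0_mult F.T.m_assoc)
next
  case (exact s b)
  then obtain a v where v: "F.wrd v" "s = F.q (F.in0 a \<otimes>\<^bsub>F.T\<^esub> F.cw v)" by blast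
  then have "F.cw [exact b] \<otimes>\<^bsub>F.T\<^esub> (F.in0 a \<otimes>\<^bsub>F.T\<^esub> F.cw v) = F.cw (ract W (exact b) a # v)"
    using F.cw_Cons[of "ract W (exact b) a" v] by (simp add: F.cw_ract F.T.m_assoc)
  then show ?case
    using v by (intro exI[of _ 1] exI[of _ "ract W (exact b) a # v"])
      (simp add: F.ext_in1_q F.q_mult F.in0_one)
qed

lemma words_degree: "w \<in> words \<Longrightarrow> \<exists>k. w \<in> ext_degree H R A W k"
  using word_form F.homogeneous_word by blast

lemma i0_degree: "i0 a \<in> ext_degree H R A W 0"
  using F.homogeneous_word[of "[]" a] by (simp add: F.ext_in0_q)

lemma i1_degree: "\<omega> \<in> carrier W \<Longrightarrow> i1 \<omega> \<in> ext_degree H R A W 1"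
  using F.homogeneous_word[of "[\<omega>]" 1] by (simp add: F.ext_in1_q F.in0_one)

lemma d_one: "d \<one>\<^bsub>L\<^esub> = \<zero>\<^bsub>L\<^esub>"
proof -
  have "d (i0 1 \<otimes>\<^bsub>L\<^esub> \<one>\<^bsub>L\<^esub>) = (d (i0 1) \<otimes>\<^bsub>L\<^esub> \<one>\<^bsub>L\<^esub>) \<oplus>\<^bsub>L\<^esub> (i0 1 \<otimes>\<^bsub>L\<^esub> d \<one>\<^bsub>L\<^esub>)"
    by (subst d_prod[OF i0_degree]) simp_all
  then show ?thesis by (simp add: F.i0_one)
qed

lemma sums_d: "s \<in> word_sums \<Longrightarrow> d s \<in> word_sums"
proof (rule sums_hom[where \<phi> = d])
  show "d w \<in> word_sums" if "w \<in> words" for w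
    using that
  proof induction
    case (scale s a)
    then show ?case by (simp add: d_prod[OF i0_degree] d_i0_exact)
  next
    case (exact s a)
    \<comment> \<open>Differentials of functions are closed, so the one-form factor in front
      contributes nothing and d passes to the rest up to sign.\<close>
    have "d (i1 (exact a)) = \<zero>\<^bsub>L\<^esub>" using d_d[of "i0 a"] by (simp add: d_i0_exact)
    with exact show ?case
      by (simp add: d_prod[OF i1_degree] F.L.minus_eq)
  qed (simp add: d_one)
qed (simp_all add: d_add)

lemma subring_sums: "subring word_sums L"
  by (rule F.L.subringI) (auto intro: words_sums[OF words.one])

lemma dg_subalgebra_sums: "dg_subalgebra H R A d word_sums"
  unfolding dg_subalgebra_def Let_def
proof (intro conjI allI ballI)
  fix s assume "s \<in> word_sums"
  then show "\<exists>ys. set ys \<subseteq> word_sums \<inter> (\<Union>k. ext_degree H R A W k) \<and> s = lsum L ys"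
  proof induction
    case zero
    show ?case by (rule exI[of _ "[]"]) simp
  next
    case (add w s)
    from add(3) obtain ys where ys: "set ys \<subseteq> word_sums \<inter> (\<Union>k. ext_degree H R A W k)" "s = lsum L ys" by blast
    obtain k where k: "w \<in> ext_degree H R A W k" using words_degree[OF add(1)] by blast
    show ?case
    proof (intro exI conjI)
      show "set (w # ys) \<subseteq> word_sums \<inter> (\<Union>k. ext_degree H R A W k)"
        unfolding list.set insert_subset using ys(1) k words_sums[OF add(1)] by blast
      show "w \<oplus>\<^bsub>L\<^esub> s = lsum L (w # ys)" by (simp add: ys(2))
    qed
  qed
qed (simp_all add: subring_sums sums_d F.L_lact sums_fun)

lemma carrier_forms: "carrier (forms H R A d) = word_sums"
proof -
  have eq: "carrier (forms H R A d) = \<Inter>{C. dg_subalgebra H R A d C \<and> range i0 \<subseteq> C}"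
    by (simp add: forms_def)
  have "range i0 \<subseteq> word_sums" using sums_i0 by blast
  then have "\<Inter>{C. dg_subalgebra H R A d C \<and> range i0 \<subseteq> C} \<subseteq> word_sums"
    using dg_subalgebra_sums by (intro Inter_lower CollectI conjI)
  moreover have "word_sums \<subseteq> C" if C: "dg_subalgebra H R A d C" "range i0 \<subseteq> C" for C
  proof
    have sub: "subring C L" and d: "\<And>s. s \<in> C \<Longrightarrow> d s \<in> C"
      \<comment> \<open>What is needed of an arbitrary competitor C is that it is a subring stable
        under d; with functions it then contains both kinds of generators.\<close>
      using C(1) unfolding dg_subalgebra_def Let_def by (elim conjE; blast)+
    have i0: "i0 a \<in> C" for a using C(2) by blast
    have i1: "i1 (exact a) \<in> C" for a using d[OF i0[of a]] by (simp only: d_i0_exact)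
    note C = subringE(2,3,6,7)[OF sub]
    fix s assume "s \<in> word_sums"
    then show "s \<in> C"
    proof induction
      case (add w s)
      from add(1) have "w \<in> C"
        by induction (rule C(2), rule C(3)[OF i0], assumption, rule C(3)[OF i1])
      then show ?case using add(3) by (rule C(4))
    qed (rule C(1))
  qed
  then have "word_sums \<subseteq> \<Inter>{C. dg_subalgebra H R A d C \<and> range i0 \<subseteq> C}"
    by (intro Inter_greatest) simp
  ultimately show ?thesis unfolding eq by (rule equalityI)
qed

lemma forms_eq: "forms H R A d = L\<lparr>carrier := word_sums\<rparr>"
  using carrier_forms by (simp add: forms_def)

lemma forms1_eq: "forms1 H R A d = W\<lparr>carrier := {\<omega> \<in> carrier W. i1 \<omega> \<in> word_sums}\<rparr>"
  by (simp add: forms1_def carrier_forms W_simps(1))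

lemma bsb_forms: "bsb (L\<lparr>carrier := word_sums\<rparr>)"
  by (rule bsb_restrict[OF F.bsb_L]) (auto simp: F.L_lact F.L_ract)

lemma i1_zero: "i1 \<zero>\<^bsub>W\<^esub> = \<zero>\<^bsub>L\<^esub>"
  by (rule additive_zero[of W L]) (simp_all add: F.i1_add)

lemma bsb_forms1: "bsb (W\<lparr>carrier := {\<omega> \<in> carrier W. i1 \<omega> \<in> word_sums}\<rparr>)"
proof -
  interpret W: abelian_group W by simp
  show ?thesis
    by (rule bsb_restrict[OF bsb_W]) (auto simp: F.i1_add i1_zero F.i1_lact F.i1_ract simp flip: F.i1_hact)
qed

context
  assumes pres: "\<And>X \<omega>. X \<in> carrier V \<Longrightarrow> \<omega> \<in> carrier W \<Longrightarrow> i1 \<omega> \<in> word_sums \<Longrightarrow> i1 (NF X \<omega>) \<in> word_sums"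
begin

text \<open>\<open>NF\<close> gives a functional on derivations by its values; membership of the
  result in the algebra generated by functions and their differentials is the premise
  \<open>pres\<close>. It is applied to exact one-forms, and the Leibniz rule then covers all
  products of generators.\<close>

lemma sums_NL:
  assumes X: "X \<in> carrier V" and s: "s \<in> word_sums"
  shows "F.NL X s \<in> word_sums"
proof (rule sums_hom[OF _ _ _ s])
  show "F.NL X w \<in> word_sums" if "w \<in> words" for w
    using that X
  proof (induction arbitrary: X)
    case one
    then show ?case by (simp add: F.NL_in0 flip: F.i0_one)
  qed (simp_all add: F.NL_leibniz F.NL_in0 F.NL_in1 F.i0_hact F.i1_hact hact_exact pres sums_sw)
qed (use X in \<open>simp_all add: cd_closed[OF F.ecd_NL] cd_add[OF F.ecd_NL]\<close>)

lemma ecd_forms1: "ecd (forms1 H R A d) NF"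
  unfolding forms1_eq by (rule ecd_restrict[OF ecd_NF bsb_forms1]) (auto simp: pres)

lemma forms_extension: "braided_derivation_extension H R A (forms1 H R A d) (forms H R A d) i0 i1 NF F.NL"
  unfolding forms1_eq forms_eq
  by (rule extension_restrict[OF F.NL_extension ecd_restrict[OF F.ecd_NL bsb_forms]])
    (auto simp: sums_NL)

end

end

theorem proposition3p10:
  fixes H :: "('k::{comm_ring, comm_monoid_mult}, 'h::{ring, monoid_mult}) hopf"
    and R :: "('h \<times> 'h) list"
    and A :: "('k, 'h, 'a::{ring, monoid_mult}) malg"
    and N :: "('a \<Rightarrow> 'a) \<Rightarrow> ('a \<Rightarrow> 'a) \<Rightarrow> ('a \<Rightarrow> 'a)"
  assumes "triangular_hopf_algebra H R"
    and "module_algebra H A"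
    and "braided_commutative R A"
    and "equivariant_cov_deriv H R A (vfields H R A) N"
  shows
    "(\<exists>NX. braided_derivation_extension H R A (vfields H R A) (multivector_fields H R A)
        (ext_in0 H R A (vfields H R A)) (ext_in1 H R A (vfields H R A)) N NX) \<and>
     (\<exists>NF.
        (\<forall>X\<in>Der H R A. \<forall>\<omega>\<in>one_forms H R A. \<forall>Y\<in>Der H R A.
           NF X \<omega> Y = X (\<omega> Y) -
             (\<Sum>(r, s)\<leftarrow>rinv R. hact (full_forms1 H R A) r \<omega> (N (hact (vfields H R A) s X) Y))) \<and>
        equivariant_cov_deriv H R A (full_forms1 H R A) NF \<and>
        (\<exists>NF'. braided_derivation_extension H R A (full_forms1 H R A) (full_forms H R A)
           (ext_in0 H R A (full_forms1 H R A)) (ext_in1 H R A (full_forms1 H R A)) NF NF') \<and>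
        (\<forall>d. braided_differential H R A d \<longrightarrow>
           (\<forall>X\<in>Der H R A. \<forall>\<omega>\<in>carrier (forms1 H R A d). NF X \<omega> \<in> carrier (forms1 H R A d)) \<longrightarrow>
           equivariant_cov_deriv H R A (forms1 H R A d) NF \<and>
           (\<exists>NF'. braided_derivation_extension H R A (forms1 H R A d) (forms H R A d)
              (ext_in0 H R A (full_forms1 H R A)) (ext_in1 H R A (full_forms1 H R A)) NF NF')))"
proof -
  \<comment> \<open>The hypothesis on \<open>N\<close> is used twice, as the derivative and as the
    source of the bimodule axioms for vector fields.\<close>
  interpret vfield_cov_deriv H R A N
    using assms by unfold_locales (auto simp: equivariant_cov_deriv_def)
  interpret V: tensor_cov_deriv H R A "vfields H R A" N
    by unfold_locales (rule bsb_V ecd_N)+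
  have "equivariant_cov_deriv H R A (forms1 H R A d) NF \<and>
      (\<exists>NF'. braided_derivation_extension H R A (forms1 H R A d) (forms H R A d)
        (ext_in0 H R A (full_forms1 H R A)) (ext_in1 H R A (full_forms1 H R A)) NF NF')"
    if "braided_differential H R A d"
      and pres: "\<forall>X\<in>Der H R A. \<forall>\<omega>\<in>carrier (forms1 H R A d). NF X \<omega> \<in> carrier (forms1 H R A d)" for d
  proof -
    interpret braided_forms H R A N d
      by unfold_locales fact
    have pres': "i1 (NF X \<omega>) \<in> word_sums" if "X \<in> carrier V" "\<omega> \<in> carrier W" "i1 \<omega> \<in> word_sums" for X \<omega>
      using pres that by (simp add: forms1_eq V_simps(1))
    show ?thesis using ecd_forms1[OF pres'] forms_extension[OF pres'] by blast
  qed
  then show ?thesis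
    \<comment> \<open>One \<open>NF\<close> serves all conjuncts: the derivative on braided forms is
      the restriction of the one on all one-forms.\<close>
    using V.NL_extension F.NL_extension ecd_NF
    by (intro conjI exI[of _ NF]) (auto simp: NF_eq V_simps(1) sum_list_sw)
qed

end
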